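(* Let $\ell>0$, $0<\sigma<\tfrac12$, $0<\alpha<1<\beta$, and assume that the unique positive solution $s$ of $\tanh(\sqrt2\, s\ell)=\left(\frac{\sigma}{2-\sigma}\right)^2\sqrt2\, s\ell$ is not an integer. Let $j\ge2$ be an integer and consider the problem $$\mu_j^{\alpha,\beta}:=\inf_{p\in P_{\alpha,\beta}}\mu_j(p).$$ This problem admits an optimal pair $(\overline p_j,\overline u_j)\in P_{\alpha,\beta}\times H^2_{\mathcal E}$, i.e. $\mu_j(\overline p_j)=\mu_j^{\alpha,\beta}$ and $\overline u_j$ is an eigenfunction corresponding to $\mu_j(\overline p_j)$, and there holds $$\mu_j^{\alpha,\beta}\le \inf_{p\in P_{\alpha,\beta}}\left\{\max_{m=1,\dots,j}\left\{\frac{1}{\|\sqrt p\,w_m\|_2^2}\right\}\right\}j^3|\Omega|,$$ where $w_m(x,y):=\sin^2(jx)$ if $(x,y)\in\Omega^j_m:=\left(\frac{(m-1)\pi}{j},\frac{m\pi}{j}\right)\times(-\ell,\ell)$ and $w_m(x,y):=0$ if $(x,y)\in\Omega\setminus\Omega^j_m$. In particular, denoting $P^{per}_{\alpha,\beta}:=\{p\in P_{\alpha,\beta}: p(x,y)=p(x+\tfrac{\pi}{j},y)\text{ for a.e. }(x,y)\in\Omega \text{ with } x+\tfrac{\pi}{j}<\pi\}$, we have $$\mu_j^{\alpha,\beta}\le\inf_{p\in P^{per}_{\alpha,\beta}}\left\{\frac{1}{\|\sqrt p\,\sin^2(jx)\|_2^2}\right\}j^4|\Omega|,$$ and the latter infimum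 is achieved by the function $$p_j(x,y)=\alpha\,\chi_{S_j}(x,y)+\beta\,\chi_{\Omega\setminus S_j}(x,y)\quad\text{for a.e. }(x,y)\in\Omega,$$ where $S_j=\{(x,y)\in\Omega:\sin^4(jx)\le t_j\}$ for $t_j>0$ such that $|S_j|=\frac{\beta-1}{\beta-\alpha}|\Omega|$.
   Context: $\Omega=(0,\pi)\times(-\ell,\ell)\subset\mathbb{R}^2$; $\chi_D$ is the characteristic function of $D$; $\|\cdot\|_2$ is the $L^2(\Omega)$ norm. Weights: $P_{\alpha,\beta}:=\{p\in L^\infty(\Omega): \alpha\le p\le\beta \text{ a.e.},\ p(x,y)=p(x,-y)\text{ a.e. in }\Omega,\ \int_\Omega p\,dx\,dy=|\Omega|\}$. Energy space: $H^2_*=\{u\in H^2(\Omega): u=0 \text{ on } \{0,\pi\}\times(-\ell,\ell)\}$, a Hilbert space with scalar product $(u,v)_{H^2_*}=\int_\Omega[\Delta u\Delta v+(1-\sigma)(2u_{xy}v_{xy}-u_{xx}v_{yy}-u_{yy}v_{xx})]\,dx\,dy$ and norm $\|u\|_{H^2_*}^2=(u,u)_{H^2_*}$. $H^2_{\mathcal E}$ is the subspace of functions $u\in H^2_*$ with $u(x,-y)=u(x,y)$. Eigenvalue problem: for $p\in P_{\alpha,\beta}$, $\lambda$ is an eigenvalue with eigenfunction $u\in H^2_*\setminus\{0\}$ if $(u,v)_{H^2_*}=\lambda\int_\Omega p\,u\,v\,dx\,dy$ for all $v\in H^2_*$. (Weak form of $\Delta^2u=\lambda p u$ in $\Omega$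 with $u=u_{xx}=0$ for $x\in\{0,\pi\}$ and $u_{yy}+\sigma u_{xx}=u_{yyy}+(2-\sigma)u_{xxy}=0$ for $y=\pm\ell$.) $\mu_1(p)\le\mu_2(p)\le\dots$ denote the (longitudinal) eigenvalues corresponding to eigenfunctions in $H^2_{\mathcal E}$, repeated according to multiplicity; equivalently, $\mu_j(p)$ is the minimum of $\|u\|_{H^2_*}^2/\|\sqrt p\,u\|_2^2$ over nonzero $u\in H^2_{\mathcal E}$ that are $(\cdot,\cdot)_{H^2_*}$-orthogonal to the first $j-1$ longitudinal eigenfunctions. "Eigenfunction corresponding to $\mu_j(p)$" means an eigenfunction in $H^2_{\mathcal E}$ with eigenvalue $\mu_j(p)$. *)

theory Defs
  imports "HOL-Analysis.Analysis"
begin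

text \<open>Elements of function spaces over a domain in the plane are represented by functions
  \<open>real \<times> real \<Rightarrow> real\<close>; only their values on the domain matter, and two functions agreeing
  almost everywhere on the domain represent the same element.\<close>

section \<open>Second order Sobolev space of a planar domain\<close>

definition ddx :: "(real \<times> real \<Rightarrow> real) \<Rightarrow> real \<times> real \<Rightarrow> real" where
  "ddx f = (\<lambda>(x, y). deriv (\<lambda>s. f (s, y)) x)"

definition ddy :: "(real \<times> real \<Rightarrow> real) \<Rightarrow> real \<times> real \<Rightarrow> real" where
  "ddy f = (\<lambda>(x, y). deriv (\<lambda>s. f (x, s)) y)"

primrec C_k :: "nat \<Rightarrow> (real \<times> real \<Rightarrow> real) \<Rightarrow> bool" where
  "C_k 0 f \<longleftrightarrow> continuous_on UNIV f"
| "C_k (Suc k) f \<longleftrightarrow> f differentiable_on UNIV \<and> C_k k (ddx f) \<and> C_k k (ddy f)"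

definition test_functions :: "(real \<times> real) set \<Rightarrow> (real \<times> real \<Rightarrow> real) set" where
  "test_functions D =
    {f. (\<forall>k. C_k k f) \<and> compact (closure {z. f z \<noteq> 0}) \<and> closure {z. f z \<noteq> 0} \<subseteq> D}"

definition L2_space :: "(real \<times> real) set \<Rightarrow> (real \<times> real \<Rightarrow> real) set" where
  "L2_space D = {f. f \<in> borel_measurable (lebesgue_on D) \<and>
                    integrable (lebesgue_on D) (\<lambda>z. (f z)\<^sup>2)}"

definition L2_norm_on :: "(real \<times> real) set \<Rightarrow> (real \<times> real \<Rightarrow> real) \<Rightarrow> real" where
  "L2_norm_on D f = sqrt (LINT z|lebesgue_on D. (f z)\<^sup>2)"

definition is_L2_weak_deriv ::
  "(real \<times> real) set \<Rightarrow> nat \<Rightarrow> nat \<Rightarrow> (real \<times> real \<Rightarrow> real) \<Rightarrow> (real \<times> real \<Rightarrow> real) \<Rightarrow> bool" where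
  "is_L2_weak_deriv D m n u g \<longleftrightarrow>
     g \<in> L2_space D \<and>
     (\<forall>f\<in>test_functions D.
        (LINT z|lebesgue_on D. u z * (ddx ^^ m) ((ddy ^^ n) f) z) =
        (- 1) ^ (m + n) * (LINT z|lebesgue_on D. g z * f z))"

definition H2_space :: "(real \<times> real) set \<Rightarrow> (real \<times> real \<Rightarrow> real) set" where
  "H2_space D = {u \<in> L2_space D. \<forall>m n. m + n \<le> 2 \<longrightarrow> (\<exists>g. is_L2_weak_deriv D m n u g)}"

text \<open>Some representative of the weak derivative, which is unique up to null sets.\<close>

definition weak_deriv ::
  "(real \<times> real) set \<Rightarrow> nat \<Rightarrow> nat \<Rightarrow> (real \<times> real \<Rightarrow> real) \<Rightarrow> real \<times> real \<Rightarrow> real" where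
  "weak_deriv D m n u = (SOME g. is_L2_weak_deriv D m n u g)"

section \<open>Plate and energy space\<close>

definition Omega :: "real \<Rightarrow> (real \<times> real) set" where
  "Omega l = {0<..<pi} \<times> {- l<..<l}"

text \<open>In dimension two, \<open>H\<^sup>2(\<Omega>)\<close> embeds into the continuous functions on the closure, so the
  boundary condition is a pointwise condition on the continuous representative.\<close>

definition H2_star :: "real \<Rightarrow> (real \<times> real \<Rightarrow> real) set" where
  "H2_star l = {u \<in> H2_space (Omega l).
     \<exists>v. continuous_on (closure (Omega l)) v \<and>
         (AE z in lebesgue_on (Omega l). u z = v z) \<and>
         (\<forall>y\<in>{- l<..<l}. v (0, y) = 0 \<and> v (pi, y) = 0)}"

definition H2_even :: "real \<Rightarrow> (real \<times> real \<Rightarrow> real) set" where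
  "H2_even l = {u \<in> H2_star l. AE z in lebesgue_on (Omega l). u (fst z, - snd z) = u z}"

definition H2_inner ::
  "real \<Rightarrow> real \<Rightarrow> (real \<times> real \<Rightarrow> real) \<Rightarrow> (real \<times> real \<Rightarrow> real) \<Rightarrow> real" where
  "H2_inner l \<sigma> u v =
    (let D = Omega l;
         uxx = weak_deriv D 2 0 u; uxy = weak_deriv D 1 1 u; uyy = weak_deriv D 0 2 u;
         vxx = weak_deriv D 2 0 v; vxy = weak_deriv D 1 1 v; vyy = weak_deriv D 0 2 v
     in LINT z|lebesgue_on D.
          (uxx z + uyy z) * (vxx z + vyy z) +
          (1 - \<sigma>) * (2 * uxy z * vxy z - uxx z * vyy z - uyy z * vxx z))"

section \<open>Weights\<close>

definition weights :: "real \<Rightarrow> real \<Rightarrow> real \<Rightarrow> (real \<times> real \<Rightarrow> real) set" where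
  "weights l \<alpha> \<beta> = {p \<in> borel_measurable (lebesgue_on (Omega l)).
     (AE z in lebesgue_on (Omega l). \<alpha> \<le> p z \<and> p z \<le> \<beta>) \<and>
     (AE z in lebesgue_on (Omega l). p z = p (fst z, - snd z)) \<and>
     (LINT z|lebesgue_on (Omega l). p z) = measure lebesgue (Omega l)}"

definition periodic_weights :: "real \<Rightarrow> real \<Rightarrow> real \<Rightarrow> nat \<Rightarrow> (real \<times> real \<Rightarrow> real) set" where
  "periodic_weights l \<alpha> \<beta> j = {p \<in> weights l \<alpha> \<beta>.
     AE z in lebesgue_on (Omega l).
       fst z + pi / real j < pi \<longrightarrow> p z = p (fst z + pi / real j, snd z)}"

section \<open>Longitudinal eigenvalues\<close>

definition weak_solution ::
  "real \<Rightarrow> real \<Rightarrow> (real \<times> real \<Rightarrow> real) \<Rightarrow> real \<Rightarrow> (real \<times> real \<Rightarrow> real) \<Rightarrow> bool" where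
  "weak_solution l \<sigma> p ev u \<longleftrightarrow>
     (\<forall>v\<in>H2_star l. H2_inner l \<sigma> u v = ev * (LINT z|lebesgue_on (Omega l). p z * u z * v z))"

definition longitudinal_eigenfunction ::
  "real \<Rightarrow> real \<Rightarrow> (real \<times> real \<Rightarrow> real) \<Rightarrow> real \<Rightarrow> (real \<times> real \<Rightarrow> real) \<Rightarrow> bool" where
  "longitudinal_eigenfunction l \<sigma> p ev u \<longleftrightarrow>
     u \<in> H2_even l \<and> \<not> (AE z in lebesgue_on (Omega l). u z = 0) \<and> weak_solution l \<sigma> p ev u"

definition longitudinal_eigenspace ::
  "real \<Rightarrow> real \<Rightarrow> (real \<times> real \<Rightarrow> real) \<Rightarrow> real \<Rightarrow> (real \<times> real \<Rightarrow> real) set" where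
  "longitudinal_eigenspace l \<sigma> p ev = {u \<in> H2_even l. weak_solution l \<sigma> p ev u}"

text \<open>\<open>E\<close>, a linear space of functions on \<open>D\<close> modulo null functions, has a basis of \<open>n\<close> elements.\<close>

definition has_dimension_ae ::
  "(real \<times> real) set \<Rightarrow> (real \<times> real \<Rightarrow> real) set \<Rightarrow> nat \<Rightarrow> bool" where
  "has_dimension_ae D E n \<longleftrightarrow>
    (\<exists>b. (\<forall>i<n. b i \<in> E) \<and>
         (\<forall>c :: nat \<Rightarrow> real.
            (AE z in lebesgue_on D. (\<Sum>i<n. c i * b i z) = 0) \<longrightarrow> (\<forall>i<n. c i = 0)) \<and>
         (\<forall>u\<in>E. \<exists>c :: nat \<Rightarrow> real. AE z in lebesgue_on D. u z = (\<Sum>i<n. c i * b i z)))"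

text \<open>\<open>\<nu> 1 \<le> \<nu> 2 \<le> \<dots>\<close> lists the longitudinal eigenvalues, each as often as its multiplicity; a real
  number that is not an eigenvalue has a zero-dimensional eigenspace and hence does not occur.
  The value \<open>\<nu> 0\<close> is irrelevant.\<close>

definition longitudinal_eigenvalue_sequence ::
  "real \<Rightarrow> real \<Rightarrow> (real \<times> real \<Rightarrow> real) \<Rightarrow> (nat \<Rightarrow> real) \<Rightarrow> bool" where
  "longitudinal_eigenvalue_sequence l \<sigma> p \<nu> \<longleftrightarrow>
     mono_on {1..} \<nu> \<and>
     (\<forall>ev. finite {k \<in> {1..}. \<nu> k = ev} \<and>
           has_dimension_ae (Omega l) (longitudinal_eigenspace l \<sigma> p ev)
             (card {k \<in> {1..}. \<nu> k = ev}))"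

definition mu :: "real \<Rightarrow> real \<Rightarrow> (real \<times> real \<Rightarrow> real) \<Rightarrow> nat \<Rightarrow> real" where
  "mu l \<sigma> p j = (THE t. \<exists>\<nu>. longitudinal_eigenvalue_sequence l \<sigma> p \<nu> \<and> t = \<nu> j)"

definition mu_inf :: "real \<Rightarrow> real \<Rightarrow> real \<Rightarrow> real \<Rightarrow> nat \<Rightarrow> real" where
  "mu_inf l \<sigma> \<alpha> \<beta> j = (INF p\<in>weights l \<alpha> \<beta>. mu l \<sigma> p j)"

section \<open>Trial functions and the piecewise constant weight\<close>

definition strip :: "real \<Rightarrow> nat \<Rightarrow> nat \<Rightarrow> (real \<times> real) set" where
  "strip l j m = {(real m - 1) * pi / real j<..<real m * pi / real j} \<times> {- l<..<l}"

definition w_trial :: "real \<Rightarrow> nat \<Rightarrow> nat \<Rightarrow> real \<times> real \<Rightarrow> real" where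
  "w_trial l j m z = (if z \<in> strip l j m then (sin (real j * fst z))\<^sup>2 else 0)"

definition S_level :: "real \<Rightarrow> nat \<Rightarrow> real \<Rightarrow> (real \<times> real) set" where
  "S_level l j t = {z \<in> Omega l. (sin (real j * fst z)) ^ 4 \<le> t}"

definition bang_bang_weight ::
  "real \<Rightarrow> real \<Rightarrow> real \<Rightarrow> nat \<Rightarrow> real \<Rightarrow> real \<times> real \<Rightarrow> real" where
  "bang_bang_weight l \<alpha> \<beta> j t z =
     \<alpha> * indicator (S_level l j t) z + \<beta> * indicator (Omega l - S_level l j t) z"

end

theory Submission
  imports Defs "HOL-Library.Function_Algebras" "HOL-Real_Asymp.Real_Asymp" "HOL-Complex_Analysis.Great_Picard"
begin

text \<open>
  Functions in \<open>H\<^sup>2\<^sub>*\<close> are bounded and uniformly Hoelder continuous in terms of their energy, so bounded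
  sequences are precompact in \<open>L\<^sup>2\<close> by Arzela and Ascoli. Minimizing Rayleigh quotients successively
  therefore yields all longitudinal eigenvalues together with the min-max principle.

  For a minimizing sequence of weights \<open>p\<^sub>n\<close>, the first \<open>j\<close> normalized eigenfunctions converge in \<open>L\<^sup>2\<close>
  along a subsequence, hence in energy, by the eigenvalue equation. Some weight \<open>p\<close> realizes the limits
  of the finitely many integrals of \<open>p\<^sub>n\<close> against products of limit functions. These functions are then
  orthonormal with respect to \<open>p\<close>, and min-max on their span shows that \<open>p\<close> is optimal.

  Both upper bounds are at least \<open>j\<^sup>4\<close>: the \<open>w\<^sub>m\<close> have disjoint supports and \<open>w\<^sub>m\<^sup>2 \<le> 1\<close>, so their squared
  norms add up to at most \<open>\<integral> p = \<bar>\<Omega>\<bar>\<close> and the smallest one is at most \<open>\<bar>\<Omega>\<bar> / j\<close>. On the other hand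
  \<open>\<mu>\<^sub>j(1) \<le> j\<^sup>4\<close>, by min-max on the span of \<open>sin x, \<dots>, sin (j x)\<close>. The piecewise constant weight is
  optimal by the bathtub principle.\<close>

text \<open>Pointwise control in the energy space rests on two special identities. As u vanishes at
  x = 0, u(x, y') - u(x, y) is the integral of u_xy over the rectangle (0, x) x (y, y'); as u also
  vanishes at x = pi, u_x has mean zero on almost every horizontal section, so that u_xx controls
  it. With Cauchy-Schwarz this gives Hoelder exponent 1/2 in both variables and bounds on the lower
  derivatives, while 0 < \<sigma> < 1/2 lets the energy control the second ones.

  \<open>mu\<close> is a definite description over nondecreasing lists whose multiplicities are
  dimensions of eigenspaces. Successive minimization therefore has to exhaust the spectrum, which
  follows from its unboundedness, and such a list has to be unique. The minimization runs among even
  functions, but eigenfunctions are tested against all of \<open>H2_star\<close>; passing to the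
  even part of a test function closes this gap.

  Functions that agree almost everywhere are different objects here, so the weighted form is merely
  semidefinite and \<open>weak_deriv\<close> is linear only up to null sets.\<close>

instantiation "fun" :: (type, real_vector) real_vector
begin

definition scaleR_fun :: "real \<Rightarrow> ('a \<Rightarrow> 'b) \<Rightarrow> 'a \<Rightarrow> 'b" where
  "scaleR_fun c f = (\<lambda>x. c *\<^sub>R f x)"

instance
  by standard (simp_all add: scaleR_fun_def fun_eq_iff scaleR_add_right scaleR_add_left)

end

lemma scaleR_fun_apply [simp]: "(c *\<^sub>R f) x = c *\<^sub>R f x"
  by (simp add: scaleR_fun_def)

lemma sum_fun_apply: "(\<Sum>i\<in>A. f i) x = (\<Sum>i\<in>A. f i x)"
  by (induction A rule: infinite_finite_induct) auto

section \<open>Semidefinite forms\<close>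

text \<open>Gaussian elimination, by induction on the number of equations. This dimension count
  supplies nonzero combinations orthogonal to given vectors, both for min-max and to keep the
  construction of eigenvectors going, and it makes dimensions unique.\<close>

lemma underdetermined_system:
  fixes M :: "nat \<Rightarrow> nat \<Rightarrow> real"
  shows "\<exists>c. (\<exists>i\<le>n. c i \<noteq> 0) \<and> (\<forall>k<n. (\<Sum>i\<le>n. c i * M k i) = 0)"
proof (induction n arbitrary: M)
  case 0
  show ?case by (rule exI[of _ "\<lambda>_. 1"]) auto
next
  case (Suc n)
  show ?case
  proof (cases "\<forall>i\<le>Suc n. M n i = 0")
    case True
    obtain c where c: "\<exists>i\<le>n. c i \<noteq> 0" "\<forall>k<n. (\<Sum>i\<le>n. c i * M k i) = 0"
      using Suc by blast
    let ?c = "\<lambda>i. if i \<le> n then c i else 0"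
    have "(\<Sum>i\<le>Suc n. ?c i * M k i) = (\<Sum>i\<le>n. c i * M k i)" for k by simp
    then show ?thesis using c True by (intro exI[of _ ?c]) (auto simp: less_Suc_eq le_SucI)
  next
    case False
    \<comment> \<open>Column q is the pivot of the last equation; the transposition s moves it to
      the last place, where it eliminates one unknown.\<close>
    then obtain q where q: "q \<le> Suc n" "M n q \<noteq> 0" by auto
    define s where "s = Transposition.transpose q (Suc n)"
    have s: "s permutes {..Suc n}" unfolding s_def using q by (simp add: permutes_swap_id)
    define N where "N k i = M k (s i)" for k i
    have Nn: "N n (Suc n) \<noteq> 0" using q by (simp add: N_def s_def)
    obtain c where c: "\<exists>i\<le>n. c i \<noteq> 0"
       "\<forall>k<n. (\<Sum>i\<le>n. c i * (N k i - N n i * N k (Suc n) / N n (Suc n))) = 0"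
      using Suc[of "\<lambda>k i. N k i - N n i * N k (Suc n) / N n (Suc n)"] by blast
    \<comment> \<open>The last unknown is solved from the last equation; the reduced system for c is
      what its substitution into the other equations leaves.\<close>
    define d where "d i = (if i \<le> n then c i else - (\<Sum>i\<le>n. c i * N n i) / N n (Suc n))" for i
    have d: "(\<Sum>i\<le>Suc n. d i * N k i) = (\<Sum>i\<le>n. c i * N k i) - (\<Sum>i\<le>n. c i * N n i) * N k (Suc n) / N n (Suc n)" for k
      by (simp add: d_def)
    have "(\<Sum>i\<le>Suc n. d i * N k i) = 0" if "k < Suc n" for k
    proof (cases "k = n")
      case True then show ?thesis using Nn by (simp add: d del: sum.atMost_Suc)
    next
      case False
      then have "(\<Sum>i\<le>n. c i * (N k i - N n i * N k (Suc n) / N n (Suc n))) = 0" using c that by auto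
      then show ?thesis unfolding d by (simp add: algebra_simps sum_subtractf sum_distrib_left sum_distrib_right sum_divide_distrib)
    qed
    moreover have "(\<Sum>i\<le>Suc n. d (s i) * M k i) = (\<Sum>i\<le>Suc n. d i * N k i)" for k
      using sum.permute[OF s, of "\<lambda>i. d i * N k i"] by (simp add: N_def s_def o_def)
    moreover have "\<exists>i\<le>Suc n. d (s i) \<noteq> 0"
    proof -
      obtain i where "i \<le> n" "c i \<noteq> 0" using c by auto
      then have "d (s (s i)) \<noteq> 0" by (simp add: s_def d_def)
      moreover have "s i \<le> Suc n" using permutes_in_image[OF s, of i] \<open>i \<le> n\<close> by auto
      ultimately show ?thesis by blast
    qed
    ultimately show ?thesis by (intro exI[of _ "\<lambda>i. d (s i)"]) auto
  qed
qed

text \<open>Semidefinite, since functions that differ only on a null set are distinct vectors at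
  zero distance. The carrier is a set, so that function spaces as well as orthogonal complements
  inside them can serve.\<close>

locale psd_form =
  fixes H :: "'v::real_vector set" and q :: "'v \<Rightarrow> 'v \<Rightarrow> real"
  assumes subspace: "subspace H"
    and add: "u \<in> H \<Longrightarrow> v \<in> H \<Longrightarrow> w \<in> H \<Longrightarrow> q (u + v) w = q u w + q v w"
    and scale: "u \<in> H \<Longrightarrow> w \<in> H \<Longrightarrow> q (c *\<^sub>R u) w = c * q u w"
    and sym: "u \<in> H \<Longrightarrow> v \<in> H \<Longrightarrow> q u v = q v u"
    and nonneg: "u \<in> H \<Longrightarrow> 0 \<le> q u u"
begin

lemma mem [simp, intro]:
  "0 \<in> H" "u \<in> H \<Longrightarrow> v \<in> H \<Longrightarrow> u + v \<in> H" "u \<in> H \<Longrightarrow> v \<in> H \<Longrightarrow> u - v \<in> H"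
  "u \<in> H \<Longrightarrow> c *\<^sub>R u \<in> H" "(\<And>i. i \<in> I \<Longrightarrow> f i \<in> H) \<Longrightarrow> sum f I \<in> H"
  using subspace by (auto intro: subspace_0 subspace_add subspace_diff subspace_scale subspace_sum)

lemma add_right: "u \<in> H \<Longrightarrow> v \<in> H \<Longrightarrow> w \<in> H \<Longrightarrow> q w (u + v) = q w u + q w v"
  using add[of u v w] sym[of w] by auto

lemma scale_right: "u \<in> H \<Longrightarrow> w \<in> H \<Longrightarrow> q w (c *\<^sub>R u) = c * q w u"
  using scale[of u w c] sym[of w] by auto

lemma zero [simp]: "w \<in> H \<Longrightarrow> q 0 w = 0" "w \<in> H \<Longrightarrow> q w 0 = 0"
  using scale[of 0 w 0] scale_right[of 0 w 0] by auto

lemma diff: "u \<in> H \<Longrightarrow> v \<in> H \<Longrightarrow> w \<in> H \<Longrightarrow> q (u - v) w = q u w - q v w"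
  using add[of u "(-1) *\<^sub>R v" w] scale[of v w "-1"] mem(4)[of v "-1"] by simp

lemma diff_right: "u \<in> H \<Longrightarrow> v \<in> H \<Longrightarrow> w \<in> H \<Longrightarrow> q w (u - v) = q w u - q w v"
  using diff[of u v w] sym[of w] by auto

lemma sum_left: "(\<And>i. i \<in> I \<Longrightarrow> f i \<in> H) \<Longrightarrow> w \<in> H \<Longrightarrow> q (\<Sum>i\<in>I. f i) w = (\<Sum>i\<in>I. q (f i) w)"
  by (induction I rule: infinite_finite_induct) (auto simp: add)

lemma sum_right: "(\<And>i. i \<in> I \<Longrightarrow> f i \<in> H) \<Longrightarrow> w \<in> H \<Longrightarrow> q w (\<Sum>i\<in>I. f i) = (\<Sum>i\<in>I. q w (f i))"
  by (induction I rule: infinite_finite_induct) (auto simp: add_right)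

text \<open>The quadratic polynomial \<open>q (u + t v) (u + t v)\<close> in t is nonnegative. If
  \<open>q v v > 0\<close>, its vertex gives the claim; if \<open>q v v = 0\<close>, it is affine
  and must have slope 0, as otherwise a suitable t gives the value -1.\<close>

lemma cauchy_schwarz:
  assumes u: "u \<in> H" and v: "v \<in> H"
  shows "(q u v)\<^sup>2 \<le> q u u * q v v"
proof -
  have expand: "0 \<le> q u u + 2 * t * q u v + t\<^sup>2 * q v v" for t
  proof -
    have "0 \<le> q (u + t *\<^sub>R v) (u + t *\<^sub>R v)" using u v by (intro nonneg) auto
    also have "\<dots> = q u u + 2 * t * q u v + t\<^sup>2 * q v v"
      using u v by (simp add: add add_right scale scale_right sym[of v u] power2_eq_square algebra_simps)
    finally show ?thesis .
  qed
  show ?thesis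
  proof (cases "q v v = 0")
    case True
    have "q u v = 0"
    proof (rule ccontr)
      assume ne: "q u v \<noteq> 0"
      have "0 \<le> q u u + 2 * (- (q u u + 1) / (2 * q u v)) * q u v"
        using expand[of "- (q u u + 1) / (2 * q u v)"] True by simp
      also have "\<dots> = -1" using ne by (simp add: field_simps)
      finally show False by simp
    qed
    then show ?thesis using True by simp
  next
    case False
    then have pos: "q v v > 0" using nonneg[OF v] by simp
    have "0 \<le> q u u + 2 * (- q u v / q v v) * q u v + (- q u v / q v v)\<^sup>2 * q v v"
      by (rule expand)
    also have "\<dots> = q u u - (q u v)\<^sup>2 / q v v"
      using pos by (simp add: power2_eq_square field_simps)
    finally show ?thesis using pos by (simp add: field_simps)
  qed
qed

lemma null_right: "u \<in> H \<Longrightarrow> v \<in> H \<Longrightarrow> q v v = 0 \<Longrightarrow> q u v = 0"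
  using cauchy_schwarz[of u v] by simp

lemma parallelogram:
  "u \<in> H \<Longrightarrow> v \<in> H \<Longrightarrow> q (u - v) (u - v) = 2 * q u u + 2 * q v v - q (u + v) (u + v)"
  by (simp add: add add_right diff diff_right algebra_simps)

lemma bound_by_two: "u \<in> H \<Longrightarrow> v \<in> H \<Longrightarrow> q (u + v) (u + v) \<le> 2 * q u u + 2 * q v v"
  using parallelogram[of u v] nonneg[of "u - v"] by simp

lemma sqrt_triangle:
  assumes "u \<in> H" "v \<in> H"
  shows "sqrt (q (u + v) (u + v)) \<le> sqrt (q u u) + sqrt (q v v)"
proof -
  have "\<bar>q u v\<bar> \<le> sqrt (q u u * q v v)"
    using cauchy_schwarz[OF assms] real_le_rsqrt[of "\<bar>q u v\<bar>"] by simp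
  then have "q (u + v) (u + v) \<le> (sqrt (q u u) + sqrt (q v v))\<^sup>2"
    using assms by (simp add: add add_right sym[of v u] power2_sum nonneg real_sqrt_mult)
  then show ?thesis using nonneg assms by (intro real_le_lsqrt) auto
qed

lemma sqrt_diff:
  assumes "u \<in> H" "v \<in> H"
  shows "\<bar>sqrt (q u u) - sqrt (q v v)\<bar> \<le> sqrt (q (u - v) (u - v))"
  using sqrt_triangle[of "u - v" v] sqrt_triangle[of "v - u" u] assms
    by (simp add: diff diff_right sym[of u v] algebra_simps abs_le_iff)

lemma orthogonal_combination:
  assumes I: "finite I" and f: "\<And>i. i \<in> I \<Longrightarrow> f i \<in> H"
    and orth: "\<And>i j. i \<in> I \<Longrightarrow> j \<in> I \<Longrightarrow> i \<noteq> j \<Longrightarrow> q (f i) (f j) = 0"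
  shows "q (\<Sum>i\<in>I. c i *\<^sub>R f i) (\<Sum>i\<in>I. c i *\<^sub>R f i) = (\<Sum>i\<in>I. (c i)\<^sup>2 * q (f i) (f i))"
proof -
  let ?S = "\<Sum>i\<in>I. c i *\<^sub>R f i"
  have m: "c i *\<^sub>R f i \<in> H" if "i \<in> I" for i using f[OF that] by simp
  have S: "?S \<in> H" using m by auto
  have "q (f i) ?S = c i * q (f i) (f i)" if i: "i \<in> I" for i
  proof -
    have "q (f i) ?S = (\<Sum>j\<in>I. q (f i) (c j *\<^sub>R f j))" using m f[OF i] by (rule sum_right)
    also have "\<dots> = (\<Sum>j\<in>I. if i = j then c i * q (f i) (f i) else 0)"
      using f i orth by (intro sum.cong refl) (auto simp: scale_right)
    finally show ?thesis using I i by simp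
  qed
  then have "q (c i *\<^sub>R f i) ?S = (c i)\<^sup>2 * q (f i) (f i)" if "i \<in> I" for i
    using f S that by (simp add: scale power2_eq_square)
  moreover have "q ?S ?S = (\<Sum>i\<in>I. q (c i *\<^sub>R f i) ?S)" using m S by (rule sum_left)
  ultimately show ?thesis by simp
qed

text \<open>The form is jointly continuous for its own seminorm: the error is q (x - X) (y - Y) + q
  (x - X) Y + q X (y - Y), and Cauchy-Schwarz bounds each term.\<close>

lemma tendsto_form:
  assumes H: "\<And>n. x n \<in> H" "\<And>n. y n \<in> H" "X \<in> H" "Y \<in> H"
    and x: "(\<lambda>n. q (x n - X) (x n - X)) \<longlonglongrightarrow> 0" and y: "(\<lambda>n. q (y n - Y) (y n - Y)) \<longlonglongrightarrow> 0"
  shows "(\<lambda>n. q (x n) (y n)) \<longlonglongrightarrow> q X Y"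
proof (rule Lim_transform_bound[THEN Lim_null[THEN iffD2], rotated -1])
  let ?s = "\<lambda>n. sqrt (q (x n - X) (x n - X)) * sqrt (q (y n - Y) (y n - Y)) +
     sqrt (q (x n - X) (x n - X)) * sqrt (q Y Y) + sqrt (q X X) * sqrt (q (y n - Y) (y n - Y))"
  have "?s \<longlonglongrightarrow> sqrt 0 * sqrt 0 + sqrt 0 * sqrt (q Y Y) + sqrt (q X X) * sqrt 0"
    by (intro tendsto_intros x y)
  then show "?s \<longlonglongrightarrow> 0" by simp
  have cs: "\<bar>q u v\<bar> \<le> sqrt (q u u) * sqrt (q v v)" if "u \<in> H" "v \<in> H" for u v
  proof -
    have "\<bar>q u v\<bar> \<le> sqrt (q u u * q v v)"
      using cauchy_schwarz[OF that] by (intro real_le_rsqrt) simp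
    then show ?thesis by (simp add: real_sqrt_mult)
  qed
  have "\<bar>q (x n) (y n) - q X Y\<bar> \<le> ?s n" for n
  proof -
    have d: "x n - X \<in> H" "y n - Y \<in> H" using H by auto
    have "q (x n) (y n) - q X Y = q (x n - X) (y n - Y) + q (x n - X) Y + q X (y n - Y)"
      using H by (simp add: diff diff_right)
    then show ?thesis using cs[OF d] cs[OF d(1) H(4)] cs[OF H(3) d(2)] by linarith
  qed
  then show "\<forall>\<^sub>F n in sequentially. norm (q (x n) (y n) - q X Y) \<le> norm (?s n)"
    by (intro always_eventually allI) (metis abs_ge_self order_trans real_norm_def)
qed

end

section \<open>Spectral theory of a compact pair of forms\<close>

text \<open>The independent elements \<open>f i\<close> make the construction of eigenvectors run forever.\<close>

locale spectral_pair = A: psd_form H a + B: psd_form H b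
  for H :: "'v::real_vector set" and a b +
  fixes C :: real and f :: "nat \<Rightarrow> 'v"
  assumes C_pos: "C > 0"
    and b_le: "u \<in> H \<Longrightarrow> b u u \<le> C * a u u"
    and compact: "(\<And>n. s n \<in> H) \<Longrightarrow> (\<And>n. a (s n) (s n) \<le> K) \<Longrightarrow>
      \<exists>r. strict_mono (r :: nat \<Rightarrow> nat) \<and>
        (\<forall>\<epsilon>>0. \<exists>N. \<forall>m\<ge>N. \<forall>n\<ge>N. b (s (r m) - s (r n)) (s (r m) - s (r n)) < \<epsilon>)"
    and complete: "(\<And>n. s n \<in> H) \<Longrightarrow>
      (\<forall>\<epsilon>>0. \<exists>N. \<forall>m\<ge>N. \<forall>n\<ge>N. a (s m - s n) (s m - s n) < \<epsilon>) \<Longrightarrow>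
      \<exists>v\<in>H. (\<lambda>n. a (s n - v) (s n - v)) \<longlonglongrightarrow> 0"
    and f_mem: "f i \<in> H"
    and f_indep: "b (\<Sum>i\<le>n. c i *\<^sub>R f i) (\<Sum>i\<le>n. c i *\<^sub>R f i) = 0 \<Longrightarrow> i \<le> n \<Longrightarrow> c i = 0"
begin

definition orth :: "(nat \<Rightarrow> 'v) \<Rightarrow> nat \<Rightarrow> 'v set" where
  "orth e k = {v \<in> H. \<forall>i<k. b v (e i) = 0}"

text \<open>The variational inequality on the complement of the earlier vectors is part of the
  definition because monotonicity, exhaustion of the spectrum and min-max all rest on it.\<close>

definition eigenvector :: "(nat \<Rightarrow> real) \<Rightarrow> (nat \<Rightarrow> 'v) \<Rightarrow> nat \<Rightarrow> bool" where
  "eigenvector \<nu> e k \<longleftrightarrow> e k \<in> orth e k \<and> b (e k) (e k) = 1 \<and> \<nu> k > 0 \<and>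
     (\<forall>v\<in>H. a (e k) v = \<nu> k * b (e k) v) \<and> (\<forall>v\<in>orth e k. \<nu> k * b v v \<le> a v v)"

lemma orthonormal:
  assumes "\<And>i. i < k \<Longrightarrow> eigenvector \<nu> e i" "i < k" "j < k"
  shows "b (e i) (e j) = (if i = j then 1 else 0)"
proof (cases i j rule: linorder_cases)
  case less
  have "b (e j) (e i) = 0" using less assms by (auto simp: eigenvector_def orth_def)
  moreover have "e i \<in> H" "e j \<in> H" using assms by (auto simp: eigenvector_def orth_def)
  ultimately show ?thesis using less B.sym[of "e i" "e j"] by simp
qed (use assms in \<open>auto simp: eigenvector_def orth_def\<close>)

text \<open>Semidefiniteness of M a - b says that M bounds the quotient b / a. Cauchy-Schwarz for
  this form replaces differentiation of the Rayleigh quotient: a maximizer is a null vector, hence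
  orthogonal to the whole complement.\<close>

lemma psd_form_orth:
  assumes e: "\<And>i. i < k \<Longrightarrow> e i \<in> H" and M: "M > 0" "\<And>v. v \<in> orth e k \<Longrightarrow> b v v \<le> M * a v v"
  shows "psd_form (orth e k) (\<lambda>u v. M * a u v - b u v)"
proof
  show "subspace (orth e k)"
    using e by (auto simp: subspace_def orth_def B.add B.scale)
next
  fix u v assume uv: "u \<in> orth e k" "v \<in> orth e k"
  then have "a u v = a v u" "b u v = b v u" using A.sym B.sym by (auto simp: orth_def)
  then show "M * a u v - b u v = M * a v u - b v u" by simp
qed (use M in \<open>auto simp: orth_def A.add B.add A.scale B.scale algebra_simps\<close>)

text \<open>Maximizing b on the unit ball of a is minimizing a / b, but the supremum is finite at
  once by \<open>b_le\<close>. A maximizing sequence is b-Cauchy along a subsequence by compactness;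
  the parallelogram law makes it a-Cauchy, and completeness yields the limit.\<close>

lemma exists_maximizer:
  assumes e: "\<And>i. i < k \<Longrightarrow> e i \<in> H"
  shows "\<exists>v\<in>orth e k. \<exists>M>0. b v v = M \<and> a v v = 1 \<and> (\<forall>w\<in>orth e k. b w w \<le> M * a w w)"
proof -
  define S where "S = {b v v | v. v \<in> orth e k \<and> a v v \<le> 1}"
  have orthH: "v \<in> H" if "v \<in> orth e k" for v using that by (simp add: orth_def)
  have orth_scale: "c *\<^sub>R v \<in> orth e k" if "v \<in> orth e k" for v c
    using that e by (auto simp: orth_def B.scale)
  have S_le: "x \<le> C" if x: "x \<in> S" for x
  proof -
    obtain v where v: "v \<in> orth e k" "a v v \<le> 1" "x = b v v" using x by (auto simp: S_def)
    then have "x \<le> C * a v v" using b_le orthH by simp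
    also have "\<dots> \<le> C" using C_pos v by simp
    finally show ?thesis .
  qed
  then have bdd: "bdd_above S" by (rule bdd_aboveI)
  define M where "M = Sup S"
  have S_M: "x \<le> M" if "x \<in> S" for x unfolding M_def using that bdd by (rule cSup_upper)
  have "0 \<in> S" unfolding S_def using e by (auto intro!: exI[of _ 0] simp: orth_def)
  have scaled: "b w w / a w w \<in> S" if w: "w \<in> orth e k" "a w w > 0" for w
  proof -
    let ?w = "(1 / sqrt (a w w)) *\<^sub>R w"
    have "b ?w ?w = b w w / a w w" "a ?w ?w = 1"
      using w orthH[OF w(1)] by (auto simp: B.scale B.scale_right A.scale A.scale_right field_simps)
    then show ?thesis using orth_scale[OF w(1)] unfolding S_def by (smt (verit) mem_Collect_eq)
  qed
  have le: "b w w \<le> M * a w w" if w: "w \<in> orth e k" for w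
  proof (cases "a w w = 0")
    case True
    then have "b w w \<le> 0" using b_le[OF orthH[OF w]] by simp
    then show ?thesis using True by simp
  next
    case False
    then have pos: "a w w > 0" using A.nonneg[OF orthH[OF w]] by simp
    then show ?thesis using S_M[OF scaled[OF w pos]] by (simp add: field_simps)
  qed
  \<comment> \<open>k orthogonality conditions on the k + 1 coefficients of \<open>f 0\<close>, ...,
    \<open>f k\<close> leave a nonzero combination in the complement, and by \<open>f_indep\<close>
    it has positive b.\<close>
  have "M > 0"
  proof -
    obtain c where c: "\<exists>i\<le>k. c i \<noteq> 0" "\<forall>j<k. (\<Sum>i\<le>k. c i * b (f i) (e j)) = 0"
      using underdetermined_system[of k "\<lambda>j i. b (f i) (e j)"] by blast
    let ?w = "\<Sum>i\<le>k. c i *\<^sub>R f i"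
    have wH: "?w \<in> H" using f_mem by auto
    have w: "?w \<in> orth e k"
      using wH c(2) e f_mem by (auto simp: orth_def B.sum_left B.scale)
    have "b ?w ?w \<noteq> 0" using f_indep c(1) by blast
    then have "b ?w ?w > 0" using B.nonneg[OF wH] by simp
    then have "a ?w ?w \<noteq> 0" using b_le[OF wH] by auto
    then have "a ?w ?w > 0" using A.nonneg[OF wH] by simp
    then show ?thesis using \<open>b ?w ?w > 0\<close> S_M[OF scaled[OF w]] by (smt (verit) divide_pos_pos)
  qed
  have "\<exists>v. v \<in> orth e k \<and> a v v \<le> 1 \<and> b v v > M - 1 / real (Suc n)" for n
  proof -
    have "M - 1 / real (Suc n) < Sup S" by (simp add: M_def)
    then obtain x where "x \<in> S" "M - 1 / real (Suc n) < x"
      using less_cSup_iff[OF _ bdd] \<open>0 \<in> S\<close> by blast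
    then show ?thesis by (auto simp: S_def)
  qed
  then obtain u where u: "\<And>n. u n \<in> orth e k" "\<And>n. a (u n) (u n) \<le> 1" "\<And>n. b (u n) (u n) > M - 1 / real (Suc n)"
    by metis
  obtain r where r: "strict_mono (r :: nat \<Rightarrow> nat)"
    and cauchy: "\<forall>\<epsilon>>0. \<exists>N. \<forall>m\<ge>N. \<forall>n\<ge>N. b (u (r m) - u (r n)) (u (r m) - u (r n)) < \<epsilon>"
    using compact[of u 1] u orthH by blast
  define w where "w n = u (r n)" for n
  have w: "w n \<in> orth e k" "w n \<in> H" "a (w n) (w n) \<le> 1" for n
    using u orthH by (auto simp: w_def)
  have wb: "b (w n) (w n) > M - 1 / real (Suc n)" for n
  proof -
    have "n \<le> r n" using r by (rule seq_suble)
    then have "1 / real (Suc (r n)) \<le> 1 / real (Suc n)" by (simp add: field_simps)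
    then show ?thesis using u(3)[of "r n"] by (simp add: w_def)
  qed
  have "\<forall>\<epsilon>>0. \<exists>N. \<forall>m\<ge>N. \<forall>n\<ge>N. a (w m - w n) (w m - w n) < \<epsilon>"
  proof (intro allI impI)
    fix \<epsilon> :: real assume "\<epsilon> > 0"
    then obtain N1 where N1: "\<And>m n. m \<ge> N1 \<Longrightarrow> n \<ge> N1 \<Longrightarrow> b (w m - w n) (w m - w n) < \<epsilon> * M / 2"
      using cauchy \<open>M > 0\<close> unfolding w_def by (metis half_gt_zero mult_pos_pos)
    obtain N2 where N2: "1 / real (Suc N2) < \<epsilon> * M / 8"
      using nat_approx_posE[of "\<epsilon> * M / 8"] \<open>\<epsilon> > 0\<close> \<open>M > 0\<close> by auto
    have "a (w m - w n) (w m - w n) < \<epsilon>" if mn: "m \<ge> max N1 N2" "n \<ge> max N1 N2" for m n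
    proof -
      have small: "1 / real (Suc i) < \<epsilon> * M / 8" if "i \<ge> N2" for i
      proof -
        have "1 / real (Suc i) \<le> 1 / real (Suc N2)" using that by (simp add: field_simps)
        then show ?thesis using N2 by simp
      qed
      have sum_orth: "w m + w n \<in> orth e k" using w e by (auto simp: orth_def B.add)
      \<comment> \<open>Here a is at most 1 at both points, and \<open>M * a\<close> at their sum is
        at least b there, which the parallelogram law for b shows to be close to 4 M.\<close>
      have "M * a (w m - w n) (w m - w n) = 2 * (M * a (w m) (w m)) + 2 * (M * a (w n) (w n)) - M * a (w m + w n) (w m + w n)"
        unfolding A.parallelogram[OF w(2) w(2), of m n] by (simp add: algebra_simps)
      also have "\<dots> \<le> 2 * M + 2 * M - b (w m + w n) (w m + w n)"
        using le[OF sum_orth] w(3)[of m] w(3)[of n] \<open>M > 0\<close> by (smt (verit) mult_left_le)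
      also have "\<dots> = 4 * M - (2 * b (w m) (w m) + 2 * b (w n) (w n) - b (w m - w n) (w m - w n))"
        using B.parallelogram[OF w(2) w(2), of m n] by simp
      also have "\<dots> < \<epsilon> * M"
        using wb[of m] wb[of n] small[of m] small[of n] N1[of m n] mn by simp
      finally show ?thesis using \<open>M > 0\<close> by simp
    qed
    then show "\<exists>N. \<forall>m\<ge>N. \<forall>n\<ge>N. a (w m - w n) (w m - w n) < \<epsilon>" by blast
  qed
  then obtain v where v: "v \<in> H" and lim: "(\<lambda>n. a (w n - v) (w n - v)) \<longlonglongrightarrow> 0"
    using complete[of w] w by blast
  have limb: "(\<lambda>n. b (w n - v) (w n - v)) \<longlonglongrightarrow> 0"
  proof (rule tendsto_sandwich[OF _ _ tendsto_const])
    show "(\<lambda>n. C * a (w n - v) (w n - v)) \<longlonglongrightarrow> 0" using lim by (auto intro: tendsto_mult_right_zero)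
  qed (use b_le B.nonneg w v in auto)
  have av: "(\<lambda>n. a (w n) (w n)) \<longlonglongrightarrow> a v v"
  proof -
    have "(\<lambda>n. sqrt (a (w n) (w n))) \<longlonglongrightarrow> sqrt (a v v)"
    proof (rule Lim_transform_bound[THEN Lim_null[THEN iffD2], rotated -1])
      show "(\<lambda>n. sqrt (a (w n - v) (w n - v))) \<longlonglongrightarrow> 0" using tendsto_real_sqrt[OF lim] by simp
      show "\<forall>\<^sub>F n in sequentially. norm (sqrt (a (w n) (w n)) - sqrt (a v v)) \<le> norm (sqrt (a (w n - v) (w n - v)))"
        using A.sqrt_diff[OF w(2) v] by (auto intro!: always_eventually simp: A.nonneg w v)
    qed
    from tendsto_power[OF this, of 2] show ?thesis using A.nonneg w v by simp
  qed
  have bv: "(\<lambda>n. b (w n) (w n)) \<longlonglongrightarrow> b v v"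
  proof -
    have "(\<lambda>n. sqrt (b (w n) (w n))) \<longlonglongrightarrow> sqrt (b v v)"
    proof (rule Lim_transform_bound[THEN Lim_null[THEN iffD2], rotated -1])
      show "(\<lambda>n. sqrt (b (w n - v) (w n - v))) \<longlonglongrightarrow> 0" using tendsto_real_sqrt[OF limb] by simp
      show "\<forall>\<^sub>F n in sequentially. norm (sqrt (b (w n) (w n)) - sqrt (b v v)) \<le> norm (sqrt (b (w n - v) (w n - v)))"
        using B.sqrt_diff[OF w(2) v] by (auto intro!: always_eventually simp: B.nonneg w v)
    qed
    from tendsto_power[OF this, of 2] show ?thesis using B.nonneg w v by simp
  qed
  have "a v v \<le> 1" using av w(3) by (intro LIMSEQ_le_const2) auto
  have v_orth: "v \<in> orth e k"
    unfolding orth_def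
  proof (intro CollectI conjI allI impI v)
    fix i assume i: "i < k"
    have "(b v (e i))\<^sup>2 \<le> b (w n - v) (w n - v) * b (e i) (e i)" for n
    proof -
      have "b (w n - v) (e i) = - b v (e i)" using w(1)[of n] i e v by (simp add: orth_def B.diff)
      then show ?thesis using B.cauchy_schwarz[of "w n - v" "e i"] w v e i by simp
    qed
    moreover have "(\<lambda>n. b (w n - v) (w n - v) * b (e i) (e i)) \<longlonglongrightarrow> 0"
      using limb by (rule tendsto_mult_left_zero)
    ultimately have "(b v (e i))\<^sup>2 \<le> 0" by (intro LIMSEQ_le_const) auto
    then show "b v (e i) = 0" by simp
  qed
  have "M \<le> b v v"
  proof (rule LIMSEQ_le)
    show "(\<lambda>n. M - 1 / real (Suc n)) \<longlonglongrightarrow> M"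
      using tendsto_diff[OF tendsto_const lim_1_over_n[THEN LIMSEQ_Suc]] by simp
  qed (use bv wb in \<open>auto intro!: exI[of _ 0] less_imp_le\<close>)
  moreover have "M * a v v \<le> M" using \<open>a v v \<le> 1\<close> \<open>M > 0\<close> by simp
  \<comment> \<open>The chain M <= b v v <= M a v v <= M collapses to equalities.\<close>
  ultimately have "b v v = M" "M * a v v = M" using le[OF v_orth] by linarith+
  then show ?thesis using v_orth \<open>M > 0\<close> le by (intro bexI[of _ v] exI[of _ M]) auto
qed

text \<open>The maximizer v satisfies the Euler equation inside the complement. It extends to all of
  H because b v vanishes on the earlier eigenvectors and, by their own equations, so does a v. The
  eigenvalue is 1 / M, and \<open>b v v = M\<close> explains the factor 1 / sqrt M.\<close>

lemma exists_next_eigenvector: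
  assumes E: "\<And>i. i < k \<Longrightarrow> eigenvector \<nu> e i"
  shows "\<exists>t u. eigenvector (\<nu>(k := t)) (e(k := u)) k"
proof -
  have e: "e i \<in> H" if "i < k" for i using E[OF that] by (simp add: eigenvector_def orth_def)
  obtain v M where v: "v \<in> orth e k" and M: "M > 0" "b v v = M" "a v v = 1"
    and le: "\<And>w. w \<in> orth e k \<Longrightarrow> b w w \<le> M * a w w"
    using exists_maximizer[of k e] e by blast
  interpret Q: psd_form "orth e k" "\<lambda>u v. M * a u v - b u v"
    using e M(1) le by (rule psd_form_orth)
  have vH: "v \<in> H" using v by (simp add: orth_def)
  have euler: "a v g = b v g / M" if g: "g \<in> H" for g
  proof -
    \<comment> \<open>The b-orthogonal projection of g to the span of the earlier eigenvectors, so
      that g - p lies in the complement.\<close>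
    define p where "p = (\<Sum>i<k. b g (e i) *\<^sub>R e i)"
    have pH: "p \<in> H" unfolding p_def using e by auto
    have "b p (e j) = b g (e j)" if "j < k" for j
    proof -
      have "b p (e j) = (\<Sum>i<k. b g (e i) * b (e i) (e j))"
        unfolding p_def using e that by (subst B.sum_left) (auto simp: B.scale)
      also have "\<dots> = (\<Sum>i<k. if i = j then b g (e i) else 0)"
        using orthonormal[OF E] that by (intro sum.cong) auto
      finally show ?thesis using that by simp
    qed
    then have h: "g - p \<in> orth e k" using g pH e by (auto simp: orth_def B.diff)
    have "M * a (g - p) v - b (g - p) v = 0" using Q.null_right[OF h v] M by simp
    then have 1: "M * a v (g - p) = b v (g - p)" using A.sym B.sym g pH vH by simp
    have bv: "b v (e i) = 0" if "i < k" for i using v that by (simp add: orth_def)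
    have av: "a v (e i) = 0" if "i < k" for i
    proof -
      have "a v (e i) = a (e i) v" using A.sym vH e that by simp
      also have "\<dots> = \<nu> i * b (e i) v" using E[OF that] vH by (simp add: eigenvector_def)
      finally show ?thesis using bv[OF that] B.sym vH e that by simp
    qed
    have "a v p = 0"
      unfolding p_def using e vH av by (subst A.sum_right) (auto simp: A.scale_right intro!: sum.neutral)
    moreover have "b v p = 0"
      unfolding p_def using e vH bv by (subst B.sum_right) (auto simp: B.scale_right intro!: sum.neutral)
    ultimately
    show ?thesis using 1 M vH pH g by (simp add: A.diff_right B.diff_right field_simps)
  qed
  let ?u = "(1 / sqrt M) *\<^sub>R v" and ?t = "1 / M"
  let ?e = "e(k := ?u)"
  have orth_eq: "orth ?e k = orth e k" by (auto simp: orth_def)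
  have "?u \<in> orth e k" using v e by (auto simp: orth_def B.scale)
  moreover have "b ?u ?u = 1" using vH M by (simp add: B.scale B.scale_right)
  moreover have "a ?u g = ?t * b ?u g" if "g \<in> H" for g
    using vH that euler by (simp add: A.scale B.scale)
  moreover have "?t * b w w \<le> a w w" if "w \<in> orth e k" for w
    using le[OF that] M by (simp add: field_simps)
  ultimately show ?thesis
    using M(1) by (intro exI[of _ ?t] exI[of _ ?u]) (simp add: eigenvector_def orth_eq)
qed

text \<open>The predicate at k reads both sequences only up to k, so dependent choice applies to the
  pairs of eigenvalue and eigenvector.\<close>

theorem exists_eigen_sequence: "\<exists>\<nu> e. \<forall>k. eigenvector \<nu> e k"
proof -
  let ?P = "\<lambda>(g :: nat \<Rightarrow> real \<times> 'v) k r. eigenvector ((fst \<circ> g)(k := fst r)) ((snd \<circ> g)(k := snd r)) k"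
  have cong: "eigenvector \<nu> e k = eigenvector \<nu>' e' k" if "\<And>i. i \<le> k \<Longrightarrow> \<nu> i = \<nu>' i" "\<And>i. i \<le> k \<Longrightarrow> e i = e' i"
    for \<nu> \<nu>' e e' k
  proof -
    have "orth e k = orth e' k" using that by (auto simp: orth_def)
    then show ?thesis using that by (simp add: eigenvector_def)
  qed
  have "\<exists>g. \<forall>k. ?P g k (g k)"
  proof (rule dependent_wellorder_choice)
    fix r :: "real \<times> 'v" and g h :: "nat \<Rightarrow> real \<times> 'v" and k :: nat
    assume "\<And>i. i < k \<Longrightarrow> g i = h i"
    then show "?P g k r = ?P h k r" by (intro cong) auto
  next
    fix k and g :: "nat \<Rightarrow> real \<times> 'v"
    assume "\<And>i. i < k \<Longrightarrow> ?P g i (g i)"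
    then have "eigenvector (fst \<circ> g) (snd \<circ> g) i" if "i < k" for i
      using cong[of i "(fst \<circ> g)(i := fst (g i))" "fst \<circ> g" "(snd \<circ> g)(i := snd (g i))" "snd \<circ> g"] that by auto
    from exists_next_eigenvector[OF this] show "\<exists>r. ?P g k r" by auto
  qed
  then obtain g where "\<And>k. ?P g k (g k)" by blast
  then have "eigenvector (fst \<circ> g) (snd \<circ> g) k" for k
    using cong[of k "(fst \<circ> g)(k := fst (g k))" "fst \<circ> g" "(snd \<circ> g)(k := snd (g k))" "snd \<circ> g"] by auto
  then show ?thesis by blast
qed

section \<open>Monotonicity, exhaustion and min-max for the eigenvector sequence\<close>

context
  fixes \<nu> e
  assumes eig: "\<And>k. eigenvector \<nu> e k"
begin

lemma eigenvector_mem: "e k \<in> H"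
  using eig[of k] by (simp add: eigenvector_def orth_def)

lemma eigenvector_eq: "v \<in> H \<Longrightarrow> a (e k) v = \<nu> k * b (e k) v"
  using eig[of k] by (simp add: eigenvector_def)

lemma eigenvector_pos: "\<nu> k > 0"
  using eig[of k] by (simp add: eigenvector_def)

lemma eigenvector_orthonormal: "b (e i) (e j) = (if i = j then 1 else 0)"
  using orthonormal[of "Suc (max i j)" \<nu> e i j] eig by auto

lemma eigenvalues_mono: "mono \<nu>"
proof (rule monoI)
  fix m n :: nat assume "m \<le> n"
  then have "e n \<in> orth e m" using eigenvector_mem eigenvector_orthonormal by (auto simp: orth_def)
  then have "\<nu> m * b (e n) (e n) \<le> a (e n) (e n)" using eig[of m] by (simp add: eigenvector_def)
  then show "\<nu> m \<le> \<nu> n" using eigenvector_eq[OF eigenvector_mem] eigenvector_orthonormal by simp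
qed

text \<open>Orthonormal vectors have squared b-distance 2 from each other, which contradicts
  compactness if their energies, which are the eigenvalues, stay bounded.\<close>

lemma eigenvalues_unbounded: "\<exists>k. \<nu> k > K"
proof (rule ccontr)
  assume "\<not> ?thesis"
  then have "a (e k) (e k) \<le> K" for k
    using eigenvector_eq[OF eigenvector_mem] eigenvector_orthonormal by (simp add: not_less)
  then obtain r where r: "strict_mono (r :: nat \<Rightarrow> nat)"
    and cauchy: "\<forall>\<epsilon>>0. \<exists>N. \<forall>m\<ge>N. \<forall>n\<ge>N. b (e (r m) - e (r n)) (e (r m) - e (r n)) < \<epsilon>"
    using compact[of e K] eigenvector_mem by blast
  obtain N where "\<forall>m\<ge>N. \<forall>n\<ge>N. b (e (r m) - e (r n)) (e (r m) - e (r n)) < 2"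
    using cauchy[rule_format, of 2] by auto
  then have "b (e (r N) - e (r (Suc N))) (e (r N) - e (r (Suc N))) < 2" by simp
  moreover have "r N \<noteq> r (Suc N)" using strict_mono_less[OF r, of N "Suc N"] by simp
  ultimately show False
    using eigenvector_mem by (simp add: B.diff B.diff_right eigenvector_orthonormal)
qed

lemma finite_multiplicity: "finite {k. \<nu> k = t}"
proof -
  obtain K where "\<nu> K > t" using eigenvalues_unbounded by blast
  then have "{k. \<nu> k = t} \<subseteq> {..<K}"
    using eigenvalues_mono by (force simp: mono_def not_less[symmetric])
  then show ?thesis by (rule finite_subset) simp
qed

text \<open>By symmetry of both forms u is orthogonal to every \<open>e k\<close> with another
  eigenvalue, so the remainder w is orthogonal to all \<open>e k\<close> and still solves the
  equation with t. The variational inequality at some \<open>\<nu> K > t\<close> then leaves only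
  \<open>b w w = 0\<close>.\<close>

lemma eigenvector_expansion:
  assumes u: "u \<in> H" and weak: "\<And>v. v \<in> H \<Longrightarrow> a u v = t * b u v"
  defines "w \<equiv> u - (\<Sum>k | \<nu> k = t. b u (e k) *\<^sub>R e k)"
  shows "b w w = 0"
proof -
  let ?p = "\<Sum>k | \<nu> k = t. b u (e k) *\<^sub>R e k"
  have pH: "?p \<in> H" using eigenvector_mem by auto
  then have wH: "w \<in> H" using u by (auto simp: w_def)
  have we: "b w (e k) = 0" for k
  proof (cases "\<nu> k = t")
    case True
    have "b ?p (e k) = (\<Sum>i | \<nu> i = t. if i = k then b u (e i) else 0)"
      using eigenvector_mem by (subst B.sum_left) (auto simp: B.scale eigenvector_orthonormal intro!: sum.cong)
    then show ?thesis using True finite_multiplicity u pH eigenvector_mem by (simp add: w_def B.diff)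
  next
    case False
    have "b ?p (e k) = 0"
      using eigenvector_mem False by (subst B.sum_left) (auto simp: B.scale eigenvector_orthonormal intro!: sum.neutral)
    moreover have "t * b u (e k) = \<nu> k * b u (e k)"
      using weak[OF eigenvector_mem] eigenvector_eq[OF u] A.sym B.sym u eigenvector_mem by metis
    ultimately show ?thesis using False u pH eigenvector_mem by (simp add: w_def B.diff)
  qed
  have weq: "a w v = t * b w v" if v: "v \<in> H" for v
    using v u pH eigenvector_mem
    by (simp add: w_def A.diff B.diff weak A.sum_left B.sum_left A.scale B.scale eigenvector_eq sum_distrib_left right_diff_distrib mult.left_commute)
  obtain K where K: "\<nu> K > t" using eigenvalues_unbounded by blast
  have "w \<in> orth e K" using wH we by (simp add: orth_def)
  then have "\<nu> K * b w w \<le> t * b w w" using eig[of K] weq[OF wH] by (auto simp: eigenvector_def)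
  then have "b w w \<le> 0" using K by (smt (verit) mult_less_cancel_right)
  then show ?thesis using B.nonneg[OF wH] by simp
qed

text \<open>Among the combinations of k + 1 independent vectors there is a nonzero one orthogonal to
  the first k eigenvectors; on it the variational inequality for \<open>\<nu> k\<close> meets the
  bound t.\<close>

lemma min_max:
  assumes g: "\<And>i. i \<le> k \<Longrightarrow> g i \<in> H"
    and indep: "\<And>c i. b (\<Sum>i\<le>k. c i *\<^sub>R g i) (\<Sum>i\<le>k. c i *\<^sub>R g i) = 0 \<Longrightarrow> i \<le> k \<Longrightarrow> c i = (0::real)"
    and le: "\<And>c :: nat \<Rightarrow> real. a (\<Sum>i\<le>k. c i *\<^sub>R g i) (\<Sum>i\<le>k. c i *\<^sub>R g i) \<le> t * b (\<Sum>i\<le>k. c i *\<^sub>R g i) (\<Sum>i\<le>k. c i *\<^sub>R g i)"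
  shows "\<nu> k \<le> t"
proof -
  obtain c where c: "\<exists>i\<le>k. c i \<noteq> 0" "\<forall>j<k. (\<Sum>i\<le>k. c i * b (g i) (e j)) = 0"
    using underdetermined_system[of k "\<lambda>j i. b (g i) (e j)"] by blast
  let ?w = "\<Sum>i\<le>k. c i *\<^sub>R g i"
  have wH: "?w \<in> H" using g by auto
  have "b ?w (e j) = (\<Sum>i\<le>k. c i * b (g i) (e j))" for j
    using eigenvector_mem g by (subst B.sum_left) (auto simp: B.scale intro!: sum.cong)
  then have w: "?w \<in> orth e k"
    using wH c(2) by (auto simp: orth_def)
  have "b ?w ?w \<noteq> 0" using indep[of c] c(1) by blast
  then have "b ?w ?w > 0" using B.nonneg[OF wH] by simp
  moreover have "\<nu> k * b ?w ?w \<le> a ?w ?w" using eig[of k] w unfolding eigenvector_def by blast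
  then have "\<nu> k * b ?w ?w \<le> t * b ?w ?w" using le[of c] by linarith
  ultimately show ?thesis by (simp add: mult_le_cancel_right)
qed

end

end

section \<open>Square integrable functions\<close>

text \<open>Generic in the measure: it is applied to the plate, to the plane and to single
  sections.\<close>

definition l2 :: "'a measure \<Rightarrow> ('a \<Rightarrow> real) set" where
  "l2 M = {f \<in> borel_measurable M. integrable M (\<lambda>x. (f x)\<^sup>2)}"

definition ip :: "'a measure \<Rightarrow> ('a \<Rightarrow> real) \<Rightarrow> ('a \<Rightarrow> real) \<Rightarrow> real" where
  "ip M f g = (\<integral>x. f x * g x \<partial>M)"

lemma l2_measurable [measurable_dest]: "f \<in> l2 M \<Longrightarrow> f \<in> borel_measurable M"
  by (simp add: l2_def)

lemma l2_mult:
  assumes "f \<in> l2 M" "g \<in> l2 M"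
  shows "integrable M (\<lambda>x. f x * g x)"
proof (rule Bochner_Integration.integrable_bound)
  show "integrable M (\<lambda>x. (f x)\<^sup>2 + (g x)\<^sup>2)" using assms by (simp add: l2_def)
  show "AE x in M. norm (f x * g x) \<le> norm ((f x)\<^sup>2 + (g x)\<^sup>2)"
  proof (rule AE_I2)
    fix x
    have "2 * \<bar>f x * g x\<bar> \<le> (f x)\<^sup>2 + (g x)\<^sup>2"
      using sum_squares_bound[of "\<bar>f x\<bar>" "\<bar>g x\<bar>"] by (simp add: abs_mult mult.assoc)
    then show "norm (f x * g x) \<le> norm ((f x)\<^sup>2 + (g x)\<^sup>2)" by simp
  qed
qed (use assms in \<open>auto simp: l2_def\<close>)

lemma l2_add: "f \<in> l2 M \<Longrightarrow> g \<in> l2 M \<Longrightarrow> f + g \<in> l2 M"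
  using l2_mult[of f M g] by (auto simp: l2_def plus_fun_def power2_sum mult.assoc)

lemma l2_scale: "f \<in> l2 M \<Longrightarrow> c *\<^sub>R f \<in> l2 M"
  by (auto simp: l2_def scaleR_fun_def power_mult_distrib)

lemma l2_subspace: "subspace (l2 M)"
  by (auto simp: subspace_def l2_add l2_scale) (simp add: l2_def zero_fun_def)

interpretation l2: psd_form "l2 M" "ip M" for M
proof
  fix u v w :: "'a \<Rightarrow> real" and c :: real assume *: "u \<in> l2 M" "w \<in> l2 M"
  show "ip M (c *\<^sub>R u) w = c * ip M u w" by (simp add: ip_def mult.assoc)
  show "ip M u u \<ge> 0" by (simp add: ip_def)
  show "ip M u w = ip M w u" by (simp add: ip_def mult.commute)
  assume "v \<in> l2 M"
  then show "ip M (u + v) w = ip M u w + ip M v w"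
    using * by (simp add: ip_def distrib_right l2_mult)
qed (rule l2_subspace)

lemma ip_cong_AE:
  assumes [measurable]: "f \<in> borel_measurable M" "g \<in> borel_measurable M" "f' \<in> borel_measurable M" "g' \<in> borel_measurable M"
    and "AE x in M. f x = f' x" "AE x in M. g x = g' x"
  shows "ip M f g = ip M f' g'"
  unfolding ip_def by (rule integral_cong_AE) (use assms in auto)

lemma l2_cong_AE:
  assumes "f \<in> l2 M" "g \<in> borel_measurable M" "AE x in M. f x = g x"
  shows "g \<in> l2 M"
proof -
  have "integrable M (\<lambda>x. (f x)\<^sup>2) \<longleftrightarrow> integrable M (\<lambda>x. (g x)\<^sup>2)"
    using assms by (intro integrable_cong_AE) (auto simp: l2_def)
  then show ?thesis using assms by (auto simp: l2_def)
qed

lemma ip_self_eq_0_iff: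
  assumes "f \<in> l2 M"
  shows "ip M f f = 0 \<longleftrightarrow> (AE x in M. f x = 0)"
  using integral_nonneg_eq_0_iff_AE[of M "\<lambda>x. f x * f x"] l2_mult[OF assms assms] by (simp add: ip_def)

lemma l2_bounded_mult:
  assumes f: "f \<in> l2 M" and p[measurable]: "p \<in> borel_measurable M" and K: "AE x in M. \<bar>p x\<bar> \<le> K"
  shows "(\<lambda>x. p x * f x) \<in> l2 M"
proof -
  have [measurable]: "f \<in> borel_measurable M" using f by (simp add: l2_def)
  have "integrable M (\<lambda>x. (p x * f x)\<^sup>2)"
  proof (rule Bochner_Integration.integrable_bound)
    show "integrable M (\<lambda>x. K\<^sup>2 * (f x)\<^sup>2)" using f by (simp add: l2_def)
    show "AE x in M. norm ((p x * f x)\<^sup>2) \<le> norm (K\<^sup>2 * (f x)\<^sup>2)"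
      using K
    proof eventually_elim
      case (elim x)
      have "(p x)\<^sup>2 \<le> K\<^sup>2" using power_mono[OF elim abs_ge_zero, of 2] by simp
      then show ?case by (simp add: power_mult_distrib mult_right_mono)
    qed
  qed measurable
  then show ?thesis by (simp add: l2_def)
qed

lemma (in finite_measure) l2_bounded:
  assumes "f \<in> borel_measurable M" "AE x in M. \<bar>f x\<bar> \<le> K"
  shows "f \<in> l2 M"
proof -
  have "(\<lambda>x. 1) \<in> l2 M" by (simp add: l2_def)
  from l2_bounded_mult[OF this assms] show ?thesis by simp
qed

lemma (in finite_measure) l2_integrable:
  assumes "f \<in> l2 M"
  shows "integrable M f" and "(\<integral>x. \<bar>f x\<bar> \<partial>M) \<le> sqrt (measure M (space M) * ip M f f)"
proof -
  have 1: "(\<lambda>x. 1) \<in> l2 M" by (simp add: l2_def)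
  show "integrable M f" using l2_mult[OF assms 1] by simp
  have f: "(\<lambda>x. \<bar>f x\<bar>) \<in> l2 M" using assms by (auto simp: l2_def)
  have "(ip M (\<lambda>x. \<bar>f x\<bar>) (\<lambda>x. 1))\<^sup>2 \<le> ip M f f * measure M (space M)"
    using l2.cauchy_schwarz[OF f 1] by (simp add: ip_def)
  then show "(\<integral>x. \<bar>f x\<bar> \<partial>M) \<le> sqrt (measure M (space M) * ip M f f)"
    by (intro real_le_rsqrt) (simp add: ip_def mult.commute)
qed

lemma fast_subsequence:
  assumes "\<And>k. \<exists>N. \<forall>n\<ge>N. P k n"
  shows "\<exists>r. strict_mono (r :: nat \<Rightarrow> nat) \<and> (\<forall>k. \<forall>n\<ge>r k. P k n)"
proof -
  obtain N where N: "\<And>k n. n \<ge> N k \<Longrightarrow> P k n" using assms by metis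
  define r where "r k = (\<Sum>i\<le>k. Suc (N i))" for k
  have "strict_mono r" by (rule strict_monoI_Suc) (simp add: r_def)
  moreover have "N k \<le> r k" for k unfolding r_def by (cases k) auto
  ultimately show ?thesis using N by (intro exI[of _ r]) (meson order_trans)
qed

text \<open>Riesz-Fischer: a fast subsequence has summable increments almost everywhere, and Fatou's
  lemma carries the norm bounds to the limit. The almost everywhere convergent subsequence is part
  of the conclusion because pointwise bounds and symmetries of weights are passed through
  it.\<close>

theorem (in finite_measure) l2_complete:
  assumes f: "\<And>n. f n \<in> l2 M"
    and cauchy: "\<forall>\<epsilon>>0. \<exists>N. \<forall>m\<ge>N. \<forall>n\<ge>N. ip M (f m - f n) (f m - f n) < \<epsilon>"
  shows "\<exists>g\<in>l2 M. (\<lambda>n. ip M (f n - g) (f n - g)) \<longlonglongrightarrow> 0 \<and>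
           (\<exists>r. strict_mono (r :: nat \<Rightarrow> nat) \<and> (AE x in M. (\<lambda>n. f (r n) x) \<longlonglongrightarrow> g x))"
proof -
  have [measurable]: "f n \<in> borel_measurable M" for n using f by (simp add: l2_def)
  \<comment> \<open>Squared distances below 4^(-k) give distances below 2^(-k), which are
    summable.\<close>
  have "\<exists>N. \<forall>n\<ge>N. \<forall>m\<ge>N. ip M (f m - f n) (f m - f n) < (1/4) ^ k" for k
    using cauchy by (meson zero_less_divide_1_iff zero_less_numeral zero_less_power)
  then have "\<exists>N. \<forall>n\<ge>N. \<forall>m\<ge>n. ip M (f m - f n) (f m - f n) < (1/4) ^ k" for k
    by (meson order_trans)
  from fast_subsequence[where P = "\<lambda>k n. \<forall>m\<ge>n. ip M (f m - f n) (f m - f n) < (1/4) ^ k", OF this]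
  obtain r where r: "strict_mono (r :: nat \<Rightarrow> nat)"
    and rk: "\<And>k m n. n \<ge> r k \<Longrightarrow> m \<ge> n \<Longrightarrow> ip M (f m - f n) (f m - f n) < (1/4) ^ k"
    by blast
  define d where "d k = f (r (Suc k)) - f (r k)" for k
  have d: "d k \<in> l2 M" for k unfolding d_def using f by auto
  have [measurable]: "d k \<in> borel_measurable M" for k using d by (simp add: l2_def)
  define c where "c = sqrt (measure M (space M))"
  have dk: "(\<integral>x. \<bar>d k x\<bar> \<partial>M) \<le> c * (1/2) ^ k" for k
  proof -
    have "r k \<le> r (Suc k)" using r by (simp add: strict_mono_less_eq)
    then have "ip M (d k) (d k) \<le> (1/4) ^ k" unfolding d_def using rk[of k "r k" "r (Suc k)"] by simp
    then have "sqrt (ip M (d k) (d k)) \<le> sqrt ((1/4) ^ k)" by simp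
    also have "sqrt ((1/4) ^ k :: real) = (1/2) ^ k" by (simp add: real_sqrt_power real_sqrt_divide)
    finally have "c * sqrt (ip M (d k) (d k)) \<le> c * (1/2) ^ k"
      by (intro mult_left_mono) (auto simp: c_def)
    then show ?thesis using l2_integrable(2)[OF d[of k]] by (simp add: c_def real_sqrt_mult)
  qed
  have "(\<integral>\<^sup>+x. (\<Sum>k. ennreal \<bar>d k x\<bar>) \<partial>M) = (\<Sum>k. \<integral>\<^sup>+x. ennreal \<bar>d k x\<bar> \<partial>M)"
    by (rule nn_integral_suminf) measurable
  also have "\<dots> = (\<Sum>k. ennreal (\<integral>x. \<bar>d k x\<bar> \<partial>M))"
    using l2_integrable(1)[OF d] by (intro suminf_cong nn_integral_eq_integral) auto
  also have "\<dots> \<le> (\<Sum>k. ennreal (c * (1/2) ^ k))"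
    using dk by (intro suminf_le) (auto intro: ennreal_leI)
  also have "\<dots> < \<infinity>"
    by (subst suminf_ennreal2) (auto simp: c_def intro!: summable_mult)
  finally have "AE x in M. (\<Sum>k. ennreal \<bar>d k x\<bar>) \<noteq> \<infinity>"
    by (intro nn_integral_PInf_AE) (auto simp: less_top)
  then have conv: "AE x in M. convergent (\<lambda>n. f (r n) x)"
  proof eventually_elim
    case (elim x)
    then have "summable (\<lambda>k. \<bar>d k x\<bar>)" by (intro summable_suminf_not_top) auto
    then have "summable (\<lambda>k. d k x)" by (rule summable_rabs_cancel)
    then have "convergent (\<lambda>n. \<Sum>k<n. d k x)" by (simp add: summable_iff_convergent)
    moreover have "(\<Sum>k<n. d k x) = f (r n) x - f (r 0) x" for n
      using sum_lessThan_telescope[of "\<lambda>k. f (r k) x" n] by (simp add: d_def)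
    ultimately have "convergent (\<lambda>n. (f (r n) x - f (r 0) x) + f (r 0) x)"
      by (intro convergent_add) (auto simp: convergent_const)
    then show ?case by simp
  qed
  define g where "g x = lim (\<lambda>n. f (r n) x)" for x
  have [measurable]: "g \<in> borel_measurable M" unfolding g_def by measurable
  have lim: "AE x in M. (\<lambda>n. f (r n) x) \<longlonglongrightarrow> g x"
    using conv by eventually_elim (simp add: g_def convergent_LIMSEQ_iff)
  have fatou: "(\<integral>\<^sup>+x. ennreal ((f n x - g x)\<^sup>2) \<partial>M) \<le> ennreal ((1/4) ^ k)" if n: "n \<ge> r k" for n k
  proof -
    have "(\<integral>\<^sup>+x. ennreal ((f n x - g x)\<^sup>2) \<partial>M) = (\<integral>\<^sup>+x. liminf (\<lambda>i. ennreal ((f n x - f (r i) x)\<^sup>2)) \<partial>M)"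
    proof (rule nn_integral_cong_AE)
      show "AE x in M. ennreal ((f n x - g x)\<^sup>2) = liminf (\<lambda>i. ennreal ((f n x - f (r i) x)\<^sup>2))"
        using lim
      proof eventually_elim
        case (elim x)
        have "(\<lambda>i. ennreal ((f n x - f (r i) x)\<^sup>2)) \<longlonglongrightarrow> ennreal ((f n x - g x)\<^sup>2)"
          by (intro tendsto_ennrealI tendsto_intros elim)
        from lim_imp_Liminf[OF sequentially_bot this] show ?case by simp
      qed
    qed
    also have "\<dots> \<le> liminf (\<lambda>i. \<integral>\<^sup>+x. ennreal ((f n x - f (r i) x)\<^sup>2) \<partial>M)"
      by (rule nn_integral_liminf) measurable
    also have "\<dots> \<le> ennreal ((1/4) ^ k)"
    proof (rule Liminf_le)
      show "\<forall>\<^sub>F i in sequentially. (\<integral>\<^sup>+x. ennreal ((f n x - f (r i) x)\<^sup>2) \<partial>M) \<le> ennreal ((1/4) ^ k)"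
      proof (rule eventually_sequentiallyI[of n])
        fix i assume "n \<le> i"
        then have "n \<le> r i" using seq_suble[OF r, of i] by simp
        have df: "f (r i) - f n \<in> l2 M" using f by auto
        have "(\<integral>\<^sup>+x. ennreal ((f n x - f (r i) x)\<^sup>2) \<partial>M) = ennreal (ip M (f (r i) - f n) (f (r i) - f n))"
          using l2_mult[OF df df] unfolding ip_def
          by (subst nn_integral_eq_integral[symmetric])
             (auto simp: power2_commute[of "f n _"] power2_eq_square[symmetric])
        also have "\<dots> \<le> ennreal ((1/4) ^ k)"
          using rk[OF n \<open>n \<le> r i\<close>] by (intro ennreal_leI) simp
        finally show "(\<integral>\<^sup>+x. ennreal ((f n x - f (r i) x)\<^sup>2) \<partial>M) \<le> ennreal ((1/4) ^ k)" .
      qed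
    qed simp
    finally show ?thesis .
  qed
  have diff: "f n - g \<in> l2 M" "ip M (f n - g) (f n - g) \<le> (1/4) ^ k" if n: "n \<ge> r k" for n k
  proof -
    have int: "integrable M (\<lambda>x. (f n x - g x)\<^sup>2)"
      using fatou[OF n] by (intro integrableI_bounded) (auto simp: le_less_trans)
    then show "f n - g \<in> l2 M" by (simp add: l2_def fun_diff_def)
    have "ennreal (ip M (f n - g) (f n - g)) = (\<integral>\<^sup>+x. ennreal ((f n x - g x)\<^sup>2) \<partial>M)"
      using int by (simp add: nn_integral_eq_integral ip_def power2_eq_square)
    then have "ennreal (ip M (f n - g) (f n - g)) \<le> ennreal ((1/4) ^ k)" using fatou[OF n] by simp
    then show "ip M (f n - g) (f n - g) \<le> (1/4) ^ k" by (subst (asm) ennreal_le_iff) auto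
  qed
  have "f (r 0) - (f (r 0) - g) \<in> l2 M" using l2.mem(3)[OF f[of "r 0"] diff(1)[of 0 "r 0"]] by simp
  then have "g \<in> l2 M" by simp
  moreover have "(\<lambda>n. ip M (f n - g) (f n - g)) \<longlonglongrightarrow> 0"
  proof (rule LIMSEQ_I)
    fix \<epsilon> :: real assume "\<epsilon> > 0"
    then obtain k where k: "(1/4 :: real) ^ k < \<epsilon>" using real_arch_pow_inv[of \<epsilon> "1/4"] by auto
    have "norm (ip M (f n - g) (f n - g) - 0) < \<epsilon>" if "n \<ge> r k" for n
      using diff(2)[OF that] k l2.nonneg[OF diff(1)[OF that]] by simp
    then show "\<exists>N. \<forall>n\<ge>N. norm (ip M (f n - g) (f n - g) - 0) < \<epsilon>" by blast
  qed
  ultimately show ?thesis using r lim by blast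
qed

lemma l2_tendsto_ip:
  assumes f: "\<And>n. f n \<in> l2 M" "g \<in> l2 M" "h \<in> l2 M" and lim: "(\<lambda>n. ip M (f n - g) (f n - g)) \<longlonglongrightarrow> 0"
  shows "(\<lambda>n. ip M (f n) h) \<longlonglongrightarrow> ip M g h"
proof (rule Lim_transform_bound[THEN Lim_null[THEN iffD2], rotated -1])
  show "(\<lambda>n. sqrt (ip M (f n - g) (f n - g) * ip M h h)) \<longlonglongrightarrow> 0"
    using tendsto_real_sqrt[OF tendsto_mult_left_zero[OF lim]] by simp
  have "\<bar>ip M (f n) h - ip M g h\<bar> \<le> sqrt (ip M (f n - g) (f n - g) * ip M h h)" for n
  proof -
    have "ip M (f n) h - ip M g h = ip M (f n - g) h" using f by (simp add: l2.diff)
    then show ?thesis using l2.cauchy_schwarz[of "f n - g" M h] f by (intro real_le_rsqrt) auto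
  qed
  then show "\<forall>\<^sub>F n in sequentially. norm (ip M (f n) h - ip M g h) \<le> norm (sqrt (ip M (f n - g) (f n - g) * ip M h h))"
    by (intro always_eventually allI) (smt (verit) real_norm_def)
qed

section \<open>Smooth test functions\<close>

text \<open>Asking for some derivative function instead of working with \<open>deriv\<close> lets
  closure under sums, products and affine substitution go by plain induction.\<close>

primrec times_differentiable :: "nat \<Rightarrow> (real \<Rightarrow> real) \<Rightarrow> bool" where
  "times_differentiable 0 f \<longleftrightarrow> True"
| "times_differentiable (Suc k) f \<longleftrightarrow> (\<exists>g. (\<forall>x. (f has_real_derivative g x) (at x)) \<and> times_differentiable k g)"

definition smooth :: "(real \<Rightarrow> real) \<Rightarrow> bool" where
  "smooth f \<longleftrightarrow> (\<forall>k. times_differentiable k f)"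

lemma times_differentiable_mono: "times_differentiable (Suc k) f \<Longrightarrow> times_differentiable k f"
  by (induction k arbitrary: f) auto

lemma times_differentiable_const: "times_differentiable k (\<lambda>x. c)"
proof (induction k arbitrary: c)
  case (Suc k)
  show ?case by (auto intro!: exI[of _ "\<lambda>x. 0"] Suc)
qed simp

lemma times_differentiable_add: "times_differentiable k f \<Longrightarrow> times_differentiable k g \<Longrightarrow> times_differentiable k (\<lambda>x. f x + g x)"
proof (induction k arbitrary: f g)
  case (Suc k)
  then obtain f' g' where "\<And>x. (f has_real_derivative f' x) (at x)" "times_differentiable k f'"
    "\<And>x. (g has_real_derivative g' x) (at x)" "times_differentiable k g'" by auto
  then show ?case by (auto intro!: exI[of _ "\<lambda>x. f' x + g' x"] Suc.IH derivative_eq_intros)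
qed simp

lemma times_differentiable_mult: "times_differentiable k f \<Longrightarrow> times_differentiable k g \<Longrightarrow> times_differentiable k (\<lambda>x. f x * g x)"
proof (induction k arbitrary: f g)
  case (Suc k)
  then obtain f' g' where "\<And>x. (f has_real_derivative f' x) (at x)" "times_differentiable k f'"
    "\<And>x. (g has_real_derivative g' x) (at x)" "times_differentiable k g'" by auto
  moreover have "times_differentiable k f" "times_differentiable k g" using Suc.prems times_differentiable_mono by blast+
  ultimately show ?case
    by (auto intro!: exI[of _ "\<lambda>x. f' x * g x + f x * g' x"] Suc.IH times_differentiable_add derivative_eq_intros)
qed simp

lemma times_differentiable_affine: "times_differentiable k f \<Longrightarrow> times_differentiable k (\<lambda>x. f (c * x + d))"
proof (induction k arbitrary: f)
  case (Suc k)
  then obtain f' where f': "\<And>x. (f has_real_derivative f' x) (at x)" "times_differentiable k f'" by auto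
  have "((\<lambda>x. f (c * x + d)) has_real_derivative f' (c * x + d) * c) (at x)" for x
    by (rule DERIV_chain'[OF _ f'(1)]) (auto intro!: derivative_eq_intros)
  then show ?case using times_differentiable_mult[OF Suc.IH[OF f'(2)] times_differentiable_const[of k c]] by fastforce
qed simp

lemma smooth_add: "smooth f \<Longrightarrow> smooth g \<Longrightarrow> smooth (\<lambda>x. f x + g x)"
  by (simp add: smooth_def times_differentiable_add)

lemma smooth_mult: "smooth f \<Longrightarrow> smooth g \<Longrightarrow> smooth (\<lambda>x. f x * g x)"
  by (simp add: smooth_def times_differentiable_mult)

lemma smooth_const: "smooth (\<lambda>x. c)"
  by (simp add: smooth_def times_differentiable_const)

lemma smooth_cmult: "smooth f \<Longrightarrow> smooth (\<lambda>x. c * f x)"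
  by (simp add: smooth_mult smooth_const)

lemma smooth_diff: "smooth f \<Longrightarrow> smooth g \<Longrightarrow> smooth (\<lambda>x. f x - g x)"
  using smooth_add[of f "\<lambda>x. (-1) * g x"] smooth_cmult[of g "-1"] by simp

lemma smooth_affine: "smooth f \<Longrightarrow> smooth (\<lambda>x. f (c * x + d))"
  by (simp add: smooth_def times_differentiable_affine)

lemma
  assumes "smooth f"
  shows smooth_has_deriv: "(f has_real_derivative deriv f x) (at x)"
    and smooth_deriv: "smooth (deriv f)"
proof -
  have *: "\<exists>g. (\<forall>x. (f has_real_derivative g x) (at x)) \<and> times_differentiable k g" for k
    using assms unfolding smooth_def by (metis times_differentiable.simps(2))
  have eq: "g = deriv f" if g: "\<forall>x. (f has_real_derivative g x) (at x)" for g
    using g by (intro ext) (metis DERIV_imp_deriv)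
  show "(f has_real_derivative deriv f x) (at x)" using * eq by blast
  show "smooth (deriv f)" unfolding smooth_def using * eq by blast
qed

lemma smooth_continuous: "smooth f \<Longrightarrow> continuous_on A f"
  by (meson DERIV_continuous_on smooth_has_deriv has_field_derivative_at_within)

lemma smooth_antiderivative:
  assumes "smooth f" "\<And>x. (F has_real_derivative f x) (at x)"
  shows "smooth F"
proof -
  have "times_differentiable k F" for k using assms by (cases k) (auto simp: smooth_def)
  then show ?thesis by (simp add: smooth_def)
qed

text \<open>The classical smooth function exp (-1 / x), extended by 0, with a polynomial in 1 / x as
  a factor so that the family is closed under differentiation.\<close>

definition flat :: "real poly \<Rightarrow> real \<Rightarrow> real" where
  "flat P x = (if x > 0 then poly P (1 / x) * exp (- 1 / x) else 0)"

lemma flat_tendsto_0: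
  fixes P :: "real poly"
  shows "((\<lambda>x. poly P (1 / x) * exp (- 1 / x)) \<longlongrightarrow> 0) (at_right 0)"
proof -
  have "((\<lambda>y. \<Sum>i\<le>degree P. coeff P i * (y ^ i / exp y)) \<longlongrightarrow> (\<Sum>i\<le>degree P. coeff P i * 0)) at_top"
    by (intro tendsto_sum tendsto_mult tendsto_const tendsto_power_div_exp_0)
  then have "((\<lambda>y. poly P y / exp y) \<longlongrightarrow> 0) at_top"
    by (simp add: poly_altdef sum_divide_distrib)
  then have "((\<lambda>x. poly P (inverse x) / exp (inverse x)) \<longlongrightarrow> 0) (at_right 0)"
    by (rule filterlim_compose) (rule filterlim_inverse_at_top_right)
  then show ?thesis by (simp add: exp_minus divide_inverse)
qed

text \<open>With y = 1 / x the chain rule turns P into y^2 (P - P'). At x = 0 the difference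
  quotient is of the same form with y P, and the exponential beats every polynomial.\<close>

lemma flat_has_deriv: "(flat P has_real_derivative flat ([:0, 0, 1:] * (P - pderiv P)) x) (at x)"
proof (cases x "0 :: real" rule: linorder_cases)
  case less
  have "((\<lambda>x. 0) has_real_derivative 0) (at x)" by simp
  moreover have "\<forall>\<^sub>F y in nhds x. 0 = flat P y"
    using eventually_nhds_in_open[of "{..<0}" x] less by (auto elim!: eventually_mono simp: flat_def)
  ultimately show ?thesis using less DERIV_cong_ev[of x x "\<lambda>x. 0" "flat P" 0 0] by (auto simp: flat_def)
next
  case greater
  have "((\<lambda>x. poly P (1 / x) * exp (- 1 / x)) has_real_derivative
      flat ([:0, 0, 1:] * (P - pderiv P)) x) (at x)"
    using greater
    by (auto intro!: derivative_eq_intros poly_DERIV[THEN DERIV_chain2]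
        simp: flat_def field_simps power2_eq_square)
  moreover have "\<forall>\<^sub>F y in nhds x. poly P (1 / y) * exp (- 1 / y) = flat P y"
    using eventually_nhds_in_open[of "{0<..}" x] greater by (auto elim!: eventually_mono simp: flat_def)
  ultimately show ?thesis by (subst DERIV_cong_ev[symmetric]) auto
next
  case equal
  have "((\<lambda>h. flat P h / h) \<longlongrightarrow> 0) (at_right 0)"
  proof (rule Lim_transform_eventually)
    show "((\<lambda>x. poly ([:0, 1:] * P) (1 / x) * exp (- 1 / x)) \<longlongrightarrow> 0) (at_right 0)"
      by (rule flat_tendsto_0)
    show "\<forall>\<^sub>F x in at_right 0. poly ([:0, 1:] * P) (1 / x) * exp (- 1 / x) = flat P x / x"
      by (auto simp: eventually_at_filter flat_def)
  qed
  moreover have "((\<lambda>h. flat P h / h) \<longlongrightarrow> 0) (at_left 0)"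
    by (rule Lim_transform_eventually[OF tendsto_const]) (auto simp: eventually_at_filter flat_def)
  ultimately have "((\<lambda>h. flat P h / h) \<longlongrightarrow> 0) (at 0)" by (simp add: filterlim_split_at)
  then show ?thesis using equal by (simp add: has_field_derivative_iff flat_def)
qed

lemma smooth_flat: "smooth (flat P)"
proof -
  have "times_differentiable k (flat P)" for k
    by (induction k arbitrary: P) (use flat_has_deriv in \<open>auto simp del: mult_pCons_left\<close>)
  then show ?thesis by (simp add: smooth_def)
qed

text \<open>Smooth functions with compact support in (a, b), with the support described by
  inequalities. Products of two of them will be enough to exploit planar weak derivatives.\<close>

definition test1 :: "real \<Rightarrow> real \<Rightarrow> (real \<Rightarrow> real) set" where
  "test1 a b = {f. smooth f \<and> (\<exists>p q. a < p \<and> p \<le> q \<and> q < b \<and> (\<forall>x. x < p \<or> q < x \<longrightarrow> f x = 0))}"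

lemma test1_smooth: "f \<in> test1 a b \<Longrightarrow> smooth f"
  by (simp add: test1_def)

lemma test1_zero: "f \<in> test1 a b \<Longrightarrow> x \<notin> {a<..<b} \<Longrightarrow> f x = 0"
  by (force simp: test1_def)

lemma test1_deriv:
  assumes f: "f \<in> test1 a b"
  shows "deriv f \<in> test1 a b"
proof -
  obtain p q where pq: "a < p" "p \<le> q" "q < b" "\<And>x. x < p \<or> q < x \<Longrightarrow> f x = 0"
    using f unfolding test1_def by blast
  have "deriv f x = 0" if x: "x < p \<or> q < x" for x
  proof (rule DERIV_imp_deriv)
    have "\<forall>\<^sub>F y in nhds x. 0 = f y"
      using eventually_nhds_in_open[of "{..<p} \<union> {q<..}" x] x pq(4) open_Un[OF open_lessThan open_greaterThan, of p q]
      by (auto elim!: eventually_mono)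
    moreover have "((\<lambda>x. 0 :: real) has_real_derivative 0) (at x)" by simp
    ultimately show "(f has_real_derivative 0) (at x)"
      using DERIV_cong_ev[of x x "\<lambda>x. 0" f 0 0] by auto
  qed
  then show ?thesis using pq f smooth_deriv by (auto simp: test1_def)
qed

lemma test1_combine:
  assumes f: "f \<in> test1 a b" and g: "g \<in> test1 a b"
  shows "(\<lambda>x. f x - c * g x) \<in> test1 a b"
proof -
  obtain p q where pq: "a < p" "p \<le> q" "q < b" "\<And>x. x < p \<or> q < x \<Longrightarrow> f x = 0"
    using f unfolding test1_def by blast
  obtain p' q' where pq': "a < p'" "p' \<le> q'" "q' < b" "\<And>x. x < p' \<or> q' < x \<Longrightarrow> g x = 0"
    using g unfolding test1_def by blast
  have "smooth (\<lambda>x. f x - c * g x)" using f g by (intro smooth_diff smooth_cmult test1_smooth)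
  moreover have "f x - c * g x = 0" if "x < min p p' \<or> max q q' < x" for x
    using that pq(4)[of x] pq'(4)[of x] by auto
  ultimately show ?thesis
    using pq pq' unfolding test1_def
    by (intro CollectI conjI exI[of _ "min p p'"] exI[of _ "max q q'"]) auto
qed

lemma test1_mono:
  assumes "f \<in> test1 a b" "a' \<le> a" "b \<le> b'"
  shows "f \<in> test1 a' b'"
  using assms unfolding test1_def by (smt (verit) mem_Collect_eq)

lemma test1_bounded:
  assumes "f \<in> test1 a b"
  shows "\<exists>K. \<forall>x. \<bar>f x\<bar> \<le> K"
proof -
  obtain p q where pq: "\<And>x. x < p \<or> q < x \<Longrightarrow> f x = 0"
    using assms unfolding test1_def by blast
  have "compact (f ` {p..q})"
    using assms by (intro compact_continuous_image smooth_continuous) (auto simp: test1_def)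
  then obtain K where K: "\<And>x. x \<in> {p..q} \<Longrightarrow> norm (f x) \<le> K"
    using compact_imp_bounded bounded_iff by (metis imageI)
  have "\<bar>f x\<bar> \<le> max K 0" for x using K[of x] pq[of x] by (cases "x \<in> {p..q}") auto
  then show ?thesis by blast
qed

lemma test1_measurable: "f \<in> test1 a b \<Longrightarrow> f \<in> borel_measurable borel"
  by (intro borel_measurable_continuous_onI smooth_continuous test1_smooth)

lemma test1_integrable:
  assumes "f \<in> test1 a b"
  shows "integrable lborel f"
proof -
  obtain p q where pq: "\<And>x. x < p \<or> q < x \<Longrightarrow> f x = 0"
    using assms unfolding test1_def by blast
  have "integrable lborel (\<lambda>x. indicator {p..q} x *\<^sub>R f x)"
    by (rule borel_integrable_compact) (use assms in \<open>auto intro: smooth_continuous test1_smooth\<close>)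
  moreover have "indicator {p..q} x *\<^sub>R f x = f x" for x using pq[of x] by (cases "x < p \<or> q < x") (auto simp: indicator_def)
  ultimately show ?thesis by (simp only:)
qed

lemma integral_deriv_below:
  assumes f: "f \<in> test1 a b"
  shows "(\<integral>x. indicator {..<s} x * deriv f x \<partial>lborel) = f s"
    and "(\<integral>x. indicator {s<..} x * deriv f x \<partial>lborel) = - f s"
proof -
  obtain p q where pq: "p \<le> q" "\<And>x. x < p \<or> q < x \<Longrightarrow> f x = 0" "\<And>x. x < p \<or> q < x \<Longrightarrow> deriv f x = 0"
  proof -
    obtain p q where 1: "p \<le> q" "\<And>x. x < p \<or> q < x \<Longrightarrow> f x = 0"
      using f unfolding test1_def by blast
    obtain p' q' where 2: "\<And>x. x < p' \<or> q' < x \<Longrightarrow> deriv f x = 0"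
      using test1_deriv[OF f] unfolding test1_def by blast
    show ?thesis
    proof (rule that)
      show "min p p' \<le> max q q'" using 1(1) by auto
      show "f x = 0" "deriv f x = 0" if "x < min p p' \<or> max q q' < x" for x
        using that 1(2)[of x] 2[of x] by auto
    qed
  qed
  have ftc: "(\<integral>x. indicator {c..d} x *\<^sub>R deriv f x \<partial>lborel) = f d - f c" if "c \<le> d" for c d
  proof (rule integral_FTC_Icc[OF that])
    show "(f has_vector_derivative deriv f x) (at x within {c..d})" for x
      using smooth_has_deriv[OF test1_smooth[OF f], of x]
      by (meson has_field_derivative_at_within has_real_derivative_iff_has_vector_derivative)
    show "continuous_on {c..d} (deriv f)"
      by (intro smooth_continuous smooth_deriv test1_smooth[OF f])
  qed
  have "(\<integral>x. indicator {..<s} x * deriv f x \<partial>lborel) = (\<integral>x. indicator {min (p - 1) s..s} x *\<^sub>R deriv f x \<partial>lborel)"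
  proof (rule integral_cong_AE)
    show "AE x in lborel. indicator {..<s} x * deriv f x = indicator {min (p - 1) s..s} x *\<^sub>R deriv f x"
      using AE_lborel_singleton[of s]
    proof eventually_elim
      case (elim x)
      then show ?case using pq(3)[of x] by (cases "x < p \<or> q < x") (auto simp: indicator_def)
    qed
  qed (use test1_measurable[OF test1_deriv[OF f]] in auto)
  then show "(\<integral>x. indicator {..<s} x * deriv f x \<partial>lborel) = f s"
    using pq(2)[of "min (p - 1) s"] by (subst (asm) ftc) (auto simp: min_def split: if_splits)
  have "(\<integral>x. indicator {s<..} x * deriv f x \<partial>lborel) = (\<integral>x. indicator {s..max (q + 1) s} x *\<^sub>R deriv f x \<partial>lborel)"
  proof (rule integral_cong_AE)
    show "AE x in lborel. indicator {s<..} x * deriv f x = indicator {s..max (q + 1) s} x *\<^sub>R deriv f x"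
      using AE_lborel_singleton[of s]
    proof eventually_elim
      case (elim x)
      then show ?case using pq(3)[of x] by (cases "x < p \<or> q < x") (auto simp: indicator_def)
    qed
  qed (use test1_measurable[OF test1_deriv[OF f]] in auto)
  then show "(\<integral>x. indicator {s<..} x * deriv f x \<partial>lborel) = - f s"
    using pq(2)[of "max (q + 1) s"] by (subst (asm) ftc) (auto simp: max_def split: if_splits)
qed

text \<open>Mean zero is exactly what makes the antiderivative vanish again to the right of the
  support; it starts at \<open>p - 1\<close>, to the left of it.\<close>

lemma test1_antiderivative:
  assumes f: "f \<in> test1 a b" and zero: "(\<integral>x. f x \<partial>lborel) = 0"
  shows "\<exists>F\<in>test1 a b. deriv F = f"
proof -
  obtain p q where pq: "a < p" "p \<le> q" "q < b" "\<And>x. x < p \<or> q < x \<Longrightarrow> f x = 0"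
    using f unfolding test1_def by blast
  define F where "F x = integral {p - 1..x} f" for x
  have cont: "continuous_on A f" for A using f by (intro smooth_continuous test1_smooth)
  have F0: "F x = 0" if "x < p" for x
    unfolding F_def using that pq(4) by (subst Henstock_Kurzweil_Integration.integral_cong[of _ _ "\<lambda>x. 0"]) auto
  have deriv: "(F has_real_derivative f x) (at x)" for x
  proof (cases "x < p")
    case True
    have "\<forall>\<^sub>F y in nhds x. 0 = F y"
      using eventually_nhds_in_open[of "{..<p}" x] True F0 by (auto elim!: eventually_mono)
    moreover have "((\<lambda>x. 0 :: real) has_real_derivative 0) (at x)" by simp
    ultimately show ?thesis using True pq(4)[of x] DERIV_cong_ev[of x x "\<lambda>x. 0" F 0 0] by auto
  next
    case False
    have "((\<lambda>x. integral {p - 1..x} f) has_real_derivative f x) (at x within {p - 1..x + 1})"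
      by (rule integral_has_real_derivative) (use cont False in auto)
    moreover have "at x within {p - 1..x + 1} = at x"
      using False by (intro at_within_interior) auto
    ultimately show ?thesis by (simp add: F_def[abs_def])
  qed
  have "F x = 0" if "x > q" for x
  proof -
    have "F x = (\<integral>t. indicator {p - 1..x} t *\<^sub>R f t \<partial>lborel)"
      unfolding F_def using borel_integrable_compact[of "{p - 1..x}" f] cont
      by (subst set_borel_integral_eq_integral(2)[symmetric])
         (auto simp: set_integrable_def set_lebesgue_integral_def)
    also have "\<dots> = (\<integral>t. f t \<partial>lborel)"
    proof (intro Bochner_Integration.integral_cong refl)
      fix t show "indicator {p - 1..x} t *\<^sub>R f t = f t"
        using pq(4)[of t] that by (cases "t < p \<or> q < t") (auto simp: indicator_def)
    qed
    finally show ?thesis using zero by simp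
  qed
  moreover have "smooth F" using deriv test1_smooth[OF f] by (rule smooth_antiderivative[rotated])
  ultimately have "F \<in> test1 a b" using F0 pq unfolding test1_def by force
  moreover have "deriv F = f" using deriv by (auto simp: DERIV_imp_deriv)
  ultimately show ?thesis by blast
qed

text \<open>Approximates the indicator of (a, b) from inside: the function vanishes within distance
  1 / n of the ends, and both factors tend to 1 at interior points.\<close>

definition cutoff :: "real \<Rightarrow> real \<Rightarrow> nat \<Rightarrow> real \<Rightarrow> real" where
  "cutoff a b n x = flat 1 (real n * (x - a) - 1) * flat 1 (real n * (b - x) - 1)"

lemma cutoff_bound: "0 \<le> cutoff a b n x" "cutoff a b n x \<le> 1"
proof -
  have "0 \<le> flat 1 y" "flat 1 y \<le> 1" for y by (auto simp: flat_def)
  then show "0 \<le> cutoff a b n x" "cutoff a b n x \<le> 1"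
    by (auto simp: cutoff_def mult_le_one)
qed

text \<open>The second alternative covers margins that overlap, in particular empty intervals, where
  \<open>test1 a b\<close> has no elements.\<close>

lemma cutoff_test1:
  shows "cutoff a b n \<in> test1 a b \<or> cutoff a b n = (\<lambda>x. 0)"
proof (cases "n > 0 \<and> a + 1 / real n \<le> b - 1 / real n")
  case True
  have "smooth (\<lambda>x. flat 1 (real n * x + (- real n * a - 1)) * flat 1 (- real n * x + (real n * b - 1)))"
    by (intro smooth_mult smooth_affine smooth_flat)
  then have "smooth (cutoff a b n)"
    unfolding cutoff_def[abs_def] by (simp add: algebra_simps)
  moreover have "cutoff a b n x = 0" if "x < a + 1 / real n \<or> b - 1 / real n < x" for x
    using that True by (auto simp: cutoff_def flat_def field_simps)
  ultimately show ?thesis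
    using True unfolding test1_def
    by (intro disjI1 CollectI conjI exI[of _ "a + 1 / real n"] exI[of _ "b - 1 / real n"]) auto
next
  case False
  have "cutoff a b n x = 0" for x
  proof (rule ccontr)
    assume "cutoff a b n x \<noteq> 0"
    then have "real n * (x - a) > 1" "real n * (b - x) > 1" by (auto simp: cutoff_def flat_def split: if_splits)
    then have n: "n > 0" "real n * (b - a) > 2" by (cases "n = 0", auto simp: algebra_simps)
    then have "2 / real n < b - a" by (simp add: field_simps)
    then have "a + 1 / real n \<le> b - 1 / real n" by simp
    then show False using False n by simp
  qed
  then show ?thesis by auto
qed

lemma cutoff_tendsto: "(\<lambda>n. cutoff a b n x) \<longlonglongrightarrow> indicator {a<..<b} x"
proof (cases "x \<in> {a<..<b}")
  case True
  have *: "(\<lambda>n. flat 1 (real n * y - 1)) \<longlonglongrightarrow> 1" if y: "y > 0" for y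
  proof (rule Lim_transform_eventually)
    have "(\<lambda>n. exp (- 1 / (real n * y - 1))) \<longlonglongrightarrow> exp 0"
      using y by (intro tendsto_exp) real_asymp
    then show "(\<lambda>n. exp (- 1 / (real n * y - 1))) \<longlonglongrightarrow> 1" by simp
    have "\<forall>\<^sub>F n in sequentially. real n * y > 1" using y by real_asymp
    then show "\<forall>\<^sub>F n in sequentially. exp (- 1 / (real n * y - 1)) = flat 1 (real n * y - 1)"
      by eventually_elim (simp add: flat_def)
  qed
  show ?thesis using tendsto_mult[OF *[of "x - a"] *[of "b - x"]] True by (simp add: cutoff_def)
next
  case False
  have "cutoff a b n x = 0" for n
  proof (rule ccontr)
    assume "cutoff a b n x \<noteq> 0"
    then have "real n * (x - a) > 0" "real n * (b - x) > 0" by (auto simp: cutoff_def flat_def split: if_splits)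
    then show False using False by (auto simp: zero_less_mult_iff)
  qed
  then show ?thesis using False by simp
qed

lemma exists_normalized_test1:
  assumes "a < b"
  shows "\<exists>\<rho>\<in>test1 a b. (\<integral>x. \<rho> x \<partial>lborel) = 1"
proof -
  have "(\<lambda>n. \<integral>x. cutoff a b n x \<partial>lborel) \<longlonglongrightarrow> (\<integral>x. indicator {a<..<b} x \<partial>lborel)"
  proof (rule integral_dominated_convergence)
    show "integrable lborel (\<lambda>x. indicator {a<..<b} x :: real)" 
      using assms by (intro integrable_real_indicator) auto
    show "cutoff a b n \<in> borel_measurable lborel" for n
      using cutoff_test1[of a b n] test1_measurable by auto
    show "AE x in lborel. norm (cutoff a b n x) \<le> indicator {a<..<b} x" for n
      using cutoff_test1[of a b n] test1_zero[of "cutoff a b n" a b] cutoff_bound[of a b n]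
      by (intro AE_I2) (auto simp: indicator_def)
  qed (use cutoff_tendsto in auto)
  moreover have "(\<integral>x. indicator {a<..<b} x \<partial>lborel) > (0 :: real)" using assms by simp
  ultimately have "\<forall>\<^sub>F n in sequentially. (\<integral>x. cutoff a b n x \<partial>lborel) > 0"
    by (rule order_tendstoD(1))
  then obtain n where n: "(\<integral>x. cutoff a b n x \<partial>lborel) > 0" by (auto simp: eventually_sequentially)
  then have "cutoff a b n \<in> test1 a b" using cutoff_test1[of a b n] by auto
  \<comment> \<open>With I the integral of the cutoff f, f - (1 - 1 / I) f = f / I has integral
    1.\<close>
  from test1_combine[OF this this, of "1 - 1 / (\<integral>x. cutoff a b n x \<partial>lborel)"] show ?thesis
    using n by (intro bexI) (auto simp: algebra_simps)
qed

section \<open>Products of one-variable test functions\<close>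

definition tensor :: "(real \<Rightarrow> real) \<Rightarrow> (real \<Rightarrow> real) \<Rightarrow> real \<times> real \<Rightarrow> real" where
  "tensor f g = (\<lambda>(x, y). f x * g y)"

lemma ddx_tensor: "smooth f \<Longrightarrow> ddx (tensor f g) = tensor (deriv f) g"
  using smooth_has_deriv[of f] by (auto simp: ddx_def tensor_def fun_eq_iff intro!: DERIV_imp_deriv DERIV_cmult_right)

lemma ddy_tensor: "smooth g \<Longrightarrow> ddy (tensor f g) = tensor f (deriv g)"
  using smooth_has_deriv[of g] by (auto simp: ddy_def tensor_def fun_eq_iff intro!: DERIV_imp_deriv DERIV_cmult)

lemma C_k_tensor: "smooth f \<Longrightarrow> smooth g \<Longrightarrow> C_k k (tensor f g)"
proof (induction k arbitrary: f g)
  case 0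
  have "continuous_on UNIV (\<lambda>z :: real \<times> real. f (fst z) * g (snd z))"
    by (intro continuous_intros continuous_on_compose2[OF smooth_continuous[OF 0(1)]]
      continuous_on_compose2[OF smooth_continuous[OF 0(2)]]) auto
  then show ?case by (simp add: tensor_def case_prod_unfold)
next
  case (Suc k)
  have "tensor f g differentiable (at z)" for z
  proof -
    have f: "(f has_derivative (*) (deriv f (fst z))) (at (fst z))"
     and g: "(g has_derivative (*) (deriv g (snd z))) (at (snd z))"
      using smooth_has_deriv Suc.prems by (auto simp: has_field_derivative_def)
    have "(\<lambda>z. f (fst z) * g (snd z)) differentiable (at z)"
      by (intro differentiable_mult 
        differentiableI[OF has_derivative_compose[where f = fst, OF bounded_linear_imp_has_derivative[OF bounded_linear_fst] f]]
        differentiableI[OF has_derivative_compose[where f = snd, OF bounded_linear_imp_has_derivative[OF bounded_linear_snd] g]])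
    then show ?thesis by (simp add: tensor_def case_prod_unfold)
  qed
  then show ?case
    using Suc by (auto simp: ddx_tensor ddy_tensor smooth_deriv differentiable_on_def intro: differentiable_at_withinI)
qed

lemma tensor_test_function:
  assumes f: "f \<in> test1 a b" and g: "g \<in> test1 c d"
  shows "tensor f g \<in> test_functions ({a<..<b} \<times> {c<..<d})"
proof -
  obtain p q where pq: "a < p" "p \<le> q" "q < b" "\<And>x. x < p \<or> q < x \<Longrightarrow> f x = 0"
    using f unfolding test1_def by blast
  obtain p' q' where pq': "c < p'" "p' \<le> q'" "q' < d" "\<And>x. x < p' \<or> q' < x \<Longrightarrow> g x = 0"
    using g unfolding test1_def by blast
  have "closure {z. tensor f g z \<noteq> 0} \<subseteq> {p..q} \<times> {p'..q'}"
  proof (rule closure_minimal)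
    show "{z. tensor f g z \<noteq> 0} \<subseteq> {p..q} \<times> {p'..q'}"
      using pq(4) pq'(4) by (auto simp: tensor_def) (meson not_le)+
  qed (auto intro!: closed_Times)
  moreover have "compact ({p..q} \<times> {p'..q'})" by (intro compact_Times compact_Icc)
  then have "compact (closure {z. tensor f g z \<noteq> 0})"
    using calculation by (metis closed_closure compact_Int_closed inf.absorb_iff2)
  moreover have "{p..q} \<times> {p'..q'} \<subseteq> {a<..<b} \<times> {c<..<d}" using pq pq' by auto
  ultimately show ?thesis using C_k_tensor f g by (auto simp: test_functions_def test1_def)
qed

section \<open>Weak derivatives in the plane\<close>

text \<open>\<open>ennreal\<close> truncates at 0, so \<open>?p\<close> and \<open>?n\<close> are
  the positive and the negative part. As densities they define finite measures that agree on boxes,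
  a generator stable under intersection, hence everywhere; so the densities agree.\<close>

lemma AE_zero_if_integral_box_zero:
  fixes k :: "'a::euclidean_space \<Rightarrow> real"
  assumes k: "integrable lborel k"
    and zero: "\<And>a b. (\<integral>x. indicator (box a b) x * k x \<partial>lborel) = 0"
  shows "AE x in lborel. k x = 0"
proof -
  have [measurable]: "k \<in> borel_measurable borel" using k by simp
  let ?p = "\<lambda>x. ennreal (k x)" and ?n = "\<lambda>x. ennreal (- k x)"
  have fin: "(\<integral>\<^sup>+x. ?p x \<partial>lborel) \<noteq> \<infinity>" "(\<integral>\<^sup>+x. ?n x \<partial>lborel) \<noteq> \<infinity>"
    using k by (auto simp: real_integrable_def)
  have "density lborel ?p = density lborel ?n"
  proof (rule measure_eqI_generator_eq[where \<Omega> = UNIV and E = "range (\<lambda>(a, b). box a b :: 'a set)"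
        and A = "\<lambda>i. box (- real i *\<^sub>R One) (real i *\<^sub>R One)"])
    show "Int_stable (range (\<lambda>(a, b). box a b :: 'a set))"
      by (auto simp: Int_stable_def box_Int_box)
    show "sets (density lborel ?p) = sigma_sets UNIV (range (\<lambda>(a, b). box a b :: 'a set))"
      "sets (density lborel ?n) = sigma_sets UNIV (range (\<lambda>(a, b). box a b :: 'a set))"
      by (simp_all add: borel_eq_box)
    show "(\<Union>i. box (- real i *\<^sub>R One) (real i *\<^sub>R One :: 'a)) = UNIV"
      using UN_box_eq_UNIV by simp
    show "range (\<lambda>i. box (- real i *\<^sub>R One) (real i *\<^sub>R One)) \<subseteq> range (\<lambda>(a, b). box a b :: 'a set)"
      by auto
    show "emeasure (density lborel ?p) (box (- real i *\<^sub>R One) (real i *\<^sub>R One)) \<noteq> \<infinity>" for i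
    proof -
      have "emeasure (density lborel ?p) (box (- real i *\<^sub>R One) (real i *\<^sub>R One)) \<le> (\<integral>\<^sup>+x. ?p x \<partial>lborel)"
        by (simp add: emeasure_density) (auto intro!: nn_integral_mono simp: indicator_def)
      then show ?thesis using fin(1) by (auto simp: top_unique)
    qed
    fix X assume "X \<in> range (\<lambda>(a, b). box a b :: 'a set)"
    then obtain a b where X: "X = box a b" by auto
    let ?k = "\<lambda>x. indicator X x * k x"
    have int: "integrable lborel ?k" using k X by (auto intro!: integrable_real_mult_indicator simp: mult.commute)
    have e: "(\<integral>\<^sup>+x. ?p x * indicator X x \<partial>lborel) = (\<integral>\<^sup>+x. ennreal (?k x) \<partial>lborel)"
      "(\<integral>\<^sup>+x. ?n x * indicator X x \<partial>lborel) = (\<integral>\<^sup>+x. ennreal (- ?k x) \<partial>lborel)"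
      by (auto intro!: nn_integral_cong simp: indicator_def)
    have "enn2real (\<integral>\<^sup>+x. ennreal (?k x) \<partial>lborel) = enn2real (\<integral>\<^sup>+x. ennreal (- ?k x) \<partial>lborel)"
      using zero[of a b] int by (simp add: real_lebesgue_integral_def X)
    moreover have "(\<integral>\<^sup>+x. ennreal (?k x) \<partial>lborel) < top" "(\<integral>\<^sup>+x. ennreal (- ?k x) \<partial>lborel) < top"
      using int by (auto simp: real_integrable_def less_top)
    ultimately have "(\<integral>\<^sup>+x. ennreal (?k x) \<partial>lborel) = (\<integral>\<^sup>+x. ennreal (- ?k x) \<partial>lborel)"
      by (metis ennreal_enn2real)
    then show "emeasure (density lborel ?p) X = emeasure (density lborel ?n) X"
      using X e by (simp add: emeasure_density)
  qed auto
  then have "AE x in lborel. ?p x = ?n x"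
    using fin by (subst (asm) finite_density_unique) auto
  then show ?thesis
  proof eventually_elim
    case (elim x)
    then show ?case by (cases "k x \<ge> 0") (auto simp: ennreal_neg)
  qed
qed

lemma
  fixes f :: "real \<times> real \<Rightarrow> real"
  assumes f: "integrable lborel f"
  shows planar_sections: "AE x in lborel. integrable lborel (\<lambda>y. f (x, y))"
      "AE y in lborel. integrable lborel (\<lambda>x. f (x, y))"
    and planar_integrable: "integrable lborel (\<lambda>x. \<integral>y. f (x, y) \<partial>lborel)"
      "integrable lborel (\<lambda>y. \<integral>x. f (x, y) \<partial>lborel)"
    and planar_Fubini: "(\<integral>x. (\<integral>y. f (x, y) \<partial>lborel) \<partial>lborel) = (\<integral>z. f z \<partial>lborel)"
      "(\<integral>y. (\<integral>x. f (x, y) \<partial>lborel) \<partial>lborel) = (\<integral>z. f z \<partial>lborel)"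
proof -
  have g: "integrable (lborel \<Otimes>\<^sub>M lborel) f" using f by (simp add: lborel_prod)
  then have h: "integrable (lborel \<Otimes>\<^sub>M lborel) (\<lambda>(x, y). f (x, y))" by simp
  show "AE x in lborel. integrable lborel (\<lambda>y. f (x, y))"
    "integrable lborel (\<lambda>x. \<integral>y. f (x, y) \<partial>lborel)"
    "(\<integral>x. (\<integral>y. f (x, y) \<partial>lborel) \<partial>lborel) = (\<integral>z. f z \<partial>lborel)"
    using lborel_pair.AE_integrable_fst'[OF g] lborel_pair.integrable_fst'[OF g] lborel_pair.integral_fst'[OF g]
    by (simp_all add: lborel_prod)
  show "AE y in lborel. integrable lborel (\<lambda>x. f (x, y))"
    "integrable lborel (\<lambda>y. \<integral>x. f (x, y) \<partial>lborel)"
    "(\<integral>y. (\<integral>x. f (x, y) \<partial>lborel) \<partial>lborel) = (\<integral>z. f z \<partial>lborel)"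
    using lborel_pair.AE_integrable_snd[OF h] lborel_pair.integrable_snd[OF h] lborel_pair.integral_snd[OF h]
    by (simp_all add: lborel_prod)
qed

lemma AE_planar_snd:
  assumes "AE y in (lborel :: real measure). Q y"
  shows "AE z in (lborel :: (real \<times> real) measure). Q (snd z)"
proof -
  obtain N where "{y \<in> space lborel. \<not> Q y} \<subseteq> N" "emeasure lborel N = 0" "N \<in> sets lborel"
    using AE_E[OF assms] by blast
  then have N: "N \<in> null_sets lborel" "{y. \<not> Q y} \<subseteq> N" by auto
  have "emeasure (lborel \<Otimes>\<^sub>M lborel) ((UNIV :: real set) \<times> N) = emeasure lborel (UNIV :: real set) * emeasure lborel N"
    by (rule lborel.emeasure_pair_measure_Times) (use N(1) in auto)
  then have "(UNIV :: real set) \<times> N \<in> null_sets (lborel \<Otimes>\<^sub>M lborel)"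
    using N by (intro null_setsI pair_measureI) auto
  then have "AE z in lborel \<Otimes>\<^sub>M lborel. z \<notin> (UNIV :: real set) \<times> N" by (rule AE_not_in)
  then have "AE z in (lborel \<Otimes>\<^sub>M lborel :: (real \<times> real) measure). Q (snd z)"
    by eventually_elim (use N in auto)
  then show ?thesis unfolding lborel_prod .
qed

lemma
  fixes f g :: "real \<Rightarrow> real"
  assumes f: "integrable lborel f" and g: "integrable lborel g"
  shows integrable_product: "integrable lborel (\<lambda>z. f (fst z) * g (snd z))"
    and integral_product: "(\<integral>z. f (fst z) * g (snd z) \<partial>lborel) = (\<integral>x. f x \<partial>lborel) * (\<integral>y. g y \<partial>lborel)"
proof -
  have [measurable]: "f \<in> borel_measurable borel" "g \<in> borel_measurable borel" using f g by auto
  have "integrable (lborel \<Otimes>\<^sub>M lborel) (\<lambda>z. f (fst z) * g (snd z))"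
    by (rule lborel_pair.Fubini_integrable) (use f g in \<open>auto simp: abs_mult\<close>)
  then show int: "integrable lborel (\<lambda>z. f (fst z) * g (snd z))" by (simp add: lborel_prod)
  show "(\<integral>z. f (fst z) * g (snd z) \<partial>lborel) = (\<integral>x. f x \<partial>lborel) * (\<integral>y. g y \<partial>lborel)"
    using planar_Fubini(1)[OF int] by simp
qed

lemma integrable_mult_bounded:
  fixes f h :: "'a \<Rightarrow> real"
  assumes f: "integrable M f" and [measurable]: "h \<in> borel_measurable M" and h: "\<And>x. \<bar>h x\<bar> \<le> K"
  shows "integrable M (\<lambda>x. f x * h x)" "integrable M (\<lambda>x. h x * f x)"
proof -
  have [measurable]: "f \<in> borel_measurable M" using f by simp
  show "integrable M (\<lambda>x. f x * h x)"
  proof (rule Bochner_Integration.integrable_bound)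
    show "integrable M (\<lambda>x. K * \<bar>f x\<bar>)" using f by simp
    show "AE x in M. norm (f x * h x) \<le> norm (K * \<bar>f x\<bar>)"
    proof (rule AE_I2)
      fix x
      have "\<bar>h x\<bar> * \<bar>f x\<bar> \<le> K * \<bar>f x\<bar>" using h[of x] by (rule mult_right_mono) simp
      then show "norm (f x * h x) \<le> norm (K * \<bar>f x\<bar>)"
        using abs_ge_self[of "K * \<bar>f x\<bar>"] by (simp add: abs_mult mult.commute)
    qed
  qed simp
  then show "integrable M (\<lambda>x. h x * f x)" by (simp add: mult.commute)
qed

lemma
  assumes f: "f \<in> test1 a b" and g: "g \<in> test1 c d"
  shows tensor_measurable: "tensor f g \<in> borel_measurable borel"
    and tensor_bounded: "\<exists>K. \<forall>z. \<bar>tensor f g z\<bar> \<le> K"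
proof -
  have [measurable]: "f \<in> borel_measurable borel" "g \<in> borel_measurable borel"
    using f g test1_measurable by auto
  have "(\<lambda>z. f (fst z) * g (snd z)) \<in> borel_measurable (borel \<Otimes>\<^sub>M borel)" by measurable
  then show "tensor f g \<in> borel_measurable borel" by (simp add: tensor_def case_prod_unfold borel_prod)
  obtain K where K: "\<And>x. \<bar>f x\<bar> \<le> K" using test1_bounded[OF f] by blast
  obtain K' where K': "\<And>x. \<bar>g x\<bar> \<le> K'" using test1_bounded[OF g] by blast
  have "\<bar>tensor f g z\<bar> \<le> K * K'" for z
    using mult_mono[OF K[of "fst z"] K'[of "snd z"]] K[of 0] by (simp add: tensor_def case_prod_unfold abs_mult)
  then show "\<exists>K. \<forall>z. \<bar>tensor f g z\<bar> \<le> K" by blast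
qed

lemma integrable_mult_tensor:
  assumes "integrable lborel k" "f \<in> test1 a b" "g \<in> test1 c d"
  shows "integrable lborel (\<lambda>z. k z * tensor f g z)"
proof -
  obtain K where "\<And>z. \<bar>tensor f g z\<bar> \<le> K" using tensor_bounded assms by blast
  then show ?thesis using assms tensor_measurable by (intro integrable_mult_bounded) auto
qed

text \<open>Products of cutoffs converge, dominated by 1, to indicators of rectangles, which reduces
  the claim to integrals over boxes.\<close>

lemma AE_zero_if_integral_tensor_zero:
  fixes k :: "real \<times> real \<Rightarrow> real"
  assumes k: "integrable lborel k"
    and zero: "\<And>f g. f \<in> test1 a b \<Longrightarrow> g \<in> test1 c d \<Longrightarrow> (\<integral>z. k z * tensor f g z \<partial>lborel) = 0"
  shows "AE z in lborel. z \<in> {a<..<b} \<times> {c<..<d} \<longrightarrow> k z = 0"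
proof -
  have [measurable]: "k \<in> borel_measurable borel" using k by simp
  let ?D = "{a<..<b} \<times> {c<..<d}"
  have D: "?D \<in> sets borel" by (intro borel_open open_Times) auto
  have "AE z in lborel. indicator ?D z * k z = 0"
  proof (rule AE_zero_if_integral_box_zero)
    show "integrable lborel (\<lambda>z. indicator ?D z * k z)"
      using k D by (auto intro!: integrable_real_mult_indicator simp: mult.commute)
    fix p q :: "real \<times> real"
    \<comment> \<open>Sides of the intersection of the box with the rectangle; where it is empty,
      the cutoffs vanish.\<close>
    define a' b' c' d' where "a' = max a (fst p)" and "b' = min b (fst q)"
      and "c' = max c (snd p)" and "d' = min d (snd q)"
    let ?t = "\<lambda>n. tensor (cutoff a' b' n) (cutoff c' d' n)"
    have "(\<lambda>n. \<integral>z. k z * ?t n z \<partial>lborel) \<longlonglongrightarrow> (\<integral>z. indicator (box p q) z * (indicator ?D z * k z) \<partial>lborel)"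
    proof (rule integral_dominated_convergence)
      show "integrable lborel (\<lambda>z. \<bar>k z\<bar>)" using k by simp
      have box: "box p q = {fst p<..<fst q} \<times> {snd p<..<snd q}"
        by (cases p; cases q) (auto simp: box_def Basis_prod_def)
      show "AE z in lborel. (\<lambda>n. k z * ?t n z) \<longlonglongrightarrow> indicator (box p q) z * (indicator ?D z * k z)"
      proof (rule AE_I2)
        fix z :: "real \<times> real"
        have "(\<lambda>n. k z * (cutoff a' b' n (fst z) * cutoff c' d' n (snd z))) \<longlonglongrightarrow>
          k z * (indicator {a'<..<b'} (fst z) * indicator {c'<..<d'} (snd z))"
          by (intro tendsto_intros cutoff_tendsto)
        moreover have "k z * (indicator {a'<..<b'} (fst z) * indicator {c'<..<d'} (snd z)) =
          indicator (box p q) z * (indicator ?D z * k z)"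
          by (cases z) (auto simp: box indicator_def a'_def b'_def c'_def d'_def)
        ultimately show "(\<lambda>n. k z * ?t n z) \<longlonglongrightarrow> indicator (box p q) z * (indicator ?D z * k z)"
          by (simp add: tensor_def case_prod_unfold)
      qed
      show "AE z in lborel. norm (k z * ?t n z) \<le> \<bar>k z\<bar>" for n
      proof (rule AE_I2)
        fix z
        have "\<bar>?t n z\<bar> \<le> 1" using cutoff_bound by (auto simp: tensor_def case_prod_unfold abs_mult intro!: mult_le_one)
        from mult_left_mono[OF this abs_ge_zero[of "k z"]]
        show "norm (k z * ?t n z) \<le> \<bar>k z\<bar>" by (simp add: abs_mult)
      qed
      have "cutoff p q n \<in> borel_measurable borel" for p q n
        using cutoff_test1[of p q n] test1_measurable by auto
      note [measurable] = this
      have "?t n \<in> borel_measurable (borel \<Otimes>\<^sub>M borel)" for n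
        unfolding tensor_def case_prod_unfold by measurable
      then have [measurable]: "?t n \<in> borel_measurable borel" for n by (simp add: borel_prod)
      show "(\<lambda>z. k z * ?t n z) \<in> borel_measurable lborel" for n by simp
      show "(\<lambda>z. indicator (box p q) z * (indicator ?D z * k z)) \<in> borel_measurable lborel"
        using D by simp
    qed
    moreover have "(\<integral>z. k z * ?t n z \<partial>lborel) = 0" for n
    proof (cases "cutoff a' b' n = (\<lambda>x. 0) \<or> cutoff c' d' n = (\<lambda>x. 0)")
      case True
      then have "?t n = (\<lambda>z. 0)" by (auto simp: tensor_def)
      then show ?thesis by simp
    next
      case False
      then have "cutoff a' b' n \<in> test1 a' b'" "cutoff c' d' n \<in> test1 c' d'" using cutoff_test1 by blast+
      then have "cutoff a' b' n \<in> test1 a b" "cutoff c' d' n \<in> test1 c d"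
        by (auto elim!: test1_mono simp: a'_def b'_def c'_def d'_def)
      then show ?thesis by (rule zero)
    qed
    ultimately show "(\<integral>z. indicator (box p q) z * (indicator ?D z * k z) \<partial>lborel) = 0"
      by (simp add: LIMSEQ_const_iff)
  qed
  then show ?thesis by eventually_elim (auto simp: indicator_def)
qed

text \<open>The lemma of du Bois-Reymond with a parameter y. Subtracting the primitive P of A leaves
  G with vanishing weak x-derivative; since every test function in x is a multiple of
  \<open>\<rho>\<close> plus a derivative, G depends on y alone.\<close>

theorem weak_x_derivative_antiderivative:
  fixes g A :: "real \<times> real \<Rightarrow> real"
  assumes "a < b" and g: "integrable lborel g" and A: "integrable lborel A"
    and weak: "\<And>f h. f \<in> test1 a b \<Longrightarrow> h \<in> test1 c d \<Longrightarrow>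
      (\<integral>z. g z * tensor (deriv f) h z \<partial>lborel) = - (\<integral>z. A z * tensor f h z \<partial>lborel)"
  shows "\<exists>C. integrable lborel C \<and> (AE z in lborel. z \<in> {a<..<b} \<times> {c<..<d} \<longrightarrow>
    g z = C (snd z) + (\<integral>s. indicator {a<..<fst z} s * A (s, snd z) \<partial>lborel))"
proof -
  have [measurable]: "g \<in> borel_measurable borel" "A \<in> borel_measurable borel" using g A by auto
  have [measurable]: "A \<in> borel_measurable (borel \<Otimes>\<^sub>M borel)" "g \<in> borel_measurable (borel \<Otimes>\<^sub>M borel)"
    by (simp_all add: borel_prod)
  \<comment> \<open>Cut off to (a, b) in the first variable, which makes P integrable over the
    plane.\<close>
  define P where "P z = indicator {a<..<b} (fst z) * (\<integral>s. indicator {a<..<fst z} s * A (s, snd z) \<partial>lborel)" for z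
  define N where "N y = (\<integral>s. \<bar>A (s, y)\<bar> \<partial>lborel)" for y
  have N: "integrable lborel N" unfolding N_def using A by (intro planar_integrable) simp
  have Am: "AE y in lborel. integrable lborel (\<lambda>s. A (s, y))" using A by (rule planar_sections)
  have P_le: "\<bar>P (x, y)\<bar> \<le> indicator {a<..<b} x * N y" if y: "integrable lborel (\<lambda>s. A (s, y))" for x y
  proof -
    have int: "integrable lborel (\<lambda>s. indicator {a<..<x} s * A (s, y))"
      using y by (intro integrable_mult_bounded(2)[where K = 1]) (auto simp: indicator_def)
    have "\<bar>\<integral>s. indicator {a<..<x} s * A (s, y) \<partial>lborel\<bar> \<le> N y"
      unfolding N_def using y int
      by (intro order_trans[OF integral_abs_bound] integral_mono) (auto simp: indicator_def)
    then show ?thesis by (simp add: P_def indicator_def)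
  qed
  have "(\<lambda>z. \<integral>s. (if a < s \<and> s < fst z then A (s, snd z) else 0) \<partial>lborel) \<in> borel_measurable (borel \<Otimes>\<^sub>M borel)"
    by measurable
  moreover have "(\<integral>s. (if a < s \<and> s < fst z then A (s, snd z) else 0) \<partial>lborel) =
      (\<integral>s. indicator {a<..<fst z} s * A (s, snd z) \<partial>lborel)" for z
    by (intro Bochner_Integration.integral_cong) (auto simp: indicator_def)
  ultimately have "(\<lambda>z. \<integral>s. indicator {a<..<fst z} s * A (s, snd z) \<partial>lborel) \<in> borel_measurable (borel \<Otimes>\<^sub>M borel)"
    by simp
  then have P_meas [measurable]: "P \<in> borel_measurable (borel \<Otimes>\<^sub>M borel)"
    unfolding P_def[abs_def] by measurable
  then have P_meas' [measurable]: "P \<in> borel_measurable borel" by (simp add: borel_prod)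
  have Am2: "AE z in (lborel :: (real \<times> real) measure). integrable lborel (\<lambda>s. A (s, snd z))"
    using Am by (rule AE_planar_snd)
  have P: "integrable lborel P"
  proof (rule Bochner_Integration.integrable_bound)
    show "integrable lborel (\<lambda>z. indicator {a<..<b} (fst z) * N (snd z))"
      using \<open>a < b\<close> N by (intro integrable_product) (auto intro!: integrable_real_indicator)
    show "AE z in lborel. norm (P z) \<le> norm (indicator {a<..<b} (fst z) * N (snd z))"
      using Am2
    proof eventually_elim
      case (elim z)
      then show ?case using P_le[of "snd z" "fst z"] by auto
    qed
  qed simp
  have P_weak: "(\<integral>z. P z * tensor (deriv f) h z \<partial>lborel) = - (\<integral>z. A z * tensor f h z \<partial>lborel)"
    if f: "f \<in> test1 a b" and h: "h \<in> test1 c d" for f h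
  proof -
    have f': "deriv f \<in> test1 a b" using f by (rule test1_deriv)
    have [measurable]: "deriv f \<in> borel_measurable borel" using f' by (rule test1_measurable)
    have inner: "(\<integral>x. P (x, y) * deriv f x \<partial>lborel) = - (\<integral>s. A (s, y) * f s \<partial>lborel)"
      if y: "integrable lborel (\<lambda>s. A (s, y))" for y
    proof -
      have [measurable]: "(\<lambda>s. A (s, y)) \<in> borel_measurable borel" using y by simp
      \<comment> \<open>Interchanging the integrals over the triangle a < s < x leaves, for fixed s,
        the integral of \<open>deriv f\<close> beyond s, which is \<open>- f s\<close>.\<close>
      let ?F = "\<lambda>x s. if a < s \<and> s < x then A (s, y) * deriv f x else 0"
      have int: "integrable (lborel \<Otimes>\<^sub>M lborel) (\<lambda>(x, s). ?F x s)"
      proof (rule Bochner_Integration.integrable_bound)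
        show "integrable (lborel \<Otimes>\<^sub>M lborel) (\<lambda>z. deriv f (fst z) * A (snd z, y))"
          using integrable_product[OF test1_integrable[OF f'] y] by (simp add: lborel_prod)
        show "AE z in lborel \<Otimes>\<^sub>M lborel. norm (case z of (x, s) \<Rightarrow> ?F x s) \<le> norm (deriv f (fst z) * A (snd z, y))"
          by (intro AE_I2) (auto simp: indicator_def abs_mult)
      qed (simp add: case_prod_unfold)
      have "(\<integral>x. P (x, y) * deriv f x \<partial>lborel) = (\<integral>x. (\<integral>s. ?F x s \<partial>lborel) \<partial>lborel)"
      proof (rule Bochner_Integration.integral_cong[OF refl])
        fix x show "P (x, y) * deriv f x = (\<integral>s. ?F x s \<partial>lborel)"
        proof (cases "x \<in> {a<..<b}")
          case True
          then have "P (x, y) * deriv f x = (\<integral>s. indicator {a<..<x} s * A (s, y) * deriv f x \<partial>lborel)"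
            by (simp add: P_def)
          also have "\<dots> = (\<integral>s. ?F x s \<partial>lborel)"
            by (intro Bochner_Integration.integral_cong) (auto simp: indicator_def)
          finally show ?thesis .
        next
          case False
          then have "deriv f x = 0" using test1_zero[OF f'] by blast
          then show ?thesis by (simp cong: if_cong)
        qed
      qed
      also have "\<dots> = (\<integral>s. (\<integral>x. ?F x s \<partial>lborel) \<partial>lborel)"
        using lborel_pair.Fubini_integral[OF int] by simp
      also have "\<dots> = (\<integral>s. - (A (s, y) * f s) \<partial>lborel)"
      proof (rule Bochner_Integration.integral_cong[OF refl])
        fix s
        have "(\<integral>x. ?F x s \<partial>lborel) = (\<integral>x. indicator {a<..} s * A (s, y) * (indicator {s<..} x * deriv f x) \<partial>lborel)"
          by (intro Bochner_Integration.integral_cong) (auto simp: indicator_def)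
        also have "\<dots> = indicator {a<..} s * A (s, y) * - f s"
          by (subst integral_mult_right_zero) (simp add: integral_deriv_below(2)[OF f])
        also have "\<dots> = - (A (s, y) * f s)"
          using test1_zero[OF f, of s] by (auto simp: indicator_def)
        finally show "(\<integral>x. ?F x s \<partial>lborel) = - (A (s, y) * f s)" .
      qed
      finally show ?thesis by simp
    qed
    have "(\<integral>z. P z * tensor (deriv f) h z \<partial>lborel) = (\<integral>y. (\<integral>x. P (x, y) * deriv f x \<partial>lborel) * h y \<partial>lborel)"
      using planar_Fubini(2)[OF integrable_mult_tensor[OF P f' h]] by (simp add: tensor_def mult.assoc[symmetric])
    also have "\<dots> = (\<integral>y. - (\<integral>s. A (s, y) * f s \<partial>lborel) * h y \<partial>lborel)"
    proof (rule integral_cong_AE)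
      have [measurable]: "h \<in> borel_measurable borel" "f \<in> borel_measurable borel"
        using f h test1_measurable by auto
      show "(\<lambda>y. (\<integral>x. P (x, y) * deriv f x \<partial>lborel) * h y) \<in> borel_measurable lborel"
        "(\<lambda>y. - (\<integral>s. A (s, y) * f s \<partial>lborel) * h y) \<in> borel_measurable lborel"
        by measurable
      show "AE y in lborel. (\<integral>x. P (x, y) * deriv f x \<partial>lborel) * h y = - (\<integral>s. A (s, y) * f s \<partial>lborel) * h y"
        using Am by eventually_elim (simp add: inner)
    qed
    also have "\<dots> = - (\<integral>z. A z * tensor f h z \<partial>lborel)"
      using planar_Fubini(2)[OF integrable_mult_tensor[OF A f h]] by (simp add: tensor_def mult.assoc[symmetric])
    finally show ?thesis .
  qed
  define G where "G z = g z - P z" for z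
  have G: "integrable lborel G" unfolding G_def using g P by simp
  have G_weak: "(\<integral>z. G z * tensor (deriv f) h z \<partial>lborel) = 0" if "f \<in> test1 a b" "h \<in> test1 c d" for f h
    using weak[OF that] P_weak[OF that] integrable_mult_tensor[OF g test1_deriv[OF that(1)] that(2)]
      integrable_mult_tensor[OF P test1_deriv[OF that(1)] that(2)]
    by (simp add: G_def left_diff_distrib)
  obtain \<rho> where \<rho>: "\<rho> \<in> test1 a b" "(\<integral>x. \<rho> x \<partial>lborel) = 1"
    using exists_normalized_test1[OF \<open>a < b\<close>] by blast
  \<comment> \<open>If G does not depend on x, then averaging it against \<open>\<rho>\<close>,
    which has integral 1, recovers it.\<close>
  define C where "C y = (\<integral>s. G (s, y) * \<rho> s \<partial>lborel)" for y
  have G\<rho>: "integrable lborel (\<lambda>z. G z * \<rho> (fst z))"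
  proof -
    obtain K where "\<And>x. \<bar>\<rho> x\<bar> \<le> K" using test1_bounded[OF \<rho>(1)] by blast
    moreover have "(\<lambda>z. \<rho> (fst (z :: real \<times> real))) \<in> borel_measurable (borel \<Otimes>\<^sub>M borel)"
      using test1_measurable[OF \<rho>(1)] by simp
    ultimately show ?thesis using G by (intro integrable_mult_bounded(1)) (auto simp: borel_prod)
  qed
  have C: "integrable lborel C" using planar_integrable(2)[OF G\<rho>] by (simp add: C_def[abs_def])
  have IC: "integrable lborel (\<lambda>z. indicator {a<..<b} (fst z) * C (snd z))"
    using \<open>a < b\<close> C by (intro integrable_product) (auto intro!: integrable_real_indicator)
  have "AE z in lborel. z \<in> {a<..<b} \<times> {c<..<d} \<longrightarrow> G z - indicator {a<..<b} (fst z) * C (snd z) = 0"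
  proof (rule AE_zero_if_integral_tensor_zero)
    show "integrable lborel (\<lambda>z. G z - indicator {a<..<b} (fst z) * C (snd z))" using G IC by simp
    fix \<xi> h assume \<xi>: "\<xi> \<in> test1 a b" and h: "h \<in> test1 c d"
    \<comment> \<open>\<open>\<xi> - m \<rho>\<close> has mean zero and so is the derivative of a
      test function, against which G vanishes.\<close>
    define m where "m = (\<integral>x. \<xi> x \<partial>lborel)"
    have "(\<lambda>x. \<xi> x - m * \<rho> x) \<in> test1 a b" using \<xi> \<rho>(1) by (rule test1_combine)
    moreover have "(\<integral>x. \<xi> x - m * \<rho> x \<partial>lborel) = 0"
      using test1_integrable[OF \<xi>] test1_integrable[OF \<rho>(1)] \<rho>(2) by (simp add: m_def)
    ultimately obtain F where F: "F \<in> test1 a b" "deriv F = (\<lambda>x. \<xi> x - m * \<rho> x)"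
      using test1_antiderivative by blast
    have "0 = (\<integral>z. G z * tensor (deriv F) h z \<partial>lborel)" using G_weak[OF F(1) h] by simp
    also have "\<dots> = (\<integral>z. G z * tensor \<xi> h z - m * (G z * tensor \<rho> h z) \<partial>lborel)"
      unfolding F(2) by (intro Bochner_Integration.integral_cong) (auto simp: tensor_def algebra_simps)
    also have "\<dots> = (\<integral>z. G z * tensor \<xi> h z \<partial>lborel) - m * (\<integral>z. G z * tensor \<rho> h z \<partial>lborel)"
      using integrable_mult_tensor[OF G \<xi> h] integrable_mult_tensor[OF G \<rho>(1) h] by simp
    finally have 1: "(\<integral>z. G z * tensor \<xi> h z \<partial>lborel) = m * (\<integral>z. G z * tensor \<rho> h z \<partial>lborel)" by simp
    have 2: "(\<integral>z. G z * tensor \<rho> h z \<partial>lborel) = (\<integral>y. C y * h y \<partial>lborel)"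
      using planar_Fubini(2)[OF integrable_mult_tensor[OF G \<rho>(1) h]] by (simp add: tensor_def mult.assoc[symmetric] C_def)
    have "(\<integral>z. indicator {a<..<b} (fst z) * C (snd z) * tensor \<xi> h z \<partial>lborel)
      = (\<integral>z. \<xi> (fst z) * (C (snd z) * h (snd z)) \<partial>lborel)"
      using test1_zero[OF \<xi>] by (intro Bochner_Integration.integral_cong) (auto simp: tensor_def indicator_def)
    also have "\<dots> = m * (\<integral>y. C y * h y \<partial>lborel)"
      unfolding m_def
    proof (rule integral_product)
      obtain K where "\<And>x. \<bar>h x\<bar> \<le> K" using test1_bounded[OF h] by blast
      then show "integrable lborel (\<lambda>y. C y * h y)"
        using C test1_measurable[OF h] by (intro integrable_mult_bounded(1)) auto
    qed (rule test1_integrable[OF \<xi>])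
    finally have 3: "(\<integral>z. indicator {a<..<b} (fst z) * C (snd z) * tensor \<xi> h z \<partial>lborel) = m * (\<integral>y. C y * h y \<partial>lborel)" .
    show "(\<integral>z. (G z - indicator {a<..<b} (fst z) * C (snd z)) * tensor \<xi> h z \<partial>lborel) = 0"
      using 1 2 3 integrable_mult_tensor[OF G \<xi> h] integrable_mult_tensor[OF IC \<xi> h]
      by (simp add: left_diff_distrib)
  qed
  then have "AE z in lborel. z \<in> {a<..<b} \<times> {c<..<d} \<longrightarrow>
    g z = C (snd z) + (\<integral>s. indicator {a<..<fst z} s * A (s, snd z) \<partial>lborel)"
    by eventually_elim (auto simp: G_def P_def)
  then show ?thesis using C by blast
qed

section \<open>Exchange of the two coordinates\<close>

lemma planar_swap: "distr lborel lborel prod.swap = (lborel :: (real \<times> real) measure)"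
proof -
  have "prod.swap = (\<lambda>(x :: real, y :: real). (y, x))" by (simp add: fun_eq_iff)
  then show ?thesis
    using lborel_pair.distr_pair_swap[where ?'a = real and ?'b = real] by (simp add: lborel_prod)
qed

lemma planar_swap_measurable [measurable]:
  "prod.swap \<in> (borel :: (real \<times> real) measure) \<rightarrow>\<^sub>M borel"
  by (intro borel_measurable_continuous_onI continuous_intros)

lemma
  fixes f :: "real \<times> real \<Rightarrow> real"
  assumes [measurable]: "f \<in> borel_measurable borel"
  shows integral_swap: "(\<integral>z. f (prod.swap z) \<partial>lborel) = (\<integral>z. f z \<partial>lborel)"
    and integrable_swap: "integrable lborel (\<lambda>z. f (prod.swap z)) \<longleftrightarrow> integrable lborel f"
proof -
  have "(\<integral>z. f z \<partial>(distr lborel lborel prod.swap)) = (\<integral>z. f (prod.swap z) \<partial>lborel)"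
    by (rule integral_distr) auto
  then show "(\<integral>z. f (prod.swap z) \<partial>lborel) = (\<integral>z. f z \<partial>lborel)" by (simp only: planar_swap)
  have "integrable (distr lborel lborel prod.swap) f = integrable lborel (\<lambda>z. f (prod.swap z))"
    by (rule integrable_distr_eq) auto
  then show "integrable lborel (\<lambda>z. f (prod.swap z)) \<longleftrightarrow> integrable lborel f" by (simp only: planar_swap)
qed

lemma AE_swap:
  assumes "AE z in (lborel :: (real \<times> real) measure). Q z"
  shows "AE z in lborel. Q (prod.swap z)"
proof (rule AE_distrD[where P = Q and M' = lborel])
  show "prod.swap \<in> (lborel :: (real \<times> real) measure) \<rightarrow>\<^sub>M lborel" by simp
  show "AE z in distr lborel lborel prod.swap. Q z" unfolding planar_swap by (rule assms)
qed

lemma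
  assumes Q: "AE z in (lborel :: (real \<times> real) measure). Q z"
  shows AE_sections_fst: "AE x in lborel. AE y in lborel. Q (x, y)"
    and AE_sections_snd: "AE y in lborel. AE x in lborel. Q (x, y)"
proof -
  show "AE x in lborel. AE y in lborel. Q (x, y)"
    using lborel_pair.AE_pair[of Q] Q unfolding lborel_prod by blast
  show "AE y in lborel. AE x in lborel. Q (x, y)"
    using lborel_pair.AE_pair[of "\<lambda>z. Q (prod.swap z)"] AE_swap[OF Q] unfolding lborel_prod by simp
qed

lemma weak_y_derivative_antiderivative:
  fixes g A :: "real \<times> real \<Rightarrow> real"
  assumes "c < d" and g: "integrable lborel g" and A: "integrable lborel A"
    and weak: "\<And>f h. f \<in> test1 a b \<Longrightarrow> h \<in> test1 c d \<Longrightarrow>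
      (\<integral>z. g z * tensor f (deriv h) z \<partial>lborel) = - (\<integral>z. A z * tensor f h z \<partial>lborel)"
  shows "\<exists>C. integrable lborel C \<and> (AE z in lborel. z \<in> {a<..<b} \<times> {c<..<d} \<longrightarrow>
    g z = C (fst z) + (\<integral>t. indicator {c<..<snd z} t * A (fst z, t) \<partial>lborel))"
proof -
  have [measurable]: "g \<in> borel_measurable borel" "A \<in> borel_measurable borel" using g A by auto
  have tensor_swap: "tensor f h (prod.swap z) = tensor h f z" for f h z
    by (cases z) (simp add: tensor_def)
  have *: "(\<integral>z. k (prod.swap z) * tensor h f z \<partial>lborel) = (\<integral>z. k z * tensor f h z \<partial>lborel)"
    if "k \<in> borel_measurable borel" "f \<in> test1 a b" "h \<in> test1 c d" for k f h
  proof -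
    have "(\<lambda>z. k z * tensor f h z) \<in> borel_measurable borel"
      using that tensor_measurable by (intro borel_measurable_times)
    from integral_swap[OF this] show ?thesis by (simp add: tensor_swap)
  qed
  have "\<exists>C. integrable lborel C \<and> (AE z in lborel. z \<in> {c<..<d} \<times> {a<..<b} \<longrightarrow>
    g (prod.swap z) = C (snd z) + (\<integral>s. indicator {c<..<fst z} s * A (prod.swap (s, snd z)) \<partial>lborel))"
  proof (rule weak_x_derivative_antiderivative[OF \<open>c < d\<close>])
    show "integrable lborel (\<lambda>z. g (prod.swap z))" "integrable lborel (\<lambda>z. A (prod.swap z))"
      using g A by (simp_all add: integrable_swap)
    show "(\<integral>z. g (prod.swap z) * tensor (deriv h) f z \<partial>lborel) = - (\<integral>z. A (prod.swap z) * tensor h f z \<partial>lborel)"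
      if "h \<in> test1 c d" "f \<in> test1 a b" for f h
      using weak[OF that(2,1)] that by (simp add: * test1_deriv)
  qed
  then obtain C where C: "integrable lborel C" and ae: "AE z in lborel. z \<in> {c<..<d} \<times> {a<..<b} \<longrightarrow>
    g (prod.swap z) = C (snd z) + (\<integral>s. indicator {c<..<fst z} s * A (prod.swap (s, snd z)) \<partial>lborel)" by blast
  from AE_swap[OF ae]
  have "AE z in lborel. z \<in> {a<..<b} \<times> {c<..<d} \<longrightarrow>
    g z = C (fst z) + (\<integral>t. indicator {c<..<snd z} t * A (fst z, t) \<partial>lborel)"
    by eventually_elim auto
  then show ?thesis using C by blast
qed

text \<open>The set where f and g differ inside S is open and null, hence empty; continuity then
  reaches the closure.\<close>

lemma continuous_eq_if_AE_eq:
  fixes f g :: "'a::euclidean_space \<Rightarrow> real"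
  assumes S: "open S" and f: "continuous_on (closure S) f" and g: "continuous_on (closure S) g"
    and ae: "AE x in lborel. x \<in> S \<longrightarrow> f x = g x" and x: "x \<in> closure S"
  shows "f x = g x"
proof -
  define U where "U = {x \<in> S. f x - g x \<in> - {0}}"
  have "continuous_on S (\<lambda>x. f x - g x)"
    using f g closure_subset by (intro continuous_on_diff) (auto intro: continuous_on_subset)
  then have "open U"
    using continuous_open_preimage[of S "\<lambda>x. f x - g x" "- {0}"] S open_Compl[OF closed_singleton, of "0 :: real"]
    by (simp add: U_def vimage_def Int_def)
  moreover have "negligible U"
  proof -
    have "AE x in lebesgue. x \<notin> U" using AE_completion[OF ae] by eventually_elim (auto simp: U_def)
    then show ?thesis by (simp add: negligible_iff_null_sets AE_iff_null_sets[symmetric] \<open>open U\<close> lebesgue_openin)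
  qed
  ultimately have "U = {}" using open_not_negligible by blast
  then have "f x - g x = 0" if "x \<in> S" for x using that by (auto simp: U_def)
  then have "f x - g x = 0"
    using continuous_constant_on_closure[of S "\<lambda>x. f x - g x" 0 x] f g x by (auto intro: continuous_on_diff)
  then show ?thesis by simp
qed

lemma continuous_indefinite_integral:
  fixes k :: "real \<Rightarrow> real"
  assumes k: "integrable lborel k"
  shows "continuous_on UNIV (\<lambda>x. \<integral>s. indicator {a<..<x} s * k s \<partial>lborel)"
proof (rule continuous_on_sequentiallyI)
  fix u :: "nat \<Rightarrow> real" and x assume u: "u \<longlonglongrightarrow> x"
  have [measurable]: "k \<in> borel_measurable borel" using k by simp
  show "(\<lambda>n. \<integral>s. indicator {a<..<u n} s * k s \<partial>lborel) \<longlonglongrightarrow> (\<integral>s. indicator {a<..<x} s * k s \<partial>lborel)"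
  proof (rule integral_dominated_convergence)
    show "integrable lborel (\<lambda>s. \<bar>k s\<bar>)" using k by simp
    show "AE s in lborel. (\<lambda>n. indicator {a<..<u n} s * k s) \<longlonglongrightarrow> indicator {a<..<x} s * k s"
      using AE_lborel_singleton[of x]
    proof eventually_elim
      case (elim s)
      have "\<forall>\<^sub>F n in sequentially. indicator {a<..<x} s * k s = indicator {a<..<u n} s * k s"
      proof (cases "s < x")
        case True
        show ?thesis using order_tendstoD(1)[OF u True] by eventually_elim (use True in \<open>auto simp: indicator_def\<close>)
      next
        case False
        then have "x < s" using elim by simp
        show ?thesis using order_tendstoD(2)[OF u \<open>x < s\<close>] by eventually_elim (use False in \<open>auto simp: indicator_def\<close>)
      qed
      then show ?case by (rule Lim_transform_eventually[OF tendsto_const])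
    qed
  qed (auto simp: indicator_def)
qed

section \<open>Pointwise estimates on the plate\<close>

text \<open>The square root of the area of the rectangle is the source of the Hoelder exponent
  1/2.\<close>

lemma rectangle_cauchy_schwarz:
  fixes B :: "real \<times> real \<Rightarrow> real"
  assumes B: "B \<in> l2 lborel" and "a \<le> b" "c \<le> d"
  shows "(\<integral>z. indicator ({a..b} \<times> {c..d}) z * \<bar>B z\<bar> \<partial>lborel) \<le> sqrt ((b - a) * (d - c) * ip lborel B B)"
proof -
  let ?R = "{a..b} \<times> {c..d}"
  have R: "?R \<in> sets borel" by (intro borel_closed closed_Times) auto
  have m: "emeasure lborel ?R = ennreal ((b - a) * (d - c))"
  proof -
    have "emeasure (lborel \<Otimes>\<^sub>M lborel) ?R = emeasure lborel {a..b} * emeasure lborel {c..d}"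
      by (rule lborel.emeasure_pair_measure_Times) auto
    then show ?thesis using assms by (simp add: lborel_prod ennreal_mult)
  qed
  have int: "integrable lborel (indicator ?R :: _ \<Rightarrow> real)"
    using R m by (intro integrable_real_indicator) auto
  then have ind: "(\<lambda>z. indicator ?R z) \<in> l2 lborel"
  proof -
    have "(\<lambda>z. (indicator ?R z :: real)\<^sup>2) = indicator ?R" by (auto simp: indicator_def)
    then show ?thesis using int R by (simp add: l2_def)
  qed
  have abs: "(\<lambda>z. \<bar>B z\<bar>) \<in> l2 lborel" using B by (auto simp: l2_def)
  have "ip lborel (\<lambda>z. indicator ?R z) (\<lambda>z. indicator ?R z) = (b - a) * (d - c)"
  proof -
    have "ip lborel (\<lambda>z. indicator ?R z) (\<lambda>z. indicator ?R z) = (\<integral>z. indicator ?R z \<partial>lborel)"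
      unfolding ip_def by (intro Bochner_Integration.integral_cong) (auto simp: indicator_def)
    then show ?thesis using m R assms by (simp add: measure_def)
  qed
  then have "(ip lborel (\<lambda>z. indicator ?R z) (\<lambda>z. \<bar>B z\<bar>))\<^sup>2 \<le> (b - a) * (d - c) * ip lborel B B"
    using l2.cauchy_schwarz[OF ind abs] by (simp add: ip_def)
  then show ?thesis unfolding ip_def by (rule real_le_rsqrt)
qed

lemma Omega_borel [measurable]: "Omega l \<in> sets borel"
  unfolding Omega_def by (intro borel_open open_Times open_greaterThanLessThan)

text \<open>\<open>v\<close> is the continuous representative of \<open>u \<in> H\<^sup>2\<^sub>*\<close>, and \<open>g\<close>, \<open>h\<close>, \<open>A\<close>, \<open>B\<close> are \<open>u\<^sub>x\<close>, \<open>u\<^sub>y\<close>,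
  \<open>u\<^sub>x\<^sub>x\<close>, \<open>u\<^sub>x\<^sub>y\<close> extended by zero.\<close>

locale plate_data =
  fixes l :: real and v g h A B :: "real \<times> real \<Rightarrow> real"
  assumes l: "l > 0"
    and v: "continuous_on UNIV v"
    and v_boundary: "\<And>y. y \<in> {-l<..<l} \<Longrightarrow> v (0, y) = 0" "\<And>y. y \<in> {-l<..<l} \<Longrightarrow> v (pi, y) = 0"
    and g: "integrable lborel g" and h: "integrable lborel h"
    and A: "integrable lborel A" and B: "integrable lborel B"
    and A2: "A \<in> l2 lborel" and B2: "B \<in> l2 lborel"
    and g0: "\<And>z. z \<notin> Omega l \<Longrightarrow> g z = 0" and h0: "\<And>z. z \<notin> Omega l \<Longrightarrow> h z = 0"
    and A0: "\<And>z. z \<notin> Omega l \<Longrightarrow> A z = 0" and B0: "\<And>z. z \<notin> Omega l \<Longrightarrow> B z = 0"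
    and weak_g: "\<And>\<phi> \<psi>. \<phi> \<in> test1 0 pi \<Longrightarrow> \<psi> \<in> test1 (-l) l \<Longrightarrow>
      (\<integral>z. indicator (Omega l) z * v z * tensor (deriv \<phi>) \<psi> z \<partial>lborel) = - (\<integral>z. g z * tensor \<phi> \<psi> z \<partial>lborel)"
    and weak_h: "\<And>\<phi> \<psi>. \<phi> \<in> test1 0 pi \<Longrightarrow> \<psi> \<in> test1 (-l) l \<Longrightarrow>
      (\<integral>z. indicator (Omega l) z * v z * tensor \<phi> (deriv \<psi>) z \<partial>lborel) = - (\<integral>z. h z * tensor \<phi> \<psi> z \<partial>lborel)"
    and weak_A: "\<And>\<phi> \<psi>. \<phi> \<in> test1 0 pi \<Longrightarrow> \<psi> \<in> test1 (-l) l \<Longrightarrow>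
      (\<integral>z. g z * tensor (deriv \<phi>) \<psi> z \<partial>lborel) = - (\<integral>z. A z * tensor \<phi> \<psi> z \<partial>lborel)"
    and weak_B: "\<And>\<phi> \<psi>. \<phi> \<in> test1 0 pi \<Longrightarrow> \<psi> \<in> test1 (-l) l \<Longrightarrow>
      (\<integral>z. h z * tensor (deriv \<phi>) \<psi> z \<partial>lborel) = - (\<integral>z. B z * tensor \<phi> \<psi> z \<partial>lborel)"
begin

lemma borel [measurable]: "v \<in> borel_measurable borel" "g \<in> borel_measurable borel" "h \<in> borel_measurable borel"
  "A \<in> borel_measurable borel" "B \<in> borel_measurable borel"
  using v g h A B by (auto intro: borel_measurable_continuous_onI)

lemma borel_pair [measurable]: "v \<in> borel_measurable (borel \<Otimes>\<^sub>M borel)" "g \<in> borel_measurable (borel \<Otimes>\<^sub>M borel)"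
  "h \<in> borel_measurable (borel \<Otimes>\<^sub>M borel)" "A \<in> borel_measurable (borel \<Otimes>\<^sub>M borel)" "B \<in> borel_measurable (borel \<Otimes>\<^sub>M borel)"
  using borel by (simp_all add: borel_prod)

lemma vx: "continuous_on S (\<lambda>x. v (x, y))" and vy: "continuous_on S (\<lambda>y. v (x, y))"
  by (auto intro!: continuous_on_compose2[OF v] continuous_intros)

lemma integrable_vO: "integrable lborel (\<lambda>z. indicator (Omega l) z * v z)"
proof -
  have K: "compact ({0..pi} \<times> {-l..l})" by (intro compact_Times compact_Icc)
  have "integrable lborel (\<lambda>z. indicator ({0..pi} \<times> {-l..l}) z *\<^sub>R v z)"
    by (rule borel_integrable_compact[OF K]) (rule continuous_on_subset[OF v], simp)
  then have "integrable lborel (\<lambda>z. (indicator ({0..pi} \<times> {-l..l}) z *\<^sub>R v z) * indicator (Omega l) z)"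
    by (rule integrable_mult_bounded(1)[where K = 1]) (simp_all add: indicator_def)
  moreover have "(\<lambda>z. (indicator ({0..pi} \<times> {-l..l}) z *\<^sub>R v z) * indicator (Omega l) z) = (\<lambda>z. indicator (Omega l) z * v z)"
    by (rule ext) (auto simp: indicator_def Omega_def)
  ultimately show ?thesis by (simp only:)
qed

lemma v_boundary_closed: "y \<in> {-l..l} \<Longrightarrow> v (0, y) = 0" "y \<in> {-l..l} \<Longrightarrow> v (pi, y) = 0"
proof -
  have cl: "closure {-l<..<l} = {-l..l}" using l by simp
  show "y \<in> {-l..l} \<Longrightarrow> v (0, y) = 0" "y \<in> {-l..l} \<Longrightarrow> v (pi, y) = 0"
    using continuous_constant_on_closure[of "{-l<..<l}" "\<lambda>y. v (0, y)" 0 y]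
      continuous_constant_on_closure[of "{-l<..<l}" "\<lambda>y. v (pi, y)" 0 y] cl vy v_boundary by auto
qed

text \<open>The constant of integration on a section is \<open>v (0, y) = 0\<close>, and continuity
  of both sides turns almost every x into every x in [0, pi].\<close>

lemma v_from_g:
  "AE y in lborel. y \<in> {-l<..<l} \<longrightarrow> integrable lborel (\<lambda>s. g (s, y)) \<and>
     (\<forall>x\<in>{0..pi}. v (x, y) = (\<integral>s. indicator {0<..<x} s * g (s, y) \<partial>lborel))"
proof -
  obtain C where "AE z in lborel. z \<in> {0<..<pi} \<times> {-l<..<l} \<longrightarrow>
     indicator (Omega l) z * v z = C (snd z) + (\<integral>s. indicator {0<..<fst z} s * g (s, snd z) \<partial>lborel)"
    using weak_x_derivative_antiderivative[OF pi_gt_zero integrable_vO g weak_g] by blast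
  from AE_sections_snd[OF this] planar_sections(2)[OF g] show ?thesis
  proof eventually_elim
    case (elim y)
    show ?case
    proof (intro impI conjI ballI)
      assume y: "y \<in> {-l<..<l}"
      show "integrable lborel (\<lambda>s. g (s, y))" by (rule elim)
      have eq: "v (x, y) = C y + (\<integral>s. indicator {0<..<x} s * g (s, y) \<partial>lborel)" if x: "x \<in> {0..pi}" for x
      proof (rule continuous_eq_if_AE_eq[of "{0<..<pi}" "\<lambda>x. v (x, y)" "\<lambda>x. C y + (\<integral>s. indicator {0<..<x} s * g (s, y) \<partial>lborel)"])
        show "continuous_on (closure {0<..<pi}) (\<lambda>x. v (x, y))" by (rule vx)
        show "continuous_on (closure {0<..<pi}) (\<lambda>x. C y + (\<integral>s. indicator {0<..<x} s * g (s, y) \<partial>lborel))"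
          by (intro continuous_on_add continuous_on_const continuous_on_subset[OF continuous_indefinite_integral[OF elim(2)]]) simp
        show "AE x in lborel. x \<in> {0<..<pi} \<longrightarrow> v (x, y) = C y + (\<integral>s. indicator {0<..<x} s * g (s, y) \<partial>lborel)"
          using elim(1) by eventually_elim (use y in \<open>auto simp: Omega_def\<close>)
      qed (use x in auto)
      have "C y = 0" using eq[of 0] v_boundary(1)[OF y] by simp
      then show "v (x, y) = (\<integral>s. indicator {0<..<x} s * g (s, y) \<partial>lborel)" if "x \<in> {0..pi}" for x
        using eq[OF that] by simp
    qed
  qed
qed

lemma indicator_section_integral_le:
  fixes k :: "real \<Rightarrow> real"
  assumes "integrable lborel k" "S \<in> sets borel"
  shows "\<bar>\<integral>s. indicator S s * k s \<partial>lborel\<bar> \<le> (\<integral>s. \<bar>k s\<bar> \<partial>lborel)"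
proof -
  have [measurable]: "S \<in> sets borel" by fact
  have "integrable lborel (\<lambda>s. indicator S s * k s)"
    using assms by (intro integrable_mult_bounded(2)[where K = 1]) (auto simp: indicator_def)
  then show ?thesis
    using assms by (intro order_trans[OF integral_abs_bound] integral_mono) (auto simp: indicator_def)
qed

text \<open>Since \<open>v\<close> vanishes at both ends, \<open>g\<close> has mean zero on almost every horizontal section.\<close>

lemma g_bound_A: "AE z in lborel. \<bar>g z\<bar> \<le> 2 * (indicator {0<..<pi} (fst z) * (\<integral>s. \<bar>A (s, snd z)\<bar> \<partial>lborel))"
proof -
  let ?N = "\<lambda>y. \<integral>s. \<bar>A (s, y)\<bar> \<partial>lborel"
  let ?P = "\<lambda>x y. \<integral>s. indicator {0<..<x} s * A (s, y) \<partial>lborel"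
  obtain C where C: "AE z in lborel. z \<in> {0<..<pi} \<times> {-l<..<l} \<longrightarrow>
     g z = C (snd z) + ?P (fst z) (snd z)"
    using weak_x_derivative_antiderivative[OF pi_gt_zero g A weak_A] by blast
  have "AE y in lborel. y \<in> {-l<..<l} \<longrightarrow> integrable lborel (\<lambda>s. A (s, y)) \<and> \<bar>C y\<bar> \<le> ?N y"
    using AE_sections_snd[OF C] planar_sections(2)[OF A] v_from_g
  proof eventually_elim
    case (elim y)
    show ?case
    proof (intro impI conjI)
      assume y: "y \<in> {-l<..<l}"
      show "integrable lborel (\<lambda>s. A (s, y))" by (rule elim)
      let ?I = "indicator {0<..<pi} :: real \<Rightarrow> real"
      have cont: "continuous_on UNIV (\<lambda>x. ?P x y)" using elim(2) by (rule continuous_indefinite_integral)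
      then have [measurable]: "(\<lambda>x. ?P x y) \<in> borel_measurable borel" by (rule borel_measurable_continuous_onI)
      have P_le: "\<bar>?P x y\<bar> \<le> ?N y" for x using elim(2) by (intro indicator_section_integral_le) auto
      have I: "integrable lborel ?I" by (rule integrable_real_indicator) auto
      have IP: "integrable lborel (\<lambda>x. ?I x * ?P x y)"
        using I by (rule integrable_mult_bounded(1)) (use P_le in auto)
      \<comment> \<open>The value of v at x = pi makes C y minus the average of the primitive
        \<open>?P\<close>, so it is bounded by \<open>?N y\<close>. Adding the primitive itself
        gives the factor 2 of the statement.\<close>
      have "0 = (\<integral>x. ?I x * g (x, y) \<partial>lborel)"
        using elim(3) y v_boundary(2)[OF y] by auto
      also have "\<dots> = (\<integral>x. C y * ?I x + ?I x * ?P x y \<partial>lborel)"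
      proof (rule integral_cong_AE)
        show "AE x in lborel. ?I x * g (x, y) = C y * ?I x + ?I x * ?P x y"
          using elim(1) by eventually_elim (use y in \<open>auto simp: indicator_def\<close>)
      qed measurable
      also have "\<dots> = C y * pi + (\<integral>x. ?I x * ?P x y \<partial>lborel)"
        using I IP by simp
      finally have "C y * pi = - (\<integral>x. ?I x * ?P x y \<partial>lborel)" by simp
      then have "\<bar>C y * pi\<bar> = \<bar>\<integral>x. ?I x * ?P x y \<partial>lborel\<bar>" by simp
      then have "\<bar>C y\<bar> * pi = \<bar>\<integral>x. ?I x * ?P x y \<partial>lborel\<bar>" by (simp add: abs_mult)
      also have "\<dots> \<le> (\<integral>x. ?N y * ?I x \<partial>lborel)"
      proof (intro order_trans[OF integral_abs_bound] integral_mono)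
        show "\<bar>?I x * ?P x y\<bar> \<le> ?N y * ?I x" for x using P_le[of x] by (auto simp: indicator_def)
      qed (use I IP in auto)
      also have "\<dots> = ?N y * pi" by simp
      finally show "\<bar>C y\<bar> \<le> ?N y" by simp
    qed
  qed
  from AE_planar_snd[OF this] C show ?thesis
  proof eventually_elim
    case (elim z)
    show ?case
    proof (cases "z \<in> Omega l")
      case True
      then have z: "fst z \<in> {0<..<pi}" "snd z \<in> {-l<..<l}" by (auto simp: Omega_def)
      then have "\<bar>?P (fst z) (snd z)\<bar> \<le> ?N (snd z)"
        using elim(1) by (intro indicator_section_integral_le) auto
      then show ?thesis using elim z by (cases z) auto
    next
      case False
      then show ?thesis by (auto simp: g0 indicator_def)
    qed
  qed
qed

text \<open>The constant of integration \<open>e\<close> is the \<open>y\<close>-derivative of \<open>v\<close> on the side \<open>x = 0\<close>, hence null.\<close>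

lemma y_derivative_and_mixed_difference:
  "\<exists>e. integrable lborel e \<and>
     (AE z in lborel. z \<in> {0<..<pi} \<times> {-l<..<l} \<longrightarrow>
        h z = e (snd z) + (\<integral>s. indicator {0<..<fst z} s * B (s, snd z) \<partial>lborel)) \<and>
     (\<forall>y y'. -l \<le> y \<and> y \<le> y' \<and> y' \<le> l \<longrightarrow> (\<integral>t. indicator {y<..<y'} t * e t \<partial>lborel) = 0 \<and>
        (\<forall>x\<in>{0..pi}. v (x, y') - v (x, y) = (\<integral>z. indicator ({0<..<x} \<times> {y<..<y'}) z * B z \<partial>lborel)))"
proof -
  let ?P = "\<lambda>x y. \<integral>s. indicator {0<..<x} s * B (s, y) \<partial>lborel"
  have ll: "-l < l" using l by simp
  obtain e where ie: "integrable lborel e"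
    and e: "AE z in lborel. z \<in> {0<..<pi} \<times> {-l<..<l} \<longrightarrow> h z = e (snd z) + ?P (fst z) (snd z)"
    using weak_x_derivative_antiderivative[OF pi_gt_zero h B weak_B] by blast
  obtain D where D: "AE z in lborel. z \<in> {0<..<pi} \<times> {-l<..<l} \<longrightarrow>
     indicator (Omega l) z * v z = D (fst z) + (\<integral>t. indicator {-l<..<snd z} t * h (fst z, t) \<partial>lborel)"
    using weak_y_derivative_antiderivative[OF ll integrable_vO h weak_h] by blast
  have [measurable]: "e \<in> borel_measurable borel" using ie by simp
  have rect: "(\<integral>t. indicator {y<..<y'} t * e t \<partial>lborel) = 0"
    "x \<in> {0..pi} \<Longrightarrow> v (x, y') - v (x, y) = (\<integral>z. indicator ({0<..<x} \<times> {y<..<y'}) z * B z \<partial>lborel)"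
    if y: "-l \<le> y" "y \<le> y'" "y' \<le> l" for y y' x
  proof -
    define E where "E = (\<integral>t. indicator {y<..<y'} t * e t \<partial>lborel)"
    have rect_sets: "{0<..<x} \<times> {y<..<y'} \<in> sets borel" for x :: real by (intro borel_open open_Times) auto
    have Bt: "integrable lborel (\<lambda>z. indicator ({0<..<x} \<times> {y<..<y'}) z * B z)" for x
      using B rect_sets by (intro integrable_mult_bounded(2)[where K = 1]) (auto simp: indicator_def)
    have By: "integrable lborel (\<lambda>z. indicator {y<..<y'} (snd z) * B z)"
    proof -
      have "(\<lambda>z :: real \<times> real. indicator {y<..<y'} (snd z) :: real) \<in> borel_measurable (borel \<Otimes>\<^sub>M borel)" by measurable
      then show ?thesis using B by (intro integrable_mult_bounded(2)[where K = 1]) (auto simp: indicator_def borel_prod)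
    qed
    \<comment> \<open>The rectangle integral of B in iterated form: with the y-integral inside it is
      visibly continuous in x, with the x-integral inside it matches the representation of
      h.\<close>
    define R where "R x = (\<integral>s. indicator {0<..<x} s * (\<integral>t. indicator {y<..<y'} t * B (s, t) \<partial>lborel) \<partial>lborel)" for x
    have R_eq: "R x = (\<integral>z. indicator ({0<..<x} \<times> {y<..<y'}) z * B z \<partial>lborel)" for x
      unfolding R_def planar_Fubini(1)[OF Bt, symmetric]
      by (intro Bochner_Integration.integral_cong refl) (auto simp: indicator_def)
    have R_eq': "R x = (\<integral>t. indicator {y<..<y'} t * ?P x t \<partial>lborel)" for x
      unfolding R_eq planar_Fubini(2)[OF Bt, symmetric]
      by (intro Bochner_Integration.integral_cong refl) (auto simp: indicator_def)
    have R_int: "integrable lborel (\<lambda>t. indicator {y<..<y'} t * ?P x t)" for x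
    proof -
      have "(\<integral>s. indicator ({0<..<x} \<times> {y<..<y'}) (s, t) * B (s, t) \<partial>lborel) = indicator {y<..<y'} t * ?P x t" for t
        by (auto simp: indicator_def)
      then show ?thesis using planar_integrable(2)[OF Bt[of x]] by simp
    qed
    have R_cont: "continuous_on UNIV R"
      unfolding R_def using planar_integrable(1)[OF By] by (intro continuous_indefinite_integral) simp
    have "AE x in lborel. x \<in> {0<..<pi} \<longrightarrow> v (x, y') - v (x, y) = E + R x"
      using AE_sections_fst[OF e] AE_sections_fst[OF D] planar_sections(1)[OF h]
    proof eventually_elim
      case (elim x)
      show ?case
      proof
        assume x: "x \<in> {0<..<pi}"
        have eq: "v (x, t) = D x + (\<integral>r. indicator {-l<..<t} r * h (x, r) \<partial>lborel)" if t: "t \<in> {-l..l}" for t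
        proof (rule continuous_eq_if_AE_eq[of "{-l<..<l}" "\<lambda>y. v (x, y)" "\<lambda>t. D x + (\<integral>r. indicator {-l<..<t} r * h (x, r) \<partial>lborel)"])
          show "continuous_on (closure {-l<..<l}) (\<lambda>y. v (x, y))" by (rule vy)
          show "continuous_on (closure {-l<..<l}) (\<lambda>t. D x + (\<integral>r. indicator {-l<..<t} r * h (x, r) \<partial>lborel))"
            by (intro continuous_on_add continuous_on_const continuous_on_subset[OF continuous_indefinite_integral[OF elim(3)]]) simp
          show "AE t in lborel. t \<in> {-l<..<l} \<longrightarrow> v (x, t) = D x + (\<integral>r. indicator {-l<..<t} r * h (x, r) \<partial>lborel)"
            using elim(2) by eventually_elim (use x in \<open>auto simp: Omega_def\<close>)
        qed (use t l in auto)
        have hm: "integrable lborel (\<lambda>r. indicator {-l<..<t} r * h (x, r))" for t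
          using elim(3) by (intro integrable_mult_bounded(2)[where K = 1]) (auto simp: indicator_def)
        have "v (x, y') - v (x, y) = (\<integral>r. indicator {-l<..<y'} r * h (x, r) - indicator {-l<..<y} r * h (x, r) \<partial>lborel)"
          using eq[of y] eq[of y'] y hm by simp
        also have "\<dots> = (\<integral>r. indicator {y<..<y'} r * e r + indicator {y<..<y'} r * ?P x r \<partial>lborel)"
        proof (rule integral_cong_AE)
          have "(\<lambda>r. h (x, r)) \<in> borel_measurable borel" by measurable
          then show "(\<lambda>r. indicator {-l<..<y'} r * h (x, r) - indicator {-l<..<y} r * h (x, r)) \<in> borel_measurable lborel"
            by measurable
          show "(\<lambda>r. indicator {y<..<y'} r * e r + indicator {y<..<y'} r * ?P x r) \<in> borel_measurable lborel"
            using R_int[of x] by (intro borel_measurable_add) auto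
          show "AE r in lborel. indicator {-l<..<y'} r * h (x, r) - indicator {-l<..<y} r * h (x, r) =
            indicator {y<..<y'} r * e r + indicator {y<..<y'} r * ?P x r"
            using elim(1) AE_lborel_singleton[of y] AE_lborel_singleton[of "-l"]
            by eventually_elim (use x y h0 in \<open>auto simp: indicator_def\<close>)
        qed
        also have "\<dots> = E + R x"
        proof -
          have "integrable lborel (\<lambda>r. indicator {y<..<y'} r * e r)"
            using ie by (intro integrable_mult_bounded(2)[where K = 1]) (auto simp: indicator_def)
          then show ?thesis using R_int[of x] by (simp add: E_def R_eq')
        qed
        finally show "v (x, y') - v (x, y) = E + R x" .
      qed
    qed
    \<comment> \<open>Both sides are continuous in x, so the identity also holds at x = 0, where v
      and R vanish; this forces E = 0.\<close>
    then have all: "v (x, y') - v (x, y) = E + R x" if "x \<in> {0..pi}" for x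
      using that
      by (intro continuous_eq_if_AE_eq[of "{0<..<pi}" "\<lambda>x. v (x, y') - v (x, y)" "\<lambda>x. E + R x"])
         (auto intro!: continuous_on_diff vx continuous_on_add continuous_on_const continuous_on_subset[OF R_cont])
    have "R 0 = 0" by (simp add: R_def)
    then have "E = 0" using all[of 0] v_boundary_closed(1)[of y] v_boundary_closed(1)[of y'] y by simp
    then show "(\<integral>t. indicator {y<..<y'} t * e t \<partial>lborel) = 0"
      "x \<in> {0..pi} \<Longrightarrow> v (x, y') - v (x, y) = (\<integral>z. indicator ({0<..<x} \<times> {y<..<y'}) z * B z \<partial>lborel)"
      using all by (auto simp: E_def R_eq)
  qed
  show ?thesis using ie e rect by (intro exI[of _ e]) blast
qed

lemma mixed_difference:
  assumes "x \<in> {0..pi}" "-l \<le> y" "y \<le> y'" "y' \<le> l"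
  shows "v (x, y') - v (x, y) = (\<integral>z. indicator ({0<..<x} \<times> {y<..<y'}) z * B z \<partial>lborel)"
  using y_derivative_and_mixed_difference assms by blast

text \<open>All integrals of e over subintervals vanish, so e is null and h is a pure primitive of
  B. The factor 1 gives the bound the shape that \<open>norm_from_section_bound\<close>
  expects.\<close>

lemma h_bound_B: "AE z in lborel. \<bar>h z\<bar> \<le> 1 * (indicator {0<..<pi} (fst z) * (\<integral>s. \<bar>B (s, snd z)\<bar> \<partial>lborel))"
proof -
  obtain e where ie: "integrable lborel e"
    and e: "AE z in lborel. z \<in> {0<..<pi} \<times> {-l<..<l} \<longrightarrow>
        h z = e (snd z) + (\<integral>s. indicator {0<..<fst z} s * B (s, snd z) \<partial>lborel)"
    and zero: "\<And>y y'. -l \<le> y \<Longrightarrow> y \<le> y' \<Longrightarrow> y' \<le> l \<Longrightarrow> (\<integral>t. indicator {y<..<y'} t * e t \<partial>lborel) = 0"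
    using y_derivative_and_mixed_difference by blast
  have "AE t in lborel. indicator {-l<..<l} t * e t = 0"
  proof (rule AE_zero_if_integral_box_zero)
    show "integrable lborel (\<lambda>t. indicator {-l<..<l} t * e t)"
      using ie by (intro integrable_mult_bounded(2)[where K = 1]) (auto simp: indicator_def)
    fix a b :: real
    \<comment> \<open>Clips (a, b) to (-l, l); the outer maximum keeps y <= y' when nothing is
      left.\<close>
    define y y' where "y = max a (-l)" and "y' = max y (min b l)"
    have "(\<integral>t. indicator (box a b) t * (indicator {-l<..<l} t * e t) \<partial>lborel) = (\<integral>t. indicator {y<..<y'} t * e t \<partial>lborel)"
      by (intro Bochner_Integration.integral_cong refl) (auto simp: indicator_def box_real y_def y'_def)
    also have "\<dots> = 0"
    proof (cases "y \<le> l")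
      case True
      then show ?thesis by (intro zero) (auto simp: y_def y'_def)
    next
      case False
      then have "y' = y" by (auto simp: y'_def)
      then show ?thesis by simp
    qed
    finally show "(\<integral>t. indicator (box a b) t * (indicator {-l<..<l} t * e t) \<partial>lborel) = 0" .
  qed
  from AE_planar_snd[OF this] AE_planar_snd[OF planar_sections(2)[OF B]] e show ?thesis
  proof eventually_elim
    case (elim z)
    show ?case
    proof (cases "z \<in> Omega l")
      case True
      then have z: "fst z \<in> {0<..<pi}" "snd z \<in> {-l<..<l}" by (auto simp: Omega_def)
      then have "\<bar>\<integral>s. indicator {0<..<fst z} s * B (s, snd z) \<partial>lborel\<bar> \<le> (\<integral>s. \<bar>B (s, snd z)\<bar> \<partial>lborel)"
        using elim(2) by (intro indicator_section_integral_le) auto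
      then show ?thesis using elim z by (cases z) auto
    next
      case False
      then show ?thesis by (auto simp: h0 indicator_def)
    qed
  qed
qed

text \<open>Cauchy-Schwarz on a section of length pi gives one factor pi, integrating the resulting
  bound over x in (0, pi) the other.\<close>

lemma norm_from_section_bound:
  fixes k K :: "real \<times> real \<Rightarrow> real"
  assumes k[measurable]: "k \<in> borel_measurable borel" and K: "K \<in> l2 lborel" and K0: "\<And>z. z \<notin> Omega l \<Longrightarrow> K z = 0"
    and iK: "integrable lborel K"
    and le: "AE z in lborel. \<bar>k z\<bar> \<le> c * (indicator {0<..<pi} (fst z) * (\<integral>s. \<bar>K (s, snd z)\<bar> \<partial>lborel))"
  shows "k \<in> l2 lborel" "ip lborel k k \<le> (c * pi)\<^sup>2 * ip lborel K K"
proof -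
  let ?I = "indicator {0<..<pi} :: real \<Rightarrow> real"
  have [measurable]: "K \<in> borel_measurable (borel \<Otimes>\<^sub>M borel)" using K by (simp add: l2_def borel_prod)
  have K2: "integrable lborel (\<lambda>z. (K z)\<^sup>2)" using K by (simp add: l2_def)
  define Q where "Q y = (\<integral>s. (K (s, y))\<^sup>2 \<partial>lborel)" for y
  have Q: "integrable lborel Q" "(\<integral>y. Q y \<partial>lborel) = ip lborel K K"
    unfolding Q_def using planar_integrable(2)[OF K2] planar_Fubini(2)[OF K2]
    by (simp_all add: ip_def power2_eq_square)
  have II: "integrable lborel ?I" by (rule integrable_real_indicator) auto
  have "AE y in lborel. (\<integral>s. \<bar>K (s, y)\<bar> \<partial>lborel)\<^sup>2 \<le> pi * Q y"
    using planar_sections(2)[OF K2]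
  proof eventually_elim
    case (elim y)
    have 1: "?I \<in> l2 lborel"
    proof -
      have "(\<lambda>z. (?I z)\<^sup>2) = ?I" by (auto simp: indicator_def)
      then show ?thesis using II by (simp add: l2_def)
    qed
    have 2: "(\<lambda>s. \<bar>K (s, y)\<bar>) \<in> l2 lborel" using elim by (simp add: l2_def)
    have "ip lborel ?I ?I = pi"
    proof -
      have "ip lborel ?I ?I = (\<integral>z. ?I z \<partial>lborel)"
        unfolding ip_def by (intro Bochner_Integration.integral_cong) (auto simp: indicator_def)
      then show ?thesis by simp
    qed
    moreover have "ip lborel ?I (\<lambda>s. \<bar>K (s, y)\<bar>) = (\<integral>s. \<bar>K (s, y)\<bar> \<partial>lborel)"
      unfolding ip_def
    proof (intro Bochner_Integration.integral_cong refl)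
      fix s show "?I s * \<bar>K (s, y)\<bar> = \<bar>K (s, y)\<bar>"
        using K0[of "(s, y)"] by (cases "s \<in> {0<..<pi}") (auto simp: Omega_def)
    qed
    moreover have "ip lborel (\<lambda>s. \<bar>K (s, y)\<bar>) (\<lambda>s. \<bar>K (s, y)\<bar>) = Q y"
      by (simp add: ip_def Q_def power2_eq_square)
    ultimately show ?case using l2.cauchy_schwarz[OF 1 2] by simp
  qed
  from AE_planar_snd[OF this] le
  have bound: "AE z in lborel. (k z)\<^sup>2 \<le> (c\<^sup>2 * pi) * (?I (fst z) * Q (snd z))"
  proof eventually_elim
    case (elim z)
    let ?N = "\<integral>s. \<bar>K (s, snd z)\<bar> \<partial>lborel"
    have "(k z)\<^sup>2 \<le> (c * (?I (fst z) * ?N))\<^sup>2"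
      using power_mono[OF elim(2) abs_ge_zero, of 2] by simp
    also have "\<dots> = c\<^sup>2 * ?I (fst z) * ?N\<^sup>2" by (simp add: power_mult_distrib indicator_def)
    also have "\<dots> \<le> c\<^sup>2 * ?I (fst z) * (pi * Q (snd z))" by (intro mult_left_mono elim) auto
    finally show ?case by (simp add: mult_ac)
  qed
  have int: "integrable lborel (\<lambda>z. (c\<^sup>2 * pi) * (?I (fst z) * Q (snd z)))"
    using integrable_product[OF II Q(1)] by simp
  have k2: "integrable lborel (\<lambda>z. (k z)\<^sup>2)"
    by (rule Bochner_Integration.integrable_bound[OF int]) (use bound in \<open>auto elim!: eventually_mono\<close>)
  then show "k \<in> l2 lborel" by (simp add: l2_def)
  have "ip lborel k k = (\<integral>z. (k z)\<^sup>2 \<partial>lborel)" by (simp add: ip_def power2_eq_square)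
  also have "\<dots> \<le> (\<integral>z. (c\<^sup>2 * pi) * (?I (fst z) * Q (snd z)) \<partial>lborel)"
    using k2 int bound by (rule integral_mono_AE)
  also have "\<dots> = (c * pi)\<^sup>2 * ip lborel K K"
    using integral_product[OF II Q(1)] Q(2) by (simp add: power2_eq_square)
  finally show "ip lborel k k \<le> (c * pi)\<^sup>2 * ip lborel K K" .
qed

lemma g_norm: "g \<in> l2 lborel" "ip lborel g g \<le> (2 * pi)\<^sup>2 * ip lborel A A"
  using norm_from_section_bound[OF borel(2) A2 A0 A g_bound_A] by auto

lemma h_norm: "h \<in> l2 lborel" "ip lborel h h \<le> pi\<^sup>2 * ip lborel B B"
  using norm_from_section_bound[OF borel(3) B2 B0 B h_bound_B] by auto

text \<open>The increment is an integral of B over a rectangle of area at most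
  \<open>pi * (y' - y)\<close>.\<close>

lemma hoelder_y:
  assumes "x \<in> {0..pi}" "-l \<le> y" "y \<le> y'" "y' \<le> l"
  shows "\<bar>v (x, y') - v (x, y)\<bar> \<le> sqrt (pi * (y' - y) * ip lborel B B)"
proof -
  have m: "{0<..<x} \<times> {y<..<y'} \<in> sets borel" by (intro borel_open open_Times) auto
  have m': "{0..pi} \<times> {y..y'} \<in> sets borel" by (intro borel_closed closed_Times) auto
  have "\<bar>v (x, y') - v (x, y)\<bar> \<le> (\<integral>z. \<bar>indicator ({0<..<x} \<times> {y<..<y'}) z * B z\<bar> \<partial>lborel)"
    unfolding mixed_difference[OF assms] by (rule integral_abs_bound)
  also have "\<dots> \<le> (\<integral>z. indicator ({0..pi} \<times> {y..y'}) z * \<bar>B z\<bar> \<partial>lborel)"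
    using B m m' assms
    by (intro integral_mono integrable_abs integrable_mult_bounded(2)[where K = 1]) (auto simp: indicator_def)
  also have "\<dots> \<le> sqrt ((pi - 0) * (y' - y) * ip lborel B B)"
    using assms by (intro rectangle_cauchy_schwarz B2) auto
  finally show ?thesis by simp
qed

text \<open>By the mixed difference formula the increment in \<open>x\<close> varies little with \<open>y\<close>, so bounding its
  average over \<open>y\<close> is enough.\<close>

lemma hoelder_x:
  assumes x: "0 \<le> x" "x \<le> x'" "x' \<le> pi" and y: "-l \<le> y" "y \<le> l"
  shows "\<bar>v (x', y) - v (x, y)\<bar> \<le> sqrt ((x' - x) * (2 * l) * ip lborel g g) / (2 * l) + sqrt ((x' - x) * (2 * l) * ip lborel B B)"
proof -
  let ?R = "{x..x'} \<times> {-l..l}"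
  have R: "?R \<in> sets borel" by (intro borel_closed closed_Times) auto
  have rect: "{0<..<x} \<times> {y<..<y'} \<in> sets borel" for x y y' :: real
    by (intro borel_open open_Times) auto
  define \<beta> where "\<beta> = (\<integral>z. indicator ?R z * \<bar>B z\<bar> \<partial>lborel)"
  have iR: "integrable lborel (\<lambda>z. indicator ?R z * \<bar>B z\<bar>)" "integrable lborel (\<lambda>z. indicator ?R z * \<bar>g z\<bar>)"
    using B g R by (auto intro!: integrable_mult_bounded(2)[where K = 1] simp: indicator_def)
  have mixed: "\<bar>(v (x', t') - v (x', t)) - (v (x, t') - v (x, t))\<bar> \<le> \<beta>" if t: "-l \<le> t" "t \<le> t'" "t' \<le> l" for t t'
  proof -
    let ?i = "\<lambda>x. indicator ({0<..<x} \<times> {t<..<t'}) :: real \<times> real \<Rightarrow> real"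
    have i: "integrable lborel (\<lambda>z. ?i x z * B z)" for x
      using B rect by (intro integrable_mult_bounded(2)[where K = 1]) (auto simp: indicator_def)
    have eq: "(v (x', t') - v (x', t)) - (v (x, t') - v (x, t)) = (\<integral>z. ?i x' z * B z - ?i x z * B z \<partial>lborel)"
      using i mixed_difference[of x t t'] mixed_difference[of x' t t'] t x by simp
    have "\<bar>(v (x', t') - v (x', t)) - (v (x, t') - v (x, t))\<bar> \<le> (\<integral>z. \<bar>?i x' z * B z - ?i x z * B z\<bar> \<partial>lborel)"
      unfolding eq by (rule integral_abs_bound)
    also have "\<dots> \<le> \<beta>"
      unfolding \<beta>_def
    proof (rule integral_mono[OF _ iR(1)])
      show "integrable lborel (\<lambda>z. \<bar>?i x' z * B z - ?i x z * B z\<bar>)"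
        by (rule integrable_abs[OF Bochner_Integration.integrable_diff[OF i i]])
      fix z
      have "\<bar>?i x' z - ?i x z\<bar> \<le> indicator ?R z"
        using x t by (cases z) (auto simp: indicator_def)
      then have "\<bar>?i x' z - ?i x z\<bar> * \<bar>B z\<bar> \<le> indicator ?R z * \<bar>B z\<bar>" by (rule mult_right_mono) simp
      then show "\<bar>?i x' z * B z - ?i x z * B z\<bar> \<le> indicator ?R z * \<bar>B z\<bar>"
        by (simp only: left_diff_distrib[symmetric] abs_mult)
    qed
    finally show ?thesis .
  qed
  have iJ: "integrable lborel (\<lambda>t. indicator {-l<..<l} t * c)" for c :: real
    using l by (intro integrable_mult_bounded(1)[where K = "\<bar>c\<bar>"] integrable_real_indicator) auto
  \<comment> \<open>At height t the increment in x is bounded by a section integral of the absolute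
    value of g, and moving from t to y costs at most \<open>\<beta>\<close>. Integrating over t
    produces the length 2 l on the left and a planar integral on the right.\<close>
  have "AE t in lborel. indicator {-l<..<l} t * \<bar>v (x', y) - v (x, y)\<bar> \<le>
    indicator {-l<..<l} t * \<beta> + (\<integral>s. indicator ?R (s, t) * \<bar>g (s, t)\<bar> \<partial>lborel)"
    using v_from_g
  proof eventually_elim
    case (elim t)
    have nn: "(\<integral>s. indicator ?R (s, t) * \<bar>g (s, t)\<bar> \<partial>lborel) \<ge> 0" by (intro integral_nonneg_AE) auto
    show ?case
    proof (cases "t \<in> {-l<..<l}")
      case True
      then have ig: "integrable lborel (\<lambda>s. g (s, t))"
        and vg: "\<And>x. x \<in> {0..pi} \<Longrightarrow> v (x, t) = (\<integral>s. indicator {0<..<x} s * g (s, t) \<partial>lborel)"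
        using elim by auto
      let ?i = "\<lambda>x. indicator {0<..<x} :: real \<Rightarrow> real"
      have i: "integrable lborel (\<lambda>s. ?i x s * g (s, t))" for x
        using ig by (intro integrable_mult_bounded(2)[where K = 1]) (auto simp: indicator_def)
      have i2: "integrable lborel (\<lambda>s. indicator ?R (s, t) * \<bar>g (s, t)\<bar>)"
      proof -
        have "indicator ?R (s, t) = (indicator {x..x'} s :: real)" for s using True by (auto simp: indicator_def)
        then show ?thesis using ig by (auto intro!: integrable_mult_bounded(2)[where K = 1] simp: indicator_def)
      qed
      have eq: "v (x', t) - v (x, t) = (\<integral>s. ?i x' s * g (s, t) - ?i x s * g (s, t) \<partial>lborel)"
        using i vg x by simp
      have "\<bar>v (x', t) - v (x, t)\<bar> \<le> (\<integral>s. \<bar>?i x' s * g (s, t) - ?i x s * g (s, t)\<bar> \<partial>lborel)"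
        unfolding eq by (rule integral_abs_bound)
      also have "\<dots> \<le> (\<integral>s. indicator ?R (s, t) * \<bar>g (s, t)\<bar> \<partial>lborel)"
      proof (rule integral_mono[OF _ i2])
        show "integrable lborel (\<lambda>s. \<bar>?i x' s * g (s, t) - ?i x s * g (s, t)\<bar>)"
          by (rule integrable_abs[OF Bochner_Integration.integrable_diff[OF i i]])
        fix s
        have "\<bar>?i x' s - ?i x s\<bar> \<le> indicator ?R (s, t)"
          using x True by (auto simp: indicator_def)
        then have "\<bar>?i x' s - ?i x s\<bar> * \<bar>g (s, t)\<bar> \<le> indicator ?R (s, t) * \<bar>g (s, t)\<bar>" by (rule mult_right_mono) simp
        then show "\<bar>?i x' s * g (s, t) - ?i x s * g (s, t)\<bar> \<le> indicator ?R (s, t) * \<bar>g (s, t)\<bar>"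
          by (simp only: left_diff_distrib[symmetric] abs_mult)
      qed
      finally have "\<bar>v (x', t) - v (x, t)\<bar> \<le> (\<integral>s. indicator ?R (s, t) * \<bar>g (s, t)\<bar> \<partial>lborel)" .
      moreover have "\<bar>(v (x', y) - v (x', t)) - (v (x, y) - v (x, t))\<bar> \<le> \<beta>"
        using mixed[of t y] mixed[of y t] True y by (cases "t \<le> y") auto
      ultimately show ?thesis using True by simp
    qed (use nn in simp)
  qed
  then have "(\<integral>t. indicator {-l<..<l} t * \<bar>v (x', y) - v (x, y)\<bar> \<partial>lborel) \<le>
    (\<integral>t. indicator {-l<..<l} t * \<beta> + (\<integral>s. indicator ?R (s, t) * \<bar>g (s, t)\<bar> \<partial>lborel) \<partial>lborel)"
    using planar_integrable(2)[OF iR(2)] iJ by (intro integral_mono_AE Bochner_Integration.integrable_add) auto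
  also have "\<dots> = 2 * l * \<beta> + (\<integral>z. indicator ?R z * \<bar>g z\<bar> \<partial>lborel)"
    using planar_integrable(2)[OF iR(2)] planar_Fubini(2)[OF iR(2)] iJ[of \<beta>] l by simp
  finally have "2 * l * \<bar>v (x', y) - v (x, y)\<bar> \<le> 2 * l * \<beta> + (\<integral>z. indicator ?R z * \<bar>g z\<bar> \<partial>lborel)"
    using l by simp
  moreover define P where "P = sqrt ((x' - x) * (2 * l) * ip lborel g g)"
  moreover define Q where "Q = sqrt ((x' - x) * (2 * l) * ip lborel B B)"
  moreover have "(\<integral>z. indicator ?R z * \<bar>g z\<bar> \<partial>lborel) \<le> sqrt ((x' - x) * (l - - l) * ip lborel g g)"
    using x l by (intro rectangle_cauchy_schwarz g_norm) auto
  moreover have "\<beta> \<le> sqrt ((x' - x) * (l - - l) * ip lborel B B)"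
    unfolding \<beta>_def using x l by (intro rectangle_cauchy_schwarz B2) auto
  ultimately have "2 * l * \<bar>v (x', y) - v (x, y)\<bar> \<le> 2 * l * \<beta> + P" "\<beta> \<le> Q" by auto
  then have "2 * l * \<bar>v (x', y) - v (x, y)\<bar> \<le> 2 * l * Q + P" using l by (smt (verit) mult_left_mono)
  then have "\<bar>v (x', y) - v (x, y)\<bar> \<le> (2 * l * Q + P) / (2 * l)" using l by (simp add: pos_le_divide_eq mult.commute)
  also have "\<dots> = P / (2 * l) + Q" using l by (simp add: add_divide_distrib)
  finally show ?thesis by (simp add: P_def Q_def)
qed

end

section \<open>Energy space\<close>

abbreviation plate :: "real \<Rightarrow> (real \<times> real) measure" where
  "plate l \<equiv> lebesgue_on (Omega l)"

lemma L2_space_eq_l2: "L2_space D = l2 (lebesgue_on D)"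
  by (simp add: L2_space_def l2_def)

lemma space_plate [simp]: "space (plate l) = Omega l"
  by (simp add: space_restrict_space)

lemma AE_plate_iff: "(AE z in plate l. P z) \<longleftrightarrow> (AE z in lborel. z \<in> Omega l \<longrightarrow> P z)"
  by (subst AE_restrict_space_iff) (auto simp: AE_completion_iff)

lemma borel_measurable_plate: "f \<in> borel_measurable borel \<Longrightarrow> f \<in> borel_measurable (plate l)"
  by (intro measurable_restrict_space1 measurable_completion) simp

lemma
  fixes f :: "real \<times> real \<Rightarrow> real"
  assumes [measurable]: "f \<in> borel_measurable borel"
  shows integral_plate: "(\<integral>z. f z \<partial>plate l) = (\<integral>z. indicator (Omega l) z * f z \<partial>lborel)"
    and integrable_plate: "integrable (plate l) f \<longleftrightarrow> integrable lborel (\<lambda>z. indicator (Omega l) z * f z)"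
proof -
  have m: "(\<lambda>z. indicator (Omega l) z * f z) \<in> borel_measurable lborel" by measurable
  show "(\<integral>z. f z \<partial>plate l) = (\<integral>z. indicator (Omega l) z * f z \<partial>lborel)"
    using integral_completion[OF m] by (simp add: integral_restrict_space)
  show "integrable (plate l) f \<longleftrightarrow> integrable lborel (\<lambda>z. indicator (Omega l) z * f z)"
    using integrable_completion[OF m] by (simp add: integrable_restrict_space)
qed

lemma emeasure_Omega: "l \<ge> 0 \<Longrightarrow> emeasure lborel (Omega l) = ennreal (2 * pi * l)"
proof -
  assume "l \<ge> 0"
  have "emeasure (lborel \<Otimes>\<^sub>M lborel) (Omega l) = emeasure lborel {0<..<pi} * emeasure lborel {-l<..<l}"
    unfolding Omega_def by (rule lborel.emeasure_pair_measure_Times) auto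
  then show ?thesis using \<open>l \<ge> 0\<close> by (simp add: lborel_prod ennreal_mult[symmetric] mult_ac)
qed

lemma measure_Omega:
  assumes "l \<ge> 0"
  shows "measure lebesgue (Omega l) = 2 * pi * l"
proof -
  have "measure lborel (Omega l) = 2 * pi * l"
    by (rule measure_eq_emeasure_eq_ennreal[OF _ emeasure_Omega[OF assms]]) (use assms in simp)
  then show ?thesis by (simp add: measure_completion)
qed

lemma finite_measure_plate: "l \<ge> 0 \<Longrightarrow> finite_measure (plate l)"
  by (intro finite_measureI) (simp add: emeasure_restrict_space emeasure_completion emeasure_Omega)

lemma measure_plate: "l \<ge> 0 \<Longrightarrow> measure (plate l) (Omega l) = 2 * pi * l"
  using measure_Omega[of l] by (simp add: measure_restrict_space)

text \<open>Replaces a Lebesgue measurable function on the plate by a Borel function on the plane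
  that vanishes outside, so that Fubini's theorem for \<open>lborel\<close> and one-dimensional
  sections become available.\<close>

definition borel_rep :: "real \<Rightarrow> (real \<times> real \<Rightarrow> real) \<Rightarrow> (real \<times> real \<Rightarrow> real) \<Rightarrow> bool" where
  "borel_rep l f g \<longleftrightarrow> g \<in> borel_measurable borel \<and> (\<forall>z. z \<notin> Omega l \<longrightarrow> g z = 0) \<and> (AE z in plate l. f z = g z)"

lemma exists_borel_rep:
  assumes f: "f \<in> borel_measurable (plate l)"
  shows "\<exists>g. borel_rep l f g"
proof -
  have "(\<lambda>z. indicator (Omega l) z *\<^sub>R f z) \<in> borel_measurable lebesgue"
    using f borel_measurable_restrict_space_iff[of "Omega l" lebesgue f] by simp
  then obtain g where [measurable]: "g \<in> borel_measurable borel" and g: "AE z in lborel. indicator (Omega l) z *\<^sub>R f z = g z"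
    using completion_ex_borel_measurable_real[of "\<lambda>z. indicator (Omega l) z *\<^sub>R f z" lborel] by auto
  have "AE z in plate l. f z = indicator (Omega l) z * g z"
    unfolding AE_plate_iff using g by eventually_elim (auto simp: indicator_def)
  then show ?thesis
    unfolding borel_rep_def by (intro exI[of _ "\<lambda>z. indicator (Omega l) z * g z"]) auto
qed

lemma borel_rep_integral:
  assumes f: "f \<in> borel_measurable (plate l)" and g: "borel_rep l f g" and t: "t \<in> borel_measurable borel"
  shows "(\<integral>z. f z * t z \<partial>plate l) = (\<integral>z. g z * t z \<partial>lborel)"
proof -
  have [measurable]: "g \<in> borel_measurable borel" and g0: "\<And>z. z \<notin> Omega l \<Longrightarrow> g z = 0"
    and ae: "AE z in plate l. f z = g z" using g by (auto simp: borel_rep_def)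
  have "(\<integral>z. f z * t z \<partial>plate l) = (\<integral>z. g z * t z \<partial>plate l)"
  proof (rule integral_cong_AE)
    have "t \<in> borel_measurable (plate l)" "g \<in> borel_measurable (plate l)"
      using t by (auto intro: borel_measurable_plate)
    then show "(\<lambda>z. f z * t z) \<in> borel_measurable (plate l)" "(\<lambda>z. g z * t z) \<in> borel_measurable (plate l)"
      using f by (auto intro!: borel_measurable_times)
    show "AE z in plate l. f z * t z = g z * t z" using ae by eventually_elim simp
  qed
  also have "\<dots> = (\<integral>z. indicator (Omega l) z * (g z * t z) \<partial>lborel)"
    using t by (intro integral_plate) measurable
  also have "\<dots> = (\<integral>z. g z * t z \<partial>lborel)"
    by (rule Bochner_Integration.integral_cong) (use g0 in \<open>auto simp: indicator_def\<close>)
  finally show ?thesis .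
qed

lemma borel_rep_l2:
  assumes l: "l \<ge> 0" and f: "f \<in> l2 (plate l)" and g: "borel_rep l f g"
  shows "g \<in> l2 lborel" "integrable lborel g" "ip lborel g g = ip (plate l) f f"
proof -
  have [measurable]: "g \<in> borel_measurable borel" and g0: "\<And>z. z \<notin> Omega l \<Longrightarrow> g z = 0"
    and ae: "AE z in plate l. f z = g z" using g by (auto simp: borel_rep_def)
  have g': "g \<in> l2 (plate l)" using f _ ae by (rule l2_cong_AE) (simp add: borel_measurable_plate)
  have eq: "indicator (Omega l) z * (g z)\<^sup>2 = (g z)\<^sup>2" "indicator (Omega l) z * g z = g z" for z
    using g0[of z] by (auto simp: indicator_def)
  have "integrable (plate l) (\<lambda>z. (g z)\<^sup>2)" using g' by (simp add: l2_def)
  then have "integrable lborel (\<lambda>z. (g z)\<^sup>2)" by (subst (asm) integrable_plate) (simp_all add: eq)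
  then show "g \<in> l2 lborel" by (simp add: l2_def)
  have "integrable (plate l) g" using finite_measure.l2_integrable(1)[OF finite_measure_plate[OF l] g'] .
  then show "integrable lborel g" by (subst (asm) integrable_plate) (simp_all add: eq)
  have "ip (plate l) f f = ip (plate l) g g"
    by (rule ip_cong_AE) (use f g' ae in \<open>auto simp: l2_def\<close>)
  also have "\<dots> = (\<integral>z. (g z)\<^sup>2 \<partial>plate l)" by (simp add: ip_def power2_eq_square)
  also have "\<dots> = (\<integral>z. (g z)\<^sup>2 \<partial>lborel)" by (subst integral_plate) (simp_all add: eq)
  finally show "ip lborel g g = ip (plate l) f f" by (simp add: ip_def power2_eq_square)
qed

section \<open>Calculus of planar test functions\<close>

definition smooth2 :: "(real \<times> real \<Rightarrow> real) \<Rightarrow> bool" where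
  "smooth2 f \<longleftrightarrow> (\<forall>k. C_k k f)"

lemma
  assumes "smooth2 f"
  shows smooth2_ddx: "smooth2 (ddx f)" and smooth2_ddy: "smooth2 (ddy f)"
    and smooth2_continuous: "continuous_on UNIV f" and smooth2_differentiable: "f differentiable (at z)"
proof -
  have *: "C_k (Suc k) f" for k using assms by (simp add: smooth2_def)
  then show "smooth2 (ddx f)" "smooth2 (ddy f)" by (simp_all add: smooth2_def)
  show "continuous_on UNIV f" using assms C_k.simps(1) unfolding smooth2_def by blast
  show "f differentiable (at z)" using *[of 0] by (cases z) (simp add: differentiable_on_def)
qed

lemma smooth2_funpow: "smooth2 f \<Longrightarrow> smooth2 ((ddx ^^ m) ((ddy ^^ n) f))"
proof -
  assume f: "smooth2 f"
  have "smooth2 ((ddy ^^ n) f)" by (induction n) (use f smooth2_ddy in auto)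
  then show ?thesis by (induction m) (use smooth2_ddx in auto)
qed

lemma
  assumes "smooth2 f"
  shows has_derivative_ddx: "((\<lambda>x. f (x, y)) has_real_derivative ddx f (x, y)) (at x)"
    and has_derivative_ddy: "((\<lambda>y. f (x, y)) has_real_derivative ddy f (x, y)) (at y)"
proof -
  have d: "f differentiable (at (x, y))" using assms by (rule smooth2_differentiable)
  have "(\<lambda>x. f (x, y)) differentiable (at x)"
    by (rule differentiable_compose[of f "\<lambda>x. (x, y)"]) (use d in \<open>auto intro!: derivative_intros differentiableI\<close>)
  then show "((\<lambda>x. f (x, y)) has_real_derivative ddx f (x, y)) (at x)"
    by (simp add: ddx_def DERIV_deriv_iff_real_differentiable)
  have "(\<lambda>y. f (x, y)) differentiable (at y)"
    by (rule differentiable_compose[of f "\<lambda>y. (x, y)"]) (use d in \<open>auto intro!: derivative_intros differentiableI\<close>)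
  then show "((\<lambda>y. f (x, y)) has_real_derivative ddy f (x, y)) (at y)"
    by (simp add: ddy_def DERIV_deriv_iff_real_differentiable)
qed

lemma continuous_l2_plate:
  assumes l: "l \<ge> 0" and f: "continuous_on UNIV f"
  shows "f \<in> l2 (plate l)"
proof -
  interpret finite_measure "plate l" using l by (rule finite_measure_plate)
  have "compact (f ` ({0..pi} \<times> {-l..l}))"
    by (intro compact_continuous_image continuous_on_subset[OF f] compact_Times compact_Icc) auto
  then obtain K where K: "\<And>z. z \<in> {0..pi} \<times> {-l..l} \<Longrightarrow> norm (f z) \<le> K"
    using compact_imp_bounded bounded_iff by (metis imageI)
  have "AE z in plate l. \<bar>f z\<bar> \<le> K"
    unfolding AE_plate_iff using K by (intro AE_I2) (force simp: Omega_def)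
  then show ?thesis using f by (intro l2_bounded borel_measurable_plate borel_measurable_continuous_onI)
qed

lemma test_function_smooth2: "f \<in> test_functions D \<Longrightarrow> smooth2 f"
  by (simp add: test_functions_def smooth2_def)

lemma test_function_derivs_l2:
  assumes "l \<ge> 0" "f \<in> test_functions D"
  shows "(ddx ^^ m) ((ddy ^^ n) f) \<in> l2 (plate l)"
  using assms by (intro continuous_l2_plate smooth2_continuous smooth2_funpow test_function_smooth2)

lemma test_function_zero: "f \<in> test_functions D \<Longrightarrow> z \<notin> D \<Longrightarrow> f z = 0"
  using closure_subset[of "{z. f z \<noteq> 0}"] unfolding test_functions_def by blast

lemma test_function_derivative_support:
  assumes "f \<in> test_functions D" "z \<notin> closure {z. f z \<noteq> 0}"
  shows "ddx f z = 0" "ddy f z = 0"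
proof -
  let ?U = "- closure {z. f z \<noteq> 0}"
  have zero: "f w = 0" if "w \<in> ?U" for w using that closure_subset[of "{z. f z \<noteq> 0}"] by blast
  obtain x y where z: "z = (x, y)" by (cases z)
  have U: "open ?U" "(x, y) \<in> ?U" using assms z by auto
  have 1: "open ((\<lambda>x. (x, y)) -` ?U)" "open (Pair x -` ?U)"
    using U by (auto intro!: open_vimage continuous_intros)
  have "\<forall>\<^sub>F s in nhds x. f (s, y) = 0"
    using eventually_nhds_in_open[OF 1(1), of x] U(2) by (auto elim!: eventually_mono intro: zero)
  then have "deriv (\<lambda>s. f (s, y)) x = deriv (\<lambda>s. 0) x" by (intro deriv_cong_ev) auto
  then show "ddx f z = 0" by (simp add: ddx_def z)
  have "\<forall>\<^sub>F s in nhds y. f (x, s) = 0"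
    using eventually_nhds_in_open[OF 1(2), of y] U(2) by (auto elim!: eventually_mono intro: zero)
  then have "deriv (\<lambda>s. f (x, s)) y = deriv (\<lambda>s. 0) y" by (intro deriv_cong_ev) auto
  then show "ddy f z = 0" by (simp add: ddy_def z)
qed

lemma test_function_derivative:
  assumes f: "f \<in> test_functions D"
  shows "ddx f \<in> test_functions D" "ddy f \<in> test_functions D"
proof -
  have *: "g \<in> test_functions D"
    if g: "smooth2 g" "\<And>z. z \<notin> closure {z. f z \<noteq> 0} \<Longrightarrow> g z = 0" for g
  proof -
    have sub: "closure {z. g z \<noteq> 0} \<subseteq> closure {z. f z \<noteq> 0}"
      using g(2) by (intro closure_minimal) auto
    moreover have "compact (closure {z. f z \<noteq> 0})" "closure {z. f z \<noteq> 0} \<subseteq> D"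
      using f by (auto simp: test_functions_def)
    ultimately have "compact (closure {z. g z \<noteq> 0})" "closure {z. g z \<noteq> 0} \<subseteq> D"
      by (metis closed_closure compact_Int_closed inf.absorb_iff2, blast)
    then show ?thesis using g(1) unfolding test_functions_def smooth2_def by blast
  qed
  show "ddx f \<in> test_functions D" "ddy f \<in> test_functions D"
    using *[OF smooth2_ddx[OF test_function_smooth2[OF f]]] *[OF smooth2_ddy[OF test_function_smooth2[OF f]]]
      test_function_derivative_support[OF f] by blast+
qed

lemma weak_deriv_tensor:
  assumes w: "is_L2_weak_deriv (Omega l) m n u g" and \<phi>: "\<phi> \<in> test1 0 pi" and \<psi>: "\<psi> \<in> test1 (-l) l"
  shows "(\<integral>z. u z * tensor ((deriv ^^ m) \<phi>) ((deriv ^^ n) \<psi>) z \<partial>plate l) =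
    (- 1) ^ (m + n) * (\<integral>z. g z * tensor \<phi> \<psi> z \<partial>plate l)"
proof -
  have y: "(ddy ^^ n) (tensor f h) = tensor f ((deriv ^^ n) h) \<and> (deriv ^^ n) h \<in> test1 (-l) l"
    if "h \<in> test1 (-l) l" for f h n
    using that by (induction n) (auto simp: ddy_tensor test1_smooth test1_deriv)
  have x: "(ddx ^^ m) (tensor f h) = tensor ((deriv ^^ m) f) h \<and> (deriv ^^ m) f \<in> test1 0 pi"
    if "f \<in> test1 0 pi" for f h m
    using that by (induction m) (auto simp: ddx_tensor test1_smooth test1_deriv)
  have t: "tensor \<phi> \<psi> \<in> test_functions (Omega l)"
    unfolding Omega_def using \<phi> \<psi> by (rule tensor_test_function)
  have "(ddx ^^ m) ((ddy ^^ n) (tensor \<phi> \<psi>)) = tensor ((deriv ^^ m) \<phi>) ((deriv ^^ n) \<psi>)"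
    using x[OF \<phi>] y[OF \<psi>] by simp
  then show ?thesis using bspec[OF conjunct2[OF w[unfolded is_L2_weak_deriv_def]] t] by simp
qed

text \<open>Two weak derivatives have equal integrals against products of one-variable test
  functions, and these separate integrable functions.\<close>

lemma weak_deriv_unique:
  assumes l: "l > 0" and g: "is_L2_weak_deriv (Omega l) m n u g" and g': "is_L2_weak_deriv (Omega l) m n u g'"
  shows "AE z in plate l. g z = g' z"
proof -
  have G: "g \<in> l2 (plate l)" "g' \<in> l2 (plate l)"
    using g g' by (auto simp: is_L2_weak_deriv_def L2_space_eq_l2)
  then have d: "g - g' \<in> l2 (plate l)" by auto
  then obtain k where k: "borel_rep l (g - g') k" using exists_borel_rep by (auto simp: l2_def)
  note kl2 = borel_rep_l2[OF less_imp_le[OF l] d k]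
  have "AE z in lborel. z \<in> {0<..<pi} \<times> {-l<..<l} \<longrightarrow> k z = 0"
  proof (rule AE_zero_if_integral_tensor_zero[OF kl2(2)])
    fix \<phi> \<psi> assume t: "\<phi> \<in> test1 0 pi" "\<psi> \<in> test1 (-l) l"
    have tl2: "tensor \<phi> \<psi> \<in> l2 (plate l)"
      using l test_function_derivs_l2[of l "tensor \<phi> \<psi>" "Omega l" 0 0] tensor_test_function[OF t] by (simp add: Omega_def)
    have "(\<integral>z. g z * tensor \<phi> \<psi> z \<partial>plate l) = (\<integral>z. g' z * tensor \<phi> \<psi> z \<partial>plate l)"
      using weak_deriv_tensor[OF g t] weak_deriv_tensor[OF g' t] by simp
    then have "ip (plate l) (g - g') (tensor \<phi> \<psi>) = 0"
      using G tl2 by (subst l2.diff) (auto simp: ip_def)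
    then show "(\<integral>z. k z * tensor \<phi> \<psi> z \<partial>lborel) = 0"
      using borel_rep_integral[OF _ k tensor_measurable[OF t]] d by (simp add: ip_def l2_def)
  qed
  then have "AE z in plate l. k z = 0" by (simp add: AE_plate_iff Omega_def)
  moreover have "AE z in plate l. (g - g') z = k z" using k by (simp add: borel_rep_def)
  ultimately show ?thesis by eventually_elim simp
qed

lemma weak_deriv_cong_AE:
  assumes l: "l > 0" and u: "u \<in> borel_measurable (plate l)" "u' \<in> borel_measurable (plate l)" "AE z in plate l. u z = u' z"
  shows "is_L2_weak_deriv (Omega l) m n u = is_L2_weak_deriv (Omega l) m n u'"
proof -
  have "(\<integral>z. u z * t z \<partial>plate l) = (\<integral>z. u' z * t z \<partial>plate l)" if "t \<in> l2 (plate l)" for t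
    by (rule integral_cong_AE) (use u that in \<open>auto simp: l2_def elim!: eventually_mono\<close>)
  then show ?thesis using l test_function_derivs_l2[of l _ "Omega l" m n]
    by (intro ext) (simp add: is_L2_weak_deriv_def)
qed

lemma weak_deriv_add:
  assumes l: "l > 0" and u: "u \<in> l2 (plate l)" "v \<in> l2 (plate l)"
    and g: "is_L2_weak_deriv (Omega l) m n u g" and h: "is_L2_weak_deriv (Omega l) m n v h"
  shows "is_L2_weak_deriv (Omega l) m n (u + v) (g + h)"
proof -
  have G: "g \<in> l2 (plate l)" "h \<in> l2 (plate l)"
    using g h by (auto simp: is_L2_weak_deriv_def L2_space_eq_l2)
  have t: "(ddx ^^ m) ((ddy ^^ n) f) \<in> l2 (plate l)" "f \<in> l2 (plate l)" if "f \<in> test_functions (Omega l)" for f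
    using test_function_derivs_l2[of l f "Omega l" m n] test_function_derivs_l2[of l f "Omega l" 0 0] l that by auto
  show ?thesis
    unfolding is_L2_weak_deriv_def L2_space_eq_l2
  proof (intro conjI ballI)
    show "g + h \<in> l2 (plate l)" using G by (rule l2_add)
    fix f assume f: "f \<in> test_functions (Omega l)"
    show "(\<integral>z. (u + v) z * (ddx ^^ m) ((ddy ^^ n) f) z \<partial>plate l) = (- 1) ^ (m + n) * (\<integral>z. (g + h) z * f z \<partial>plate l)"
      using g h f l2.add[OF u t(1)[OF f]] l2.add[OF G t(2)[OF f]]
      by (simp add: is_L2_weak_deriv_def ip_def distrib_left)
  qed
qed

lemma weak_deriv_scale:
  assumes g: "is_L2_weak_deriv (Omega l) m n u g"
  shows "is_L2_weak_deriv (Omega l) m n (c *\<^sub>R u) (c *\<^sub>R g)"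
  using g l2_scale[of g "plate l" c]
  by (simp add: is_L2_weak_deriv_def L2_space_eq_l2 mult.assoc)

text \<open>Both sides of the defining identity are continuous in L2, so taking weak derivatives is
  a closed operation; completeness of the energy space depends on it.\<close>

lemma weak_deriv_limit:
  assumes l: "l > 0" and u: "\<And>k. u k \<in> l2 (plate l)" "U \<in> l2 (plate l)"
    and g: "\<And>k. is_L2_weak_deriv (Omega l) m n (u k) (g k)" and G: "G \<in> l2 (plate l)"
    and lim: "(\<lambda>k. ip (plate l) (u k - U) (u k - U)) \<longlonglongrightarrow> 0" "(\<lambda>k. ip (plate l) (g k - G) (g k - G)) \<longlonglongrightarrow> 0"
  shows "is_L2_weak_deriv (Omega l) m n U G"
  unfolding is_L2_weak_deriv_def L2_space_eq_l2
proof (intro conjI ballI G)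
  fix f assume f: "f \<in> test_functions (Omega l)"
  have t: "(ddx ^^ m) ((ddy ^^ n) f) \<in> l2 (plate l)" "f \<in> l2 (plate l)"
    using test_function_derivs_l2[of l f "Omega l" m n] test_function_derivs_l2[of l f "Omega l" 0 0] l f by auto
  have gl2: "g k \<in> l2 (plate l)" for k using g by (auto simp: is_L2_weak_deriv_def L2_space_eq_l2)
  have eq: "ip (plate l) (u k) ((ddx ^^ m) ((ddy ^^ n) f)) = (- 1) ^ (m + n) * ip (plate l) (g k) f" for k
    using g[of k] f by (simp add: is_L2_weak_deriv_def ip_def)
  have "(\<lambda>k. ip (plate l) (u k) ((ddx ^^ m) ((ddy ^^ n) f))) \<longlonglongrightarrow> ip (plate l) U ((ddx ^^ m) ((ddy ^^ n) f))"
    using u t lim by (intro l2_tendsto_ip)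
  moreover have "(\<lambda>k. (- 1) ^ (m + n) * ip (plate l) (g k) f) \<longlonglongrightarrow> (- 1) ^ (m + n) * ip (plate l) G f"
    using gl2 G t lim by (intro tendsto_mult tendsto_const l2_tendsto_ip)
  ultimately have "ip (plate l) U ((ddx ^^ m) ((ddy ^^ n) f)) = (- 1) ^ (m + n) * ip (plate l) G f"
    unfolding eq by (rule LIMSEQ_unique)
  then show "(\<integral>z. U z * (ddx ^^ m) ((ddy ^^ n) f) z \<partial>plate l) = (- 1) ^ (m + n) * (\<integral>z. G z * f z \<partial>plate l)"
    by (simp add: ip_def)
qed

section \<open>Chosen weak derivatives and the energy form\<close>

abbreviation wd :: "real \<Rightarrow> nat \<Rightarrow> nat \<Rightarrow> (real \<times> real \<Rightarrow> real) \<Rightarrow> real \<times> real \<Rightarrow> real" where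
  "wd l \<equiv> weak_deriv (Omega l)"

lemma H2_space_l2: "u \<in> H2_space (Omega l) \<Longrightarrow> u \<in> l2 (plate l)"
  by (simp add: H2_space_def L2_space_eq_l2)

lemma wd_is_weak_deriv:
  assumes "u \<in> H2_space (Omega l)" "m + n \<le> 2"
  shows "is_L2_weak_deriv (Omega l) m n u (wd l m n u)"
  using assms someI_ex[of "is_L2_weak_deriv (Omega l) m n u"] by (auto simp: H2_space_def weak_deriv_def)

lemma wd_l2: "u \<in> H2_space (Omega l) \<Longrightarrow> m + n \<le> 2 \<Longrightarrow> wd l m n u \<in> l2 (plate l)"
  using wd_is_weak_deriv[of u l m n] by (simp add: is_L2_weak_deriv_def L2_space_eq_l2)

lemma wd_unique:
  assumes "l > 0" "u \<in> H2_space (Omega l)" "m + n \<le> 2" "is_L2_weak_deriv (Omega l) m n u g"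
  shows "AE z in plate l. wd l m n u z = g z"
  using assms weak_deriv_unique wd_is_weak_deriv by blast

text \<open>An equality everywhere, not just almost everywhere: both functions satisfy the same
  predicate, so the choice operator picks the same representative.\<close>

lemma wd_cong_AE:
  assumes "l > 0" "u \<in> borel_measurable (plate l)" "u' \<in> borel_measurable (plate l)" "AE z in plate l. u z = u' z"
  shows "wd l m n u = wd l m n u'"
  unfolding weak_deriv_def weak_deriv_cong_AE[OF assms] ..

lemma H2_space_subspace:
  assumes l: "l > 0"
  shows "subspace (H2_space (Omega l))"
proof -
  have "(\<lambda>z. 0) \<in> H2_space (Omega l)"
    by (auto simp: H2_space_def L2_space_def is_L2_weak_deriv_def intro!: exI[of _ "\<lambda>z. 0"])
  moreover have "u + v \<in> H2_space (Omega l)" if "u \<in> H2_space (Omega l)" "v \<in> H2_space (Omega l)" for u v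
    using that weak_deriv_add[OF l H2_space_l2 H2_space_l2 wd_is_weak_deriv wd_is_weak_deriv]
      l2_add[OF H2_space_l2 H2_space_l2] by (simp add: H2_space_def[of "Omega l"] L2_space_eq_l2) blast
  moreover have "c *\<^sub>R u \<in> H2_space (Omega l)" if "u \<in> H2_space (Omega l)" for u c
    using that weak_deriv_scale[OF wd_is_weak_deriv[OF that]] l2_scale[OF H2_space_l2[OF that]]
    by (auto simp: H2_space_def[of "Omega l"] L2_space_eq_l2)
  ultimately show ?thesis by (simp add: subspace_def zero_fun_def)
qed

text \<open>The chosen derivatives are linear only up to null sets, so linearity is stated inside an
  inner product, where null sets do not matter.\<close>

lemma
  assumes l: "l > 0" and mn: "m + n \<le> 2" and u: "u \<in> H2_space (Omega l)" and g: "g \<in> l2 (plate l)"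
  shows ip_wd_add: "v \<in> H2_space (Omega l) \<Longrightarrow> ip (plate l) (wd l m n (u + v)) g = ip (plate l) (wd l m n u) g + ip (plate l) (wd l m n v) g"
    and ip_wd_scale: "ip (plate l) (wd l m n (c *\<^sub>R u)) g = c * ip (plate l) (wd l m n u) g"
proof -
  have H: "subspace (H2_space (Omega l))" using l by (rule H2_space_subspace)
  have gm: "g \<in> borel_measurable (plate l)" using g by (simp add: l2_def)
  have wm: "wd l m n w \<in> borel_measurable (plate l)" if "w \<in> H2_space (Omega l)" for w
    using wd_l2[OF that mn] by (simp add: l2_def)
  {
    assume v: "v \<in> H2_space (Omega l)"
    have s: "wd l m n u + wd l m n v \<in> l2 (plate l)" using u v mn by (intro l2_add wd_l2)
    have "ip (plate l) (wd l m n (u + v)) g = ip (plate l) (wd l m n u + wd l m n v) g"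
    proof (rule ip_cong_AE[OF wm gm _ gm])
      show "u + v \<in> H2_space (Omega l)" using H u v by (rule subspace_add)
      then show "AE z in plate l. wd l m n (u + v) z = (wd l m n u + wd l m n v) z"
        by (intro wd_unique[OF l] mn weak_deriv_add[OF l] H2_space_l2 wd_is_weak_deriv u v)
    qed (use s in \<open>auto simp: l2_def\<close>)
    then show "ip (plate l) (wd l m n (u + v)) g = ip (plate l) (wd l m n u) g + ip (plate l) (wd l m n v) g"
      using l2.add[OF wd_l2[OF u mn] wd_l2[OF v mn] g] by simp
  }
  have s: "c *\<^sub>R wd l m n u \<in> l2 (plate l)" using u mn by (intro l2_scale wd_l2)
  have "ip (plate l) (wd l m n (c *\<^sub>R u)) g = ip (plate l) (c *\<^sub>R wd l m n u) g"
  proof (rule ip_cong_AE[OF wm gm _ gm])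
    show "c *\<^sub>R u \<in> H2_space (Omega l)" using H u by (rule subspace_scale)
    then show "AE z in plate l. wd l m n (c *\<^sub>R u) z = (c *\<^sub>R wd l m n u) z"
      by (intro wd_unique[OF l] mn weak_deriv_scale wd_is_weak_deriv u)
  qed (use s in \<open>auto simp: l2_def\<close>)
  then show "ip (plate l) (wd l m n (c *\<^sub>R u)) g = c * ip (plate l) (wd l m n u) g"
    using l2.scale[OF wd_l2[OF u mn] g] by simp
qed

lemma wd_form:
  assumes l: "l > 0" and mn: "m + n \<le> 2"
  shows "psd_form (H2_space (Omega l)) (\<lambda>u v. ip (plate l) (wd l m n u) (wd l m n v))"
proof
  show "subspace (H2_space (Omega l))" using l by (rule H2_space_subspace)
  fix u v w c assume u: "u \<in> H2_space (Omega l)" and w: "w \<in> H2_space (Omega l)"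
  note l2 = wd_l2[OF u mn] wd_l2[OF w mn]
  show "ip (plate l) (wd l m n u) (wd l m n w) = ip (plate l) (wd l m n w) (wd l m n u)"
    "0 \<le> ip (plate l) (wd l m n u) (wd l m n u)"
    "ip (plate l) (wd l m n (c *\<^sub>R u)) (wd l m n w) = c * ip (plate l) (wd l m n u) (wd l m n w)"
    using l2.sym[OF l2] l2.nonneg[OF l2(1)] ip_wd_scale[OF l mn u l2(2)] by auto
  assume "v \<in> H2_space (Omega l)"
  then show "ip (plate l) (wd l m n (u + v)) (wd l m n w) =
      ip (plate l) (wd l m n u) (wd l m n w) + ip (plate l) (wd l m n v) (wd l m n w)"
    using ip_wd_add[OF l mn u l2(2)] by simp
qed

text \<open>Expanding the product of the Laplacians and subtracting (1 - \<sigma>) times the cross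
  terms leaves them with the factor \<sigma>.\<close>

lemma H2_inner_eq:
  assumes u: "u \<in> H2_space (Omega l)" and v: "v \<in> H2_space (Omega l)"
  shows "H2_inner l \<sigma> u v =
    ip (plate l) (wd l 2 0 u) (wd l 2 0 v) + ip (plate l) (wd l 0 2 u) (wd l 0 2 v) +
    \<sigma> * (ip (plate l) (wd l 2 0 u) (wd l 0 2 v) + ip (plate l) (wd l 0 2 u) (wd l 2 0 v)) +
    2 * (1 - \<sigma>) * ip (plate l) (wd l 1 1 u) (wd l 1 1 v)"
proof -
  have i: "integrable (plate l) (\<lambda>z. wd l m n u z * wd l m' n' v z)" if "m + n \<le> 2" "m' + n' \<le> 2" for m n m' n'
    using that u v by (intro l2_mult wd_l2)
  note i' = i[of 2 0 2 0] i[of 0 2 0 2] i[of 2 0 0 2] i[of 0 2 2 0] i[of 1 1 1 1]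
  have "H2_inner l \<sigma> u v = (\<integral>z. wd l 2 0 u z * wd l 2 0 v z + wd l 0 2 u z * wd l 0 2 v z +
    \<sigma> * (wd l 2 0 u z * wd l 0 2 v z + wd l 0 2 u z * wd l 2 0 v z) + 2 * (1 - \<sigma>) * (wd l 1 1 u z * wd l 1 1 v z) \<partial>plate l)"
    unfolding H2_inner_def Let_def by (intro Bochner_Integration.integral_cong refl) (simp add: algebra_simps)
  also have "\<dots> = ip (plate l) (wd l 2 0 u) (wd l 2 0 v) + ip (plate l) (wd l 0 2 u) (wd l 0 2 v) +
    \<sigma> * (ip (plate l) (wd l 2 0 u) (wd l 0 2 v) + ip (plate l) (wd l 0 2 u) (wd l 2 0 v)) +
    2 * (1 - \<sigma>) * ip (plate l) (wd l 1 1 u) (wd l 1 1 v)"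
    using i' by (simp add: ip_def)
  finally show ?thesis .
qed

text \<open>Twice the cross term W is bounded by X + Y in absolute value, so with \<sigma> < 1/2 it
  absorbs at most half of X + Y; the factor 2 (1 - \<sigma>) of Z lies between 1 and 2.\<close>

lemma H2_inner_bounds:
  assumes "u \<in> H2_space (Omega l)" and \<sigma>: "0 < \<sigma>" "\<sigma> < 1 / 2"
  shows "ip (plate l) (wd l 2 0 u) (wd l 2 0 u) \<le> 2 * H2_inner l \<sigma> u u"
    and "ip (plate l) (wd l 0 2 u) (wd l 0 2 u) \<le> 2 * H2_inner l \<sigma> u u"
    and "ip (plate l) (wd l 1 1 u) (wd l 1 1 u) \<le> H2_inner l \<sigma> u u"
    and "0 \<le> H2_inner l \<sigma> u u"
    and "H2_inner l \<sigma> u u \<le> 2 * (ip (plate l) (wd l 2 0 u) (wd l 2 0 u) + ip (plate l) (wd l 0 2 u) (wd l 0 2 u) +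
      ip (plate l) (wd l 1 1 u) (wd l 1 1 u))"
proof -
  let ?x = "wd l 2 0 u" and ?y = "wd l 0 2 u" and ?z = "wd l 1 1 u"
  have l2: "?x \<in> l2 (plate l)" "?y \<in> l2 (plate l)" "?z \<in> l2 (plate l)" using assms by (auto intro!: wd_l2)
  define X Y Z W where "X = ip (plate l) ?x ?x" "Y = ip (plate l) ?y ?y" "Z = ip (plate l) ?z ?z" "W = ip (plate l) ?x ?y"
  note defs = this
  have nn: "X \<ge> 0" "Y \<ge> 0" "Z \<ge> 0" using l2 by (auto simp: defs l2.nonneg)
  have "0 \<le> ip (plate l) (?x + ?y) (?x + ?y)" "0 \<le> ip (plate l) (?x - ?y) (?x - ?y)"
    using l2 by (auto intro!: l2.nonneg)
  then have W: "- (X + Y) \<le> 2 * W" "2 * W \<le> X + Y"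
    using l2 l2.sym[OF l2(2,1)] by (simp_all add: defs l2.add l2.add_right l2.diff l2.diff_right)
  have e: "H2_inner l \<sigma> u u = X + Y + \<sigma> * (2 * W) + 2 * (1 - \<sigma>) * Z"
    using assms l2.sym[OF l2(2,1)] by (simp add: H2_inner_eq defs)
  have "- (\<sigma> * (X + Y)) \<le> \<sigma> * (2 * W)" "\<sigma> * (2 * W) \<le> \<sigma> * (X + Y)"
    using mult_left_mono[OF W(1), of \<sigma>] mult_left_mono[OF W(2), of \<sigma>] \<sigma> by (simp_all only: mult_minus_right less_imp_le)
  moreover have "\<sigma> * (X + Y) \<le> 1 / 2 * (X + Y)" using \<sigma> nn by (intro mult_right_mono) auto
  moreover have "1 * Z \<le> 2 * (1 - \<sigma>) * Z" "2 * (1 - \<sigma>) * Z \<le> 2 * Z" using \<sigma> nn by (intro mult_right_mono; simp)+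
  note bounds = calculation this
  have "(X + Y) / 2 + Z \<le> H2_inner l \<sigma> u u \<and> H2_inner l \<sigma> u u \<le> 2 * (X + Y + Z)"
  proof -
    \<comment> \<open>The products with \<sigma> are abstracted to S, T and V, which leaves a linear
      problem.\<close>
    have "(X + Y) / 2 + Z \<le> X + Y + T + V \<and> X + Y + T + V \<le> 2 * (X + Y + Z)"
      if "- S \<le> T" "T \<le> S" "S \<le> 1 / 2 * (X + Y)" "1 * Z \<le> V" "V \<le> 2 * Z" for S T V
      using that nn by (simp add: field_simps)
    from this[OF bounds] show ?thesis unfolding e .
  qed
  then have b: "X + Y + 2 * Z \<le> 2 * H2_inner l \<sigma> u u" "H2_inner l \<sigma> u u \<le> 2 * (X + Y + Z)"
    by (simp_all add: field_simps)
  show "ip (plate l) ?x ?x \<le> 2 * H2_inner l \<sigma> u u" unfolding defs[symmetric] using b nn by linarith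
  show "ip (plate l) ?y ?y \<le> 2 * H2_inner l \<sigma> u u" unfolding defs[symmetric] using b nn by linarith
  show "ip (plate l) ?z ?z \<le> H2_inner l \<sigma> u u" unfolding defs[symmetric] using b nn by linarith
  show "0 \<le> H2_inner l \<sigma> u u" using b nn by linarith
  show "H2_inner l \<sigma> u u \<le> 2 * (ip (plate l) ?x ?x + ip (plate l) ?y ?y + ip (plate l) ?z ?z)"
    unfolding defs[symmetric] by (rule b)
qed

section \<open>The boundary condition and continuous representatives\<close>

lemma H2_star_H2_space: "u \<in> H2_star l \<Longrightarrow> u \<in> H2_space (Omega l)"
  by (simp add: H2_star_def)

lemma H2_star_subspace:
  assumes l: "l > 0"
  shows "subspace (H2_star l)"
proof -
  have H: "subspace (H2_space (Omega l))" using l by (rule H2_space_subspace)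
  show ?thesis
    unfolding subspace_def
  proof (intro conjI ballI allI)
    show "0 \<in> H2_star l"
      using subspace_0[OF H] by (auto simp: H2_star_def zero_fun_def intro!: exI[of _ "\<lambda>z. 0"])
    fix u w c assume u: "u \<in> H2_star l"
    then obtain v where v: "continuous_on (closure (Omega l)) v" "AE z in plate l. u z = v z"
      "\<forall>y\<in>{-l<..<l}. v (0, y) = 0 \<and> v (pi, y) = 0" unfolding H2_star_def by blast
    have "c *\<^sub>R u \<in> H2_space (Omega l)" using H H2_star_H2_space[OF u] by (rule subspace_scale)
    moreover have "AE z in plate l. (c *\<^sub>R u) z = c * v z" using v(2) by eventually_elim simp
    ultimately show "c *\<^sub>R u \<in> H2_star l"
      using v unfolding H2_star_def by (intro CollectI conjI exI[of _ "\<lambda>z. c * v z"]) (auto intro: continuous_intros)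
    assume w: "w \<in> H2_star l"
    then obtain v' where v': "continuous_on (closure (Omega l)) v'" "AE z in plate l. w z = v' z"
      "\<forall>y\<in>{-l<..<l}. v' (0, y) = 0 \<and> v' (pi, y) = 0" unfolding H2_star_def by blast
    have "u + w \<in> H2_space (Omega l)" using H H2_star_H2_space[OF u] H2_star_H2_space[OF w] by (rule subspace_add)
    moreover have "AE z in plate l. (u + w) z = v z + v' z" using v(2) v'(2) by eventually_elim simp
    ultimately show "u + w \<in> H2_star l"
      using v v' unfolding H2_star_def by (intro CollectI conjI exI[of _ "\<lambda>z. v z + v' z"]) (auto intro: continuous_intros)
  qed
qed

lemma H2_inner_form:
  assumes l: "l > 0" and \<sigma>: "0 < \<sigma>" "\<sigma> < 1 / 2"
  shows "psd_form (H2_space (Omega l)) (H2_inner l \<sigma>)"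
proof
  have H: "subspace (H2_space (Omega l))" using l by (rule H2_space_subspace)
  then show "subspace (H2_space (Omega l))" .
  fix u v w c assume u: "u \<in> H2_space (Omega l)" and w: "w \<in> H2_space (Omega l)"
  show "0 \<le> H2_inner l \<sigma> u u" using H2_inner_bounds(4)[OF u \<sigma>] .
  show "H2_inner l \<sigma> u w = H2_inner l \<sigma> w u"
    using u w by (simp add: H2_inner_eq l2.sym[OF wd_l2[OF u] wd_l2[OF w]])
  show "H2_inner l \<sigma> (c *\<^sub>R u) w = c * H2_inner l \<sigma> u w"
    using u w subspace_scale[OF H u, of c] by (simp add: H2_inner_eq ip_wd_scale[OF l _ u] wd_l2 algebra_simps)
  assume v: "v \<in> H2_space (Omega l)"
  show "H2_inner l \<sigma> (u + v) w = H2_inner l \<sigma> u w + H2_inner l \<sigma> v w"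
    using u v w subspace_add[OF H u v] by (simp add: H2_inner_eq ip_wd_add[OF l _ u _ v] wd_l2 algebra_simps)
qed

lemma closure_Omega: "l > 0 \<Longrightarrow> closure (Omega l) = {0..pi} \<times> {-l..l}"
  by (simp add: Omega_def closure_Times)

text \<open>Clamping the coordinates retracts the plane continuously onto the closed
  rectangle.\<close>

lemma continuous_extension_plane:
  assumes l: "l > 0" and v: "continuous_on (closure (Omega l)) v"
  shows "\<exists>V. continuous_on UNIV V \<and> (\<forall>z\<in>closure (Omega l). V z = (v z :: real))"
proof -
  have cl: "closure (Omega l) = cbox (0, -l) (pi, l)" using l by (simp add: closure_Omega cbox_Pair_eq)
  have "continuous_on UNIV (\<lambda>z. v (clamp (0, -l) (pi, l) z))"
    using v unfolding cl by (rule clamp_continuous_on)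
  moreover have "v (clamp (0, -l) (pi, l) z) = v z" if "z \<in> closure (Omega l)" for z
    using that unfolding cl by simp
  ultimately show ?thesis by blast
qed

text \<open>The representative is continuous on the whole plane, so its sections are continuous and
  it is Borel without any restriction of the domain.\<close>

definition rep_on_plate :: "real \<Rightarrow> (real \<times> real \<Rightarrow> real) \<Rightarrow> (real \<times> real \<Rightarrow> real) \<Rightarrow> bool" where
  "rep_on_plate l u v \<longleftrightarrow> continuous_on UNIV v \<and> (AE z in plate l. u z = v z) \<and>
     (\<forall>y\<in>{-l<..<l}. v (0, y) = 0 \<and> v (pi, y) = 0)"

lemma H2_star_rep:
  assumes l: "l > 0" and u: "u \<in> H2_star l"
  shows "\<exists>v. rep_on_plate l u v"
proof -
  obtain v where v: "continuous_on (closure (Omega l)) v" "AE z in plate l. u z = v z"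
    "\<forall>y\<in>{-l<..<l}. v (0, y) = 0 \<and> v (pi, y) = 0" using u unfolding H2_star_def by blast
  obtain V where V: "continuous_on UNIV V" "\<And>z. z \<in> closure (Omega l) \<Longrightarrow> V z = v z"
    using continuous_extension_plane[OF l v(1)] by blast
  have "AE z in plate l. u z = V z"
    using v(2) AE_space by eventually_elim (use V(2) closure_subset[of "Omega l"] in auto)
  then show ?thesis using V v(3) l by (intro exI[of _ V]) (auto simp: rep_on_plate_def closure_Omega)
qed

lemma H2_starI:
  assumes "u \<in> H2_space (Omega l)" "rep_on_plate l u v"
  shows "u \<in> H2_star l"
  using assms continuous_on_subset[of UNIV v "closure (Omega l)"] by (auto simp: H2_star_def rep_on_plate_def)

lemma plate_data_exists:
  assumes l: "l > 0" and u: "u \<in> H2_space (Omega l)" and v: "rep_on_plate l u v"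
    and g: "borel_rep l (wd l 1 0 u) g" and h: "borel_rep l (wd l 0 1 u) h"
    and A: "borel_rep l (wd l 2 0 u) A" and B: "borel_rep l (wd l 1 1 u) B"
  shows "plate_data l v g h A B"
proof -
  have l0: "l \<ge> 0" using l by simp
  have vm: "v \<in> borel_measurable borel" using v by (auto simp: rep_on_plate_def intro: borel_measurable_continuous_onI)
  have um: "u \<in> borel_measurable (plate l)" using H2_space_l2[OF u] by (simp add: l2_def)
  note l2 = wd_l2[OF u, of 1 0] wd_l2[OF u, of 0 1] wd_l2[OF u, of 2 0] wd_l2[OF u, of 1 1]
  have wm: "wd l m n u \<in> borel_measurable (plate l)" if "m + n \<le> 2" for m n
    using wd_l2[OF u that] by (simp add: l2_def)
  have lhs: "(\<integral>z. u z * t z \<partial>plate l) = (\<integral>z. indicator (Omega l) z * v z * t z \<partial>lborel)"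
    if t: "t \<in> borel_measurable borel" for t
  proof -
    have "(\<integral>z. u z * t z \<partial>plate l) = (\<integral>z. v z * t z \<partial>plate l)"
      using v um borel_measurable_plate[OF t] borel_measurable_plate[OF vm]
      by (intro integral_cong_AE borel_measurable_times) (auto simp: rep_on_plate_def elim!: eventually_mono)
    also have "\<dots> = (\<integral>z. indicator (Omega l) z * (v z * t z) \<partial>lborel)"
      using t vm by (intro integral_plate borel_measurable_times)
    finally show ?thesis by (simp add: mult.assoc)
  qed
  show ?thesis
  proof
    fix \<phi> \<psi> assume t: "\<phi> \<in> test1 0 pi" "\<psi> \<in> test1 (-l) l"
    note t' = test1_deriv[OF t(1)] test1_deriv[OF t(2)]
    show g_weak: "(\<integral>z. indicator (Omega l) z * v z * tensor (deriv \<phi>) \<psi> z \<partial>lborel) = - (\<integral>z. g z * tensor \<phi> \<psi> z \<partial>lborel)"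
      using weak_deriv_tensor[OF wd_is_weak_deriv[OF u, of 1 0] t] borel_rep_integral[OF wm g tensor_measurable[OF t]]
        lhs[OF tensor_measurable[OF t'(1) t(2)]] by simp
    show "(\<integral>z. indicator (Omega l) z * v z * tensor \<phi> (deriv \<psi>) z \<partial>lborel) = - (\<integral>z. h z * tensor \<phi> \<psi> z \<partial>lborel)"
      using weak_deriv_tensor[OF wd_is_weak_deriv[OF u, of 0 1] t] borel_rep_integral[OF wm h tensor_measurable[OF t]]
        lhs[OF tensor_measurable[OF t(1) t'(2)]] by simp
    \<comment> \<open>That A is the weak x-derivative of g is obtained from u:
      \<open>deriv \<phi>\<close> is again a test function, so both integrals are the same integral
      of u against a second derivative. The argument for B and h is the same.\<close>
    have "- (\<integral>z. g z * tensor (deriv \<phi>) \<psi> z \<partial>lborel) = (\<integral>z. u z * tensor (deriv (deriv \<phi>)) \<psi> z \<partial>plate l)"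
      using weak_deriv_tensor[OF wd_is_weak_deriv[OF u, of 1 0] t'(1) t(2)]
        borel_rep_integral[OF wm g tensor_measurable[OF t'(1) t(2)]] by simp
    also have "\<dots> = (\<integral>z. A z * tensor \<phi> \<psi> z \<partial>lborel)"
      using weak_deriv_tensor[OF wd_is_weak_deriv[OF u, of 2 0] t] borel_rep_integral[OF wm A tensor_measurable[OF t]]
      by (simp add: numeral_2_eq_2)
    finally show "(\<integral>z. g z * tensor (deriv \<phi>) \<psi> z \<partial>lborel) = - (\<integral>z. A z * tensor \<phi> \<psi> z \<partial>lborel)" by simp
    have "- (\<integral>z. h z * tensor (deriv \<phi>) \<psi> z \<partial>lborel) = (\<integral>z. u z * tensor (deriv \<phi>) (deriv \<psi>) z \<partial>plate l)"
      using weak_deriv_tensor[OF wd_is_weak_deriv[OF u, of 0 1] t'(1) t(2)]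
        borel_rep_integral[OF wm h tensor_measurable[OF t'(1) t(2)]] by simp
    also have "\<dots> = (\<integral>z. B z * tensor \<phi> \<psi> z \<partial>lborel)"
      using weak_deriv_tensor[OF wd_is_weak_deriv[OF u, of 1 1] t] borel_rep_integral[OF wm B tensor_measurable[OF t]] by simp
    finally show "(\<integral>z. h z * tensor (deriv \<phi>) \<psi> z \<partial>lborel) = - (\<integral>z. B z * tensor \<phi> \<psi> z \<partial>lborel)" by simp
  qed (use l v g h A B l2 borel_rep_l2[OF l0 _ g] borel_rep_l2[OF l0 _ h] borel_rep_l2[OF l0 _ A] borel_rep_l2[OF l0 _ B]
        in \<open>auto simp: rep_on_plate_def borel_rep_def\<close>)
qed

text \<open>\<open>8 * pi\<^sup>2\<close> is the section constant \<open>(2 * pi)\<^sup>2\<close>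
  times the 2 in the energy bound for the second x-derivative; \<open>16 * pi\<^sup>2 * l\<close> is
  that times the height 2 l of the plate.\<close>

lemma H2_star_estimates:
  assumes l: "l > 0" and \<sigma>: "0 < \<sigma>" "\<sigma> < 1 / 2"
    and u: "u \<in> H2_space (Omega l)" and v: "rep_on_plate l u v"
  defines "e \<equiv> H2_inner l \<sigma> u u"
  shows "x \<in> {0..pi} \<Longrightarrow> y \<in> {-l..l} \<Longrightarrow> y' \<in> {-l..l} \<Longrightarrow> \<bar>v (x, y') - v (x, y)\<bar> \<le> sqrt (pi * \<bar>y' - y\<bar> * e)"
    and "x \<in> {0..pi} \<Longrightarrow> x' \<in> {0..pi} \<Longrightarrow> y \<in> {-l..l} \<Longrightarrow>
       \<bar>v (x', y) - v (x, y)\<bar> \<le> sqrt (\<bar>x' - x\<bar> * (16 * pi\<^sup>2 * l * e)) / (2 * l) + sqrt (\<bar>x' - x\<bar> * (2 * l * e))"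
    and "ip (plate l) (wd l 1 0 u) (wd l 1 0 u) \<le> 8 * pi\<^sup>2 * e"
    and "ip (plate l) (wd l 0 1 u) (wd l 0 1 u) \<le> pi\<^sup>2 * e"
proof -
  have l0: "l \<ge> 0" using l by simp
  have "\<exists>g. borel_rep l (wd l m n u) g" if "m + n \<le> 2" for m n
    using exists_borel_rep wd_l2[OF u that] by (auto simp: l2_def)
  from this[of 1 0] this[of 0 1] this[of 2 0] this[of 1 1]
  obtain g h A B where reps: "borel_rep l (wd l 1 0 u) g" "borel_rep l (wd l 0 1 u) h"
    "borel_rep l (wd l 2 0 u) A" "borel_rep l (wd l 1 1 u) B" by auto
  interpret plate_data l v g h A B using l u v reps by (rule plate_data_exists)
  have "ip lborel B B = ip (plate l) (wd l 1 1 u) (wd l 1 1 u)"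
    using borel_rep_l2(3)[OF l0 wd_l2[OF u] reps(4)] by simp
  also have "\<dots> \<le> e" using H2_inner_bounds(3)[OF u \<sigma>] by (simp add: e_def)
  finally have B: "ip lborel B B \<le> e" .
  have "ip lborel A A = ip (plate l) (wd l 2 0 u) (wd l 2 0 u)"
    using borel_rep_l2(3)[OF l0 wd_l2[OF u] reps(3)] by simp
  also have "\<dots> \<le> 2 * e" using H2_inner_bounds(1)[OF u \<sigma>] by (simp add: e_def)
  finally have A: "(2 * pi)\<^sup>2 * ip lborel A A \<le> (2 * pi)\<^sup>2 * (2 * e)" by (rule mult_left_mono) simp
  have g_le: "ip lborel g g \<le> 8 * pi\<^sup>2 * e"
    using order_trans[OF g_norm(2) A] by (simp add: power2_eq_square)
  show "ip (plate l) (wd l 1 0 u) (wd l 1 0 u) \<le> 8 * pi\<^sup>2 * e"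
    using borel_rep_l2(3)[OF l0 wd_l2[OF u] reps(1)] g_le by simp
  have "pi\<^sup>2 * ip lborel B B \<le> pi\<^sup>2 * e" using B by (rule mult_left_mono) simp
  with h_norm(2) have "ip lborel h h \<le> pi\<^sup>2 * e" by (rule order_trans)
  then show "ip (plate l) (wd l 0 1 u) (wd l 0 1 u) \<le> pi\<^sup>2 * e"
    using borel_rep_l2(3)[OF l0 wd_l2[OF u] reps(2)] by simp
  {
    assume x: "x \<in> {0..pi}" and y: "y \<in> {-l..l}" "y' \<in> {-l..l}"
    have *: "\<bar>v (x, b) - v (x, a)\<bar> \<le> sqrt (pi * (b - a) * e)" if "-l \<le> a" "a \<le> b" "b \<le> l" for a b
    proof -
      have "sqrt (pi * (b - a) * ip lborel B B) \<le> sqrt (pi * (b - a) * e)"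
        using that B by (intro real_sqrt_le_mono mult_left_mono) auto
      with hoelder_y[OF x that] show ?thesis by (rule order_trans)
    qed
    show "\<bar>v (x, y') - v (x, y)\<bar> \<le> sqrt (pi * \<bar>y' - y\<bar> * e)"
      using *[of y y'] *[of y' y] y by (cases "y \<le> y'") (auto simp: abs_minus_commute)
  }
  {
    assume x: "x \<in> {0..pi}" "x' \<in> {0..pi}" and y: "y \<in> {-l..l}"
    have *: "\<bar>v (b, y) - v (a, y)\<bar> \<le> sqrt ((b - a) * (16 * pi\<^sup>2 * l * e)) / (2 * l) + sqrt ((b - a) * (2 * l * e))"
      if ab: "0 \<le> a" "a \<le> b" "b \<le> pi" for a b
    proof -
      have "sqrt ((b - a) * (2 * l) * ip lborel g g) / (2 * l) \<le> sqrt ((b - a) * (2 * l) * (8 * pi\<^sup>2 * e)) / (2 * l)"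
        using ab l g_le by (intro divide_right_mono real_sqrt_le_mono mult_left_mono) auto
      moreover have "sqrt ((b - a) * (2 * l) * ip lborel B B) \<le> sqrt ((b - a) * (2 * l) * e)"
        using ab l B by (intro real_sqrt_le_mono mult_left_mono) auto
      moreover have eqs: "(b - a) * (2 * l) * (8 * pi\<^sup>2 * e) = (b - a) * (16 * pi\<^sup>2 * l * e)"
        "(b - a) * (2 * l) * e = (b - a) * (2 * l * e)" by simp_all
      moreover have "\<bar>v (b, y) - v (a, y)\<bar> \<le> sqrt ((b - a) * (2 * l) * ip lborel g g) / (2 * l) + sqrt ((b - a) * (2 * l) * ip lborel B B)"
        using hoelder_x[of a b y] ab y by auto
      ultimately show ?thesis unfolding eqs by linarith
    qed
    show "\<bar>v (x', y) - v (x, y)\<bar> \<le> sqrt (\<bar>x' - x\<bar> * (16 * pi\<^sup>2 * l * e)) / (2 * l) + sqrt (\<bar>x' - x\<bar> * (2 * l * e))"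
      using *[of x x'] *[of x' x] x by (cases "x \<le> x'") (auto simp: abs_minus_commute)
  }
qed

section \<open>Embedding constants, completeness and compactness\<close>

lemma ip_le_sup:
  assumes l: "l > 0" and f: "f \<in> l2 (plate l)" and B: "AE z in plate l. \<bar>f z\<bar> \<le> B"
  shows "ip (plate l) f f \<le> B\<^sup>2 * (2 * pi * l)"
proof -
  interpret finite_measure "plate l" using l by (intro finite_measure_plate) simp
  have "ip (plate l) f f \<le> (\<integral>z. B\<^sup>2 \<partial>plate l)"
    unfolding ip_def
  proof (rule integral_mono_AE)
    show "AE z in plate l. f z * f z \<le> B\<^sup>2"
      using B
    proof eventually_elim
      case (elim z)
      from power_mono[OF elim abs_ge_zero, of 2] show ?case by (simp add: power2_eq_square)
    qed
  qed (use f in \<open>auto intro: l2_mult\<close>)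
  then show ?thesis using l by (simp add: measure_plate mult_ac)
qed

lemma rep_on_plate_diff:
  assumes "rep_on_plate l u v" "rep_on_plate l u' v'"
  shows "rep_on_plate l (u - u') (\<lambda>z. v z - v' z)"
proof -
  have "AE z in plate l. u z = v z" "AE z in plate l. u' z = v' z" using assms by (auto simp: rep_on_plate_def)
  then have "AE z in plate l. (u - u') z = v z - v' z" by eventually_elim simp
  then show ?thesis using assms by (auto simp: rep_on_plate_def intro: continuous_on_diff)
qed

lemma rep_l2: "l > 0 \<Longrightarrow> continuous_on UNIV v \<Longrightarrow> v \<in> l2 (plate l)"
  by (rule continuous_l2_plate) simp_all

lemma ip_le_rep_bound:
  assumes l: "l > 0" and u: "u \<in> l2 (plate l)" and v: "AE z in plate l. u z = v z"
    and B: "\<And>z. z \<in> closure (Omega l) \<Longrightarrow> \<bar>v z\<bar> \<le> B"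
  shows "ip (plate l) u u \<le> B\<^sup>2 * (2 * pi * l)"
proof (rule ip_le_sup[OF l u])
  show "AE z in plate l. \<bar>u z\<bar> \<le> B"
    using v AE_space by eventually_elim (use B closure_subset[of "Omega l"] in auto)
qed

lemma H2_star_bounds:
  assumes l: "l > 0" and \<sigma>: "0 < \<sigma>" "\<sigma> < 1 / 2"
  shows "\<exists>C>0. \<forall>u\<in>H2_star l.
     (\<forall>v z. rep_on_plate l u v \<and> z \<in> closure (Omega l) \<longrightarrow> \<bar>v z\<bar> \<le> C * sqrt (H2_inner l \<sigma> u u)) \<and>
     (\<forall>m n. m + n \<le> 2 \<longrightarrow> ip (plate l) (wd l m n u) (wd l m n u) \<le> C * H2_inner l \<sigma> u u) \<and>
     ip (plate l) u u \<le> C * H2_inner l \<sigma> u u"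
proof -
  \<comment> \<open>Starting at the corner-free boundary point (0, 0), where v vanishes, one moves
    to (x, 0) and then to (x, y). K adds the two horizontal Hoelder terms for distance pi and the
    vertical one for distance l.\<close>
  define K where "K = sqrt (pi * (16 * pi\<^sup>2 * l)) / (2 * l) + sqrt (pi * (2 * l)) + sqrt (pi * l)"
  have K0: "K \<ge> 0" using l by (simp add: K_def)
  have sup: "\<bar>v z\<bar> \<le> K * sqrt (H2_inner l \<sigma> u u)"
    if u: "u \<in> H2_star l" and v: "rep_on_plate l u v" and z: "z \<in> closure (Omega l)" for u v z
  proof -
    define e where "e = H2_inner l \<sigma> u u"
    note est = H2_star_estimates[OF l \<sigma> H2_star_H2_space[OF u] v, folded e_def]
    have e: "e \<ge> 0" using H2_inner_bounds(4)[OF H2_star_H2_space[OF u] \<sigma>] by (simp add: e_def)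
    obtain x y where xy: "z = (x, y)" "x \<in> {0..pi}" "y \<in> {-l..l}" using z l by (cases z) (auto simp: closure_Omega)
    have "v (0, 0) = 0" using v l by (simp add: rep_on_plate_def)
    then have "\<bar>v (x, 0)\<bar> \<le> sqrt (\<bar>x\<bar> * (16 * pi\<^sup>2 * l * e)) / (2 * l) + sqrt (\<bar>x\<bar> * (2 * l * e))"
      using est(2)[of 0 x 0] xy l by simp
    also have "\<dots> \<le> sqrt (pi * (16 * pi\<^sup>2 * l * e)) / (2 * l) + sqrt (pi * (2 * l * e))"
      using xy l e by (intro add_mono divide_right_mono real_sqrt_le_mono mult_right_mono) auto
    finally have 1: "\<bar>v (x, 0)\<bar> \<le> sqrt (pi * (16 * pi\<^sup>2 * l * e)) / (2 * l) + sqrt (pi * (2 * l * e))" .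
    have "\<bar>v (x, y) - v (x, 0)\<bar> \<le> sqrt (pi * \<bar>y\<bar> * e)" using est(1)[of x 0 y] xy l by simp
    also have "\<dots> \<le> sqrt (pi * l * e)" using xy l e by (intro real_sqrt_le_mono mult_right_mono mult_left_mono) auto
    finally have 2: "\<bar>v (x, y) - v (x, 0)\<bar> \<le> sqrt (pi * l * e)" .
    have "K * sqrt e = sqrt (pi * (16 * pi\<^sup>2 * l * e)) / (2 * l) + sqrt (pi * (2 * l * e)) + sqrt (pi * l * e)"
      by (simp add: K_def real_sqrt_mult algebra_simps)
    then show ?thesis using 1 2 xy by (simp add: e_def[symmetric])
  qed
  \<comment> \<open>The sum of all constants that occur: K for the supremum, its square times the
    area for the L2 norm, \<open>8 * pi\<^sup>2\<close> and \<open>pi\<^sup>2\<close> for the first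
    derivatives, 2 for the second ones.\<close>
  define C where "C = K + K\<^sup>2 * (2 * pi * l) + 8 * pi\<^sup>2 + pi\<^sup>2 + 2"
  have "C > 0" "K \<le> C" "K\<^sup>2 * (2 * pi * l) \<le> C" "8 * pi\<^sup>2 \<le> C" "pi\<^sup>2 \<le> C" "2 \<le> C"
    using K0 l by (auto simp: C_def add_nonneg_pos add_nonneg_nonneg)
  note C = this
  show ?thesis
  proof (intro exI[of _ C] conjI ballI C allI impI)
    fix u assume u: "u \<in> H2_star l"
    let ?e = "H2_inner l \<sigma> u u"
    have uH: "u \<in> H2_space (Omega l)" using u by (rule H2_star_H2_space)
    have ul2: "u \<in> l2 (plate l)" using uH by (rule H2_space_l2)
    have e: "?e \<ge> 0" using H2_inner_bounds(4)[OF uH \<sigma>] .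
    obtain v where v: "rep_on_plate l u v" using H2_star_rep[OF l u] by blast
    have "ip (plate l) u u \<le> (K * sqrt ?e)\<^sup>2 * (2 * pi * l)"
      using sup[OF u v] v by (intro ip_le_rep_bound[OF l ul2, of v]) (auto simp: rep_on_plate_def)
    then have ipu: "ip (plate l) u u \<le> K\<^sup>2 * (2 * pi * l) * ?e" using e by (simp add: power_mult_distrib mult_ac)
    also have "\<dots> \<le> C * ?e" using C e by (intro mult_right_mono)
    finally show ipC: "ip (plate l) u u \<le> C * ?e" .
    have scale: "t \<le> C * ?e" if "t \<le> c * ?e" "c \<le> C" for t c
      using that mult_right_mono[OF that(2) e] by simp
    fix m n :: nat assume mn: "m + n \<le> 2"
    then consider "m = 0" "n = 0" | "m = 1" "n = 0" | "m = 0" "n = 1" | "m = 2" "n = 0" | "m = 1" "n = 1" | "m = 0" "n = 2"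
      by fastforce
    then show "ip (plate l) (wd l m n u) (wd l m n u) \<le> C * ?e"
    proof cases
      case 1
      have "is_L2_weak_deriv (Omega l) 0 0 u u" using ul2 by (simp add: is_L2_weak_deriv_def L2_space_eq_l2)
      then have "AE z in plate l. wd l 0 0 u z = u z" by (intro wd_unique[OF l uH]) simp
      moreover have "wd l 0 0 u \<in> l2 (plate l)" using uH by (intro wd_l2) simp_all
      ultimately have "ip (plate l) (wd l 0 0 u) (wd l 0 0 u) = ip (plate l) u u"
        using ul2 by (intro ip_cong_AE) (auto simp: l2_def)
      then show ?thesis using ipC 1 by simp
    next
      case 2 then show ?thesis using scale[OF H2_star_estimates(3)[OF l \<sigma> uH v]] C by simp
    next
      case 3 then show ?thesis using scale[OF H2_star_estimates(4)[OF l \<sigma> uH v]] C by simp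
    next
      case 4 then show ?thesis using scale[OF H2_inner_bounds(1)[OF uH \<sigma>]] C by simp
    next
      case 5 then show ?thesis using scale[of _ 1] H2_inner_bounds(3)[OF uH \<sigma>] C by simp
    next
      case 6 then show ?thesis using scale[OF H2_inner_bounds(2)[OF uH \<sigma>]] C by simp
    qed
  next
    fix u v z assume "u \<in> H2_star l" "rep_on_plate l u v \<and> z \<in> closure (Omega l)"
    then have "\<bar>v z\<bar> \<le> K * sqrt (H2_inner l \<sigma> u u)" "u \<in> H2_space (Omega l)" using sup H2_star_H2_space by auto
    then show "\<bar>v z\<bar> \<le> C * sqrt (H2_inner l \<sigma> u u)"
      using C H2_inner_bounds(4)[OF _ \<sigma>, of u l] mult_right_mono[of K C "sqrt (H2_inner l \<sigma> u u)"] by simp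
  qed
qed

text \<open>Energy Cauchy sequences converge uniformly by the supremum bound, which preserves the
  boundary values. Their weak derivatives converge in L2, and closedness identifies the limits as
  weak derivatives of U.\<close>

theorem H2_star_complete:
  assumes l: "l > 0" and \<sigma>: "0 < \<sigma>" "\<sigma> < 1 / 2" and u: "\<And>n. u n \<in> H2_star l"
    and cauchy: "\<forall>\<epsilon>>0. \<exists>N. \<forall>m\<ge>N. \<forall>n\<ge>N. H2_inner l \<sigma> (u m - u n) (u m - u n) < \<epsilon>"
  shows "\<exists>U\<in>H2_star l. (\<lambda>n. H2_inner l \<sigma> (u n - U) (u n - U)) \<longlonglongrightarrow> 0"
proof -
  let ?a = "H2_inner l \<sigma>" and ?S = "closure (Omega l)"
  interpret finite_measure "plate l" using l by (intro finite_measure_plate) simp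
  have uH: "u n \<in> H2_space (Omega l)" for n using u by (rule H2_star_H2_space)
  have dH: "u m - u n \<in> H2_star l" for m n using H2_star_subspace[OF l] u by (intro subspace_diff)
  obtain C where C: "C > 0"
    and sup: "\<And>u v z. u \<in> H2_star l \<Longrightarrow> rep_on_plate l u v \<Longrightarrow> z \<in> ?S \<Longrightarrow> \<bar>v z\<bar> \<le> C * sqrt (?a u u)"
    and wdC: "\<And>u m n. u \<in> H2_star l \<Longrightarrow> m + n \<le> 2 \<Longrightarrow> ip (plate l) (wd l m n u) (wd l m n u) \<le> C * ?a u u"
    using H2_star_bounds[OF l \<sigma>] by blast
  obtain v where v: "\<And>n. rep_on_plate l (u n) (v n)" using H2_star_rep[OF l u] by metis
  have "\<exists>w. \<forall>\<epsilon>>0. \<exists>N. \<forall>n z. N \<le> n \<and> z \<in> ?S \<longrightarrow> dist (v n z) (w z) < \<epsilon>"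
  proof (rule uniformly_convergent_eq_cauchy[THEN iffD2], intro allI impI)
    fix \<epsilon> :: real assume \<epsilon>: "\<epsilon> > 0"
    then obtain N where N: "\<And>m n. m \<ge> N \<Longrightarrow> n \<ge> N \<Longrightarrow> ?a (u m - u n) (u m - u n) < (\<epsilon> / C)\<^sup>2"
      using cauchy C by (meson divide_pos_pos zero_less_power)
    have "dist (v m z) (v n z) < \<epsilon>" if "N \<le> m" "N \<le> n" "z \<in> ?S" for m n z
    proof -
      have "\<bar>v m z - v n z\<bar> \<le> C * sqrt (?a (u m - u n) (u m - u n))"
        using sup[OF dH rep_on_plate_diff[OF v v] that(3)] by simp
      also have "\<dots> < C * sqrt ((\<epsilon> / C)\<^sup>2)"
        using N[OF that(1,2)] C by (intro mult_strict_left_mono real_sqrt_less_mono)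
      also have "\<dots> = \<epsilon>" using C \<epsilon> by simp
      finally show ?thesis by (simp add: dist_real_def)
    qed
    then show "\<exists>N. \<forall>m n z. N \<le> m \<and> N \<le> n \<and> z \<in> ?S \<longrightarrow> dist (v m z) (v n z) < \<epsilon>" by blast
  qed
  then obtain w where w: "\<And>\<epsilon>. \<epsilon> > 0 \<Longrightarrow> \<exists>N. \<forall>n z. N \<le> n \<and> z \<in> ?S \<longrightarrow> dist (v n z) (w z) < \<epsilon>" by blast
  have "uniform_limit ?S v w sequentially"
    unfolding uniform_limit_sequentially_iff using w by meson
  moreover have "\<forall>\<^sub>F n in sequentially. continuous_on ?S (v n)"
    using v by (intro always_eventually allI) (auto simp: rep_on_plate_def intro: continuous_on_subset)
  ultimately have "continuous_on ?S w" using uniform_limit_theorem by (metis sequentially_bot)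
  then obtain U where U: "continuous_on UNIV U" "\<And>z. z \<in> ?S \<Longrightarrow> U z = w z"
    using continuous_extension_plane[OF l] by blast
  have Ul2: "U \<in> l2 (plate l)" using l U(1) by (rule rep_l2)
  have ul2: "u n \<in> l2 (plate l)" for n using uH by (rule H2_space_l2)
  have limU: "(\<lambda>n. ip (plate l) (u n - U) (u n - U)) \<longlonglongrightarrow> 0"
  proof (rule LIMSEQ_I)
    fix \<epsilon> :: real assume \<epsilon>: "\<epsilon> > 0"
    \<comment> \<open>Uniform closeness \<open>\<delta>\<close> on a plate of area 2 pi l makes the
      squared L2 distance at most \<epsilon> / 2.\<close>
    define \<delta> where "\<delta> = sqrt (\<epsilon> / (2 * (2 * pi * l)))"
    have \<delta>: "\<delta> > 0" "\<delta>\<^sup>2 * (2 * pi * l) < \<epsilon>" using \<epsilon> l by (simp_all add: \<delta>_def)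
    obtain N where N: "\<And>n z. N \<le> n \<Longrightarrow> z \<in> ?S \<Longrightarrow> dist (v n z) (w z) < \<delta>" using w[OF \<delta>(1)] by blast
    have "norm (ip (plate l) (u n - U) (u n - U) - 0) < \<epsilon>" if "n \<ge> N" for n
    proof -
      have d: "u n - U \<in> l2 (plate l)" using ul2 Ul2 by auto
      have "AE z in plate l. u n z = v n z" using v by (auto simp: rep_on_plate_def)
      then have "AE z in plate l. (u n - U) z = v n z - U z" by eventually_elim simp
      then have "ip (plate l) (u n - U) (u n - U) \<le> \<delta>\<^sup>2 * (2 * pi * l)"
        using N[OF that] U(2) by (intro ip_le_rep_bound[OF l d]) (auto simp: dist_real_def less_imp_le)
      then show ?thesis using \<delta> l2.nonneg[OF d] by simp
    qed
    then show "\<exists>N. \<forall>n\<ge>N. norm (ip (plate l) (u n - U) (u n - U) - 0) < \<epsilon>" by blast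
  qed
  have wdlim: "\<exists>G\<in>l2 (plate l). (\<lambda>k. ip (plate l) (wd l m n (u k) - G) (wd l m n (u k) - G)) \<longlonglongrightarrow> 0"
    if mn: "m + n \<le> 2" for m n
  proof -
    interpret W: psd_form "H2_space (Omega l)" "\<lambda>u v. ip (plate l) (wd l m n u) (wd l m n v)"
      using l mn by (rule wd_form)
    have wl: "wd l m n (u k) \<in> l2 (plate l)" for k using uH mn by (rule wd_l2)
    have eq: "ip (plate l) (wd l m n (u i) - wd l m n (u k)) (wd l m n (u i) - wd l m n (u k)) =
      ip (plate l) (wd l m n (u i - u k)) (wd l m n (u i - u k))" for i k
      using uH wl by (simp add: W.diff W.diff_right l2.diff l2.diff_right)
    have "\<forall>\<epsilon>>0. \<exists>N. \<forall>i\<ge>N. \<forall>k\<ge>N. ip (plate l) (wd l m n (u i) - wd l m n (u k)) (wd l m n (u i) - wd l m n (u k)) < \<epsilon>"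
    proof (intro allI impI)
      fix \<epsilon> :: real assume "\<epsilon> > 0"
      then obtain N where N: "\<And>i k. i \<ge> N \<Longrightarrow> k \<ge> N \<Longrightarrow> ?a (u i - u k) (u i - u k) < \<epsilon> / C"
        using cauchy C by (meson divide_pos_pos)
      have "ip (plate l) (wd l m n (u i) - wd l m n (u k)) (wd l m n (u i) - wd l m n (u k)) < \<epsilon>" if "i \<ge> N" "k \<ge> N" for i k
        using wdC[OF dH mn, of i k] N[OF that] C unfolding eq by (simp add: field_simps)
      then show "\<exists>N. \<forall>i\<ge>N. \<forall>k\<ge>N. ip (plate l) (wd l m n (u i) - wd l m n (u k)) (wd l m n (u i) - wd l m n (u k)) < \<epsilon>" by blast
    qed
    from l2_complete[OF wl this] show ?thesis by blast
  qed
  have UH: "U \<in> H2_space (Omega l)"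
    unfolding H2_space_def L2_space_eq_l2
  proof (intro CollectI conjI Ul2 allI impI)
    fix m n :: nat assume mn: "m + n \<le> 2"
    obtain G where "G \<in> l2 (plate l)" "(\<lambda>k. ip (plate l) (wd l m n (u k) - G) (wd l m n (u k) - G)) \<longlonglongrightarrow> 0"
      using wdlim[OF mn] by blast
    then show "\<exists>g. is_L2_weak_deriv (Omega l) m n U g"
      using weak_deriv_limit[OF l ul2 Ul2 wd_is_weak_deriv[OF uH mn] _ limU] by blast
  qed
  have Urep: "rep_on_plate l U U"
    unfolding rep_on_plate_def
  proof (intro conjI ballI U(1))
    fix y assume y: "y \<in> {-l<..<l}"
    have "U p = 0" if p: "p \<in> ?S" "\<And>n. v n p = 0" for p
    proof (rule ccontr)
      assume "U p \<noteq> 0"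
      then obtain N where "\<forall>n z. N \<le> n \<and> z \<in> ?S \<longrightarrow> dist (v n z) (w z) < \<bar>U p\<bar>" using w[of "\<bar>U p\<bar>"] by auto
      then have "dist (v N p) (w p) < \<bar>U p\<bar>" using p by blast
      then show False using p U(2)[OF p(1)] by (simp add: dist_real_def)
    qed
    moreover have "(0, y) \<in> ?S" "(pi, y) \<in> ?S" using y l by (auto simp: closure_Omega)
    moreover have "v n (0, y) = 0" "v n (pi, y) = 0" for n using v[of n] y by (auto simp: rep_on_plate_def)
    ultimately show "U (0, y) = 0" "U (pi, y) = 0" by blast+
  qed simp
  have Ustar: "U \<in> H2_star l" using UH Urep by (rule H2_starI)
  have lim2: "(\<lambda>k. ip (plate l) (wd l m n (u k - U)) (wd l m n (u k - U))) \<longlonglongrightarrow> 0" if mn: "m + n \<le> 2" for m n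
  proof -
    interpret W: psd_form "H2_space (Omega l)" "\<lambda>u v. ip (plate l) (wd l m n u) (wd l m n v)"
      using l mn by (rule wd_form)
    obtain G where G: "G \<in> l2 (plate l)" "(\<lambda>k. ip (plate l) (wd l m n (u k) - G) (wd l m n (u k) - G)) \<longlonglongrightarrow> 0"
      using wdlim[OF mn] by blast
    have "is_L2_weak_deriv (Omega l) m n U G"
      using weak_deriv_limit[OF l ul2 Ul2 wd_is_weak_deriv[OF uH mn] G(1) limU G(2)] .
    then have ae: "AE z in plate l. wd l m n U z = G z" using wd_unique[OF l UH mn] by blast
    have wl: "wd l m n (u k) \<in> l2 (plate l)" "wd l m n U \<in> l2 (plate l)" for k using uH UH mn by (auto intro: wd_l2)
    have "ip (plate l) (wd l m n (u k - U)) (wd l m n (u k - U)) = ip (plate l) (wd l m n (u k) - G) (wd l m n (u k) - G)" for k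
    proof -
      have "ip (plate l) (wd l m n (u k - U)) (wd l m n (u k - U)) =
        ip (plate l) (wd l m n (u k) - wd l m n U) (wd l m n (u k) - wd l m n U)"
        using uH UH wl by (simp add: W.diff W.diff_right l2.diff l2.diff_right)
      also have "\<dots> = ip (plate l) (wd l m n (u k) - G) (wd l m n (u k) - G)"
      proof (rule ip_cong_AE)
        show "AE z in plate l. (wd l m n (u k) - wd l m n U) z = (wd l m n (u k) - G) z"
          using ae by eventually_elim simp
        then show "AE z in plate l. (wd l m n (u k) - wd l m n U) z = (wd l m n (u k) - G) z" .
      qed (use l2.mem(3)[OF wl] l2.mem(3)[OF wl(1) G(1)] in \<open>auto simp: l2_def\<close>)
      finally show ?thesis .
    qed
    then show ?thesis using G(2) by simp
  qed
  have "(\<lambda>n. ?a (u n - U) (u n - U)) \<longlonglongrightarrow> 0"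
  proof (rule tendsto_sandwich[OF _ _ tendsto_const])
    let ?w = "\<lambda>m n k. ip (plate l) (wd l m n (u k - U)) (wd l m n (u k - U))"
    have "(\<lambda>k. 2 * (?w 2 0 k + ?w 0 2 k + ?w 1 1 k)) \<longlonglongrightarrow> 2 * (0 + 0 + 0)"
      by (intro tendsto_mult tendsto_add tendsto_const lim2) auto
    then show "(\<lambda>k. 2 * (?w 2 0 k + ?w 0 2 k + ?w 1 1 k)) \<longlonglongrightarrow> 0" by simp
    have d: "u k - U \<in> H2_space (Omega l)" for k using H2_space_subspace[OF l] uH UH by (rule subspace_diff)
    show "\<forall>\<^sub>F k in sequentially. 0 \<le> ?a (u k - U) (u k - U)"
      using H2_inner_bounds(4)[OF d \<sigma>] by simp
    show "\<forall>\<^sub>F k in sequentially. ?a (u k - U) (u k - U) \<le> 2 * (?w 2 0 k + ?w 0 2 k + ?w 1 1 k)"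
      using H2_inner_bounds(5)[OF d \<sigma>] by (intro always_eventually allI)
  qed
  then show ?thesis using Ustar by blast
qed

theorem H2_star_compact:
  assumes l: "l > 0" and \<sigma>: "0 < \<sigma>" "\<sigma> < 1 / 2" and u: "\<And>n. u n \<in> H2_star l"
    and K: "\<And>n. H2_inner l \<sigma> (u n) (u n) \<le> K"
  shows "\<exists>r. strict_mono (r :: nat \<Rightarrow> nat) \<and>
    (\<forall>\<epsilon>>0. \<exists>N. \<forall>m\<ge>N. \<forall>n\<ge>N. ip (plate l) (u (r m) - u (r n)) (u (r m) - u (r n)) < \<epsilon>)"
proof -
  let ?a = "H2_inner l \<sigma>" and ?S = "closure (Omega l)"
  have uH: "u n \<in> H2_space (Omega l)" for n using u by (rule H2_star_H2_space)
  have a0: "0 \<le> ?a (u n) (u n)" for n using H2_inner_bounds(4)[OF uH \<sigma>] .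
  then have K0: "K \<ge> 0" using K[of 0] by (rule order_trans)
  obtain C where C: "C > 0"
    and sup: "\<And>u v z. u \<in> H2_star l \<Longrightarrow> rep_on_plate l u v \<Longrightarrow> z \<in> ?S \<Longrightarrow> \<bar>v z\<bar> \<le> C * sqrt (?a u u)"
    using H2_star_bounds[OF l \<sigma>] by blast
  obtain v where v: "\<And>n. rep_on_plate l (u n) (v n)" using H2_star_rep[OF l u] by metis
  \<comment> \<open>A common modulus of continuity: a vertical and then a horizontal move, with
    every energy replaced by its bound K. Its continuity at 0 is the equicontinuity.\<close>
  define \<omega> where "\<omega> t = sqrt (pi * t * K) + (sqrt (t * (16 * pi\<^sup>2 * l * K)) / (2 * l) + sqrt (t * (2 * l * K)))" for t
  have mod: "\<bar>v n p - v n q\<bar> \<le> \<omega> (norm (p - q))" if pq: "p \<in> ?S" "q \<in> ?S" for n p q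
  proof -
    let ?e = "?a (u n) (u n)"
    obtain x y x' y' where p: "p = (x, y)" "x \<in> {0..pi}" "y \<in> {-l..l}" and q: "q = (x', y')" "x' \<in> {0..pi}" "y' \<in> {-l..l}"
      using pq l by (cases p; cases q) (auto simp: closure_Omega)
    have nx: "\<bar>x - x'\<bar> \<le> norm (p - q)" and ny: "\<bar>y - y'\<bar> \<le> norm (p - q)"
      using norm_fst_le[of "x - x'" "y - y'"] norm_snd_le[of "y - y'" "x - x'"] p q by auto
    note est = H2_star_estimates[OF l \<sigma> uH v]
    have "\<bar>v n (x, y) - v n (x, y')\<bar> \<le> sqrt (pi * \<bar>y - y'\<bar> * ?e)" using est(1)[of x y' y] p q by simp
    also have "\<dots> \<le> sqrt (pi * norm (p - q) * K)"
      using ny K[of n] a0[of n] by (intro real_sqrt_le_mono mult_mono) auto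
    finally have 1: "\<bar>v n (x, y) - v n (x, y')\<bar> \<le> sqrt (pi * norm (p - q) * K)" .
    have "\<bar>v n (x, y') - v n (x', y')\<bar> \<le> sqrt (\<bar>x - x'\<bar> * (16 * pi\<^sup>2 * l * ?e)) / (2 * l) + sqrt (\<bar>x - x'\<bar> * (2 * l * ?e))"
      using est(2)[of x' x y'] p q by simp
    also have "\<dots> \<le> sqrt (norm (p - q) * (16 * pi\<^sup>2 * l * K)) / (2 * l) + sqrt (norm (p - q) * (2 * l * K))"
      using nx K[of n] a0[of n] l by (intro add_mono divide_right_mono real_sqrt_le_mono mult_mono) auto
    finally show ?thesis using 1 p q by (simp add: \<omega>_def)
  qed
  have \<omega>: "\<exists>d>0. \<forall>t. \<bar>t\<bar> < d \<longrightarrow> \<omega> t < e" if "e > 0" for e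
  proof -
    have "isCont \<omega> 0" unfolding \<omega>_def using l by (intro continuous_intros) auto
    then have "\<exists>d>0. \<forall>t. dist t 0 < d \<longrightarrow> dist (\<omega> t) (\<omega> 0) < e" using that by (simp add: continuous_at_eps_delta)
    then show ?thesis by (auto simp: dist_real_def \<omega>_def abs_less_iff)
  qed
  obtain g r where r: "strict_mono (r :: nat \<Rightarrow> nat)"
    and lim: "\<And>e. 0 < e \<Longrightarrow> \<exists>N. \<forall>n x. n \<ge> N \<and> x \<in> ?S \<longrightarrow> norm (v (r n) x - g x) < e"
  proof (rule Arzela_Ascoli[of ?S v "C * sqrt K"])
    show "compact ?S" using l by (simp add: closure_Omega compact_Times)
    show "norm (v n z) \<le> C * sqrt K" if "z \<in> ?S" for n z
    proof -
      have "\<bar>v n z\<bar> \<le> C * sqrt (?a (u n) (u n))" using sup[OF u v that] .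
      also have "\<dots> \<le> C * sqrt K" using K C by (intro mult_left_mono) auto
      finally show ?thesis by simp
    qed
    show "\<exists>d. 0 < d \<and> (\<forall>n y. y \<in> ?S \<and> norm (x - y) < d \<longrightarrow> norm (v n x - v n y) < e)" if "x \<in> ?S" "0 < e" for x e
    proof -
      obtain d where d: "d > 0" "\<And>t. \<bar>t\<bar> < d \<Longrightarrow> \<omega> t < e" using \<omega>[OF \<open>0 < e\<close>] by blast
      have "norm (v n x - v n y) < e" if "y \<in> ?S" "norm (x - y) < d" for n y
        using mod[OF \<open>x \<in> ?S\<close> that(1), of n] d(2)[of "norm (x - y)"] that(2) by simp
      then show ?thesis using d(1) by blast
    qed
  qed (rule that)
  have "\<exists>N. \<forall>m\<ge>N. \<forall>n\<ge>N. ip (plate l) (u (r m) - u (r n)) (u (r m) - u (r n)) < \<epsilon>" if \<epsilon>: "\<epsilon> > 0" for \<epsilon>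
  proof -
    define \<delta> where "\<delta> = sqrt (\<epsilon> / (2 * (2 * pi * l)))"
    have \<delta>: "\<delta> > 0" "\<delta>\<^sup>2 * (2 * pi * l) < \<epsilon>" using \<epsilon> l by (simp_all add: \<delta>_def)
    obtain N where N: "\<And>n x. n \<ge> N \<Longrightarrow> x \<in> ?S \<Longrightarrow> norm (v (r n) x - g x) < \<delta> / 2"
      using lim[of "\<delta> / 2"] \<delta>(1) by auto
    have "ip (plate l) (u (r m) - u (r n)) (u (r m) - u (r n)) < \<epsilon>" if "m \<ge> N" "n \<ge> N" for m n
    proof -
      have "ip (plate l) (u (r m) - u (r n)) (u (r m) - u (r n)) \<le> \<delta>\<^sup>2 * (2 * pi * l)"
      proof (rule ip_le_rep_bound[OF l])
        show "u (r m) - u (r n) \<in> l2 (plate l)" using H2_space_l2[OF uH] by auto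
        show "AE z in plate l. (u (r m) - u (r n)) z = v (r m) z - v (r n) z"
          using rep_on_plate_diff[OF v v] by (simp add: rep_on_plate_def)
        show "\<bar>v (r m) z - v (r n) z\<bar> \<le> \<delta>" if "z \<in> ?S" for z
          using N[OF \<open>m \<ge> N\<close> that] N[OF \<open>n \<ge> N\<close> that] by (smt (verit) field_sum_of_halves real_norm_def)
      qed
      then show ?thesis using \<delta>(2) by simp
    qed
    then show ?thesis by blast
  qed
  then show ?thesis using r by blast
qed

section \<open>Reflection in the long axis\<close>

definition mirror :: "real \<times> real \<Rightarrow> real \<times> real" where
  "mirror z = (fst z, - snd z)"

lemma mirror_mirror [simp]: "mirror (mirror z) = z"
  by (simp add: mirror_def)

lemma mirror_Omega [simp]: "mirror z \<in> Omega l \<longleftrightarrow> z \<in> Omega l"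
  by (cases z) (auto simp: mirror_def Omega_def)

lemma continuous_mirror: "continuous_on S mirror"
  unfolding mirror_def by (intro continuous_intros)

text \<open>The reflection is written as a diagonal linear map with entries 1 and -1, whose Jacobian
  factor is 1.\<close>

lemma lebesgue_mirror:
  "mirror \<in> lebesgue \<rightarrow>\<^sub>M lebesgue" "distr lebesgue lebesgue mirror = lebesgue"
proof -
  let ?c = "\<lambda>j :: real \<times> real. if j = (0, 1) then -1 else 1 :: real"
  let ?T = "\<lambda>x. 0 + (\<Sum>j\<in>Basis. (?c j * (x \<bullet> j)) *\<^sub>R j)"
  have T: "?T = mirror"
    by (auto simp: fun_eq_iff mirror_def Basis_prod_def sum.union_disjoint)
  have "?T \<in> lebesgue \<rightarrow>\<^sub>M lebesgue" by (rule lebesgue_affine_measurable) auto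
  then show m: "mirror \<in> lebesgue \<rightarrow>\<^sub>M lebesgue" unfolding T .
  have "(lebesgue :: (real \<times> real) measure) = density (distr lebesgue lebesgue ?T) (\<lambda>_. (\<Prod>j\<in>Basis. \<bar>?c j\<bar>))"
    by (rule lebesgue_affine_euclidean) auto
  then have "lebesgue = density (distr lebesgue lebesgue mirror) (\<lambda>_. (\<Prod>j\<in>(Basis :: (real \<times> real) set). \<bar>?c j\<bar>))"
    unfolding T .
  moreover have "(\<Prod>j\<in>(Basis :: (real \<times> real) set). \<bar>?c j\<bar>) = 1" by (rule prod.neutral) auto
  ultimately show "distr lebesgue lebesgue mirror = lebesgue" by (simp add: density_1)
qed

lemma mirror_measurable: "mirror \<in> plate l \<rightarrow>\<^sub>M plate l"
  by (rule measurable_restrict_space3) (use lebesgue_mirror in auto)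

lemma distr_plate_mirror: "distr (plate l) (plate l) mirror = plate l"
proof (rule measure_eqI)
  fix A assume "A \<in> sets (distr (plate l) (plate l) mirror)"
  then have A: "A \<in> sets (plate l)" by simp
  then have A': "A \<in> sets lebesgue" "A \<subseteq> Omega l"
    by (auto simp: sets_restrict_space_iff)
  have v: "mirror -` A \<inter> Omega l = mirror -` A" using A'(2) by auto (metis mirror_Omega subsetD)
  have mv: "mirror -` A \<in> sets lebesgue" using measurable_sets[OF lebesgue_mirror(1) A'(1)] by simp
  have "emeasure (distr (plate l) (plate l) mirror) A = emeasure (plate l) (mirror -` A)"
    using A by (simp add: emeasure_distr[OF mirror_measurable] v)
  also have "\<dots> = emeasure lebesgue (mirror -` A)"
    using v by (subst emeasure_restrict_space) auto
  also have "\<dots> = emeasure (distr lebesgue lebesgue mirror) A"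
    using A'(1) by (simp add: emeasure_distr[OF lebesgue_mirror(1)])
  also have "\<dots> = emeasure (plate l) A"
    using A' by (simp add: lebesgue_mirror(2) emeasure_restrict_space)
  finally show "emeasure (distr (plate l) (plate l) mirror) A = emeasure (plate l) A" .
qed simp

lemma measurable_mirror: "f \<in> borel_measurable (plate l) \<Longrightarrow> (\<lambda>z. f (mirror z)) \<in> borel_measurable (plate l)"
  by (rule measurable_compose[OF mirror_measurable])

lemma integral_mirror:
  fixes f :: "real \<times> real \<Rightarrow> real"
  assumes "f \<in> borel_measurable (plate l)"
  shows "(\<integral>z. f (mirror z) \<partial>plate l) = (\<integral>z. f z \<partial>plate l)"
  using integral_distr[OF mirror_measurable assms] by (simp add: distr_plate_mirror)

lemma integrable_mirror:
  fixes f :: "real \<times> real \<Rightarrow> real"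
  assumes "f \<in> borel_measurable (plate l)"
  shows "integrable (plate l) (\<lambda>z. f (mirror z)) \<longleftrightarrow> integrable (plate l) f"
  using integrable_distr_eq[OF mirror_measurable assms] by (simp add: distr_plate_mirror)

lemma AE_mirror:
  assumes "AE z in plate l. P z"
  shows "AE z in plate l. P (mirror z)"
proof (rule AE_distrD[where M' = "plate l" and P = P, OF mirror_measurable])
  show "AE z in distr (plate l) (plate l) mirror. P z" unfolding distr_plate_mirror by (rule assms)
qed

abbreviation mirrored :: "(real \<times> real \<Rightarrow> real) \<Rightarrow> real \<times> real \<Rightarrow> real" where
  "mirrored f \<equiv> \<lambda>z. f (mirror z)"

lemma l2_mirror: "f \<in> l2 (plate l) \<Longrightarrow> mirrored f \<in> l2 (plate l)"
  using integrable_mirror[of "\<lambda>z. (f z)\<^sup>2" l] measurable_mirror[of f l] by (auto simp: l2_def)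

lemma ip_mirror:
  assumes "f \<in> l2 (plate l)" "g \<in> l2 (plate l)"
  shows "ip (plate l) (mirrored f) (mirrored g) = ip (plate l) f g"
  using integral_mirror[of "\<lambda>z. f z * g z" l] assms by (auto simp: ip_def l2_def)

text \<open>The factor c makes this rule and its y-counterpart applicable to their own results:
  every y-derivative changes the sign.\<close>

lemma ddx_mirror: "ddx (\<lambda>z. c * f (mirror z)) = (\<lambda>z. c * ddx f (mirror z))" if "smooth2 f"
proof (rule ext)
  fix z :: "real \<times> real" obtain x y where z: "z = (x, y)" by (cases z)
  have "((\<lambda>s. c * f (s, - y)) has_real_derivative c * ddx f (x, - y)) (at x)"
    using has_derivative_ddx[OF that, of "- y" x] by (rule DERIV_cmult)
  then show "ddx (\<lambda>z. c * f (mirror z)) z = c * ddx f (mirror z)"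
    unfolding z by (subst ddx_def) (simp add: mirror_def DERIV_imp_deriv)
qed

lemma ddy_mirror: "ddy (\<lambda>z. c * f (mirror z)) = (\<lambda>z. (- c) * ddy f (mirror z))" if "smooth2 f"
proof (rule ext)
  fix z :: "real \<times> real" obtain x y where z: "z = (x, y)" by (cases z)
  have "((\<lambda>s. f (x, - s)) has_real_derivative ddy f (x, - y) * (- 1)) (at y)"
    by (rule DERIV_chain2[OF has_derivative_ddy[OF that]]) (auto intro!: derivative_eq_intros)
  from DERIV_cmult[OF this, of c] show "ddy (\<lambda>z. c * f (mirror z)) z = (- c) * ddy f (mirror z)"
    unfolding z by (subst ddy_def) (simp add: mirror_def DERIV_imp_deriv)
qed

lemma C_k_mirror: "smooth2 f \<Longrightarrow> C_k k (\<lambda>z. c * f (mirror z))"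
proof (induction k arbitrary: f c)
  case 0
  have "continuous_on UNIV (\<lambda>z. c * f (mirror z))"
    by (intro continuous_intros continuous_on_compose2[OF smooth2_continuous[OF 0] continuous_mirror]) auto
  then show ?case by simp
next
  case (Suc k)
  have "(\<lambda>z. c * f (mirror z)) differentiable (at z)" for z
  proof -
    have "mirror differentiable (at z)" unfolding mirror_def
      by (intro differentiableI) (auto intro!: derivative_eq_intros)
    then have "(\<lambda>z. f (mirror z)) differentiable (at z)"
      using differentiable_compose[of f mirror z UNIV] smooth2_differentiable[OF Suc.prems] by simp
    then show ?thesis by (intro differentiable_mult) auto
  qed
  then have "(\<lambda>z. c * f (mirror z)) differentiable_on UNIV" by (simp add: differentiable_on_def)
  moreover have "C_k k (ddx (\<lambda>z. c * f (mirror z)))"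
    unfolding ddx_mirror[OF Suc.prems] by (rule Suc.IH[OF smooth2_ddx[OF Suc.prems]])
  moreover have "C_k k (ddy (\<lambda>z. c * f (mirror z)))"
    unfolding ddy_mirror[OF Suc.prems] by (rule Suc.IH[OF smooth2_ddy[OF Suc.prems]])
  ultimately show ?case by simp
qed

lemma derivs_mirror:
  assumes f: "smooth2 f"
  shows "(ddx ^^ m) ((ddy ^^ n) (mirrored f)) = (\<lambda>z. (- 1) ^ n * (ddx ^^ m) ((ddy ^^ n) f) (mirror z))"
proof -
  have s: "smooth2 ((ddx ^^ m) ((ddy ^^ n) f))" for m n using f by (rule smooth2_funpow)
  have y: "(ddy ^^ n) (mirrored f) = (\<lambda>z. (- 1) ^ n * (ddy ^^ n) f (mirror z))"
  proof (induction n)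
    case (Suc n)
    then show ?case using ddy_mirror[OF s[of 0 n], of "(- 1) ^ n"] by simp
  qed simp
  show ?thesis
  proof (induction m)
    case (Suc m)
    then show ?case using ddx_mirror[OF s[of m n], of "(- 1) ^ n"] by simp
  qed (simp add: y)
qed

lemma test_functions_mirror:
  assumes f: "f \<in> test_functions (Omega l)"
  shows "mirrored f \<in> test_functions (Omega l)"
proof -
  let ?S = "{z. f z \<noteq> 0}"
  have sm: "smooth2 f" using f by (rule test_function_smooth2)
  have ck: "C_k k (mirrored f)" for k using C_k_mirror[OF sm, of k 1] by simp
  have cl: "closure {z. f (mirror z) \<noteq> 0} = mirror ` closure ?S"
  proof -
    have "{z. f (mirror z) \<noteq> 0} = mirror ` ?S"
    proof (intro set_eqI iffI)
      fix z assume "z \<in> {z. f (mirror z) \<noteq> 0}"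
      then show "z \<in> mirror ` ?S" by (intro image_eqI[of _ _ "mirror z"]) simp_all
    next
      fix z assume "z \<in> mirror ` ?S"
      then obtain w where "z = mirror w" "f w \<noteq> 0" by blast
      then show "z \<in> {z. f (mirror z) \<noteq> 0}" by simp
    qed
    moreover have "linear mirror" by (rule linearI) (auto simp: mirror_def)
    moreover have "inj mirror" by (metis injI mirror_mirror)
    ultimately show ?thesis using closure_injective_linear_image[of mirror ?S] by simp
  qed
  have "compact (closure ?S)" "closure ?S \<subseteq> Omega l" using f by (auto simp: test_functions_def)
  then have "compact (mirror ` closure ?S)" "mirror ` closure ?S \<subseteq> Omega l"
    by (auto intro!: compact_continuous_image[OF continuous_mirror])
  then show ?thesis unfolding test_functions_def mem_Collect_eq cl using ck by blast
qed

lemma weak_deriv_mirror: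
  assumes l: "l > 0" and u: "u \<in> l2 (plate l)" and g: "is_L2_weak_deriv (Omega l) m n u g"
  shows "is_L2_weak_deriv (Omega l) m n (mirrored u) ((- 1) ^ n *\<^sub>R mirrored g)"
  unfolding is_L2_weak_deriv_def L2_space_eq_l2
proof (intro conjI ballI)
  have gl: "g \<in> l2 (plate l)" using g by (simp add: is_L2_weak_deriv_def L2_space_eq_l2)
  then show "(- 1) ^ n *\<^sub>R mirrored g \<in> l2 (plate l)" by (intro l2_scale l2_mirror)
  fix f assume f: "f \<in> test_functions (Omega l)"
  have mf: "mirrored f \<in> test_functions (Omega l)" using f by (rule test_functions_mirror)
  have sm: "smooth2 f" using f by (rule test_function_smooth2)
  let ?D = "(ddx ^^ m) ((ddy ^^ n) f)"
  have D: "?D \<in> l2 (plate l)" "f \<in> l2 (plate l)"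
    using test_function_derivs_l2[of l f "Omega l" m n] test_function_derivs_l2[of l f "Omega l" 0 0] f l by auto
  have "(\<integral>z. u (mirror z) * ?D z \<partial>plate l) = ip (plate l) (mirrored u) (mirrored (mirrored ?D))"
    by (simp add: ip_def)
  also have "\<dots> = ip (plate l) u (mirrored ?D)" using u D by (intro ip_mirror l2_mirror)
  also have "\<dots> = (- 1) ^ n * (\<integral>z. u z * (ddx ^^ m) ((ddy ^^ n) (mirrored f)) z \<partial>plate l)"
    unfolding derivs_mirror[OF sm] ip_def
    by (subst integral_mult_right_zero[symmetric]) (simp add: mult.left_commute power_mult_distrib[symmetric] mult.assoc[symmetric])
  also have "\<dots> = (- 1) ^ n * ((- 1) ^ (m + n) * (\<integral>z. g z * f (mirror z) \<partial>plate l))"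
    using g mf by (simp add: is_L2_weak_deriv_def)
  also have "(\<integral>z. g z * f (mirror z) \<partial>plate l) = ip (plate l) (mirrored (mirrored g)) (mirrored f)"
    by (simp add: ip_def)
  also have "\<dots> = ip (plate l) (mirrored g) f" using gl D by (intro ip_mirror l2_mirror)
  also have "(- 1) ^ n * ((- 1) ^ (m + n) * ip (plate l) (mirrored g) f) =
      (- 1) ^ (m + n) * (\<integral>z. ((- 1) ^ n *\<^sub>R mirrored g) z * f z \<partial>plate l)"
    by (simp add: ip_def mult.assoc)
  finally show "(\<integral>z. u (mirror z) * ?D z \<partial>plate l) = (- 1) ^ (m + n) * (\<integral>z. ((- 1) ^ n *\<^sub>R mirrored g) z * f z \<partial>plate l)" .
qed

lemma H2_space_mirror:
  assumes l: "l > 0" and u: "u \<in> H2_space (Omega l)"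
  shows "mirrored u \<in> H2_space (Omega l)"
  using l2_mirror[OF H2_space_l2[OF u]] weak_deriv_mirror[OF l H2_space_l2[OF u] wd_is_weak_deriv[OF u]]
  by (auto simp: H2_space_def[of "Omega l"] L2_space_eq_l2)

lemma H2_star_mirror:
  assumes l: "l > 0" and u: "u \<in> H2_star l"
  shows "mirrored u \<in> H2_star l"
proof -
  obtain v where v: "rep_on_plate l u v" using H2_star_rep[OF l u] by blast
  have "rep_on_plate l (mirrored u) (mirrored v)"
    unfolding rep_on_plate_def
  proof (intro conjI ballI)
    show "continuous_on UNIV (mirrored v)"
      using v continuous_on_compose2[OF _ continuous_mirror, of UNIV v] by (simp add: rep_on_plate_def)
    show "AE z in plate l. mirrored u z = mirrored v z"
      using v AE_mirror[of "\<lambda>z. u z = v z" l] by (simp add: rep_on_plate_def)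
  qed (use v in \<open>simp_all add: rep_on_plate_def mirror_def\<close>)
  then show ?thesis using H2_starI[OF H2_space_mirror[OF l H2_star_H2_space[OF u]]] by blast
qed

text \<open>A reflected derivative gains the sign (-1)^n, with n the number of y-derivatives. Only
  the mixed derivative changes sign, and the energy contains it in pairs.\<close>

lemma H2_inner_mirror:
  assumes l: "l > 0" and u: "u \<in> H2_space (Omega l)" and v: "v \<in> H2_space (Omega l)"
  shows "H2_inner l \<sigma> (mirrored u) (mirrored v) = H2_inner l \<sigma> u v"
proof -
  have *: "ip (plate l) (wd l m n (mirrored u)) (wd l m' n' (mirrored v)) =
      (- 1) ^ (n + n') * ip (plate l) (wd l m n u) (wd l m' n' v)"
    if mn: "m + n \<le> 2" "m' + n' \<le> 2" for m n m' n'
  proof -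
    have ae: "AE z in plate l. wd l m n (mirrored w) z = ((- 1) ^ n *\<^sub>R mirrored (wd l m n w)) z"
      if "w \<in> H2_space (Omega l)" "m + n \<le> 2" for w m n
      using that weak_deriv_mirror[OF l H2_space_l2[OF that(1)] wd_is_weak_deriv[OF that]]
      by (intro wd_unique[OF l H2_space_mirror[OF l that(1)]])
    have m2: "wd l m n w \<in> l2 (plate l)" "wd l m n (mirrored w) \<in> l2 (plate l)"
        "(- 1) ^ n *\<^sub>R mirrored (wd l m n w) \<in> l2 (plate l)"
      if "w \<in> H2_space (Omega l)" "m + n \<le> 2" for w m n
      using that H2_space_mirror[OF l that(1)] by (auto intro!: wd_l2 l2_scale l2_mirror)
    have "ip (plate l) (wd l m n (mirrored u)) (wd l m' n' (mirrored v)) =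
      ip (plate l) ((- 1) ^ n *\<^sub>R mirrored (wd l m n u)) ((- 1) ^ n' *\<^sub>R mirrored (wd l m' n' v))"
      using m2[OF u mn(1)] m2[OF v mn(2)] ae[OF u mn(1)] ae[OF v mn(2)] by (intro ip_cong_AE) (auto simp: l2_def)
    also have "\<dots> = (- 1) ^ (n + n') * ip (plate l) (mirrored (wd l m n u)) (mirrored (wd l m' n' v))"
      using m2[OF u mn(1)] m2[OF v mn(2)] by (simp add: l2.scale l2.scale_right l2_mirror power_add)
    also have "\<dots> = (- 1) ^ (n + n') * ip (plate l) (wd l m n u) (wd l m' n' v)"
      using m2(1)[OF u mn(1)] m2(1)[OF v mn(2)] by (simp add: ip_mirror)
    finally show ?thesis .
  qed
  show ?thesis
    using u v H2_space_mirror[OF l] by (simp add: H2_inner_eq * )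
qed

lemma H2_inner_cong_AE:
  assumes "l > 0" "u \<in> borel_measurable (plate l)" "u' \<in> borel_measurable (plate l)" "AE z in plate l. u z = u' z"
  shows "H2_inner l \<sigma> u v = H2_inner l \<sigma> u' v" "H2_inner l \<sigma> v u = H2_inner l \<sigma> v u'"
  using wd_cong_AE[OF assms] by (simp_all add: H2_inner_def)

lemma H2_even_iff: "u \<in> H2_even l \<longleftrightarrow> u \<in> H2_star l \<and> (AE z in plate l. mirrored u z = u z)"
  by (simp add: H2_even_def mirror_def)

lemma H2_even_subspace:
  assumes l: "l > 0"
  shows "subspace (H2_even l)"
proof -
  have H: "subspace (H2_star l)" using l by (rule H2_star_subspace)
  have "AE z in plate l. mirrored (u + v) z = (u + v) z"
    if "AE z in plate l. mirrored u z = u z" "AE z in plate l. mirrored v z = v z" for u v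
    using that by eventually_elim simp
  moreover have "AE z in plate l. mirrored (c *\<^sub>R u) z = (c *\<^sub>R u) z"
    if "AE z in plate l. mirrored u z = u z" for u c
    using that by eventually_elim simp
  moreover have "AE z in plate l. mirrored 0 z = (0 :: real \<times> real \<Rightarrow> real) z" by simp
  ultimately show ?thesis using H by (auto simp: subspace_def H2_even_iff)
qed

text \<open>Replacing a test function v by its even part w changes neither side: u and p are even,
  and both the energy and the plate measure are invariant under the reflection.\<close>

lemma weak_solution_if_even:
  assumes l: "l > 0" and \<sigma>: "0 < \<sigma>" "\<sigma> < 1 / 2" and p: "p \<in> weights l \<alpha> \<beta>" and u: "u \<in> H2_even l"
    and weak: "\<And>v. v \<in> H2_even l \<Longrightarrow> H2_inner l \<sigma> u v = ev * (\<integral>z. p z * u z * v z \<partial>plate l)"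
  shows "weak_solution l \<sigma> p ev u"
  unfolding weak_solution_def
proof
  fix v assume v: "v \<in> H2_star l"
  interpret A: psd_form "H2_space (Omega l)" "H2_inner l \<sigma>" using l \<sigma> by (rule H2_inner_form)
  have us: "u \<in> H2_star l" and ue: "AE z in plate l. mirrored u z = u z" using u by (auto simp: H2_even_iff)
  note uH = H2_star_H2_space[OF us] and vH = H2_star_H2_space[OF v]
  have mv: "mirrored v \<in> H2_star l" using l v by (rule H2_star_mirror)
  note mvH = H2_star_H2_space[OF mv]
  have um: "u \<in> borel_measurable (plate l)" and vm: "v \<in> borel_measurable (plate l)"
    using H2_space_l2[OF uH] H2_space_l2[OF vH] by (auto simp: l2_def)
  note mum = measurable_mirror[OF um] and mvm = measurable_mirror[OF vm]
  define w where "w = (1 / 2) *\<^sub>R (v + mirrored v)"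
  have "w \<in> H2_star l"
    unfolding w_def using H2_star_subspace[OF l] v mv by (intro subspace_scale subspace_add)
  then have w: "w \<in> H2_even l" by (simp add: H2_even_iff w_def add.commute)
  have pm: "p \<in> borel_measurable (plate l)" and pe: "AE z in plate l. p z = mirrored p z"
    and pb: "AE z in plate l. \<alpha> \<le> p z \<and> p z \<le> \<beta>" using p by (auto simp: weights_def mirror_def)
  have pu: "(\<lambda>z. p z * u z) \<in> l2 (plate l)"
  proof (rule l2_bounded_mult[OF H2_space_l2[OF uH] pm])
    show "AE z in plate l. \<bar>p z\<bar> \<le> max \<bar>\<alpha>\<bar> \<bar>\<beta>\<bar>" using pb by eventually_elim auto
  qed
  have "H2_inner l \<sigma> u (mirrored v) = H2_inner l \<sigma> (mirrored u) (mirrored v)"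
    using H2_inner_cong_AE(1)[OF l mum um ue] by simp
  also have "\<dots> = H2_inner l \<sigma> u v" using l uH vH by (rule H2_inner_mirror)
  finally have "H2_inner l \<sigma> u w = H2_inner l \<sigma> u v"
    using uH vH mvH by (simp add: w_def A.scale_right A.add_right)
  moreover have "(\<integral>z. p z * u z * w z \<partial>plate l) = (\<integral>z. p z * u z * v z \<partial>plate l)"
  proof -
    have "ip (plate l) (\<lambda>z. p z * u z) (mirrored v) = ip (plate l) (mirrored (\<lambda>z. p z * u z)) (mirrored v)"
    proof (rule ip_cong_AE)
      show "AE z in plate l. p z * u z = mirrored (\<lambda>z. p z * u z) z"
        using ue pe by eventually_elim simp
    qed (use pu measurable_mirror[of "\<lambda>z. p z * u z" l] mvm in \<open>auto simp: l2_def\<close>)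
    also have "\<dots> = ip (plate l) (\<lambda>z. p z * u z) v" using pu H2_space_l2[OF vH] by (rule ip_mirror)
    finally have "ip (plate l) (\<lambda>z. p z * u z) w = ip (plate l) (\<lambda>z. p z * u z) v"
      using pu H2_space_l2[OF vH] H2_space_l2[OF mvH] by (simp add: w_def l2.scale_right l2.add_right)
    then show ?thesis by (simp add: ip_def)
  qed
  ultimately show "H2_inner l \<sigma> u v = ev * (\<integral>z. p z * u z * v z \<partial>plate l)"
    using weak[OF w] by simp
qed

section \<open>Sine functions\<close>

lemma test_function_integrable:
  assumes l: "l > 0" and f: "f \<in> test_functions (Omega l)" and W: "continuous_on UNIV W"
  shows "integrable lborel (\<lambda>z. W (fst z) * f z)" "(\<integral>z. W (fst z) * f z \<partial>plate l) = (\<integral>z. W (fst z) * f z \<partial>lborel)"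
proof -
  interpret finite_measure "plate l" using l by (intro finite_measure_plate) simp
  have cont: "continuous_on UNIV (\<lambda>z. W (fst z) * f z)"
    by (intro continuous_on_mult continuous_on_compose2[OF W] continuous_on_fst continuous_on_id
        smooth2_continuous test_function_smooth2[OF f]) auto
  then have m: "(\<lambda>z. W (fst z) * f z) \<in> borel_measurable borel" by (rule borel_measurable_continuous_onI)
  have eq: "indicator (Omega l) z * (W (fst z) * f z) = W (fst z) * f z" for z
    using test_function_zero[OF f, of z] by (auto simp: indicator_def)
  show "integrable lborel (\<lambda>z. W (fst z) * f z)"
    using l2_integrable(1)[OF continuous_l2_plate[OF _ cont]] l unfolding integrable_plate[OF m] eq by simp
  show "(\<integral>z. W (fst z) * f z \<partial>plate l) = (\<integral>z. W (fst z) * f z \<partial>lborel)"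
    unfolding integral_plate[OF m] eq ..
qed

lemma integral_derivative_zero:
  fixes F F' :: "real \<Rightarrow> real"
  assumes "a \<le> b" and F: "\<And>x. (F has_real_derivative F' x) (at x)" and c: "continuous_on UNIV F'"
    and ends: "F a = 0" "F b = 0" and out: "\<And>x. x \<notin> {a..b} \<Longrightarrow> F' x = 0"
  shows "(\<integral>x. F' x \<partial>lborel) = 0"
proof -
  have "(\<integral>x. indicator {a..b} x *\<^sub>R F' x \<partial>lborel) = F b - F a"
  proof (rule integral_FTC_Icc[OF \<open>a \<le> b\<close>])
    show "(F has_vector_derivative F' x) (at x within {a..b})" for x
      using F[of x] by (meson has_field_derivative_at_within has_real_derivative_iff_has_vector_derivative)
  qed (rule continuous_on_subset[OF c], simp)
  moreover have "(\<lambda>x. indicator {a..b} x *\<^sub>R F' x) = F'"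
  proof
    fix x show "indicator {a..b} x *\<^sub>R F' x = F' x" using out[of x] by (cases "x \<in> {a..b}") auto
  qed
  ultimately show ?thesis using ends by (simp only: diff_self)
qed

lemma integrate_by_parts_x:
  assumes l: "l > 0" and f: "f \<in> test_functions (Omega l)"
    and W: "\<And>x. (W has_real_derivative W' x) (at x)" and W': "continuous_on UNIV W'"
  shows "(\<integral>z. W (fst z) * ddx f z \<partial>plate l) = - (\<integral>z. W' (fst z) * f z \<partial>plate l)"
proof -
  have Wc: "continuous_on UNIV W" using W by (meson DERIV_continuous_on has_field_derivative_at_within)
  note df = test_function_derivative(1)[OF f] and sf = test_function_smooth2[OF f]
  note i1 = test_function_integrable[OF l df Wc] and i2 = test_function_integrable[OF l f W']
  have i: "integrable lborel (\<lambda>z. W (fst z) * ddx f z + W' (fst z) * f z)" using i1 i2 by simp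
  have "(\<integral>x. W x * ddx f (x, y) + W' x * f (x, y) \<partial>lborel) = 0" for y
  proof (rule integral_derivative_zero[of 0 pi "\<lambda>x. W x * f (x, y)"])
    show "((\<lambda>x. W x * f (x, y)) has_real_derivative W x * ddx f (x, y) + W' x * f (x, y)) (at x)" for x
      using DERIV_mult[OF W has_derivative_ddx[OF sf, of y x]] by (simp add: add.commute mult.commute)
    show "continuous_on UNIV (\<lambda>x. W x * ddx f (x, y) + W' x * f (x, y))"
      by (intro continuous_intros Wc W' continuous_on_compose2[OF smooth2_continuous[OF smooth2_ddx[OF sf]]]
          continuous_on_compose2[OF smooth2_continuous[OF sf]]) auto
    show "W 0 * f (0, y) = 0" "W pi * f (pi, y) = 0"
      using test_function_zero[OF f] by (simp_all add: Omega_def)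
    show "W x * ddx f (x, y) + W' x * f (x, y) = 0" if "x \<notin> {0..pi}" for x
      using test_function_zero[OF f, of "(x, y)"] test_function_zero[OF df, of "(x, y)"] that by (auto simp: Omega_def)
  qed simp
  then have "(\<integral>z. W (fst z) * ddx f z + W' (fst z) * f z \<partial>lborel) = 0"
    using planar_Fubini(2)[OF i] by simp
  then show ?thesis using i1 i2 by simp
qed

lemma integrate_ddy:
  assumes l: "l > 0" and f: "f \<in> test_functions (Omega l)" and W: "continuous_on UNIV W"
  shows "(\<integral>z. W (fst z) * ddy f z \<partial>plate l) = 0"
proof -
  note df = test_function_derivative(2)[OF f] and sf = test_function_smooth2[OF f]
  note i = test_function_integrable[OF l df W]
  have "(\<integral>y. ddy f (x, y) \<partial>lborel) = 0" for x
  proof (rule integral_derivative_zero[of "-l" l "\<lambda>y. f (x, y)"])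
    show "((\<lambda>y. f (x, y)) has_real_derivative ddy f (x, y)) (at y)" for y
      using sf by (rule has_derivative_ddy)
    show "continuous_on UNIV (\<lambda>y. ddy f (x, y))"
      by (intro continuous_intros continuous_on_compose2[OF smooth2_continuous[OF smooth2_ddy[OF sf]]]) auto
    show "f (x, -l) = 0" "f (x, l) = 0" using test_function_zero[OF f] by (simp_all add: Omega_def)
    show "ddy f (x, y) = 0" if "y \<notin> {-l..l}" for y
      using test_function_zero[OF df, of "(x, y)"] that by (auto simp: Omega_def)
  qed (use l in simp)
  then show ?thesis using planar_Fubini(1)[OF i(1)] i(2) by simp
qed

text \<open>Constant in y, so all y-derivatives vanish and the energy on the span is diagonal with
  entries proportional to m^4. The natural conditions at the long sides fail for m >= 1; these are
  trial functions.\<close>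

definition sine :: "nat \<Rightarrow> real \<times> real \<Rightarrow> real" where
  "sine m = (\<lambda>z. sin (real m * fst z))"

lemma sine_continuous: "continuous_on UNIV (sine m)"
  unfolding sine_def by (intro continuous_intros)

lemma sine_l2: "l > 0 \<Longrightarrow> sine m \<in> l2 (plate l)"
  using sine_continuous by (intro continuous_l2_plate) simp_all

lemma sine_weak_derivs:
  assumes l: "l > 0"
  shows "is_L2_weak_deriv (Omega l) 0 0 (sine m) (sine m)"
    "is_L2_weak_deriv (Omega l) 1 0 (sine m) (\<lambda>z. real m * cos (real m * fst z))"
    "is_L2_weak_deriv (Omega l) 2 0 (sine m) (\<lambda>z. - (real m)\<^sup>2 * sine m z)"
    "is_L2_weak_deriv (Omega l) 0 1 (sine m) (\<lambda>z. 0)"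
    "is_L2_weak_deriv (Omega l) 1 1 (sine m) (\<lambda>z. 0)"
    "is_L2_weak_deriv (Omega l) 0 2 (sine m) (\<lambda>z. 0)"
proof -
  let ?s = "\<lambda>x. sin (real m * x)" and ?c = "\<lambda>x. real m * cos (real m * x)" and ?s' = "\<lambda>x. - (real m)\<^sup>2 * sin (real m * x)"
  have l0: "(\<lambda>z. 0) \<in> l2 (plate l)" by (simp add: l2_def)
  have sl: "(\<lambda>z. - (real m)\<^sup>2 * sine m z) \<in> l2 (plate l)"
    using l by (intro continuous_l2_plate continuous_intros sine_continuous) auto
  have cl: "(\<lambda>z. real m * cos (real m * fst z)) \<in> l2 (plate l)"
    using l by (intro continuous_l2_plate continuous_intros) auto
  have s: "(?s has_real_derivative ?c x) (at x)" "(?c has_real_derivative ?s' x) (at x)" for x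
    by (auto intro!: derivative_eq_intros simp: power2_eq_square)
  have cont: "continuous_on UNIV ?s" "continuous_on UNIV ?c" "continuous_on UNIV ?s'" by (auto intro!: continuous_intros)
  note d1 = test_function_derivative(1) and d2 = test_function_derivative(2)
  show "is_L2_weak_deriv (Omega l) 0 0 (sine m) (sine m)"
    using sine_l2[OF l] by (simp add: is_L2_weak_deriv_def L2_space_eq_l2)
  show "is_L2_weak_deriv (Omega l) 1 0 (sine m) (\<lambda>z. real m * cos (real m * fst z))"
    using cl integrate_by_parts_x[OF l _ s(1) cont(2)] by (simp add: is_L2_weak_deriv_def L2_space_eq_l2 sine_def)
  show "is_L2_weak_deriv (Omega l) 2 0 (sine m) (\<lambda>z. - (real m)\<^sup>2 * sine m z)"
    using sl integrate_by_parts_x[OF l d1 s(1) cont(2)] integrate_by_parts_x[OF l _ s(2) cont(3)]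
    by (simp add: is_L2_weak_deriv_def L2_space_eq_l2 sine_def numeral_2_eq_2 mult.assoc)
  show "is_L2_weak_deriv (Omega l) 0 1 (sine m) (\<lambda>z. 0)"
    using l0 integrate_ddy[OF l _ cont(1)] by (simp add: is_L2_weak_deriv_def L2_space_eq_l2 sine_def)
  show "is_L2_weak_deriv (Omega l) 1 1 (sine m) (\<lambda>z. 0)"
    using l0 integrate_by_parts_x[OF l d2 s(1) cont(2)] integrate_ddy[OF l _ cont(2)]
    by (simp add: is_L2_weak_deriv_def L2_space_eq_l2 sine_def)
  show "is_L2_weak_deriv (Omega l) 0 2 (sine m) (\<lambda>z. 0)"
    using l0 integrate_ddy[OF l d2 cont(1)] by (simp add: is_L2_weak_deriv_def L2_space_eq_l2 sine_def numeral_2_eq_2)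
qed

lemma sine_H2_space: "l > 0 \<Longrightarrow> sine m \<in> H2_space (Omega l)"
  unfolding H2_space_def L2_space_eq_l2
proof (intro CollectI conjI allI impI sine_l2)
  fix i k :: nat assume l: "l > 0" and "i + k \<le> 2"
  then consider "i = 0" "k = 0" | "i = 1" "k = 0" | "i = 0" "k = 1" | "i = 2" "k = 0" | "i = 1" "k = 1" | "i = 0" "k = 2"
    by fastforce
  then show "\<exists>g. is_L2_weak_deriv (Omega l) i k (sine m) g"
    using sine_weak_derivs[OF l, of m] by cases blast+
qed

lemma sine_H2_even: "l > 0 \<Longrightarrow> sine m \<in> H2_even l"
proof -
  assume l: "l > 0"
  have "rep_on_plate l (sine m) (sine m)"
    using sine_continuous by (simp add: rep_on_plate_def sine_def sin_npi)
  then have "sine m \<in> H2_star l" using sine_H2_space[OF l] by (rule H2_starI[rotated])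
  then show ?thesis by (simp add: H2_even_iff sine_def mirror_def)
qed

lemma integral_sin_sin:
  assumes "m \<ge> 1" "k \<ge> 1"
  shows "(\<integral>x. indicator {0..pi} x *\<^sub>R (sin (real m * x) * sin (real k * x)) \<partial>lborel) = (if m = k then pi / 2 else 0)"
proof -
  define F where "F x = (if m = k then x / 2 - sin (2 * real m * x) / (4 * real m)
      else (sin ((real m - real k) * x) / (real m - real k) - sin ((real m + real k) * x) / (real m + real k)) / 2)" for x
  have m: "real m \<noteq> 0" "real m + real k \<noteq> 0" using assms by auto
  have "(\<integral>x. indicator {0..pi} x *\<^sub>R (sin (real m * x) * sin (real k * x)) \<partial>lborel) = F pi - F 0"
  proof (rule integral_FTC_Icc)
    fix x
    have "(F has_real_derivative sin (real m * x) * sin (real k * x)) (at x)"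
    proof (cases "m = k")
      case True
      have "((\<lambda>x. x / 2 - sin (2 * real m * x) / (4 * real m)) has_real_derivative (1 - cos (2 * (real m * x))) / 2) (at x)"
        using m by (auto intro!: derivative_eq_intros simp: field_simps)
      then show ?thesis using True by (simp add: F_def[abs_def] cos_double_sin power2_eq_square)
    next
      case False
      have "((\<lambda>x. (sin ((real m - real k) * x) / (real m - real k) - sin ((real m + real k) * x) / (real m + real k)) / 2)
         has_real_derivative (cos ((real m - real k) * x) - cos ((real m + real k) * x)) / 2) (at x)"
        using m False by (auto intro!: derivative_eq_intros)
      moreover have "(cos ((real m - real k) * x) - cos ((real m + real k) * x)) / 2 = sin (real m * x) * sin (real k * x)"
        by (simp add: left_diff_distrib distrib_right cos_add cos_diff)
      ultimately show ?thesis using False by (simp add: F_def[abs_def])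
    qed
    then show "(F has_vector_derivative sin (real m * x) * sin (real k * x)) (at x within {0..pi})"
      by (meson has_field_derivative_at_within has_real_derivative_iff_has_vector_derivative)
  qed (auto intro!: continuous_intros)
  moreover have "sin (2 * real m * pi) = 0" "sin ((real m + real k) * pi) = 0" "sin ((real m - real k) * pi) = 0"
  proof -
    show "sin (2 * real m * pi) = 0" "sin ((real m + real k) * pi) = 0"
      using sin_npi[of "2 * m"] sin_npi[of "m + k"] by (simp_all add: mult.commute)
    have "sin ((real m - real k) * pi) = sin (real m * pi) * cos (real k * pi) - cos (real m * pi) * sin (real k * pi)"
      by (simp add: left_diff_distrib sin_diff)
    then show "sin ((real m - real k) * pi) = 0" by (simp add: sin_npi)
  qed
  ultimately show ?thesis by (simp add: F_def)
qed

lemma ip_sine: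
  assumes l: "l > 0" and mk: "m \<ge> 1" "k \<ge> 1"
  shows "ip (plate l) (sine m) (sine k) = (if m = k then pi * l else 0)"
proof -
  let ?f = "\<lambda>x. indicator {0..pi} x *\<^sub>R (sin (real m * x) * sin (real k * x)) :: real" and ?g = "indicator {-l..l} :: real \<Rightarrow> real"
  have f: "integrable lborel ?f" by (rule borel_integrable_compact) (auto intro!: continuous_intros)
  have g: "integrable lborel ?g" by (rule integrable_real_indicator) (use l in auto)
  have sm: "(\<lambda>z. sine m z * sine k z) \<in> borel_measurable borel"
    by (intro borel_measurable_times borel_measurable_continuous_onI sine_continuous)
  have "ip (plate l) (sine m) (sine k) = (\<integral>z. indicator (Omega l) z * (sine m z * sine k z) \<partial>lborel)"
    unfolding ip_def using sm by (rule integral_plate)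
  also have "\<dots> = (\<integral>z. ?f (fst z) * ?g (snd z) \<partial>lborel)"
  proof (rule integral_cong_AE)
    \<comment> \<open>The open plate and the product of closed intervals differ only on four
      lines.\<close>
    have x: "AE z in (lborel :: (real \<times> real) measure). fst z \<noteq> 0 \<and> fst z \<noteq> pi"
      using AE_swap[OF AE_planar_snd[of "\<lambda>x. x \<noteq> 0 \<and> x \<noteq> pi"]] AE_lborel_singleton[of "0 :: real"] AE_lborel_singleton[of pi]
      by (auto simp: AE_conj_iff)
    have y: "AE z in (lborel :: (real \<times> real) measure). snd z \<noteq> l \<and> snd z \<noteq> - l"
      using AE_planar_snd[of "\<lambda>x. x \<noteq> l \<and> x \<noteq> - l"] AE_lborel_singleton[of l] AE_lborel_singleton[of "- l"]
      by (auto simp: AE_conj_iff)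
    show "AE z in lborel. indicator (Omega l) z * (sine m z * sine k z) = ?f (fst z) * ?g (snd z)"
      using x y by eventually_elim (auto simp: indicator_def Omega_def sine_def)
    show "(\<lambda>z. indicator (Omega l) z * (sine m z * sine k z)) \<in> borel_measurable lborel"
      using sm by simp
    show "(\<lambda>z. ?f (fst z) * ?g (snd z)) \<in> borel_measurable lborel"
      using integrable_product[OF f g] by simp
  qed
  also have "\<dots> = (\<integral>x. ?f x \<partial>lborel) * (\<integral>y. ?g y \<partial>lborel)" using f g by (rule integral_product)
  also have "\<dots> = (if m = k then pi * l else 0)" using integral_sin_sin[OF mk] l by simp
  finally show ?thesis .
qed

lemma H2_inner_sine:
  assumes l: "l > 0"
  shows "H2_inner l \<sigma> (sine m) (sine k) = (real m)\<^sup>2 * (real k)\<^sup>2 * ip (plate l) (sine m) (sine k)"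
proof -
  have S: "sine i \<in> H2_space (Omega l)" "sine i \<in> l2 (plate l)" for i using l sine_H2_space sine_l2 by auto
  have ae: "AE z in plate l. wd l 2 0 (sine i) z = - (real i)\<^sup>2 * sine i z"
    "AE z in plate l. wd l 1 1 (sine i) z = 0"
    "AE z in plate l. wd l 0 2 (sine i) z = 0" for i
    using sine_weak_derivs[OF l, of i] by (auto intro!: wd_unique[OF l S(1)])
  have m: "wd l 2 0 (sine i) \<in> borel_measurable (plate l)" "wd l 1 1 (sine i) \<in> borel_measurable (plate l)"
    "wd l 0 2 (sine i) \<in> borel_measurable (plate l)" "(\<lambda>z. - (real i)\<^sup>2 * sine i z) \<in> borel_measurable (plate l)"
    "(\<lambda>z. 0) \<in> borel_measurable (plate l)" for i
    using wd_l2[OF S(1)[of i], of 2 0] wd_l2[OF S(1)[of i], of 1 1] wd_l2[OF S(1)[of i], of 0 2] S(2)[of i]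
    by (auto simp: l2_def)
  let ?D = "\<lambda>i z. - (real i)\<^sup>2 * sine i z"
  have "ip (plate l) (wd l 2 0 (sine m)) (wd l 2 0 (sine k)) = ip (plate l) (?D m) (?D k)"
    by (intro ip_cong_AE m ae)
  also have "\<dots> = (\<integral>z. ((real m)\<^sup>2 * (real k)\<^sup>2) * (sine m z * sine k z) \<partial>plate l)"
    unfolding ip_def by (intro Bochner_Integration.integral_cong) auto
  also have "\<dots> = (real m)\<^sup>2 * (real k)\<^sup>2 * ip (plate l) (sine m) (sine k)" by (simp add: ip_def)
  finally have "ip (plate l) (wd l 2 0 (sine m)) (wd l 2 0 (sine k)) = (real m)\<^sup>2 * (real k)\<^sup>2 * ip (plate l) (sine m) (sine k)" .
  moreover have "ip (plate l) (wd l 0 2 (sine m)) (wd l 0 2 (sine k)) = ip (plate l) (\<lambda>z. 0) (\<lambda>z. 0)"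
    by (intro ip_cong_AE m ae)
  moreover have "ip (plate l) (wd l 2 0 (sine m)) (wd l 0 2 (sine k)) = ip (plate l) (?D m) (\<lambda>z. 0)"
    by (intro ip_cong_AE m ae)
  moreover have "ip (plate l) (wd l 0 2 (sine m)) (wd l 2 0 (sine k)) = ip (plate l) (\<lambda>z. 0) (?D k)"
    by (intro ip_cong_AE m ae)
  moreover have "ip (plate l) (wd l 1 1 (sine m)) (wd l 1 1 (sine k)) = ip (plate l) (\<lambda>z. 0) (\<lambda>z. 0)"
    by (intro ip_cong_AE m ae)
  moreover have "ip (plate l) (\<lambda>z. 0) f = 0" "ip (plate l) f (\<lambda>z. 0) = 0" for f by (simp_all add: ip_def)
  ultimately show ?thesis
    unfolding H2_inner_eq[OF S(1) S(1)] by simp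
qed

section \<open>Longitudinal eigenvalues of a weight\<close>

text \<open>Expanding n + 1 independent functions in a basis of n elements gives n equations for n +
  1 coefficients, hence a forbidden vanishing combination. Without this the multiplicities in the
  definition of \<open>mu\<close> would not determine anything.\<close>

lemma dimension_ae_unique:
  assumes "has_dimension_ae D E n" "has_dimension_ae D E m"
  shows "n = m"
proof -
  have le: "m \<le> n" if n: "has_dimension_ae D E n" and m: "has_dimension_ae D E m" for n m
  proof (rule ccontr)
    assume "\<not> m \<le> n"
    then have nm: "n < m" by simp
    obtain b where b: "\<And>u. u \<in> E \<Longrightarrow> \<exists>c :: nat \<Rightarrow> real. AE z in lebesgue_on D. u z = (\<Sum>i<n. c i * b i z)"
      using n unfolding has_dimension_ae_def by blast
    obtain b' where b': "\<And>i. i < m \<Longrightarrow> b' i \<in> E"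
      "\<And>c :: nat \<Rightarrow> real. (AE z in lebesgue_on D. (\<Sum>i<m. c i * b' i z) = 0) \<Longrightarrow> \<forall>i<m. c i = 0"
      using m unfolding has_dimension_ae_def by blast
    have "\<exists>c :: nat \<Rightarrow> real. AE z in lebesgue_on D. b' i z = (\<Sum>k<n. c k * b k z)" if "i < m" for i
      using b b'(1) that by blast
    then obtain M :: "nat \<Rightarrow> nat \<Rightarrow> real" where M: "\<And>i. i < m \<Longrightarrow> AE z in lebesgue_on D. b' i z = (\<Sum>k<n. M i k * b k z)"
      by metis
    obtain c where c: "\<exists>i\<le>n. c i \<noteq> 0" "\<forall>k<n. (\<Sum>i\<le>n. c i * M i k) = 0"
      using underdetermined_system[of n "\<lambda>k i. M i k"] by blast
    \<comment> \<open>The coefficients of the first n + 1 functions, padded by zeros to all m of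
      them.\<close>
    define d where "d i = (if i \<le> n then c i else 0)" for i
    have "AE z in lebesgue_on D. \<forall>i\<in>{..n}. b' i z = (\<Sum>k<n. M i k * b k z)"
      using M nm by (intro AE_finite_allI) auto
    then have "AE z in lebesgue_on D. (\<Sum>i<m. d i * b' i z) = 0"
    proof eventually_elim
      case (elim z)
      have "(\<Sum>i<m. d i * b' i z) = (\<Sum>i\<le>n. c i * b' i z)"
        using nm by (intro sum.mono_neutral_cong_right) (auto simp: d_def)
      also have "\<dots> = (\<Sum>i\<le>n. \<Sum>k<n. c i * M i k * b k z)"
        using elim by (intro sum.cong) (auto simp: sum_distrib_left mult.assoc)
      also have "\<dots> = (\<Sum>k<n. (\<Sum>i\<le>n. c i * M i k) * b k z)"
        by (subst sum.swap) (simp add: sum_distrib_right)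
      also have "\<dots> = 0" using c(2) by simp
      finally show ?case .
    qed
    then have d0: "\<forall>i<m. d i = 0" by (rule b'(2))
    obtain i where "i \<le> n" "c i \<noteq> 0" using c(1) by blast
    then show False using d0[rule_format, of i] nm by (simp add: d_def)
  qed
  show ?thesis using le assms by (meson antisym)
qed

text \<open>Let k be the first index where the sequences differ, with the smaller value t in one of
  them. In the other one t occurs only before k, where both agree, whereas the first takes it at k
  once more; the multiplicities would differ.\<close>

lemma mono_sequence_eq_if_multiplicities_eq:
  fixes \<nu> \<nu>' :: "nat \<Rightarrow> real"
  assumes mono: "mono_on {1..} \<nu>" "mono_on {1..} \<nu>'"
    and fin: "\<And>t. finite {k \<in> {1..}. \<nu> k = t}" "\<And>t. finite {k \<in> {1..}. \<nu>' k = t}"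
    and card: "\<And>t. card {k \<in> {1..}. \<nu> k = t} = card {k \<in> {1..}. \<nu>' k = t}"
  shows "k \<ge> 1 \<Longrightarrow> \<nu> k = \<nu>' k"
proof (induction k rule: less_induct)
  case (less k)
  have *: False
    if m: "mono_on {1..} g'" and f: "finite {k \<in> {1..}. g k = g k0}" and c: "card {k \<in> {1..}. g k = g k0} = card {k \<in> {1..}. g' k = g k0}"
      and eq: "\<And>i. i < k0 \<Longrightarrow> i \<ge> 1 \<Longrightarrow> g i = g' i" and lt: "g k0 < g' k0" and k0: "k0 \<ge> 1"
    for g g' :: "nat \<Rightarrow> real" and k0
  proof -
    have "{i \<in> {1..}. g' i = g k0} \<subset> {i \<in> {1..}. g i = g k0}"
    proof
      show "{i \<in> {1..}. g' i = g k0} \<subseteq> {i \<in> {1..}. g i = g k0}"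
      proof
        fix i assume i: "i \<in> {i \<in> {1..}. g' i = g k0}"
        have "i < k0"
        proof (rule ccontr)
          assume "\<not> i < k0"
          then have "g' k0 \<le> g' i" using mono_onD[OF m, of k0 i] k0 i by auto
          then show False using i lt by simp
        qed
        then show "i \<in> {i \<in> {1..}. g i = g k0}" using eq[of i] i by auto
      qed
      have "k0 \<in> {i \<in> {1..}. g i = g k0}" "k0 \<notin> {i \<in> {1..}. g' i = g k0}" using lt k0 by auto
      then show "{i \<in> {1..}. g' i = g k0} \<noteq> {i \<in> {1..}. g i = g k0}" by blast
    qed
    from psubset_card_mono[OF f this] c show False by simp
  qed
  show ?case
  proof (cases "\<nu> k" "\<nu>' k" rule: linorder_cases)
    case less': less
    then show ?thesis using *[OF mono(2) fin(1) card _ less'] less by blast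
  next
    case greater
    then show ?thesis using *[OF mono(1) fin(2) card[symmetric] _ greater] less by metis
  qed simp
qed

section \<open>Spectral theory for a fixed weight\<close>

locale weighted_plate =
  fixes l \<sigma> \<alpha> \<beta> :: real and p :: "real \<times> real \<Rightarrow> real"
  assumes l: "l > 0" and \<sigma>: "0 < \<sigma>" "\<sigma> < 1 / 2" and \<alpha>: "0 < \<alpha>" and p: "p \<in> weights l \<alpha> \<beta>"
begin

definition b :: "(real \<times> real \<Rightarrow> real) \<Rightarrow> (real \<times> real \<Rightarrow> real) \<Rightarrow> real" where
  "b u v = (\<integral>z. p z * u z * v z \<partial>plate l)"

lemma p_measurable: "p \<in> borel_measurable (plate l)"
  and p_bounds: "AE z in plate l. \<alpha> \<le> p z \<and> p z \<le> \<beta>"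
  and p_integral: "(\<integral>z. p z \<partial>plate l) = measure lebesgue (Omega l)"
  using p by (auto simp: weights_def)

lemma pu_l2: "u \<in> l2 (plate l) \<Longrightarrow> (\<lambda>z. p z * u z) \<in> l2 (plate l)"
proof (rule l2_bounded_mult)
  show "AE z in plate l. \<bar>p z\<bar> \<le> \<beta>" using p_bounds by eventually_elim (use \<alpha> in auto)
qed (use p_measurable in auto)

lemma b_ip: "b u v = ip (plate l) (\<lambda>z. p z * u z) v"
  by (simp add: b_def ip_def)

lemma b_lower_upper:
  assumes u: "u \<in> l2 (plate l)"
  shows "\<alpha> * ip (plate l) u u \<le> b u u" "b u u \<le> \<beta> * ip (plate l) u u"
proof -
  have i: "integrable (plate l) (\<lambda>z. u z * u z)" "integrable (plate l) (\<lambda>z. p z * u z * u z)"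
    using l2_mult[OF u u] l2_mult[OF pu_l2[OF u] u] by auto
  have "(\<integral>z. \<alpha> * (u z * u z) \<partial>plate l) \<le> b u u"
    unfolding b_def
  proof (rule integral_mono_AE)
    show "AE z in plate l. \<alpha> * (u z * u z) \<le> p z * u z * u z"
      using p_bounds by eventually_elim (simp add: mult_right_mono mult.assoc)
  qed (use i in auto)
  then show "\<alpha> * ip (plate l) u u \<le> b u u" by (simp add: ip_def)
  have "b u u \<le> (\<integral>z. \<beta> * (u z * u z) \<partial>plate l)"
    unfolding b_def
  proof (rule integral_mono_AE)
    show "AE z in plate l. p z * u z * u z \<le> \<beta> * (u z * u z)"
      using p_bounds by eventually_elim (simp add: mult_right_mono mult.assoc)
  qed (use i in auto)
  then show "b u u \<le> \<beta> * ip (plate l) u u" by (simp add: ip_def)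
qed

lemma \<beta>_pos: "\<beta> > 0"
proof (rule ccontr)
  assume "\<not> \<beta> > 0"
  then have neg: "\<not> (\<alpha> \<le> p z \<and> p z \<le> \<beta>)" for z using \<alpha> by auto
  have "AE z in plate l. False" by (rule eventually_mono[OF p_bounds]) (use neg in blast)
  then have "(\<integral>z. 1 \<partial>plate l) = (\<integral>z. 0 \<partial>plate l :: real)"
    by (intro integral_cong_AE) (auto elim!: eventually_mono)
  then have "measure (plate l) (Omega l) = 0" by simp
  then show False using l by (simp add: measure_plate)
qed

lemma even_l2: "u \<in> H2_even l \<Longrightarrow> u \<in> l2 (plate l)"
  and even_H2: "u \<in> H2_even l \<Longrightarrow> u \<in> H2_space (Omega l)"
  and even_star: "u \<in> H2_even l \<Longrightarrow> u \<in> H2_star l"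
  by (auto simp: H2_even_iff intro: H2_space_l2 H2_star_H2_space)

lemma b_null_iff:
  assumes u: "u \<in> l2 (plate l)"
  shows "b u u = 0 \<longleftrightarrow> (AE z in plate l. u z = 0)"
proof -
  have "b u u = 0 \<longleftrightarrow> ip (plate l) u u = 0"
  proof
    assume "b u u = 0"
    then have "\<not> ip (plate l) u u > 0" using b_lower_upper(1)[OF u] mult_pos_pos[OF \<alpha>, of "ip (plate l) u u"] by auto
    then show "ip (plate l) u u = 0" using l2.nonneg[OF u] by auto
  next
    assume "ip (plate l) u u = 0"
    then show "b u u = 0" using b_lower_upper[OF u] by simp
  qed
  then show ?thesis using ip_self_eq_0_iff[OF u] by simp
qed

sublocale B: psd_form "l2 (plate l)" b
proof
  fix u v w :: "real \<times> real \<Rightarrow> real" and c :: real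
  assume u: "u \<in> l2 (plate l)" and w: "w \<in> l2 (plate l)"
  show "0 \<le> b u u" using order_trans[OF mult_nonneg_nonneg[OF less_imp_le[OF \<alpha>] l2.nonneg[OF u]] b_lower_upper(1)[OF u]] .
  show "b u w = b w u" unfolding b_def by (rule Bochner_Integration.integral_cong) auto
  show "b (c *\<^sub>R u) w = c * b u w"
    unfolding b_def by (subst integral_mult_right_zero[symmetric]) (simp add: mult_ac)
  assume v: "v \<in> l2 (plate l)"
  show "b (u + v) w = b u w + b v w"
    using l2_mult[OF pu_l2[OF u] w] l2_mult[OF pu_l2[OF v] w]
    by (simp add: b_def distrib_left distrib_right)
qed (rule l2_subspace)

lemma even_complete:
  assumes u: "\<And>n. u n \<in> H2_even l"
    and cauchy: "\<forall>\<epsilon>>0. \<exists>N. \<forall>m\<ge>N. \<forall>n\<ge>N. H2_inner l \<sigma> (u m - u n) (u m - u n) < \<epsilon>"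
  shows "\<exists>U\<in>H2_even l. (\<lambda>n. H2_inner l \<sigma> (u n - U) (u n - U)) \<longlonglongrightarrow> 0"
proof -
  obtain U where U: "U \<in> H2_star l" and lim: "(\<lambda>n. H2_inner l \<sigma> (u n - U) (u n - U)) \<longlonglongrightarrow> 0"
    using H2_star_complete[OF l \<sigma> even_star[OF u] cauchy] by blast
  obtain C where C: "\<And>w. w \<in> H2_star l \<Longrightarrow> ip (plate l) w w \<le> C * H2_inner l \<sigma> w w"
    using H2_star_bounds[OF l \<sigma>] by blast
  have d: "u n - U \<in> H2_star l" for n using H2_star_subspace[OF l] even_star[OF u] U by (rule subspace_diff)
  have Ul: "U \<in> l2 (plate l)" and ul: "u n \<in> l2 (plate l)" for n
    using U even_l2[OF u] H2_space_l2 H2_star_H2_space by auto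
  have lim2: "(\<lambda>n. ip (plate l) (u n - U) (u n - U)) \<longlonglongrightarrow> 0"
  proof (rule tendsto_sandwich[OF _ _ tendsto_const])
    show "(\<lambda>n. C * H2_inner l \<sigma> (u n - U) (u n - U)) \<longlonglongrightarrow> 0" using lim by (rule tendsto_mult_right_zero)
  qed (use C[OF d] l2.nonneg[OF l2.mem(3)[OF ul Ul]] in auto)
  let ?M = "mirrored U - U"
  have Ml: "mirrored U - U \<in> l2 (plate l)" using Ul l2_mirror[OF Ul] by auto
  have "ip (plate l) ?M ?M \<le> 4 * ip (plate l) (u n - U) (u n - U)" for n
  proof -
    let ?d = "u n - U"
    have dl: "?d \<in> l2 (plate l)" using ul Ul by auto
    \<comment> \<open>As \<open>u n\<close> is even, the defect of U from evenness is
      \<open>?d\<close> minus its reflection, whose squared norm is at most 4 times that of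
      \<open>?d\<close> and tends to 0.\<close>
    have "AE z in plate l. ?M z = (?d + (-1) *\<^sub>R mirrored ?d) z"
    proof -
      have "AE z in plate l. mirrored (u n) z = u n z" using u by (simp add: H2_even_iff)
      then show ?thesis by eventually_elim simp
    qed
    then have "ip (plate l) ?M ?M = ip (plate l) (?d + (-1) *\<^sub>R mirrored ?d) (?d + (-1) *\<^sub>R mirrored ?d)"
      using Ml l2_add[OF dl l2_scale[OF l2_mirror[OF dl], of "-1"]] by (intro ip_cong_AE) (auto simp: l2_def)
    also have "\<dots> \<le> 2 * ip (plate l) ?d ?d + 2 * ip (plate l) ((-1) *\<^sub>R mirrored ?d) ((-1) *\<^sub>R mirrored ?d)"
      using dl l2_scale[OF l2_mirror[OF dl], of "-1"] by (rule l2.bound_by_two)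
    also have "ip (plate l) ((-1) *\<^sub>R mirrored ?d) ((-1) *\<^sub>R mirrored ?d) = ip (plate l) (mirrored ?d) (mirrored ?d)"
      unfolding ip_def by (intro Bochner_Integration.integral_cong) (simp_all add: algebra_simps)
    also have "\<dots> = ip (plate l) ?d ?d" using dl by (intro ip_mirror)
    finally show ?thesis by linarith
  qed
  moreover have lim4: "(\<lambda>n. 4 * ip (plate l) (u n - U) (u n - U)) \<longlonglongrightarrow> 0" using lim2 by (rule tendsto_mult_right_zero)
  ultimately have "ip (plate l) ?M ?M \<le> 0" by (intro LIMSEQ_le_const[OF lim4]) blast
  then have "ip (plate l) ?M ?M = 0" using l2.nonneg[OF Ml] by simp
  then have "AE z in plate l. ?M z = 0" using ip_self_eq_0_iff[OF Ml] by simp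
  then have "AE z in plate l. mirrored U z = U z" by eventually_elim simp
  then have "U \<in> H2_even l" using U by (simp add: H2_even_iff)
  then show ?thesis using lim by blast
qed

lemma sine_combination:
  assumes "\<And>i. i \<in> I \<Longrightarrow> g i \<ge> 1" "inj_on g I" "finite I"
  shows "ip (plate l) (\<Sum>i\<in>I. c i *\<^sub>R sine (g i)) (\<Sum>i\<in>I. c i *\<^sub>R sine (g i)) = pi * l * (\<Sum>i\<in>I. (c i)\<^sup>2)"
    and "H2_inner l \<sigma> (\<Sum>i\<in>I. c i *\<^sub>R sine (g i)) (\<Sum>i\<in>I. c i *\<^sub>R sine (g i)) = pi * l * (\<Sum>i\<in>I. (c i)\<^sup>2 * real (g i) ^ 4)"
proof -
  interpret A: psd_form "H2_space (Omega l)" "H2_inner l \<sigma>" using l \<sigma> by (rule H2_inner_form)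
  have ip: "ip (plate l) (sine (g i)) (sine (g k)) = (if k = i then pi * l else 0)" if "i \<in> I" "k \<in> I" for i k
    using ip_sine[OF l assms(1)[OF that(1)] assms(1)[OF that(2)]] assms(2) that by (auto simp: inj_on_def)
  show "ip (plate l) (\<Sum>i\<in>I. c i *\<^sub>R sine (g i)) (\<Sum>i\<in>I. c i *\<^sub>R sine (g i)) = pi * l * (\<Sum>i\<in>I. (c i)\<^sup>2)"
    by (subst l2.orthogonal_combination[OF assms(3)])
       (use sine_l2[OF l] in \<open>auto simp: ip sum_distrib_left intro!: sum.cong\<close>)
  show "H2_inner l \<sigma> (\<Sum>i\<in>I. c i *\<^sub>R sine (g i)) (\<Sum>i\<in>I. c i *\<^sub>R sine (g i)) = pi * l * (\<Sum>i\<in>I. (c i)\<^sup>2 * real (g i) ^ 4)"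
    by (subst A.orthogonal_combination[OF assms(3)])
       (use sine_H2_space[OF l] in \<open>auto simp: ip H2_inner_sine[OF l] sum_distrib_left power2_eq_square power4_eq_xxxx intro!: sum.cong\<close>)
qed

lemma sine_independent:
  assumes "b (\<Sum>i\<le>n. c i *\<^sub>R sine (Suc i)) (\<Sum>i\<le>n. c i *\<^sub>R sine (Suc i)) = 0" "i \<le> n"
  shows "c i = 0"
proof -
  let ?w = "\<Sum>i\<le>n. c i *\<^sub>R sine (Suc i)"
  have w: "?w \<in> l2 (plate l)" using sine_l2[OF l] by auto
  have "ip (plate l) ?w ?w \<le> 0" using b_lower_upper(1)[OF w] assms(1) \<alpha> by (simp add: mult_le_0_iff)
  then have "pi * l * (\<Sum>i\<le>n. (c i)\<^sup>2) \<le> 0" using sine_combination(1)[of "{..n}" Suc c] by simp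
  moreover have "pi * l > 0" using l by simp
  ultimately have "(\<Sum>i\<le>n. (c i)\<^sup>2) \<le> 0" by (meson mult_pos_pos not_le)
  moreover have "(c i)\<^sup>2 \<le> (\<Sum>i\<le>n. (c i)\<^sup>2)" using assms(2) by (intro member_le_sum) auto
  ultimately have "(c i)\<^sup>2 \<le> 0" by (rule order_trans[rotated])
  then show ?thesis by simp
qed

text \<open>A named constant, because the interpretation of \<open>spectral_pair\<close> takes the
  comparison constant of the two forms as a parameter.\<close>

definition embedding_const :: real where
  "embedding_const = (SOME C. C > 0 \<and> (\<forall>u\<in>H2_star l. ip (plate l) u u \<le> C * H2_inner l \<sigma> u u))"

lemma embedding: "embedding_const > 0" "u \<in> H2_star l \<Longrightarrow> ip (plate l) u u \<le> embedding_const * H2_inner l \<sigma> u u"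
proof -
  have "\<exists>C>0. \<forall>u\<in>H2_star l. ip (plate l) u u \<le> C * H2_inner l \<sigma> u u"
    using H2_star_bounds[OF l \<sigma>] by blast
  from someI_ex[OF this] show "embedding_const > 0" "u \<in> H2_star l \<Longrightarrow> ip (plate l) u u \<le> embedding_const * H2_inner l \<sigma> u u"
    unfolding embedding_const_def by auto
qed

text \<open>The bound of b by the energy goes through the L2 norm, with \<beta> from the weight and
  the rest from the embedding. The index of the sines is shifted because \<open>sine 0\<close>
  vanishes.\<close>

sublocale spectral_pair "H2_even l" "H2_inner l \<sigma>" b "\<beta> * embedding_const" "\<lambda>i. sine (Suc i)"
proof -
  interpret A: psd_form "H2_space (Omega l)" "H2_inner l \<sigma>" using l \<sigma> by (rule H2_inner_form)
  show "spectral_pair (H2_even l) (H2_inner l \<sigma>) b (\<beta> * embedding_const) (\<lambda>i. sine (Suc i))"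
  proof
    show "subspace (H2_even l)" using l by (rule H2_even_subspace)
    show "\<beta> * embedding_const > 0" using \<beta>_pos embedding(1) by simp
    fix u v w c assume u: "u \<in> H2_even l" and w: "w \<in> H2_even l"
    show "H2_inner l \<sigma> (c *\<^sub>R u) w = c * H2_inner l \<sigma> u w" using even_H2[OF u] even_H2[OF w] by (rule A.scale)
    show "0 \<le> H2_inner l \<sigma> u u" using even_H2[OF u] by (rule A.nonneg)
    show "H2_inner l \<sigma> u w = H2_inner l \<sigma> w u" using even_H2[OF u] even_H2[OF w] by (rule A.sym)
    show "b (c *\<^sub>R u) w = c * b u w" using even_l2[OF u] even_l2[OF w] by (rule B.scale)
    show "0 \<le> b u u" using even_l2[OF u] by (rule B.nonneg)
    show "b u w = b w u" using even_l2[OF u] even_l2[OF w] by (rule B.sym)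
    {
      assume v: "v \<in> H2_even l"
      show "H2_inner l \<sigma> (u + v) w = H2_inner l \<sigma> u w + H2_inner l \<sigma> v w"
        using A.add[OF even_H2[OF u] even_H2[OF v] even_H2[OF w]] .
      show "b (u + v) w = b u w + b v w"
        using B.add[OF even_l2[OF u] even_l2[OF v] even_l2[OF w]] .
    }
    show "b u u \<le> \<beta> * embedding_const * H2_inner l \<sigma> u u"
      unfolding mult.assoc
      using b_lower_upper(2)[OF even_l2[OF u]] mult_left_mono[OF embedding(2)[OF even_star[OF u]] less_imp_le[OF \<beta>_pos]]
      by (rule order_trans)
  next
    fix s :: "nat \<Rightarrow> real \<times> real \<Rightarrow> real" and K assume s: "\<And>n. s n \<in> H2_even l" and K: "\<And>n. H2_inner l \<sigma> (s n) (s n) \<le> K"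
    have "\<exists>r. strict_mono (r :: nat \<Rightarrow> nat) \<and>
      (\<forall>\<epsilon>>0. \<exists>N. \<forall>m\<ge>N. \<forall>n\<ge>N. ip (plate l) (s (r m) - s (r n)) (s (r m) - s (r n)) < \<epsilon>)"
      using even_star[OF s] K by (rule H2_star_compact[OF l \<sigma>])
    then obtain r where r: "strict_mono (r :: nat \<Rightarrow> nat)"
      and c: "\<forall>\<epsilon>>0. \<exists>N. \<forall>m\<ge>N. \<forall>n\<ge>N. ip (plate l) (s (r m) - s (r n)) (s (r m) - s (r n)) < \<epsilon>"
      by auto
    have "\<exists>N. \<forall>m\<ge>N. \<forall>n\<ge>N. b (s (r m) - s (r n)) (s (r m) - s (r n)) < \<epsilon>" if "\<epsilon> > 0" for \<epsilon>
    proof -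
      obtain N where N: "\<And>m n. m \<ge> N \<Longrightarrow> n \<ge> N \<Longrightarrow> ip (plate l) (s (r m) - s (r n)) (s (r m) - s (r n)) < \<epsilon> / \<beta>"
        using c[rule_format, of "\<epsilon> / \<beta>"] \<beta>_pos \<open>\<epsilon> > 0\<close> by auto
      have "b (s (r m) - s (r n)) (s (r m) - s (r n)) < \<epsilon>" if "m \<ge> N" "n \<ge> N" for m n
        using b_lower_upper(2)[OF l2.mem(3)[OF even_l2[OF s] even_l2[OF s]], of "r m" "r n"] N[OF that] \<beta>_pos
        by (simp add: field_simps)
      then show ?thesis by blast
    qed
    then show "\<exists>r. strict_mono (r :: nat \<Rightarrow> nat) \<and> (\<forall>\<epsilon>>0. \<exists>N. \<forall>m\<ge>N. \<forall>n\<ge>N. b (s (r m) - s (r n)) (s (r m) - s (r n)) < \<epsilon>)"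
      using r by auto
  next
    fix s :: "nat \<Rightarrow> real \<times> real \<Rightarrow> real" assume "\<And>n. s n \<in> H2_even l"
      "\<forall>\<epsilon>>0. \<exists>N. \<forall>m\<ge>N. \<forall>n\<ge>N. H2_inner l \<sigma> (s m - s n) (s m - s n) < \<epsilon>"
    then show "\<exists>v\<in>H2_even l. (\<lambda>n. H2_inner l \<sigma> (s n - v) (s n - v)) \<longlonglongrightarrow> 0" by (rule even_complete)
  next
    show "sine (Suc i) \<in> H2_even l" for i using l by (rule sine_H2_even)
  next
    show "c i = 0" if "b (\<Sum>i\<le>n. c i *\<^sub>R sine (Suc i)) (\<Sum>i\<le>n. c i *\<^sub>R sine (Suc i)) = 0" "i \<le> n" for n c i
      using that by (rule sine_independent)
  qed
qed

lemma weak_solution_iff: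
  assumes "u \<in> H2_even l"
  shows "weak_solution l \<sigma> p t u \<longleftrightarrow> (\<forall>v\<in>H2_even l. H2_inner l \<sigma> u v = t * b u v)"
  using weak_solution_if_even[OF l \<sigma> p assms, of t] even_star by (auto simp: weak_solution_def b_def)

text \<open>Eigenvectors are numbered from 0, eigenvalues from 1. The \<open>e k\<close> with
  \<open>\<nu> k = t\<close> form a basis of the eigenspace: orthonormality makes them independent,
  and \<open>eigenvector_expansion\<close> makes them span.\<close>

theorem eigenvalue_sequence:
  assumes eig: "\<And>k. eigenvector \<nu> e k"
  shows "longitudinal_eigenvalue_sequence l \<sigma> p (\<lambda>k. \<nu> (k - 1))"
  unfolding longitudinal_eigenvalue_sequence_def
proof (intro conjI allI)
  show "mono_on {1..} (\<lambda>k. \<nu> (k - 1))"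
    using eigenvalues_mono[OF eig] by (auto simp: mono_on_def mono_def)
  fix t
  define I where "I = {k. \<nu> k = t}"
  have fin: "finite I" unfolding I_def using eig by (rule finite_multiplicity)
  have shift: "{k \<in> {1..}. \<nu> (k - 1) = t} = Suc ` I"
  proof (intro set_eqI iffI)
    fix k assume "k \<in> {k \<in> {1..}. \<nu> (k - 1) = t}"
    then show "k \<in> Suc ` I" by (intro image_eqI[of _ _ "k - 1"]) (auto simp: I_def)
  qed (auto simp: I_def)
  then show "finite {k \<in> {1..}. \<nu> (k - 1) = t}" using fin by simp
  have card: "card {k \<in> {1..}. \<nu> (k - 1) = t} = card I" unfolding shift by (simp add: card_image)
  obtain h where h: "bij_betw h {0..<card I} I" using ex_bij_betw_nat_finite[OF fin] by blast
  then have h': "bij_betw h {..<card I} I" by (simp add: atLeast0LessThan)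
  have eH: "e k \<in> H2_even l" for k using eig by (rule eigenvector_mem)
  have el: "e k \<in> l2 (plate l)" for k using eH by (rule even_l2)
  show "has_dimension_ae (Omega l) (longitudinal_eigenspace l \<sigma> p t) (card {k \<in> {1..}. \<nu> (k - 1) = t})"
    unfolding has_dimension_ae_def card
  proof (intro exI[of _ "\<lambda>i. e (h i)"] conjI allI impI ballI)
    fix i assume i: "i < card I"
    then have "\<nu> (h i) = t" using bij_betw_apply[OF h'] by (auto simp: I_def)
    then show "e (h i) \<in> longitudinal_eigenspace l \<sigma> p t"
      using eH eigenvector_eq[OF eig] by (simp add: longitudinal_eigenspace_def weak_solution_iff)
  next
    fix c :: "nat \<Rightarrow> real" and i
    assume ae: "AE z in plate l. (\<Sum>i<card I. c i * e (h i) z) = 0" and i: "i < card I"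
    let ?w = "\<Sum>i<card I. c i *\<^sub>R e (h i)"
    have wl: "?w \<in> l2 (plate l)" using el by auto
    have wH: "?w \<in> H2_even l" using eH by auto
    have "b ?w ?w = 0" unfolding b_null_iff[OF wl] using ae by (simp add: sum_fun_apply)
    then have "b (e (h i)) ?w = 0" by (rule B.null_right[OF eH wH])
    then have "0 = (\<Sum>k<card I. c k * b (e (h i)) (e (h k)))"
      using eH by (simp add: B.sum_right B.scale_right)
    also have "\<dots> = (\<Sum>k<card I. if i = k then c k else 0)"
    proof (intro sum.cong refl)
      fix k assume "k \<in> {..<card I}"
      then have "h i = h k \<longleftrightarrow> i = k" using h' i by (auto simp: bij_betw_def inj_on_def)
      then show "c k * b (e (h i)) (e (h k)) = (if i = k then c k else 0)"
        using eigenvector_orthonormal[OF eig] by simp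
    qed
    also have "\<dots> = c i" using i by simp
    finally show "c i = 0" by simp
  next
    fix u assume "u \<in> longitudinal_eigenspace l \<sigma> p t"
    then have u: "u \<in> H2_even l" and weak: "\<And>v. v \<in> H2_even l \<Longrightarrow> H2_inner l \<sigma> u v = t * b u v"
      by (auto simp: longitudinal_eigenspace_def weak_solution_iff)
    let ?w = "u - (\<Sum>k | \<nu> k = t. b u (e k) *\<^sub>R e k)"
    have "b ?w ?w = 0" using eigenvector_expansion[OF eig u weak] by simp
    moreover have "?w \<in> l2 (plate l)" using even_l2[OF u] el by (intro l2.mem) auto
    ultimately have "AE z in plate l. ?w z = 0" using b_null_iff by blast
    then have "AE z in plate l. u z = (\<Sum>i<card I. b u (e (h i)) * e (h i) z)"
    proof eventually_elim
      case (elim z)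
      then have "u z = (\<Sum>k\<in>I. b u (e k) * e k z)" by (simp add: sum_fun_apply I_def)
      also have "\<dots> = (\<Sum>i<card I. b u (e (h i)) * e (h i) z)"
        using sum.reindex_bij_betw[OF h', of "\<lambda>k. b u (e k) * e k z"] by simp
      finally show ?case .
    qed
    then show "\<exists>c :: nat \<Rightarrow> real. AE z in plate l. u z = (\<Sum>i<card I. c i * e (h i) z)"
      by (intro exI[of _ "\<lambda>i. b u (e (h i))"])
  qed
qed

text \<open>Resolves the definite description: any other admissible list has the same multiplicities
  and so the same entries.\<close>

theorem mu_eq:
  assumes eig: "\<And>k. eigenvector \<nu> e k"
  shows "mu l \<sigma> p (Suc k) = \<nu> k"
  unfolding mu_def
proof (rule the_equality)
  show "\<exists>\<nu>'. longitudinal_eigenvalue_sequence l \<sigma> p \<nu>' \<and> \<nu> k = \<nu>' (Suc k)"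
    using eigenvalue_sequence[OF eig] by (intro exI[of _ "\<lambda>k. \<nu> (k - 1)"]) simp
  fix t assume "\<exists>\<nu>'. longitudinal_eigenvalue_sequence l \<sigma> p \<nu>' \<and> t = \<nu>' (Suc k)"
  then obtain \<nu>' where \<nu>': "longitudinal_eigenvalue_sequence l \<sigma> p \<nu>'" "t = \<nu>' (Suc k)" by blast
  note s = eigenvalue_sequence[OF eig, unfolded longitudinal_eigenvalue_sequence_def]
    and s' = \<nu>'(1)[unfolded longitudinal_eigenvalue_sequence_def]
  have "\<nu> (Suc k - 1) = \<nu>' (Suc k)"
  proof (rule mono_sequence_eq_if_multiplicities_eq[of "\<lambda>k. \<nu> (k - 1)" \<nu>'])
    show "card {k \<in> {1..}. \<nu> (k - 1) = t} = card {k \<in> {1..}. \<nu>' k = t}" for t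
      using s s' dimension_ae_unique by blast
  qed (use s s' in auto)
  then show "t = \<nu> k" using \<nu>'(2) by simp
qed

lemma mu_le:
  assumes "\<And>i. i \<le> k \<Longrightarrow> g i \<in> H2_even l"
    and "\<And>c i. b (\<Sum>i\<le>k. c i *\<^sub>R g i) (\<Sum>i\<le>k. c i *\<^sub>R g i) = 0 \<Longrightarrow> i \<le> k \<Longrightarrow> c i = (0::real)"
    and "\<And>c :: nat \<Rightarrow> real. H2_inner l \<sigma> (\<Sum>i\<le>k. c i *\<^sub>R g i) (\<Sum>i\<le>k. c i *\<^sub>R g i) \<le>
      t * b (\<Sum>i\<le>k. c i *\<^sub>R g i) (\<Sum>i\<le>k. c i *\<^sub>R g i)"
  shows "mu l \<sigma> p (Suc k) \<le> t"
proof -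
  obtain \<nu> e where eig: "\<And>k. eigenvector \<nu> e k" using exists_eigen_sequence by blast
  show ?thesis unfolding mu_eq[OF eig] using assms by (rule min_max[OF eig])
qed

lemma exists_eigenfunction:
  obtains u where "longitudinal_eigenfunction l \<sigma> p (mu l \<sigma> p (Suc k)) u"
proof -
  obtain \<nu> e where eig: "\<And>k. eigenvector \<nu> e k" using exists_eigen_sequence by blast
  have e: "e k \<in> H2_even l" using eig by (rule eigenvector_mem)
  have "b (e k) (e k) = 1" using eigenvector_orthonormal[OF eig] by simp
  then have "\<not> (AE z in plate l. e k z = 0)" using b_null_iff[OF even_l2[OF e]] by simp
  then have "longitudinal_eigenfunction l \<sigma> p (mu l \<sigma> p (Suc k)) (e k)"
    unfolding mu_eq[OF eig] longitudinal_eigenfunction_def weak_solution_iff[OF e]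
    using e eigenvector_eq[OF eig] by blast
  then show ?thesis by (rule that)
qed

text \<open>Expresses the eigenvalues through \<open>mu\<close> alone, so that bases for a whole
  sequence of weights can be chosen and compared.\<close>

lemma eigen_basis:
  obtains e where "\<And>i. e i \<in> H2_even l" "\<And>i k. b (e i) (e k) = (if i = k then 1 else 0)"
    "\<And>i v. v \<in> H2_even l \<Longrightarrow> H2_inner l \<sigma> (e i) v = mu l \<sigma> p (Suc i) * b (e i) v"
    "\<And>i. mu l \<sigma> p (Suc i) > 0" "mono (\<lambda>i. mu l \<sigma> p (Suc i))"
proof -
  obtain \<nu> e where eig: "\<And>k. eigenvector \<nu> e k" using exists_eigen_sequence by blast
  show ?thesis
    by (rule that[of e]; (unfold mu_eq[OF eig])?)
       (use eigenvector_mem[OF eig] eigenvector_orthonormal[OF eig] eigenvector_eq[OF eig] eigenvector_pos[OF eig]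
         eigenvalues_mono[OF eig] in simp_all)
qed

end

section \<open>Existence of an optimal weight\<close>

lemma weights_average:
  assumes q: "q \<in> weights l \<alpha> \<beta>" and q': "q' \<in> weights l \<alpha> \<beta>" and l: "l > 0"
  shows "(1 / 2) *\<^sub>R (q + q') \<in> weights l \<alpha> \<beta>"
proof -
  interpret finite_measure "plate l" using l by (intro finite_measure_plate) simp
  have m: "q \<in> borel_measurable (plate l)" "q' \<in> borel_measurable (plate l)"
    and b: "AE z in plate l. \<alpha> \<le> q z \<and> q z \<le> \<beta>" "AE z in plate l. \<alpha> \<le> q' z \<and> q' z \<le> \<beta>"
    and e: "AE z in plate l. q z = q (fst z, - snd z)" "AE z in plate l. q' z = q' (fst z, - snd z)"
    and i: "(\<integral>z. q z \<partial>plate l) = measure lebesgue (Omega l)" "(\<integral>z. q' z \<partial>plate l) = measure lebesgue (Omega l)"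
    using q q' by (auto simp: weights_def)
  have int: "integrable (plate l) f" if "f \<in> borel_measurable (plate l)" "AE z in plate l. \<alpha> \<le> f z \<and> f z \<le> \<beta>" for f
  proof (rule integrable_const_bound[OF _ that(1)])
    show "AE z in plate l. norm (f z) \<le> max \<bar>\<alpha>\<bar> \<bar>\<beta>\<bar>" using that(2) by eventually_elim auto
  qed
  have "(1 / 2) *\<^sub>R (q + q') \<in> borel_measurable (plate l)"
    using m by (auto simp: scaleR_fun_def plus_fun_def intro!: borel_measurable_add borel_measurable_times)
  moreover have "AE z in plate l. \<alpha> \<le> ((1 / 2) *\<^sub>R (q + q')) z \<and> ((1 / 2) *\<^sub>R (q + q')) z \<le> \<beta>"
    using b by eventually_elim auto
  moreover have "AE z in plate l. ((1 / 2) *\<^sub>R (q + q')) z = ((1 / 2) *\<^sub>R (q + q')) (fst z, - snd z)"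
    using e by eventually_elim simp
  moreover have "(\<integral>z. ((1 / 2) *\<^sub>R (q + q')) z \<partial>plate l) = measure lebesgue (Omega l)"
  proof -
    have "(\<integral>z. ((1 / 2) *\<^sub>R (q + q')) z \<partial>plate l) = (\<integral>z. (1 / 2) * (q z + q' z) \<partial>plate l)"
      by (rule Bochner_Integration.integral_cong) auto
    also have "\<dots> = (1 / 2) * ((\<integral>z. q z \<partial>plate l) + (\<integral>z. q' z \<partial>plate l))"
      using int[OF m(1) b(1)] int[OF m(2) b(2)] by simp
    finally show ?thesis using i by simp
  qed
  ultimately show ?thesis unfolding weights_def by blast
qed

text \<open>Elements of almost minimal \<open>L\<^sup>2\<close> norm of a decreasing sequence of convex sets form a Cauchy
  sequence by the parallelogram law; this avoids weak-star compactness in \<open>L\<^sup>\<infinity>\<close>.\<close>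

theorem weights_compact:
  assumes l: "l > 0" and p: "\<And>n. p n \<in> weights l \<alpha> \<beta>" and G: "finite G"
    and int: "\<And>g. g \<in> G \<Longrightarrow> integrable (plate l) g"
    and lim: "\<And>g. g \<in> G \<Longrightarrow> (\<lambda>n. \<integral>z. p n z * g z \<partial>plate l) \<longlonglongrightarrow> L g"
  shows "\<exists>q\<in>weights l \<alpha> \<beta>. \<forall>g\<in>G. (\<integral>z. q z * g z \<partial>plate l) = L g"
proof -
  interpret finite_measure "plate l" using l by (intro finite_measure_plate) simp
  define K where "K = max \<bar>\<alpha>\<bar> \<bar>\<beta>\<bar>"
  have wm: "q \<in> borel_measurable (plate l)" and wb: "AE z in plate l. \<alpha> \<le> q z \<and> q z \<le> \<beta>"
    and wK: "AE z in plate l. \<bar>q z\<bar> \<le> K" and we: "AE z in plate l. q z = q (mirror z)"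
    and wi: "(\<integral>z. q z \<partial>plate l) = measure lebesgue (Omega l)"
    if "q \<in> weights l \<alpha> \<beta>" for q
  proof -
    show "AE z in plate l. \<alpha> \<le> q z \<and> q z \<le> \<beta>" using that by (simp add: weights_def)
    then show "AE z in plate l. \<bar>q z\<bar> \<le> K" by eventually_elim (auto simp: K_def)
  qed (use that in \<open>auto simp: weights_def mirror_def\<close>)
  have wl: "q \<in> l2 (plate l)" if "q \<in> weights l \<alpha> \<beta>" for q
    using wm[OF that] wK[OF that] by (rule l2_bounded)
  have wg: "integrable (plate l) (\<lambda>z. q z * g z)" if "q \<in> weights l \<alpha> \<beta>" "g \<in> G" for q g
  proof (rule Bochner_Integration.integrable_bound)
    show "integrable (plate l) (\<lambda>z. K * \<bar>g z\<bar>)" using int[OF that(2)] by simp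
    show "(\<lambda>z. q z * g z) \<in> borel_measurable (plate l)" using wm[OF that(1)] int[OF that(2)] by simp
    show "AE z in plate l. norm (q z * g z) \<le> norm (K * \<bar>g z\<bar>)"
      using wK[OF that(1)] by eventually_elim (auto simp: abs_mult intro!: mult_right_mono)
  qed
  \<comment> \<open>Weights that meet the finitely many integral conditions up to 1 / (n + 1). These
    sets are nonempty by the convergence hypothesis, decreasing, and closed under midpoints.\<close>
  define A where "A n = {q \<in> weights l \<alpha> \<beta>. \<forall>g\<in>G. \<bar>(\<integral>z. q z * g z \<partial>plate l) - L g\<bar> \<le> 1 / real (Suc n)}" for n
  have A_w: "q \<in> weights l \<alpha> \<beta>" if "q \<in> A n" for q n using that by (simp add: A_def)
  have A_ne: "A n \<noteq> {}" for n
  proof -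
    have "\<forall>g\<in>G. \<forall>\<^sub>F k in sequentially. \<bar>(\<integral>z. p k z * g z \<partial>plate l) - L g\<bar> \<le> 1 / real (Suc n)"
    proof
      fix g assume "g \<in> G"
      then have "\<forall>\<^sub>F k in sequentially. dist (\<integral>z. p k z * g z \<partial>plate l) (L g) < 1 / real (Suc n)"
        using lim by (intro tendstoD) auto
      then show "\<forall>\<^sub>F k in sequentially. \<bar>(\<integral>z. p k z * g z \<partial>plate l) - L g\<bar> \<le> 1 / real (Suc n)"
        by eventually_elim (simp add: dist_real_def)
    qed
    then have "\<forall>\<^sub>F k in sequentially. \<forall>g\<in>G. \<bar>(\<integral>z. p k z * g z \<partial>plate l) - L g\<bar> \<le> 1 / real (Suc n)"
      using G by (rule eventually_ball_finite[rotated])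
    then obtain k where "\<forall>g\<in>G. \<bar>(\<integral>z. p k z * g z \<partial>plate l) - L g\<bar> \<le> 1 / real (Suc n)"
      by (auto simp: eventually_sequentially)
    then have "p k \<in> A n" using p by (simp add: A_def)
    then show ?thesis by blast
  qed
  have A_mono: "A m \<subseteq> A n" if "n \<le> m" for m n
  proof -
    have "1 / real (Suc m) \<le> 1 / real (Suc n)" using that by (simp add: field_simps)
    then show ?thesis unfolding A_def by force
  qed
  have A_avg: "(1 / 2) *\<^sub>R (q + q') \<in> A n" if q: "q \<in> A n" "q' \<in> A n" for q q' n
  proof -
    have "\<bar>(\<integral>z. ((1 / 2) *\<^sub>R (q + q')) z * g z \<partial>plate l) - L g\<bar> \<le> 1 / real (Suc n)" if g: "g \<in> G" for g
    proof -
      have "(\<integral>z. ((1 / 2) *\<^sub>R (q + q')) z * g z \<partial>plate l) =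
          (1 / 2) * ((\<integral>z. q z * g z \<partial>plate l) + (\<integral>z. q' z * g z \<partial>plate l))"
        using wg[OF A_w[OF q(1)] g] wg[OF A_w[OF q(2)] g] by (simp add: distrib_right)
      moreover have "\<bar>(\<integral>z. q z * g z \<partial>plate l) - L g\<bar> \<le> 1 / real (Suc n)" "\<bar>(\<integral>z. q' z * g z \<partial>plate l) - L g\<bar> \<le> 1 / real (Suc n)"
        using q g by (auto simp: A_def)
      ultimately show ?thesis by (simp add: abs_le_iff) argo
    qed
    then show ?thesis using weights_average[OF A_w[OF q(1)] A_w[OF q(2)] l] by (simp add: A_def)
  qed
  define N where "N q = ip (plate l) q q" for q
  \<comment> \<open>The smallest squared norm on \<open>A n\<close>; it increases with n and is
    bounded, hence converges.\<close>
  define d where "d n = Inf (N ` A n)" for n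
  have bdd: "bdd_below (N ` A n)" for n
    by (rule bdd_belowI[of _ 0]) (use wl[OF A_w] l2.nonneg in \<open>auto simp: N_def\<close>)
  have d_le: "d n \<le> N q" if "q \<in> A n" for n q
    unfolding d_def using that bdd by (intro cInf_lower) auto
  have d_mono: "d n \<le> d m" if "n \<le> m" for m n
    unfolding d_def using A_mono[OF that] A_ne bdd by (intro cInf_superset_mono) auto
  have "d n \<le> K\<^sup>2 * (2 * pi * l)" for n
  proof -
    obtain q where q: "q \<in> A n" using A_ne by blast
    have "d n \<le> N q" using q by (rule d_le)
    also have "\<dots> \<le> K\<^sup>2 * (2 * pi * l)"
      unfolding N_def by (rule ip_le_sup[OF l wl[OF A_w[OF q]] wK[OF A_w[OF q]]])
    finally show ?thesis .
  qed
  moreover have "incseq d" using d_mono by (auto simp: incseq_def)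
  ultimately obtain D where D: "d \<longlonglongrightarrow> D" using incseq_convergent[of d "K\<^sup>2 * (2 * pi * l)"] by blast
  then have d_Cauchy: "Cauchy d" by (rule LIMSEQ_imp_Cauchy)
  have "\<exists>q\<in>A n. N q < d n + 1 / real (Suc n)" for n
  proof -
    have "Inf (N ` A n) < d n + 1 / real (Suc n)" by (simp add: d_def)
    then show ?thesis using cInf_less_iff[of "N ` A n"] A_ne bdd by auto
  qed
  then obtain q where qA: "\<And>n. q n \<in> A n" and qN: "\<And>n. N (q n) < d n + 1 / real (Suc n)" by metis
  have qw: "q n \<in> weights l \<alpha> \<beta>" for n using qA by (rule A_w)
  have ql: "q n \<in> l2 (plate l)" for n using qw by (rule wl)
  \<comment> \<open>The midpoint lies in the larger set \<open>A n\<close>, so its squared norm is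
    at least \<open>d n\<close>; the parallelogram law turns this into a bound on the
    difference.\<close>
  have est: "ip (plate l) (q m - q n) (q m - q n) \<le> 2 * (d m - d n) + 2 / real (Suc n) + 2 / real (Suc m)" if "n \<le> m" for m n
  proof -
    have "(1 / 2) *\<^sub>R (q m + q n) \<in> A n" using A_avg[OF _ qA] A_mono[OF that] qA by blast
    then have "d n \<le> N ((1 / 2) *\<^sub>R (q m + q n))" by (rule d_le)
    also have "\<dots> = ip (plate l) (q m + q n) (q m + q n) / 4"
      using ql l2_add[OF ql ql] by (simp add: N_def l2.scale l2.scale_right)
    finally have "4 * d n \<le> ip (plate l) (q m + q n) (q m + q n)" by simp
    then show ?thesis
      using l2.parallelogram[OF ql ql, of m n] qN[of m] qN[of n] by (simp add: N_def)
  qed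
  have "\<forall>\<epsilon>>0. \<exists>M. \<forall>m\<ge>M. \<forall>n\<ge>M. ip (plate l) (q m - q n) (q m - q n) < \<epsilon>"
  proof (intro allI impI)
    fix \<epsilon> :: real assume \<epsilon>: "\<epsilon> > 0"
    obtain M1 where M1: "\<And>m n. m \<ge> M1 \<Longrightarrow> n \<ge> M1 \<Longrightarrow> dist (d m) (d n) < \<epsilon> / 8"
      using d_Cauchy \<epsilon> unfolding Cauchy_def by (metis zero_less_divide_iff zero_less_numeral)
    obtain M2 where M2: "1 / real (Suc M2) < \<epsilon> / 8" using nat_approx_posE[of "\<epsilon> / 8"] \<epsilon> by auto
    have small: "1 / real (Suc i) < \<epsilon> / 8" if "i \<ge> M2" for i
    proof -
      have "1 / real (Suc i) \<le> 1 / real (Suc M2)" using that by (simp add: field_simps)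
      then show ?thesis using M2 by simp
    qed
    have *: "ip (plate l) (q m - q n) (q m - q n) < \<epsilon>" if "m \<ge> max M1 M2" "n \<ge> max M1 M2" "n \<le> m" for m n
    proof -
      have "d m - d n < \<epsilon> / 8" using order_le_less_trans[OF abs_ge_self M1[of m n, unfolded dist_real_def]] that by simp
      moreover have "2 / real (Suc i) = 2 * (1 / real (Suc i))" for i by simp
      moreover have "1 / real (Suc m) < \<epsilon> / 8" "1 / real (Suc n) < \<epsilon> / 8" using small that by auto
      ultimately show ?thesis using est[OF that(3)] \<epsilon> by argo
    qed
    have "ip (plate l) (q m - q n) (q m - q n) < \<epsilon>" if "m \<ge> max M1 M2" "n \<ge> max M1 M2" for m n
    proof (cases "n \<le> m")
      case False
      have "ip (plate l) (q m - q n) (q m - q n) = ip (plate l) (q n - q m) (q n - q m)"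
        unfolding ip_def by (intro Bochner_Integration.integral_cong) (simp_all add: algebra_simps)
      then show ?thesis using *[OF that(2,1)] False by simp
    qed (use * that in blast)
    then show "\<exists>M. \<forall>m\<ge>M. \<forall>n\<ge>M. ip (plate l) (q m - q n) (q m - q n) < \<epsilon>" by blast
  qed
  from l2_complete[OF ql this] obtain Q r where Ql: "Q \<in> l2 (plate l)"
    and r: "strict_mono (r :: nat \<Rightarrow> nat)" and Qlim: "AE z in plate l. (\<lambda>n. q (r n) z) \<longlonglongrightarrow> Q z" by blast
  have Qm: "Q \<in> borel_measurable (plate l)" using Ql by (simp add: l2_def)
  have all: "AE z in plate l. \<forall>n. P n z" if "\<And>n. AE z in plate l. P n z" for P :: "nat \<Rightarrow> real \<times> real \<Rightarrow> bool"
    using that by (simp add: AE_all_countable)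
  \<comment> \<open>The functions g are only integrable, so L2 convergence does not suffice; almost
    everywhere convergence under the common bound K allows dominated convergence.\<close>
  have Qdom: "(\<lambda>n. \<integral>z. q (r n) z * g z \<partial>plate l) \<longlonglongrightarrow> (\<integral>z. Q z * g z \<partial>plate l)" if g: "integrable (plate l) g" for g
  proof (rule integral_dominated_convergence[where w = "\<lambda>z. K * \<bar>g z\<bar>"])
    show "AE z in plate l. (\<lambda>n. q (r n) z * g z) \<longlonglongrightarrow> Q z * g z"
      using Qlim by eventually_elim (intro tendsto_intros)
    show "AE z in plate l. norm (q (r n) z * g z) \<le> K * \<bar>g z\<bar>" for n
      using wK[OF qw] by eventually_elim (auto simp: abs_mult intro!: mult_right_mono)
  qed (use g Qm wm[OF qw] in auto)
  have Qw: "Q \<in> weights l \<alpha> \<beta>"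
    unfolding weights_def
  proof (intro CollectI conjI Qm)
    have "AE z in plate l. \<forall>n. \<alpha> \<le> q (r n) z \<and> q (r n) z \<le> \<beta>" using wb[OF qw] by (intro all)
    then show "AE z in plate l. \<alpha> \<le> Q z \<and> Q z \<le> \<beta>"
      using Qlim by eventually_elim (auto intro: LIMSEQ_le_const LIMSEQ_le_const2)
    have "AE z in plate l. \<forall>n. q (r n) z = q (r n) (mirror z)" using we[OF qw] by (intro all)
    then have "AE z in plate l. Q z = Q (mirror z)"
      using Qlim AE_mirror[OF Qlim] by eventually_elim (auto intro: LIMSEQ_unique)
    then show "AE z in plate l. Q z = Q (fst z, - snd z)" by (simp add: mirror_def)
    have "(\<lambda>n. \<integral>z. q (r n) z * 1 \<partial>plate l) \<longlonglongrightarrow> (\<integral>z. Q z * 1 \<partial>plate l)" by (rule Qdom) simp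
    then show "(\<integral>z. Q z \<partial>plate l) = measure lebesgue (Omega l)"
      using wi[OF qw] by (simp add: LIMSEQ_const_iff)
  qed
  have "(\<integral>z. Q z * g z \<partial>plate l) = L g" if g: "g \<in> G" for g
  proof (rule LIMSEQ_unique[OF Qdom[OF int[OF g]]])
    show "(\<lambda>n. \<integral>z. q (r n) z * g z \<partial>plate l) \<longlonglongrightarrow> L g"
    proof (rule Lim_transform_bound[THEN Lim_null[THEN iffD2], rotated -1])
      show "(\<lambda>n. 1 / real (Suc (r n))) \<longlonglongrightarrow> 0"
        using LIMSEQ_subseq_LIMSEQ[OF lim_1_over_n[THEN LIMSEQ_Suc] r] by (simp add: o_def)
      show "\<forall>\<^sub>F n in sequentially. norm ((\<integral>z. q (r n) z * g z \<partial>plate l) - L g) \<le> norm (1 / real (Suc (r n)))"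
        using qA g by (intro always_eventually) (auto simp: A_def)
    qed
  qed
  then show ?thesis using Qw by blast
qed

text \<open>One factor keeps the weighted norm, in which eigenfunctions are normalized; the other is
  measured without weight, so that convergence can be stated uniformly over a sequence of
  weights.\<close>

lemma (in weighted_plate) b_cauchy_schwarz:
  assumes u: "u \<in> H2_even l" and v: "v \<in> H2_even l" and s: "b u u \<le> s"
  shows "\<bar>b u v\<bar> \<le> sqrt (s * (\<beta> * ip (plate l) v v))"
proof (rule real_le_rsqrt)
  have "(b u v)\<^sup>2 \<le> b u u * b v v" using u v by (rule B.cauchy_schwarz)
  also have "\<dots> \<le> s * (\<beta> * ip (plate l) v v)"
    using s b_lower_upper(2)[OF even_l2[OF v]] B.nonneg[OF u] B.nonneg[OF v] by (intro mult_mono) auto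
  finally show "\<bar>b u v\<bar>\<^sup>2 \<le> s * (\<beta> * ip (plate l) v v)" by simp
qed

lemma H2_star_compact_finite:
  fixes k :: nat
  assumes l: "l > 0" and \<sigma>: "0 < \<sigma>" "\<sigma> < 1 / 2" and u: "\<And>i n. u i n \<in> H2_star l"
    and K: "\<And>i n. H2_inner l \<sigma> (u i n) (u i n) \<le> K"
  shows "\<exists>r. strict_mono (r :: nat \<Rightarrow> nat) \<and> (\<forall>i\<le>k. \<forall>\<epsilon>>0. \<exists>N. \<forall>m\<ge>N. \<forall>n\<ge>N.
    ip (plate l) (u i (r m) - u i (r n)) (u i (r m) - u i (r n)) < \<epsilon>)"
proof (induction k)
  case 0
  have "\<exists>r. strict_mono (r :: nat \<Rightarrow> nat) \<and> (\<forall>\<epsilon>>0. \<exists>N. \<forall>m\<ge>N. \<forall>n\<ge>N.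
    ip (plate l) (u 0 (r m) - u 0 (r n)) (u 0 (r m) - u 0 (r n)) < \<epsilon>)"
    using l \<sigma> u K by (rule H2_star_compact)
  then show ?case by (metis le_zero_eq)
next
  case (Suc k)
  then obtain r where r: "strict_mono (r :: nat \<Rightarrow> nat)" and C: "\<And>i \<epsilon>. i \<le> k \<Longrightarrow> \<epsilon> > 0 \<Longrightarrow> \<exists>N. \<forall>m\<ge>N. \<forall>n\<ge>N.
    ip (plate l) (u i (r m) - u i (r n)) (u i (r m) - u i (r n)) < \<epsilon>"
    by blast
  obtain s where s: "strict_mono (s :: nat \<Rightarrow> nat)" and D: "\<And>\<epsilon>. \<epsilon> > 0 \<Longrightarrow> \<exists>N. \<forall>m\<ge>N. \<forall>n\<ge>N.
    ip (plate l) (u (Suc k) (r (s m)) - u (Suc k) (r (s n))) (u (Suc k) (r (s m)) - u (Suc k) (r (s n))) < \<epsilon>"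
    using H2_star_compact[OF l \<sigma>, of "\<lambda>n. u (Suc k) (r n)" K] u K by blast
  show ?case
  proof (intro exI[of _ "r \<circ> s"] conjI allI impI)
    show "strict_mono (r \<circ> s)" using r s by (rule strict_mono_o)
    fix i and \<epsilon> :: real assume i: "i \<le> Suc k" and \<epsilon>: "\<epsilon> > 0"
    show "\<exists>N. \<forall>m\<ge>N. \<forall>n\<ge>N.
      ip (plate l) (u i ((r \<circ> s) m) - u i ((r \<circ> s) n)) (u i ((r \<circ> s) m) - u i ((r \<circ> s) n)) < \<epsilon>"
    proof (cases "i \<le> k")
      case True
      obtain N where "\<And>m n. m \<ge> N \<Longrightarrow> n \<ge> N \<Longrightarrow> ip (plate l) (u i (r m) - u i (r n)) (u i (r m) - u i (r n)) < \<epsilon>"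
        using C[OF True \<epsilon>] by blast
      then have "ip (plate l) (u i (r (s m)) - u i (r (s n))) (u i (r (s m)) - u i (r (s n))) < \<epsilon>"
        if "m \<ge> N" "n \<ge> N" for m n
        using that order_trans[OF _ seq_suble[OF s]] by blast
      then show ?thesis by auto
    next
      case False
      then have "i = Suc k" using i by simp
      then show ?thesis using D[OF \<epsilon>] by simp
    qed
  qed
qed

lemma const_weight: "l > 0 \<Longrightarrow> \<alpha> \<le> 1 \<Longrightarrow> 1 \<le> \<beta> \<Longrightarrow> (\<lambda>z. 1) \<in> weights l \<alpha> \<beta>"
  using measure_Omega[of l] by (simp add: weights_def measure_plate)

text \<open>Positivity bounds the eigenvalues below, which the real infimum needs in order to be a
  lower bound.\<close>

lemma
  assumes l: "l > 0" and \<sigma>: "0 < \<sigma>" "\<sigma> < 1 / 2" and \<alpha>: "0 < \<alpha>"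
  shows mu_pos: "p \<in> weights l \<alpha> \<beta> \<Longrightarrow> mu l \<sigma> p (Suc k) > 0"
    and mu_inf_le: "p \<in> weights l \<alpha> \<beta> \<Longrightarrow> mu_inf l \<sigma> \<alpha> \<beta> (Suc k) \<le> mu l \<sigma> p (Suc k)"
proof -
  have *: "mu l \<sigma> p (Suc k) > 0" if "p \<in> weights l \<alpha> \<beta>" for p
  proof -
    interpret weighted_plate l \<sigma> \<alpha> \<beta> p by standard fact+
    show ?thesis by (rule eigen_basis) blast
  qed
  then show "p \<in> weights l \<alpha> \<beta> \<Longrightarrow> mu l \<sigma> p (Suc k) > 0" .
  show "mu_inf l \<sigma> \<alpha> \<beta> (Suc k) \<le> mu l \<sigma> p (Suc k)" if "p \<in> weights l \<alpha> \<beta>"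
    unfolding mu_inf_def using that * by (intro cINF_lower bdd_belowI2[of _ 0]) (auto intro: less_imp_le)
qed

theorem exists_optimal_weight:
  assumes l: "l > 0" and \<sigma>: "0 < \<sigma>" "\<sigma> < 1 / 2" and \<alpha>: "0 < \<alpha>" "\<alpha> \<le> 1" and \<beta>: "1 \<le> \<beta>"
  shows "\<exists>p\<in>weights l \<alpha> \<beta>. mu l \<sigma> p (Suc k) = mu_inf l \<sigma> \<alpha> \<beta> (Suc k)"
proof -
  let ?a = "H2_inner l \<sigma>" and ?M = "mu_inf l \<sigma> \<alpha> \<beta> (Suc k)"
  \<comment> \<open>The n-th weight is chosen with eigenvalue below ?M + 1 / (n + 1), so this bounds
    the first k + 1 eigenvalues of all of them.\<close>
  let ?K = "?M + 1"
  have one: "(\<lambda>z. 1) \<in> weights l \<alpha> \<beta>" using l \<alpha>(2) \<beta> by (rule const_weight)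
  \<comment> \<open>The constant weight gives access to the facts about the energy space, which do
    not depend on the weight.\<close>
  interpret X: weighted_plate l \<sigma> \<alpha> \<beta> "\<lambda>z. 1" by standard fact+
  have "\<exists>p\<in>weights l \<alpha> \<beta>. mu l \<sigma> p (Suc k) < ?M + 1 / real (Suc n)" for n
  proof -
    have "?M < ?M + 1 / real (Suc n)" by simp
    then show ?thesis
      unfolding mu_inf_def using one mu_pos[OF l \<sigma> \<alpha>(1)]
      by (subst (asm) cINF_less_iff) (auto intro!: bdd_belowI2[of _ 0] less_imp_le)
  qed
  then obtain p where p: "\<And>n. p n \<in> weights l \<alpha> \<beta>" and pM: "\<And>n. mu l \<sigma> (p n) (Suc k) < ?M + 1 / real (Suc n)"
    by metis
  have "\<exists>e. \<forall>i. e i \<in> H2_even l \<and> (\<forall>j. weighted_plate.b l (p n) (e i) (e j) = (if i = j then 1 else 0)) \<and>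
     (\<forall>v\<in>H2_even l. ?a (e i) v = mu l \<sigma> (p n) (Suc i) * weighted_plate.b l (p n) (e i) v) \<and>
     (i \<le> k \<longrightarrow> mu l \<sigma> (p n) (Suc i) \<le> mu l \<sigma> (p n) (Suc k))" for n
  proof -
    interpret weighted_plate l \<sigma> \<alpha> \<beta> "p n" by standard (fact l \<sigma> \<alpha>(1) p)+
    obtain e where "\<And>i. e i \<in> H2_even l" "\<And>i k. b (e i) (e k) = (if i = k then 1 else 0)"
      "\<And>i v. v \<in> H2_even l \<Longrightarrow> H2_inner l \<sigma> (e i) v = mu l \<sigma> (p n) (Suc i) * b (e i) v"
      "mono (\<lambda>i. mu l \<sigma> (p n) (Suc i))"
      by (rule eigen_basis) blast
    then show ?thesis by (intro exI[of _ e]) (auto simp: mono_def)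
  qed
  then obtain e where eH: "\<And>n i. e n i \<in> H2_even l"
    and eb: "\<And>n i j. weighted_plate.b l (p n) (e n i) (e n j) = (if i = j then 1 else 0)"
    and ea: "\<And>n i v. v \<in> H2_even l \<Longrightarrow> ?a (e n i) v = mu l \<sigma> (p n) (Suc i) * weighted_plate.b l (p n) (e n i) v"
    and emono: "\<And>n i. i \<le> k \<Longrightarrow> mu l \<sigma> (p n) (Suc i) \<le> mu l \<sigma> (p n) (Suc k)"
    by metis
  have muK: "mu l \<sigma> (p n) (Suc i) \<le> ?K" if "i \<le> k" for n i
  proof -
    have "1 / real (Suc n) \<le> 1" by simp
    then show ?thesis using emono[OF that, of n] pM[of n] by linarith
  qed
  have aK: "?a (e n i) (e n i) \<le> ?K" if "i \<le> k" for n i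
    using ea[OF eH, of n i n i] eb muK[OF that, of n] by simp
  obtain r where r: "strict_mono (r :: nat \<Rightarrow> nat)"
    and rC: "\<And>i \<epsilon>. i \<le> k \<Longrightarrow> \<epsilon> > 0 \<Longrightarrow> \<exists>N. \<forall>m\<ge>N. \<forall>n\<ge>N.
      ip (plate l) (e (r m) i - e (r n) i) (e (r m) i - e (r n) i) < \<epsilon>"
  proof -
    \<comment> \<open>Capping the index at k makes the energy bound hold for every index, as the
      extraction lemma demands.\<close>
    have "\<exists>r. strict_mono (r :: nat \<Rightarrow> nat) \<and> (\<forall>i\<le>k. \<forall>\<epsilon>>0. \<exists>N. \<forall>m\<ge>N. \<forall>n\<ge>N.
      ip (plate l) (e (r m) (min i k) - e (r n) (min i k)) (e (r m) (min i k) - e (r n) (min i k)) < \<epsilon>)"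
      by (rule H2_star_compact_finite[OF l \<sigma>, where K = ?K]) (use X.even_star[OF eH] aK in auto)
    then show ?thesis using that by (metis min.absorb1)
  qed
  have K0: "?K > 0"
    using mu_pos[OF l \<sigma> \<alpha>(1) p, of 0 0] muK[of 0 0] by simp
  \<comment> \<open>The energy of a difference D is a (e m) D - a (e n) D. The eigenvalue equations
    turn each term into an eigenvalue, at most \<open>?K\<close>, times a weighted product, which is
    small because D is small in L2. The threshold for D is chosen to match.\<close>
  have "\<exists>U\<in>H2_even l. (\<lambda>n. ?a (e (r n) i - U) (e (r n) i - U)) \<longlonglongrightarrow> 0" if i: "i \<le> k" for i
  proof (rule X.even_complete[OF eH], intro allI impI)
    fix \<epsilon> :: real assume \<epsilon>: "\<epsilon> > 0"
    let ?D = "\<lambda>m n. e (r m) i - e (r n) i"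
    have twice: "x - y \<le> 2 * h" if "\<bar>x\<bar> \<le> h" "\<bar>y\<bar> \<le> h" for x y h :: real using that by linarith
    have "(\<epsilon> / (2 * ?K))\<^sup>2 / \<beta> > 0" using \<epsilon> K0 \<beta> by simp
    from rC[OF i this] obtain N where N: "\<And>m n. m \<ge> N \<Longrightarrow> n \<ge> N \<Longrightarrow>
      ip (plate l) (?D m n) (?D m n) < (\<epsilon> / (2 * ?K))\<^sup>2 / \<beta>" by blast
    have "?a (?D m n) (?D m n) < \<epsilon>" if "m \<ge> N" "n \<ge> N" for m n
    proof -
      let ?s = "sqrt (\<beta> * ip (plate l) (?D m n) (?D m n))"
      have "\<beta> * ip (plate l) (?D m n) (?D m n) < (\<epsilon> / (2 * ?K))\<^sup>2"
        using N[OF that] \<beta> by (simp add: pos_less_divide_eq mult.commute)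
      then have "?s < sqrt ((\<epsilon> / (2 * ?K))\<^sup>2)" by (rule real_sqrt_less_mono)
      also have "\<dots> = \<epsilon> / (2 * ?K)" using \<epsilon> K0 by simp
      finally have s: "?s < \<epsilon> / (2 * ?K)" .
      have D: "?D m n \<in> H2_even l" using eH by (intro X.A.mem)
      have bnd: "\<bar>?a (e q i) (?D m n)\<bar> \<le> ?K * ?s" for q
      proof -
        interpret weighted_plate l \<sigma> \<alpha> \<beta> "p q" by standard (fact l \<sigma> \<alpha>(1) p)+
        have bs: "\<bar>b (e q i) (?D m n)\<bar> \<le> ?s" using b_cauchy_schwarz[OF eH[of q i] D, of 1] eb[of q i i] by simp
        have mus: "\<bar>mu l \<sigma> (p q) (Suc i)\<bar> \<le> ?K"
          unfolding abs_of_pos[OF mu_pos[OF l \<sigma> \<alpha>(1) p]] using i by (rule muK)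
        show ?thesis unfolding ea[OF D] abs_mult
          by (rule mult_mono[OF mus bs less_imp_le[OF K0] abs_ge_zero])
      qed
      have "?a (?D m n) (?D m n) = ?a (e (r m) i) (?D m n) - ?a (e (r n) i) (?D m n)"
        using eH D by (simp add: X.A.diff)
      also have "\<dots> \<le> 2 * (?K * ?s)" by (rule twice[OF bnd bnd])
      also have "\<dots> = ?s * (2 * ?K)" by (simp only: mult_ac)
      also have "\<dots> < \<epsilon>" using s K0 by (subst (asm) pos_less_divide_eq) auto
      finally show ?thesis .
    qed
    then show "\<exists>N. \<forall>m\<ge>N. \<forall>n\<ge>N. ?a (?D m n) (?D m n) < \<epsilon>" by blast
  qed
  then have "\<forall>i\<in>{..k}. \<exists>U. U \<in> H2_even l \<and> (\<lambda>n. ?a (e (r n) i - U) (e (r n) i - U)) \<longlonglongrightarrow> 0" by blast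
  from bchoice[OF this] obtain U where UH: "\<And>i. i \<le> k \<Longrightarrow> U i \<in> H2_even l"
    and Ua: "\<And>i. i \<le> k \<Longrightarrow> (\<lambda>n. ?a (e (r n) i - U i) (e (r n) i - U i)) \<longlonglongrightarrow> 0"
    by auto
  have Ul: "U i \<in> l2 (plate l)" if "i \<le> k" for i using UH[OF that] by (rule X.even_l2)
  have dH: "e n i - U i \<in> H2_even l" if "i \<le> k" for n i using eH UH[OF that] by (intro X.A.mem)
  have Uip: "(\<lambda>n. ip (plate l) (e (r n) i - U i) (e (r n) i - U i)) \<longlonglongrightarrow> 0" if i: "i \<le> k" for i
  proof (rule tendsto_sandwich[OF _ _ tendsto_const])
    show "(\<lambda>n. X.embedding_const * ?a (e (r n) i - U i) (e (r n) i - U i)) \<longlonglongrightarrow> 0"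
      using Ua[OF i] by (rule tendsto_mult_right_zero)
    show "\<forall>\<^sub>F n in sequentially. ip (plate l) (e (r n) i - U i) (e (r n) i - U i) \<le>
      X.embedding_const * ?a (e (r n) i - U i) (e (r n) i - U i)"
      using X.embedding(2)[OF X.even_star[OF dH[OF i]]] by simp
    show "\<forall>\<^sub>F n in sequentially. 0 \<le> ip (plate l) (e (r n) i - U i) (e (r n) i - U i)"
      using l2.nonneg[OF X.even_l2[OF dH[OF i]]] by simp
  qed
  \<comment> \<open>The eigenfunctions are replaced by their limits while the weight still varies;
    the two error terms are small uniformly in the weight because of its bound \<beta>.\<close>
  have Ub: "(\<lambda>n. \<integral>z. p (r n) z * (U i z * U j z) \<partial>plate l) \<longlonglongrightarrow> (if i = j then 1 else 0)"
    if i: "i \<le> k" and j: "j \<le> k" for i j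
  proof (rule LIM_zero_cancel, rule Lim_null_comparison)
    let ?d = "\<lambda>i n. ip (plate l) (e (r n) i - U i) (e (r n) i - U i)"
    let ?s = "\<lambda>n. sqrt (1 * (\<beta> * ?d i n)) + sqrt (\<beta> * ip (plate l) (U i) (U i) * (\<beta> * ?d j n))"
    have "?s \<longlonglongrightarrow> sqrt (1 * (\<beta> * 0)) + sqrt (\<beta> * ip (plate l) (U i) (U i) * (\<beta> * 0))"
      by (intro tendsto_intros Uip i j)
    then show "?s \<longlonglongrightarrow> 0" by simp
    have "\<bar>(\<integral>z. p (r n) z * (U i z * U j z) \<partial>plate l) - (if i = j then 1 else 0)\<bar> \<le> ?s n" for n
    proof -
      let ?w = "e (r n)"
      interpret weighted_plate l \<sigma> \<alpha> \<beta> "p (r n)" by standard (fact l \<sigma> \<alpha>(1) p)+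
      have "(\<integral>z. p (r n) z * (U i z * U j z) \<partial>plate l) = b (U i) (U j)"
        by (simp add: b_def mult.assoc)
      moreover have "b (U i) (U j) - b (?w i) (?w j) = - b (?w j) (?w i - U i) - b (U i) (?w j - U j)"
        using eH UH i j B.sym[OF eH[of "r n" j] eH[of "r n" i]] B.sym[OF eH[of "r n" j] UH[OF i]]
        by (simp add: B.diff_right)
      moreover have "\<bar>b (?w j) (?w i - U i)\<bar> \<le> sqrt (1 * (\<beta> * ?d i n))"
        by (rule b_cauchy_schwarz[OF eH dH[OF i]]) (simp add: eb)
      moreover have "\<bar>b (U i) (?w j - U j)\<bar> \<le> sqrt (\<beta> * ip (plate l) (U i) (U i) * (\<beta> * ?d j n))"
        using UH[OF i] dH[OF j] b_lower_upper(2)[OF Ul[OF i]] by (rule b_cauchy_schwarz)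
      ultimately show ?thesis unfolding eb[symmetric, of i j "r n"] by linarith
    qed
    then show "\<forall>\<^sub>F n in sequentially. norm ((\<integral>z. p (r n) z * (U i z * U j z) \<partial>plate l) - (if i = j then 1 else 0)) \<le> ?s n"
      unfolding real_norm_def by (intro always_eventually allI)
  qed
  define G where "G = (\<lambda>(i, j) z. U i z * U j z) ` ({..k} \<times> {..k})"
  have "\<exists>q\<in>weights l \<alpha> \<beta>. \<forall>g\<in>G. (\<integral>z. q z * g z \<partial>plate l) = lim (\<lambda>n. \<integral>z. p (r n) z * g z \<partial>plate l)"
  proof (rule weights_compact[OF l, of "\<lambda>n. p (r n)"])
    show "finite G" by (simp add: G_def)
    fix g assume "g \<in> G"
    then obtain i j where g: "i \<le> k" "j \<le> k" "g = (\<lambda>z. U i z * U j z)" by (auto simp: G_def)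
    show "integrable (plate l) g" unfolding g(3) by (intro l2_mult Ul g)
    show "(\<lambda>n. \<integral>z. p (r n) z * g z \<partial>plate l) \<longlonglongrightarrow> lim (\<lambda>n. \<integral>z. p (r n) z * g z \<partial>plate l)"
      using Ub[OF g(1,2)] unfolding g(3) by (intro convergent_LIMSEQ_iff[THEN iffD1] convergentI)
  qed (rule p)
  then obtain q where q: "q \<in> weights l \<alpha> \<beta>"
    and qG: "\<And>g. g \<in> G \<Longrightarrow> (\<integral>z. q z * g z \<partial>plate l) = lim (\<lambda>n. \<integral>z. p (r n) z * g z \<partial>plate l)" by blast
  interpret Q: weighted_plate l \<sigma> \<alpha> \<beta> q by standard (fact l \<sigma> \<alpha>(1) q)+
  have qb: "Q.b (U i) (U j) = (if i = j then 1 else 0)" if "i \<le> k" "j \<le> k" for i j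
  proof -
    have "(\<lambda>z. U i z * U j z) \<in> G" using that by (force simp: G_def)
    from qG[OF this] show ?thesis using limI[OF Ub[OF that]] by (simp add: Q.b_def mult.assoc)
  qed
  \<comment> \<open>The equation makes the energy matrix of the eigenfunctions diagonal with the
    eigenvalues on the diagonal. In the limit it stays diagonal, with entries at most
    \<open>?M\<close>.\<close>
  have alim: "(\<lambda>n. mu l \<sigma> (p (r n)) (Suc i) * (if i = j then 1 else 0)) \<longlonglongrightarrow> ?a (U i) (U j)" if "i \<le> k" "j \<le> k" for i j
  proof -
    have "(\<lambda>n. ?a (e (r n) i) (e (r n) j)) \<longlonglongrightarrow> ?a (U i) (U j)"
      by (rule X.A.tendsto_form) (intro eH UH that Ua)+
    then show ?thesis unfolding ea[OF eH] eb .
  qed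
  have a0: "?a (U i) (U j) = 0" if "i \<le> k" "j \<le> k" "i \<noteq> j" for i j
    using alim[OF that(1,2)] that(3) by (simp add: LIMSEQ_const_iff)
  have a1: "?a (U i) (U i) \<le> ?M" if "i \<le> k" for i
  proof (rule LIMSEQ_le)
    show "(\<lambda>n. mu l \<sigma> (p (r n)) (Suc i)) \<longlonglongrightarrow> ?a (U i) (U i)" using alim[OF that that] by simp
    have "(\<lambda>n. 1 / real (Suc (r n))) \<longlonglongrightarrow> 0"
      using LIMSEQ_subseq_LIMSEQ[OF lim_1_over_n[THEN LIMSEQ_Suc] r] by (simp add: o_def)
    then show "(\<lambda>n. ?M + 1 / real (Suc (r n))) \<longlonglongrightarrow> ?M" using tendsto_add[OF tendsto_const] by fastforce
    show "\<exists>N. \<forall>n\<ge>N. mu l \<sigma> (p (r n)) (Suc i) \<le> ?M + 1 / real (Suc (r n))"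
      using order_trans[OF emono[OF that] less_imp_le[OF pM]] by blast
  qed
  have bsum: "Q.b (\<Sum>i\<le>k. c i *\<^sub>R U i) (\<Sum>i\<le>k. c i *\<^sub>R U i) = (\<Sum>i\<le>k. (c i)\<^sup>2)" for c
    by (subst Q.B.orthogonal_combination) (auto simp: UH qb)
  have asum: "?a (\<Sum>i\<le>k. c i *\<^sub>R U i) (\<Sum>i\<le>k. c i *\<^sub>R U i) \<le> ?M * (\<Sum>i\<le>k. (c i)\<^sup>2)" for c
  proof -
    have "?a (\<Sum>i\<le>k. c i *\<^sub>R U i) (\<Sum>i\<le>k. c i *\<^sub>R U i) = (\<Sum>i\<le>k. (c i)\<^sup>2 * ?a (U i) (U i))"
      by (rule X.A.orthogonal_combination) (auto simp: UH a0)
    also have "\<dots> \<le> (\<Sum>i\<le>k. (c i)\<^sup>2 * ?M)" using a1 by (intro sum_mono mult_left_mono) auto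
    finally show ?thesis by (simp add: sum_distrib_left mult.commute)
  qed
  have "mu l \<sigma> q (Suc k) \<le> ?M"
  proof (rule Q.mu_le[OF UH])
    fix c i assume "Q.b (\<Sum>i\<le>k. c i *\<^sub>R U i) (\<Sum>i\<le>k. c i *\<^sub>R U i) = 0" "i \<le> k"
    then show "c i = 0" by (simp add: bsum sum_nonneg_eq_0_iff)
  qed (use asum bsum in auto)
  then show ?thesis using mu_inf_le[OF l \<sigma> \<alpha>(1) q, of k] q by force
qed

theorem mu_inf_le_power4:
  assumes l: "l > 0" and \<sigma>: "0 < \<sigma>" "\<sigma> < 1 / 2" and \<alpha>: "0 < \<alpha>" "\<alpha> \<le> 1" and \<beta>: "1 \<le> \<beta>"
  shows "mu_inf l \<sigma> \<alpha> \<beta> (Suc k) \<le> real (Suc k) ^ 4"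
proof -
  have one: "(\<lambda>z. 1) \<in> weights l \<alpha> \<beta>" using l \<alpha>(2) \<beta> by (rule const_weight)
  interpret weighted_plate l \<sigma> \<alpha> \<beta> "\<lambda>z. 1" by standard fact+
  have "mu l \<sigma> (\<lambda>z. 1) (Suc k) \<le> real (Suc k) ^ 4"
  proof (rule mu_le)
    show "sine (Suc i) \<in> H2_even l" for i using l by (rule sine_H2_even)
    show "c i = 0" if "b (\<Sum>i\<le>k. c i *\<^sub>R sine (Suc i)) (\<Sum>i\<le>k. c i *\<^sub>R sine (Suc i)) = 0" "i \<le> k" for c i
      using that by (rule sine_independent)
    fix c :: "nat \<Rightarrow> real"
    let ?w = "\<Sum>i\<le>k. c i *\<^sub>R sine (Suc i)"
    have "b ?w ?w = ip (plate l) ?w ?w" by (simp add: b_ip)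
    then have b: "b ?w ?w = pi * l * (\<Sum>i\<le>k. (c i)\<^sup>2)" using sine_combination(1)[of "{..k}" Suc c] by simp
    have "H2_inner l \<sigma> ?w ?w = pi * l * (\<Sum>i\<le>k. (c i)\<^sup>2 * real (Suc i) ^ 4)"
      using sine_combination(2)[of "{..k}" Suc c] by simp
    also have "\<dots> \<le> pi * l * (\<Sum>i\<le>k. (c i)\<^sup>2 * real (Suc k) ^ 4)"
      using l by (intro mult_left_mono sum_mono power_mono) auto
    also have "\<dots> = real (Suc k) ^ 4 * b ?w ?w" by (simp only: b sum_distrib_right[symmetric] mult_ac)
    finally show "H2_inner l \<sigma> ?w ?w \<le> real (Suc k) ^ 4 * b ?w ?w" .
  qed
  then show ?thesis using mu_inf_le[OF l \<sigma> \<alpha>(1) one, of k] by simp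
qed

section \<open>Trial functions and the piecewise constant weight\<close>

lemma L2_norm_on_power2: "(L2_norm_on D f)\<^sup>2 = (\<integral>z. (f z)\<^sup>2 \<partial>lebesgue_on D)"
  unfolding L2_norm_on_def by (intro real_sqrt_pow2 integral_nonneg_AE) simp

lemma strip_borel [measurable]: "strip l j m \<in> sets borel"
  unfolding strip_def by (intro borel_open open_Times open_greaterThanLessThan)

lemma w_trial_l2:
  assumes "l \<ge> 0"
  shows "w_trial l j m \<in> l2 (plate l)"
proof -
  interpret finite_measure "plate l" using assms by (rule finite_measure_plate)
  have "(\<lambda>z :: real \<times> real. (sin (real j * fst z))\<^sup>2) \<in> borel_measurable borel"
    by (intro borel_measurable_continuous_onI continuous_intros)
  then have "w_trial l j m \<in> borel_measurable borel"
    unfolding w_trial_def by (rule measurable_If_set) auto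
  then show ?thesis
    by (intro l2_bounded[where K = 1] borel_measurable_plate AE_I2)
       (auto simp: w_trial_def power_le_one abs_square_le_1)
qed

text \<open>Inside the strip, j x lies strictly between consecutive multiples of pi.\<close>

lemma sin_strip_nonzero:
  assumes z: "z \<in> strip l j m" and j: "j \<ge> 1"
  shows "sin (real j * fst z) \<noteq> 0"
proof
  assume "sin (real j * fst z) = 0"
  then obtain n :: int where n: "real j * fst z = real_of_int n * pi" by (auto simp: sin_zero_iff_int2)
  have "(real m - 1) * pi / real j < fst z" "fst z < real m * pi / real j" using z by (auto simp: strip_def)
  then have "(real m - 1) * pi < real j * fst z" "real j * fst z < real m * pi"
    using j by (auto simp: pos_divide_less_eq pos_less_divide_eq mult.commute)
  then have "real_of_int (int m - 1) < real_of_int n" "real_of_int n < real_of_int (int m)" unfolding n by auto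
  then show False unfolding of_int_less_iff by linarith
qed

lemma strip_subset_Omega:
  assumes "m \<in> {1..j}"
  shows "strip l j m \<subseteq> Omega l"
proof -
  have "0 \<le> (real m - 1) * pi / real j" using assms by simp
  moreover have "real m * pi / real j \<le> pi" using assms by (simp add: pos_divide_le_eq mult.commute)
  ultimately show ?thesis by (auto simp: strip_def Omega_def)
qed

lemma strip_disjoint:
  assumes z: "z \<in> strip l j m" "z \<in> strip l j n" and j: "j \<ge> 1"
  shows "m = n"
proof -
  have "(real i - 1) * pi < real j * fst z \<and> real j * fst z < real i * pi" if "z \<in> strip l j i" for i
    using that j by (auto simp: strip_def pos_divide_less_eq pos_less_divide_eq mult.commute)
  from this[OF z(1)] this[OF z(2)] have "(real m - 1) * pi < real n * pi" "(real n - 1) * pi < real m * pi"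
    by linarith+
  then have "real m - 1 < real n" "real n - 1 < real m" by auto
  then show ?thesis by linarith
qed

text \<open>The trial function is nonzero on the whole strip, a nonempty open set, which is not
  negligible.\<close>

lemma w_trial_not_null:
  assumes l: "l > 0" and m: "m \<in> {1..j}"
  shows "\<not> (AE z in plate l. w_trial l j m z = 0)"
proof
  assume "AE z in plate l. w_trial l j m z = 0"
  then have "AE z in lborel. z \<in> Omega l \<longrightarrow> w_trial l j m z = 0" unfolding AE_plate_iff .
  then have "AE z in lborel. z \<notin> strip l j m"
  proof eventually_elim
    case (elim z)
    then show ?case
      using strip_subset_Omega[OF m] sin_strip_nonzero[of z l j m] m by (auto simp: w_trial_def)
  qed
  then have "strip l j m \<in> null_sets lborel" by (subst AE_iff_null_sets) auto
  then have "negligible (strip l j m)" by (simp add: negligible_iff_null_sets null_sets_completionI)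
  moreover have "open (strip l j m)" unfolding strip_def by (intro open_Times open_greaterThanLessThan)
  moreover have "strip l j m \<noteq> {}"
  proof -
    have "(real m - 1) * pi / real j < real m * pi / real j" using m by (intro divide_strict_right_mono) auto
    then show ?thesis using l by (simp add: strip_def)
  qed
  ultimately show False using open_not_negligible by blast
qed

lemma sin_power4_le_1: "sin x ^ 4 \<le> (1 :: real)"
  using power_le_one[of "(sin x)\<^sup>2" 2] by (simp add: abs_square_le_1 flip: power_mult)

lemma sum_w_trial_le:
  assumes "j \<ge> 1"
  shows "(\<Sum>m=1..j. (w_trial l j m z)\<^sup>2) \<le> 1"
proof -
  let ?I = "{m \<in> {1..j}. z \<in> strip l j m}"
  have "(\<Sum>m=1..j. (w_trial l j m z)\<^sup>2) \<le> (\<Sum>m=1..j. if z \<in> strip l j m then 1 else 0)"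
    by (intro sum_mono) (auto simp: w_trial_def sin_power4_le_1)
  also have "\<dots> = real (card ?I)" by (simp add: sum.If_cases Int_def)
  also have "card ?I \<le> Suc 0" by (subst card_le_Suc0_iff_eq) (auto intro: strip_disjoint[OF _ _ assms])
  finally show ?thesis by simp
qed

abbreviation sin2 :: "nat \<Rightarrow> real \<times> real \<Rightarrow> real" where
  "sin2 j \<equiv> \<lambda>z. (sin (real j * fst z))\<^sup>2"

lemma sin2_l2: "l \<ge> 0 \<Longrightarrow> sin2 j \<in> l2 (plate l)"
  by (intro continuous_l2_plate continuous_intros) auto

section \<open>Lower bounds for reciprocals of weighted norms\<close>

context weighted_plate
begin

lemma weighted_norm:
  assumes w: "w \<in> l2 (plate l)"
  shows "(L2_norm_on (Omega l) (\<lambda>z. sqrt (p z) * w z))\<^sup>2 = b w w"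
  unfolding L2_norm_on_power2 b_def
proof (rule integral_cong_AE)
  show "AE z in plate l. (sqrt (p z) * w z)\<^sup>2 = p z * w z * w z"
    using p_bounds by eventually_elim (use \<alpha> in \<open>auto simp: power_mult_distrib power2_eq_square\<close>)
qed (use p_measurable w in \<open>auto simp: l2_def\<close>)

lemma b_pos:
  assumes "w \<in> l2 (plate l)" "\<not> (AE z in plate l. w z = 0)"
  shows "b w w > 0"
proof -
  have "0 \<le> \<alpha> * ip (plate l) w w" using \<alpha> l2.nonneg[OF assms(1)] by simp
  then have "0 \<le> b w w" using b_lower_upper(1)[OF assms(1)] by (rule order_trans)
  then show ?thesis using b_null_iff[OF assms(1)] assms(2) by (simp add: less_le)
qed

lemma p_integrable: "integrable (plate l) p"
proof -
  interpret finite_measure "plate l" using l by (intro finite_measure_plate) simp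
  show ?thesis
  proof (rule integrable_const_bound[OF _ p_measurable])
    show "AE z in plate l. norm (p z) \<le> \<beta>" using p_bounds by eventually_elim (use \<alpha> in auto)
  qed
qed

lemma sum_b_le:
  assumes w: "\<And>m. m \<in> I \<Longrightarrow> w m \<in> l2 (plate l)" and le: "\<And>z. (\<Sum>m\<in>I. (w m z)\<^sup>2) \<le> 1"
  shows "(\<Sum>m\<in>I. b (w m) (w m)) \<le> measure lebesgue (Omega l)"
proof -
  have int: "integrable (plate l) (\<lambda>z. p z * w m z * w m z)" if "m \<in> I" for m
    using l2_mult[OF pu_l2[OF w[OF that]] w[OF that]] .
  have "(\<Sum>m\<in>I. b (w m) (w m)) = (\<integral>z. (\<Sum>m\<in>I. p z * w m z * w m z) \<partial>plate l)"
    unfolding b_def using int by (rule Bochner_Integration.integral_sum[symmetric])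
  also have "\<dots> \<le> (\<integral>z. p z \<partial>plate l)"
  proof (rule integral_mono_AE[OF Bochner_Integration.integrable_sum[OF int] p_integrable])
    show "AE z in plate l. (\<Sum>m\<in>I. p z * w m z * w m z) \<le> p z"
      using p_bounds
    proof eventually_elim
      case (elim z)
      then have "p z * (\<Sum>m\<in>I. (w m z)\<^sup>2) \<le> p z * 1" using \<alpha> le by (intro mult_left_mono) auto
      then show ?case by (simp add: sum_distrib_left power2_eq_square mult.assoc)
    qed
  qed
  finally show ?thesis unfolding p_integral .
qed

text \<open>Rules out the default value 1 / 0 = 0 in the maximum of reciprocals.\<close>

lemma trial_pos: "m \<in> {1..j} \<Longrightarrow> b (w_trial l j m) (w_trial l j m) > 0"
  using l by (intro b_pos w_trial_l2 w_trial_not_null) auto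

lemma sin2_pos:
  assumes "j \<ge> 1"
  shows "b (sin2 j) (sin2 j) > 0"
proof (rule b_pos)
  show "sin2 j \<in> l2 (plate l)" using l by (intro sin2_l2) simp
  show "\<not> (AE z in plate l. sin2 j z = 0)"
  proof
    assume "AE z in plate l. sin2 j z = 0"
    then have "AE z in plate l. w_trial l j 1 z = 0" by eventually_elim (auto simp: w_trial_def)
    then show False using w_trial_not_null[OF l, of 1 j] assms by simp
  qed
qed

lemma max_trial_ge:
  assumes j: "j \<ge> 1"
  shows "real j / measure lebesgue (Omega l) \<le>
    (MAX m\<in>{1..j}. 1 / (L2_norm_on (Omega l) (\<lambda>z. sqrt (p z) * w_trial l j m z))\<^sup>2)"
proof -
  let ?N = "\<lambda>m. b (w_trial l j m) (w_trial l j m)"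
  define M where "M = (MAX m\<in>{1..j}. 1 / ?N m)"
  have wl: "w_trial l j m \<in> l2 (plate l)" for m using l by (intro w_trial_l2) simp
  have le: "1 / ?N m \<le> M" if "m \<in> {1..j}" for m unfolding M_def using that by (intro Max_ge) auto
  have M: "M > 0" using le[of 1] trial_pos[of 1 j] j by (metis atLeastAtMost_iff divide_pos_pos le_refl less_le_trans zero_less_one)
  have "real j * (1 / M) = (\<Sum>m=1..j. 1 / M)" by simp
  also have "\<dots> \<le> (\<Sum>m=1..j. ?N m)"
  proof (rule sum_mono)
    fix m assume m: "m \<in> {1..j}"
    show "1 / M \<le> ?N m" using le[OF m] trial_pos[OF m] M by (simp add: divide_le_eq mult.commute)
  qed
  also have "\<dots> \<le> measure lebesgue (Omega l)" using wl sum_w_trial_le[OF j] by (rule sum_b_le)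
  finally have "real j \<le> M * measure lebesgue (Omega l)" using M by (simp add: divide_le_eq mult.commute)
  moreover have "measure lebesgue (Omega l) > 0" using l by (subst measure_Omega) auto
  ultimately have "real j / measure lebesgue (Omega l) \<le> M" by (subst pos_divide_le_eq)
  then show ?thesis unfolding weighted_norm[OF wl] M_def .
qed

lemma sin2_ge:
  assumes j: "j \<ge> 1"
  shows "1 / measure lebesgue (Omega l) \<le> 1 / (L2_norm_on (Omega l) (\<lambda>z. sqrt (p z) * sin2 j z))\<^sup>2"
proof -
  have wl: "sin2 j \<in> l2 (plate l)" using l by (intro sin2_l2) simp
  \<comment> \<open>The sum bound is used for a family with a single member.\<close>
  have "(\<Sum>m\<in>{1::nat}. b (sin2 j) (sin2 j)) \<le> measure lebesgue (Omega l)"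
    by (rule sum_b_le[OF wl]) (simp add: sin_power4_le_1)
  then show ?thesis unfolding weighted_norm[OF wl] using sin2_pos[OF j] by (intro divide_left_mono) auto
qed

end

section \<open>Level sets of the fourth power of the sine and the bathtub weight\<close>

lemma countable_sin_level:
  assumes "a > 0"
  shows "countable {x :: real. sin (a * x) = c}"
proof (cases "{x. sin (a * x) = c} = {}")
  case False
  then obtain y where y: "sin (a * y) = c" by blast
  have "{x. sin (a * x) = c} \<subseteq> (\<lambda>n. (a * y + 2 * n * pi) / a) ` \<int> \<union> (\<lambda>n. (- (a * y) + (2 * n + 1) * pi) / a) ` \<int>"
  proof
    fix x assume "x \<in> {x. sin (a * x) = c}"
    then obtain n where n: "n \<in> \<int>" "a * x = a * y + 2 * n * pi \<or> a * x = - (a * y) + (2 * n + 1) * pi"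
      using y sin_eq[of "a * x" "a * y"] by auto
    have "x = (a * y + 2 * n * pi) / a \<or> x = (- (a * y) + (2 * n + 1) * pi) / a"
      using n(2) assms by (simp only: eq_divide_eq mult.commute[of x]) auto
    then show "x \<in> (\<lambda>n. (a * y + 2 * n * pi) / a) ` \<int> \<union> (\<lambda>n. (- (a * y) + (2 * n + 1) * pi) / a) ` \<int>"
      using n(1) by blast
  qed
  then show ?thesis
    by (rule countable_subset) (auto intro!: countable_Un countable_image simp: Ints_def)
qed simp

text \<open>Only countably many x give the level t, so the level set is a null set of vertical
  lines. This makes the area of the sublevel sets continuous in t.\<close>

lemma AE_sin_level:
  assumes j: "j \<ge> 1"
  shows "AE z :: real \<times> real in lborel. sin (real j * fst z) ^ 4 \<noteq> t"
proof -
  have "{x. sin (real j * x) ^ 4 = t} \<subseteq> {x. sin (real j * x) = root 4 t} \<union> {x. sin (real j * x) = - root 4 t}"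
  proof
    fix x assume "x \<in> {x. sin (real j * x) ^ 4 = t}"
    then have "root 4 t = \<bar>sin (real j * x)\<bar>"
      using real_root_power_cancel[of 4 "\<bar>sin (real j * x)\<bar>"] by simp
    then show "x \<in> {x. sin (real j * x) = root 4 t} \<union> {x. sin (real j * x) = - root 4 t}" by auto
  qed
  then have "countable {x. sin (real j * x) ^ 4 = t}"
    by (rule countable_subset) (use j in \<open>auto intro!: countable_Un countable_sin_level\<close>)
  then have "AE x in lborel. x \<notin> {x. sin (real j * x) ^ 4 = t}"
    by (intro AE_not_in countable_imp_null_set_lborel)
  then have "AE x in lborel. sin (real j * x) ^ 4 \<noteq> t" by simp
  from AE_swap[OF AE_planar_snd[OF this]] show ?thesis by simp
qed

lemma S_level_borel [measurable]: "S_level l j t \<in> sets borel"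
proof -
  have "closed {z :: real \<times> real. sin (real j * fst z) ^ 4 \<le> t}" by (intro closed_Collect_le continuous_intros)
  moreover have "S_level l j t = Omega l \<inter> {z. sin (real j * fst z) ^ 4 \<le> t}" by (auto simp: S_level_def)
  ultimately show ?thesis by auto
qed

lemma S_level_integral:
  assumes "l \<ge> 0"
  shows "integrable (plate l) (indicator (S_level l j t) :: _ \<Rightarrow> real)"
    and "(\<integral>z. indicator (S_level l j t) z \<partial>plate l) = measure lebesgue (S_level l j t)"
proof -
  interpret finite_measure "plate l" using assms by (rule finite_measure_plate)
  have S: "S_level l j t \<subseteq> Omega l" by (auto simp: S_level_def)
  then have s: "S_level l j t \<in> sets (plate l)" by (auto simp: sets_restrict_space_iff)
  then show "integrable (plate l) (indicator (S_level l j t) :: _ \<Rightarrow> real)" by (intro integrable_real_indicator) (auto simp: less_top[symmetric])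
  show "(\<integral>z. indicator (S_level l j t) z \<partial>plate l) = measure lebesgue (S_level l j t)"
    using S s by (simp add: measure_restrict_space Int_absorb2)
qed

text \<open>Intermediate value theorem: the area of the sublevel set is continuous in t, 0 at t = 0
  and that of the whole plate at t = 1.\<close>

theorem S_level_measure_surj:
  assumes l: "l > 0" and j: "j \<ge> 1" and c: "0 < c" "c \<le> measure lebesgue (Omega l)"
  shows "\<exists>t>0. measure lebesgue (S_level l j t) = c"
proof -
  let ?F = "\<lambda>t. measure lebesgue (S_level l j t)" and ?f = "\<lambda>z :: real \<times> real. sin (real j * fst z) ^ 4"
  interpret finite_measure "plate l" using l by (intro finite_measure_plate) simp
  note F = S_level_integral[OF less_imp_le[OF l], of j]
  have ne: "AE z in plate l. ?f z \<noteq> t" for t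
    unfolding AE_plate_iff using AE_sin_level[OF j, of t] by eventually_elim simp
  have "continuous_on {0..1} ?F"
  proof (rule continuous_on_sequentiallyI)
    fix u :: "nat \<Rightarrow> real" and t :: real assume u: "u \<longlonglongrightarrow> t"
    have "(\<lambda>n. \<integral>z. indicator (S_level l j (u n)) z \<partial>plate l) \<longlonglongrightarrow> (\<integral>z. indicator (S_level l j t) z \<partial>plate l :: real)"
    proof (rule integral_dominated_convergence[where w = "\<lambda>z. 1"])
      show "AE z in plate l. (\<lambda>n. indicator (S_level l j (u n)) z) \<longlonglongrightarrow> (indicator (S_level l j t) z :: real)"
        using ne[of t]
      proof eventually_elim
        case (elim z)
        have "\<forall>\<^sub>F n in sequentially. ?f z \<le> u n \<longleftrightarrow> ?f z \<le> t"
        proof (cases "?f z < t")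
          case True
          then show ?thesis using order_tendstoD(1)[OF u, of "?f z"] by (auto elim: eventually_mono)
        next
          case False
          then have "t < ?f z" using elim by simp
          then show ?thesis using order_tendstoD(2)[OF u, of "?f z"] by (auto elim: eventually_mono)
        qed
        then have "\<forall>\<^sub>F n in sequentially. indicator (S_level l j (u n)) z = (indicator (S_level l j t) z :: real)"
          by eventually_elim (auto simp: S_level_def indicator_def)
        then show ?case by (rule tendsto_eventually)
      qed
    qed (use borel_measurable_integrable[OF F(1)] in \<open>simp_all add: indicator_le_1\<close>)
    then show "(\<lambda>n. ?F (u n)) \<longlonglongrightarrow> ?F t" unfolding F(2) .
  qed
  moreover have F0: "?F 0 = 0"
  proof -
    have "(\<integral>z. indicator (S_level l j 0) z \<partial>plate l) = (\<integral>z. 0 \<partial>plate l :: real)"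
    proof (rule integral_cong_AE)
      show "AE z in plate l. indicator (S_level l j 0) z = (0 :: real)"
        using ne[of 0]
      proof eventually_elim
        case (elim z)
        have "0 \<le> ?f z" by simp
        then show ?case using elim by (auto simp: S_level_def indicator_def simp del: power_eq_0_iff)
      qed
    qed (use F(1) in auto)
    then show ?thesis unfolding F(2) by simp
  qed
  moreover have "S_level l j 1 = Omega l"
  proof -
    have "?f z \<le> 1" for z using power_le_one[of "\<bar>sin (real j * fst z)\<bar>" 4] by simp
    then show ?thesis by (auto simp: S_level_def)
  qed
  ultimately obtain t where t: "0 \<le> t" "?F t = c" using IVT'[of ?F 0 c 1] c by auto
  \<comment> \<open>At t = 0 the area is 0, but c is positive.\<close>
  then have "t \<noteq> 0" using F0 c by auto
  then show ?thesis using t by (intro exI[of _ t]) auto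
qed

text \<open>The prescribed area of the sublevel set solves \<beta> |Omega| - (\<beta> - \<alpha>)
  |S| = |Omega|. Periodicity holds because a shift of x by pi / j changes at most the sign of sin (j
  x).\<close>

lemma bang_bang_periodic_weight:
  assumes l: "l > 0" and \<alpha>\<beta>: "\<alpha> < \<beta>" and j: "j \<ge> 1"
    and S: "measure lebesgue (S_level l j t) = (\<beta> - 1) / (\<beta> - \<alpha>) * measure lebesgue (Omega l)"
  shows "bang_bang_weight l \<alpha> \<beta> j t \<in> periodic_weights l \<alpha> \<beta> j"
proof -
  let ?w = "bang_bang_weight l \<alpha> \<beta> j t" and ?O = "measure lebesgue (Omega l)"
  interpret finite_measure "plate l" using l by (intro finite_measure_plate) simp
  have eq: "?w z = \<beta> - (\<beta> - \<alpha>) * indicator (S_level l j t) z" if "z \<in> Omega l" for z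
    using that by (auto simp: bang_bang_weight_def indicator_def)
  have i: "integrable (plate l) (indicator (S_level l j t) :: _ \<Rightarrow> real)"
    "(\<integral>z. indicator (S_level l j t) z \<partial>plate l) = measure lebesgue (S_level l j t)"
    using S_level_integral[of l j t] l by auto
  have "?w \<in> borel_measurable borel" unfolding bang_bang_weight_def by measurable
  then have "?w \<in> borel_measurable (plate l)" by (rule borel_measurable_plate)
  moreover have "AE z in plate l. \<alpha> \<le> ?w z \<and> ?w z \<le> \<beta>"
    using \<alpha>\<beta> by (intro AE_I2) (auto simp: eq indicator_def)
  moreover have "AE z in plate l. ?w z = ?w (fst z, - snd z)"
    by (intro AE_I2) (auto simp: bang_bang_weight_def indicator_def S_level_def Omega_def)
  moreover have "(\<integral>z. ?w z \<partial>plate l) = ?O"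
  proof -
    have "(\<integral>z. ?w z \<partial>plate l) = (\<integral>z. \<beta> - (\<beta> - \<alpha>) * indicator (S_level l j t) z \<partial>plate l)"
      by (intro Bochner_Integration.integral_cong) (auto simp: eq)
    also have "\<dots> = \<beta> * ?O - (\<beta> - \<alpha>) * measure lebesgue (S_level l j t)"
      using i l measure_Omega[of l] by (simp add: measure_plate mult.commute)
    also have "\<dots> = ?O" unfolding S using \<alpha>\<beta> by (simp add: field_simps)
    finally show ?thesis .
  qed
  moreover have "AE z in plate l. fst z + pi / real j < pi \<longrightarrow> ?w z = ?w (fst z + pi / real j, snd z)"
  proof (intro AE_I2 impI)
    fix z assume z: "z \<in> space (plate l)" "fst z + pi / real j < pi"
    have "real j * (fst z + pi / real j) = real j * fst z + pi" using j by (simp add: distrib_left)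
    then have "sin (real j * (fst z + pi / real j)) ^ 4 = sin (real j * fst z) ^ 4" by simp
    moreover have "0 < fst z + pi / real j" using z(1) j by (auto simp: Omega_def intro!: add_pos_pos)
    ultimately show "?w z = ?w (fst z + pi / real j, snd z)"
      using z by (auto simp: bang_bang_weight_def indicator_def S_level_def Omega_def)
  qed
  ultimately show ?thesis by (simp add: periodic_weights_def weights_def)
qed

text \<open>Bathtub principle: \<open>(p\<^sub>t - p) (sin\<^sup>4 - t)\<close> is nonnegative and \<open>p\<^sub>t - p\<close> has mean zero.\<close>

lemma bang_bang_maximizes:
  assumes l: "l > 0" and \<alpha>: "0 < \<alpha>" and q: "q \<in> weights l \<alpha> \<beta>"
    and p: "bang_bang_weight l \<alpha> \<beta> j t \<in> weights l \<alpha> \<beta>"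
  shows "(\<integral>z. q z * sin2 j z * sin2 j z \<partial>plate l) \<le> (\<integral>z. bang_bang_weight l \<alpha> \<beta> j t z * sin2 j z * sin2 j z \<partial>plate l)"
proof -
  let ?w = "bang_bang_weight l \<alpha> \<beta> j t" and ?f = "\<lambda>z. sin2 j z * sin2 j z"
  \<comment> \<open>The value 1 / 4 is some admissible \<sigma>; the claim concerns weighted
    integrals, where \<sigma> does not occur.\<close>
  interpret Q: weighted_plate l "1 / 4" \<alpha> \<beta> q by standard (use l \<alpha> q in auto)
  interpret W: weighted_plate l "1 / 4" \<alpha> \<beta> ?w by standard (use l \<alpha> p in auto)
  have sl: "sin2 j \<in> l2 (plate l)" using l by (intro sin2_l2) simp
  have i: "integrable (plate l) (\<lambda>z. q z * sin2 j z * sin2 j z)" "integrable (plate l) (\<lambda>z. ?w z * sin2 j z * sin2 j z)"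
    using l2_mult[OF Q.pu_l2[OF sl] sl] l2_mult[OF W.pu_l2[OF sl] sl] by auto
  \<comment> \<open>All weights have the same integral, so subtracting t times the weight shifts
    both sides equally and leaves a pointwise comparison.\<close>
  have "(\<integral>z. q z * sin2 j z * sin2 j z - t * q z \<partial>plate l) \<le> (\<integral>z. ?w z * sin2 j z * sin2 j z - t * ?w z \<partial>plate l)"
  proof (rule integral_mono_AE)
    have "AE z in plate l. z \<in> Omega l" by (intro AE_I2) simp
    then show "AE z in plate l. q z * sin2 j z * sin2 j z - t * q z \<le> ?w z * sin2 j z * sin2 j z - t * ?w z"
      using Q.p_bounds
    proof eventually_elim
      case (elim z)
      have f: "?f z = sin (real j * fst z) ^ 4" by (simp flip: power_add)
      have "0 \<le> (?w z - q z) * (?f z - t)"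
      proof (cases "z \<in> S_level l j t")
        case True
        then show ?thesis
          using elim unfolding f by (intro mult_nonpos_nonpos) (auto simp: bang_bang_weight_def S_level_def)
      next
        case False
        then show ?thesis
          using elim unfolding f by (intro mult_nonneg_nonneg) (auto simp: bang_bang_weight_def S_level_def)
      qed
      then show ?case by (simp add: algebra_simps)
    qed
  qed (use i Q.p_integrable W.p_integrable in auto)
  then show ?thesis using i Q.p_integrable W.p_integrable by (simp add: Q.p_integral W.p_integral)
qed

text \<open>The weight beats every admissible weight, periodic or not; as it is itself periodic, the
  infimum over the periodic ones is attained. Positivity of the norms lets the comparison pass to
  reciprocals.\<close>

theorem bang_bang_optimal:
  assumes l: "l > 0" and \<alpha>: "0 < \<alpha>" "\<alpha> < \<beta>" and j: "j \<ge> 1"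
    and S: "measure lebesgue (S_level l j t) = (\<beta> - 1) / (\<beta> - \<alpha>) * measure lebesgue (Omega l)"
  shows "1 / (L2_norm_on (Omega l) (\<lambda>z. sqrt (bang_bang_weight l \<alpha> \<beta> j t z) * sin2 j z))\<^sup>2 =
    (INF p\<in>periodic_weights l \<alpha> \<beta> j. 1 / (L2_norm_on (Omega l) (\<lambda>z. sqrt (p z) * sin2 j z))\<^sup>2)"
proof (rule sym, rule cInf_eq_minimum)
  let ?w = "bang_bang_weight l \<alpha> \<beta> j t" and ?N = "\<lambda>p. (L2_norm_on (Omega l) (\<lambda>z. sqrt (p z) * sin2 j z))\<^sup>2"
  have w: "?w \<in> periodic_weights l \<alpha> \<beta> j" using l \<alpha>(2) j S by (rule bang_bang_periodic_weight)
  then show "1 / ?N ?w \<in> (\<lambda>p. 1 / ?N p) ` periodic_weights l \<alpha> \<beta> j" by (intro imageI)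
  have sl: "sin2 j \<in> l2 (plate l)" using l by (intro sin2_l2) simp
  have N: "?N p = (\<integral>z. p z * sin2 j z * sin2 j z \<partial>plate l)" "?N p > 0" if "p \<in> weights l \<alpha> \<beta>" for p
  proof -
    interpret weighted_plate l "1 / 4" \<alpha> \<beta> p by standard (use l \<alpha> that in auto)
    show "?N p = (\<integral>z. p z * sin2 j z * sin2 j z \<partial>plate l)" unfolding weighted_norm[OF sl] b_def ..
    show "?N p > 0" unfolding weighted_norm[OF sl] using j by (rule sin2_pos)
  qed
  fix x assume "x \<in> (\<lambda>p. 1 / ?N p) ` periodic_weights l \<alpha> \<beta> j"
  then obtain p where p: "p \<in> weights l \<alpha> \<beta>" and x: "x = 1 / ?N p" by (auto simp: periodic_weights_def)
  have w': "?w \<in> weights l \<alpha> \<beta>" using w by (simp add: periodic_weights_def)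
  have "?N p \<le> ?N ?w" unfolding N(1)[OF p] N(1)[OF w'] using l \<alpha>(1) p w' by (rule bang_bang_maximizes)
  then show "1 / ?N ?w \<le> x" unfolding x using N(2)[OF p] N(2)[OF w'] by (intro divide_left_mono) auto
qed

theorem theorem3p4:
  fixes l \<sigma> \<alpha> \<beta> s :: real and j :: nat
  assumes "l > 0" and "0 < \<sigma>" and "\<sigma> < 1 / 2"
    and "0 < \<alpha>" and "\<alpha> < 1" and "1 < \<beta>"
    and "s > 0" and "tanh (sqrt 2 * s * l) = (\<sigma> / (2 - \<sigma>))\<^sup>2 * (sqrt 2 * s * l)"
    and "s \<notin> \<int>"
    and "j \<ge> 2"
  shows
    "(\<exists>p\<in>weights l \<alpha> \<beta>. \<exists>u\<in>H2_even l.
        mu l \<sigma> p j = mu_inf l \<sigma> \<alpha> \<beta> j \<and>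
        longitudinal_eigenfunction l \<sigma> p (mu l \<sigma> p j) u) \<and>
     mu_inf l \<sigma> \<alpha> \<beta> j \<le>
       (INF p\<in>weights l \<alpha> \<beta>.
          MAX m\<in>{1..j}. 1 / (L2_norm_on (Omega l) (\<lambda>z. sqrt (p z) * w_trial l j m z))\<^sup>2)
       * real j ^ 3 * measure lebesgue (Omega l) \<and>
     mu_inf l \<sigma> \<alpha> \<beta> j \<le>
       (INF p\<in>periodic_weights l \<alpha> \<beta> j.
          1 / (L2_norm_on (Omega l) (\<lambda>z. sqrt (p z) * (sin (real j * fst z))\<^sup>2))\<^sup>2)
       * real j ^ 4 * measure lebesgue (Omega l) \<and>
     (\<exists>t>0. measure lebesgue (S_level l j t) = (\<beta> - 1) / (\<beta> - \<alpha>) * measure lebesgue (Omega l)) \<and>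
     (\<forall>t>0. measure lebesgue (S_level l j t) = (\<beta> - 1) / (\<beta> - \<alpha>) * measure lebesgue (Omega l) \<longrightarrow>
        bang_bang_weight l \<alpha> \<beta> j t \<in> periodic_weights l \<alpha> \<beta> j \<and>
        1 / (L2_norm_on (Omega l)
               (\<lambda>z. sqrt (bang_bang_weight l \<alpha> \<beta> j t z) * (sin (real j * fst z))\<^sup>2))\<^sup>2 =
        (INF p\<in>periodic_weights l \<alpha> \<beta> j.
           1 / (L2_norm_on (Omega l) (\<lambda>z. sqrt (p z) * (sin (real j * fst z))\<^sup>2))\<^sup>2))"
proof -
  note \<sigma> = \<open>0 < \<sigma>\<close> \<open>\<sigma> < 1 / 2\<close>
  let ?W = "weights l \<alpha> \<beta>" and ?P = "periodic_weights l \<alpha> \<beta> j" and ?O = "measure lebesgue (Omega l)"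
  let ?M = "mu_inf l \<sigma> \<alpha> \<beta> j"
  let ?w = "\<lambda>p. MAX m\<in>{1..j}. 1 / (L2_norm_on (Omega l) (\<lambda>z. sqrt (p z) * w_trial l j m z))\<^sup>2"
  let ?s = "\<lambda>p. 1 / (L2_norm_on (Omega l) (\<lambda>z. sqrt (p z) * sin2 j z))\<^sup>2"
  obtain k where k: "j = Suc k" using \<open>j \<ge> 2\<close> by (cases j) auto
  have j: "j \<ge> 1" using k by simp
  have \<alpha>1: "\<alpha> \<le> 1" and \<beta>1: "1 \<le> \<beta>" and \<alpha>\<beta>: "\<alpha> < \<beta>" using \<open>\<alpha> < 1\<close> \<open>1 < \<beta>\<close> by auto
  have O: "?O > 0" using \<open>l > 0\<close> by (subst measure_Omega) auto
  have one: "(\<lambda>z. 1) \<in> ?W" using \<open>l > 0\<close> \<alpha>1 \<beta>1 by (rule const_weight)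
  have plate: "weighted_plate l \<sigma> \<alpha> \<beta> p" if "p \<in> ?W" for p
    using that \<open>l > 0\<close> \<sigma> \<open>0 < \<alpha>\<close> by unfold_locales
  have M: "?M \<le> real j ^ 4" unfolding k using \<open>l > 0\<close> \<sigma> \<open>0 < \<alpha>\<close> \<alpha>1 \<beta>1 by (rule mu_inf_le_power4)
  have "\<exists>p\<in>?W. \<exists>u\<in>H2_even l. mu l \<sigma> p j = ?M \<and> longitudinal_eigenfunction l \<sigma> p (mu l \<sigma> p j) u"
  proof -
    obtain p where p: "p \<in> ?W" "mu l \<sigma> p j = ?M"
      using exists_optimal_weight[OF \<open>l > 0\<close> \<sigma> \<open>0 < \<alpha>\<close> \<alpha>1 \<beta>1, of k] k by blast
    obtain u where u: "longitudinal_eigenfunction l \<sigma> p (mu l \<sigma> p j) u"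
      using weighted_plate.exists_eigenfunction[OF plate[OF p(1)], of k] k by blast
    moreover from u have "u \<in> H2_even l" by (simp add: longitudinal_eigenfunction_def)
    ultimately show ?thesis using p by blast
  qed
  moreover have "?M \<le> (INF p\<in>?W. ?w p) * real j ^ 3 * ?O"
  proof -
    have "real j / ?O \<le> (INF p\<in>?W. ?w p)"
      using one by (intro cINF_greatest weighted_plate.max_trial_ge[OF plate] j) auto
    then have "real j / ?O * real j ^ 3 * ?O \<le> (INF p\<in>?W. ?w p) * real j ^ 3 * ?O"
      using O by (intro mult_right_mono) auto
    moreover have "real j / ?O * real j ^ 3 * ?O = real j ^ 4" using O by (simp add: power_numeral_reduce)
    ultimately show ?thesis using M by linarith
  qed
  moreover have "?M \<le> (INF p\<in>?P. ?s p) * real j ^ 4 * ?O"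
  proof -
    have "1 / ?O \<le> (INF p\<in>?P. ?s p)"
    proof (rule cINF_greatest)
      \<comment> \<open>A lower bound for the real infimum requires a nonempty class of
        weights.\<close>
      have "(\<lambda>z. 1) \<in> ?P" using one by (simp add: periodic_weights_def)
      then show "?P \<noteq> {}" by blast
      show "1 / ?O \<le> ?s p" if "p \<in> ?P" for p
        using that by (intro weighted_plate.sin2_ge[OF plate] j) (simp add: periodic_weights_def)
    qed
    then have "1 / ?O * real j ^ 4 * ?O \<le> (INF p\<in>?P. ?s p) * real j ^ 4 * ?O"
      using O by (intro mult_right_mono) auto
    moreover have "1 / ?O * real j ^ 4 * ?O = real j ^ 4" using O by simp
    ultimately show ?thesis using M by linarith
  qed
  moreover have "\<exists>t>0. measure lebesgue (S_level l j t) = (\<beta> - 1) / (\<beta> - \<alpha>) * ?O"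
  proof (rule S_level_measure_surj[OF \<open>l > 0\<close> j])
    show "0 < (\<beta> - 1) / (\<beta> - \<alpha>) * ?O" using O \<alpha>\<beta> \<open>1 < \<beta>\<close> by simp
    have "(\<beta> - 1) / (\<beta> - \<alpha>) \<le> 1" using \<alpha>1 \<alpha>\<beta> by (simp add: divide_le_eq)
    then show "(\<beta> - 1) / (\<beta> - \<alpha>) * ?O \<le> ?O" using O mult_right_mono[of _ 1 ?O] by fastforce
  qed
  moreover have "bang_bang_weight l \<alpha> \<beta> j t \<in> ?P \<and> ?s (bang_bang_weight l \<alpha> \<beta> j t) = (INF p\<in>?P. ?s p)"
    if "measure lebesgue (S_level l j t) = (\<beta> - 1) / (\<beta> - \<alpha>) * ?O" for t
    using bang_bang_periodic_weight[OF \<open>l > 0\<close> \<alpha>\<beta> j that]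
      bang_bang_optimal[OF \<open>l > 0\<close> \<open>0 < \<alpha>\<close> \<alpha>\<beta> j that] by blast
  ultimately show ?thesis by blast
qed

end
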